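(* Let $(Q,N,C_1,\dots,C_N)$ be a random vector, with $N\in\{0,1,2,\dots\}\cup\{\infty\}$, $\{C_i\}_{i=1}^N$ real valued weights, $Q$ a real valued random variable with $P(|Q|>0)>0$, and let $R=\sum_{n=0}^\infty W_n$ be the solution, constructed on the weighted branching tree (see context), of $R\stackrel{\mathcal{D}}{=}\sum_{i=1}^NC_iR_i+Q$. Suppose that there exists $j\ge1$ with $P(N\ge j,|C_j|>0)>0$ such that the measure $P(\log|C_j|\in du,\ |C_j|>0,\ N\ge j)$ is nonlattice, and that for some $\alpha>0$, $E[|Q|^\alpha]<\infty$, $E\left[\sum_{i=1}^N|C_i|^\alpha\log|C_i|\right]>0$ and $E\left[\sum_{i=1}^N|C_i|^\alpha\right]=1$. In addition, assume 1) $E\left[\sum_{i=1}^N|C_i|\right]<1$ and $E\left[\left(\sum_{i=1}^N|C_i|\right)^\alpha\right]<\infty$, if $\alpha>1$; or, 2) $E\left[\left(\sum_{i=1}^N|C_i|^{\alpha/(1+\epsilon)}\right)^{1+\epsilon}\right]<\infty$ for some $0<\epsilon<1$, if $0<\alpha\le1$. Then: (a) if $\{C_i\}\ge0$ a.s., $$P(R>t)\sim H_+t^{-\alpha},\qquad P(R<-t)\sim H_-t^{-\alpha},\qquad t\to\infty,$$ where $H_\pm\ge0$ are given by $$H_\pm=\frac{1}{E\left[\sum_{i=1}^N|C_i|^\alpha\log|C_i|\right]}\int_0^\infty v^{\alpha-1}\left(P((\pm1)R>v)-E\left[\sum_{i=1}^N1((\pm1)C_iR>v)\right]\right)dv$$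 $$=\frac{E\left[\left(\left(\sum_{i=1}^NC_iR_i+Q\right)^\pm\right)^\alpha-\sum_{i=1}^N\left((C_iR_i)^\pm\right)^\alpha\right]}{\alpha E\left[\sum_{i=1}^N|C_i|^\alpha\log|C_i|\right]};$$ (b) if $P(C_j<0)>0$ for some $j\ge1$, $$P(R>t)\sim P(R<-t)\sim Ht^{-\alpha},\qquad t\to\infty,$$ where $$H=\frac{1}{2E\left[\sum_{i=1}^N|C_i|^\alpha\log|C_i|\right]}\int_0^\infty v^{\alpha-1}\left(P(|R|>v)-E\left[\sum_{i=1}^N1(|C_iR|>v)\right]\right)dv$$ $$=\frac{E\left[\left|\sum_{i=1}^NC_iR_i+Q\right|^\alpha-\sum_{i=1}^N|C_iR_i|^\alpha\right]}{2\alpha E\left[\sum_{i=1}^N|C_i|^\alpha\log|C_i|\right]}.$$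
   Context: Weighted branching tree. Let $U=\bigcup_{k=0}^\infty\{1,2,3,\dots\}^k$ be the set of finite sequences of positive integers, $\emptyset$ the empty sequence, and $(\mathbf{i},j)$ the concatenation of $\mathbf{i}\in U$ with $j$. Let $\{(Q_{\mathbf{i}},N_{\mathbf{i}},C_{(\mathbf{i},1)},\dots,C_{(\mathbf{i},N_{\mathbf{i}})})\}_{\mathbf{i}\in U}$ be iid copies of $(Q,N,C_1,\dots,C_N)$, the one at $\emptyset$ being $(Q,N,C_1,\dots,C_N)$ itself. Set $A_0=\{\emptyset\}$ and $A_n=\{(\mathbf{i},j):\mathbf{i}\in A_{n-1},\ 1\le j\le N_{\mathbf{i}}\}$ for $n\ge1$ ($j$ a finite integer), and define weights $\Pi_\emptyset=1$, $\Pi_{(\mathbf{i},j)}=C_{(\mathbf{i},j)}\Pi_{\mathbf{i}}$. Let $W_n=\sum_{\mathbf{i}\in A_n}Q_{\mathbf{i}}\Pi_{\mathbf{i}}$, $n\ge0$ (so $W_0=Q$), and $R=\sum_{n=0}^\infty W_n$ (an a.s. convergent series under the theorem's hypotheses). $\{R_i\}_{i\ge1}$ denotes a sequence of iid copies of $R$, independent of $(Q,N,C_1,\dots,C_N)$. Conventions: $x^+=\max(x,0)$, $x^-=\max(-x,0)$; $1(\cdot)$ is the indicator; $0^\alpha\log0=0$; sums $\sum_{i=1}^N$ run over all finite integers $1\le i\le N$. Components of $(Q,N,C_1,\dots,C_N)$ may be arbitrarily dependent. $P(C_j<0)$ means $P(N\ge j,C_j<0)$; "$\{C_i\}\ge0$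 a.s." means that a.s. $C_i\ge0$ for all $i\le N$. A finite measure on $\mathbb{R}$ is lattice if it is concentrated on a set $\{a+j\lambda:j\in\mathbb{Z}\}$ for some $a\in\mathbb{R}$, $\lambda>0$; otherwise it is nonlattice. If $E[\sum_{i=1}^N|C_i|^\alpha\log|C_i|]=\infty$, the constants $H_\pm,H$ are $0$. The relation $f(t)\sim Ht^{-\alpha}$ means $t^\alpha f(t)\to H$ (also when $H=0$). *)

theory Defs
  imports "HOL-Probability.Probability"
begin

section \<open>Random vectors with a random number of weights\<close>

definition idx :: "enat \<Rightarrow> nat set" where
  "idx n = {j. 1 \<le> j \<and> enat j \<le> n}"

text \<open>
  A random vector \<open>(Q, N, C\<^sub>1, \<dots>, C\<^sub>N)\<close> is given by \<open>Q\<close>, \<open>N\<close> and a family \<open>C j\<close> whose values on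
  \<open>{j > N}\<close> carry no meaning. To view it as one random element of a fixed measurable space, it is
  padded by zeros beyond \<open>N\<close>; its law is the law of the padded vector, so nothing is
  ever assumed about \<open>C j\<close> on \<open>{j > N}\<close>.
\<close>

type_synonym wvec = "real \<times> enat \<times> (nat \<Rightarrow> real)"

definition vec_space :: "wvec measure" where
  "vec_space = borel \<Otimes>\<^sub>M (count_space UNIV \<Otimes>\<^sub>M (\<Pi>\<^sub>M j\<in>{1..}. borel))"

definition padded_vec ::
    "('a \<Rightarrow> real) \<Rightarrow> ('a \<Rightarrow> enat) \<Rightarrow> (nat \<Rightarrow> 'a \<Rightarrow> real) \<Rightarrow> 'a \<Rightarrow> wvec" where
  "padded_vec Q N C \<omega> = (Q \<omega>, N \<omega>, \<lambda>j\<in>{1..}. if j \<in> idx (N \<omega>) then C j \<omega> else 0)"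


section \<open>The weighted branching tree\<close>

text \<open>
  A node is a list of positive integers with the youngest generation at the head:
  the child \<open>(i, j)\<close> of \<open>i\<close> is \<open>j # i\<close>, and \<open>C (j # i)\<close> is the weight attached to it.
\<close>

definition nodes :: "nat list set" where
  "nodes = lists {1..}"

definition node_vec ::
    "(nat list \<Rightarrow> 'a \<Rightarrow> real) \<Rightarrow> (nat list \<Rightarrow> 'a \<Rightarrow> enat) \<Rightarrow> (nat list \<Rightarrow> 'a \<Rightarrow> real) \<Rightarrow>
     nat list \<Rightarrow> 'a \<Rightarrow> wvec" where
  "node_vec Q N C i = padded_vec (Q i) (N i) (\<lambda>j. C (j # i))"

definition weighted_branching_tree ::
    "'a measure \<Rightarrow> (nat list \<Rightarrow> 'a \<Rightarrow> real) \<Rightarrow> (nat list \<Rightarrow> 'a \<Rightarrow> enat) \<Rightarrow>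
     (nat list \<Rightarrow> 'a \<Rightarrow> real) \<Rightarrow> bool" where
  "weighted_branching_tree M Q N C \<longleftrightarrow>
     prob_space M \<and>
     prob_space.indep_vars M (\<lambda>_. vec_space) (node_vec Q N C) nodes \<and>
     (\<forall>i\<in>nodes. distr M vec_space (node_vec Q N C i) = distr M vec_space (node_vec Q N C []))"

primrec generation :: "(nat list \<Rightarrow> 'a \<Rightarrow> enat) \<Rightarrow> 'a \<Rightarrow> nat \<Rightarrow> nat list set" where
  "generation N \<omega> 0 = {[]}"
| "generation N \<omega> (Suc n) = {j # i | i j. i \<in> generation N \<omega> n \<and> j \<in> idx (N i \<omega>)}"

primrec path_weight :: "(nat list \<Rightarrow> 'a \<Rightarrow> real) \<Rightarrow> 'a \<Rightarrow> nat list \<Rightarrow> real" where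
  "path_weight C \<omega> [] = 1"
| "path_weight C \<omega> (j # i) = C (j # i) \<omega> * path_weight C \<omega> i"

definition W ::
    "(nat list \<Rightarrow> 'a \<Rightarrow> real) \<Rightarrow> (nat list \<Rightarrow> 'a \<Rightarrow> enat) \<Rightarrow> (nat list \<Rightarrow> 'a \<Rightarrow> real) \<Rightarrow>
     nat \<Rightarrow> 'a \<Rightarrow> real" where
  "W Q N C n \<omega> = (\<Sum>\<^sub>\<infinity>i\<in>generation N \<omega> n. Q i \<omega> * path_weight C \<omega> i)"

definition R_series ::
    "(nat list \<Rightarrow> 'a \<Rightarrow> real) \<Rightarrow> (nat list \<Rightarrow> 'a \<Rightarrow> enat) \<Rightarrow> (nat list \<Rightarrow> 'a \<Rightarrow> real) \<Rightarrow>
     'a \<Rightarrow> real" where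
  "R_series Q N C \<omega> = (\<Sum>n. W Q N C n \<omega>)"

text \<open>
  \<open>Rc 1, Rc 2, \<dots>\<close> are iid copies of \<open>R\<close>, independent of the random element \<open>X\<close> of \<open>S\<close>
  (the last clause is independence of the two generated sigma-algebras; \<open>indep_var\<close> would
  need both random elements to have the same type).
\<close>

definition indep_iid_copies ::
    "'a measure \<Rightarrow> ('a \<Rightarrow> real) \<Rightarrow> 'b measure \<Rightarrow> ('a \<Rightarrow> 'b) \<Rightarrow> (nat \<Rightarrow> 'a \<Rightarrow> real) \<Rightarrow> bool" where
  "indep_iid_copies M R S X Rc \<longleftrightarrow>
     prob_space.indep_vars M (\<lambda>_. borel) Rc {1..} \<and>
     (\<forall>i\<ge>1. distr M borel (Rc i) = distr M borel R) \<and>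
     prob_space.indep_set M
       {X -` A \<inter> space M | A. A \<in> sets S}
       {(\<lambda>\<omega>. \<lambda>i\<in>{1..}. Rc i \<omega>) -` B \<inter> space M | B. B \<in> sets (\<Pi>\<^sub>M i\<in>{1..}. borel)}"


section \<open>Moments\<close>

definition ennreal_powr :: "ennreal \<Rightarrow> real \<Rightarrow> ennreal" where
  "ennreal_powr x p = (if x = \<infinity> then \<infinity> else ennreal (enn2real x powr p))"

text \<open>\<open>\<Sum>\<^sub>i\<^sub>\<le>\<^sub>N |C\<^sub>i|\<^sup>p\<close>, possibly infinite\<close>

definition abs_powr_sum :: "('a \<Rightarrow> enat) \<Rightarrow> (nat \<Rightarrow> 'a \<Rightarrow> real) \<Rightarrow> real \<Rightarrow> 'a \<Rightarrow> ennreal" where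
  "abs_powr_sum N C p \<omega> = (\<Sum>\<^sub>\<infinity>j\<in>idx (N \<omega>). ennreal (\<bar>C j \<omega>\<bar> powr p))"

text \<open>
  Expectation with values in the extended reals, \<open>E[X\<^sup>+] - E[X\<^sup>-]\<close> (the function \<open>ennreal\<close>
  truncates negative numbers to \<open>0\<close>).
\<close>

definition ext_expectation :: "'a measure \<Rightarrow> ('a \<Rightarrow> real) \<Rightarrow> ereal" where
  "ext_expectation M X =
     enn2ereal (\<integral>\<^sup>+\<omega>. ennreal (X \<omega>) \<partial>M) - enn2ereal (\<integral>\<^sup>+\<omega>. ennreal (- X \<omega>) \<partial>M)"

text \<open>\<open>E[\<Sum>\<^sub>i\<^sub>\<le>\<^sub>N |C\<^sub>i|\<^sup>\<alpha> log |C\<^sub>i|]\<close>; for \<open>C\<^sub>i = 0\<close> the summand is \<open>0 powr \<alpha> * ln 0 = 0\<close>.\<close>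

definition log_moment ::
    "'a measure \<Rightarrow> ('a \<Rightarrow> enat) \<Rightarrow> (nat \<Rightarrow> 'a \<Rightarrow> real) \<Rightarrow> real \<Rightarrow> ereal" where
  "log_moment M N C \<alpha> =
     ext_expectation M (\<lambda>\<omega>. \<Sum>\<^sub>\<infinity>j\<in>idx (N \<omega>). \<bar>C j \<omega>\<bar> powr \<alpha> * ln \<bar>C j \<omega>\<bar>)"


section \<open>Lattice measures\<close>

definition lattice_measure :: "real measure \<Rightarrow> bool" where
  "lattice_measure \<mu> \<longleftrightarrow>
     (\<exists>a \<delta>. \<delta> > 0 \<and> (AE x in \<mu>. x \<in> {a + of_int k * \<delta> | k. True}))"

text \<open>\<open>P(log |C\<^sub>j| \<in> du, |C\<^sub>j| > 0, N \<ge> j)\<close>\<close>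

definition log_weight_measure ::
    "'a measure \<Rightarrow> ('a \<Rightarrow> enat) \<Rightarrow> (nat \<Rightarrow> 'a \<Rightarrow> real) \<Rightarrow> nat \<Rightarrow> real measure" where
  "log_weight_measure M N C j =
     distr (restrict_space M {\<omega>\<in>space M. \<bar>C j \<omega>\<bar> > 0 \<and> enat j \<le> N \<omega>}) borel
       (\<lambda>\<omega>. ln \<bar>C j \<omega>\<bar>)"


section \<open>The functionals in the tail constants\<close>

text \<open>
  \<open>P(g(R) > v) - E[\<Sum>\<^sub>i\<^sub>\<le>\<^sub>N 1(g(C\<^sub>i R') > v)]\<close>, used with \<open>g(x) = x\<close>, \<open>- x\<close> and \<open>|x|\<close>, where \<open>R'\<close> is
  a copy of \<open>R\<close> independent of \<open>(Q, N, C\<^sub>1, \<dots>, C\<^sub>N)\<close>.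
\<close>

definition tail_gap ::
    "'a measure \<Rightarrow> ('a \<Rightarrow> enat) \<Rightarrow> (nat \<Rightarrow> 'a \<Rightarrow> real) \<Rightarrow> ('a \<Rightarrow> real) \<Rightarrow> ('a \<Rightarrow> real) \<Rightarrow>
     (real \<Rightarrow> real) \<Rightarrow> real \<Rightarrow> real" where
  "tail_gap M N C R R' g v =
     measure M {\<omega>\<in>space M. g (R \<omega>) > v} -
     (\<integral>\<omega>. (\<Sum>\<^sub>\<infinity>i\<in>idx (N \<omega>). of_bool (g (C i \<omega> * R' \<omega>) > v)) \<partial>M)"

text \<open>
  \<open>g(\<Sum>\<^sub>i\<^sub>\<le>\<^sub>N C\<^sub>i R\<^sub>i + Q)\<^sup>\<alpha> - \<Sum>\<^sub>i\<^sub>\<le>\<^sub>N g(C\<^sub>i R\<^sub>i)\<^sup>\<alpha>\<close>, used with \<open>g(x) = max x 0\<close>, \<open>max (- x) 0\<close> and \<open>|x|\<close>.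
\<close>

definition power_gap ::
    "('a \<Rightarrow> real) \<Rightarrow> ('a \<Rightarrow> enat) \<Rightarrow> (nat \<Rightarrow> 'a \<Rightarrow> real) \<Rightarrow> (nat \<Rightarrow> 'a \<Rightarrow> real) \<Rightarrow> real \<Rightarrow>
     (real \<Rightarrow> real) \<Rightarrow> 'a \<Rightarrow> real" where
  "power_gap Q N C Rc \<alpha> g \<omega> =
     g ((\<Sum>\<^sub>\<infinity>i\<in>idx (N \<omega>). C i \<omega> * Rc i \<omega>) + Q \<omega>) powr \<alpha> -
     (\<Sum>\<^sub>\<infinity>i\<in>idx (N \<omega>). g (C i \<omega> * Rc i \<omega>) powr \<alpha>)"

text \<open>
  \<open>H = 1/(\<kappa> m) \<integral>\<^sub>0\<^sup>\<infinity> v\<^sup>\<alpha>\<^sup>-\<^sup>1 gap(v) dv = E[G] / (\<kappa> \<alpha> m)\<close>, including that the integral and the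
  expectation exist (a Bochner integral of a non-integrable function would be \<open>0\<close>); by convention
  \<open>H = 0\<close> if \<open>m = \<infinity>\<close>.
\<close>

definition is_tail_constant ::
    "'a measure \<Rightarrow> real \<Rightarrow> ereal \<Rightarrow> real \<Rightarrow> (real \<Rightarrow> real) \<Rightarrow> ('a \<Rightarrow> real) \<Rightarrow> real \<Rightarrow> bool" where
  "is_tail_constant M \<alpha> m \<kappa> gap G H \<longleftrightarrow>
     (if m = \<infinity> then H = 0
      else set_integrable lborel {0<..} (\<lambda>v. v powr (\<alpha> - 1) * gap v) \<and>
           H = 1 / (\<kappa> * real_of_ereal m) * (LBINT v:{0<..}. v powr (\<alpha> - 1) * gap v) \<and>
           integrable M G \<and>
           H = (\<integral>\<omega>. G \<omega> \<partial>M) / (\<kappa> * \<alpha> * real_of_ereal m))"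

text \<open>
  \<open>f(t) \<sim> H t\<^sup>-\<^sup>\<alpha>\<close> in the sense \<open>t\<^sup>\<alpha> f(t) \<rightarrow> H\<close>; for \<open>H = 0\<close> this is not asymptotic equivalence, so
  \<open>asymp_equiv\<close> is not applicable.
\<close>

definition power_tail :: "(real \<Rightarrow> real) \<Rightarrow> real \<Rightarrow> real \<Rightarrow> bool" where
  "power_tail f \<alpha> H \<longleftrightarrow> ((\<lambda>t. t powr \<alpha> * f t) \<longlongrightarrow> H) at_top"

end

theory Submission
  imports Defs "HOL-Probability.Probability"
begin

text \<open>
  Let \<open>E\<close> denote expectation and \<open>w\<^sub>j\<close> the weights at the root, padded by zeros. The series \<open>R\<close> over the
  tree solves \<open>R = Q + \<Sum>\<^sub>j w\<^sub>j R\<^sub>j\<close> in law, with iid copies \<open>R\<^sub>j\<close> of \<open>R\<close> independent of the root. If one term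
  of the sum were responsible for each large value, \<open>P(R > v)\<close> would equal \<open>E[\<Sum>\<^sub>j 1(w\<^sub>j R\<^sub>j > v)]\<close>. The
  difference of the two is the forcing term of a renewal equation, as follows.

  Biasing the choice of a child \<open>j\<close> by \<open>\<bar>w\<^sub>j\<bar>\<^sup>\<alpha>\<close> gives a probability measure, because
  \<open>E[\<Sum>\<^sub>j \<bar>w\<^sub>j\<bar>\<^sup>\<alpha>] = 1\<close>. Under it \<open>Y = log \<bar>w\<^sub>j\<bar>\<close> is a random step whose mean is the logarithmic
  moment \<open>m > 0\<close>, and \<open>r t = exp (\<alpha> t) P(R > exp t)\<close> satisfies \<open>r t = z t + E[r (t - Y)]\<close>, where a negative
  weight exchanges \<open>r\<close> with the same function for \<open>- R\<close> (\<open>tail_fun_equation\<close>). The renewal theorem then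
  gives \<open>r t \<rightarrow> (\<integral>z) / m\<close>, which is the claim in logarithmic coordinates. Three points carry the proof.

  First, the forcing term \<open>z\<close> is integrable. For a fixed value of the weights and copies, integrating the
  difference of indicators over the level \<open>v\<close> gives at most a multiple of \<open>\<bar>Q\<bar>\<^sup>\<alpha>\<close> and products of
  different terms (\<open>max_summand_dominates\<close>: the sum differs little from its largest term). The
  expectation of these products involves moments of \<open>R\<close> of order below \<open>\<alpha>\<close> only
  (\<open>error_moment\<close>), and these are finite by iterating the fixed-point equation (\<open>moments_below\<close>). The same
  interchange of integrals turns \<open>\<integral>z\<close> into the expectation of the power gap (\<open>tail_excess_integral\<close>),
  so the two formulas for the constant agree.

  Second, the renewal theorem is proved by a maximum principle. There is \<open>b < \<alpha>\<close> with \<open>E[\<Sum>\<^sub>j \<bar>w\<^sub>j\<bar>\<^sup>b] < 1\<close>: for \<open>\<alpha> > 1\<close>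
  this is assumed with \<open>b = 1\<close>, for \<open>\<alpha> \<le> 1\<close> it follows from \<open>m > 0\<close> (\<open>exists_weight_moment_less_1\<close>). Hence
  \<open>E[exp (- \<theta> Y)] < 1\<close> with \<open>\<theta> = \<alpha> - b\<close>, and this contraction bounds \<open>r\<close> (\<open>solution_bounded\<close>). After
  averaging over windows \<open>r\<close> is Lipschitz, and a Choquet-Deny type argument applies: if \<open>r (t\<^sub>n)\<close> tends to the upper limit \<open>M\<close>, the equation forces
  \<open>r (t\<^sub>n - y) \<rightarrow> M\<close> for every \<open>y\<close> in the support of \<open>Y\<close>, hence (by the nonlattice condition) near
  constancy of \<open>r\<close> on long intervals (\<open>plateaus_exist\<close>). Integrating the equation along such plateaus
  identifies the value \<open>M\<close> through \<open>M m = \<integral>z\<close> (\<open>plateau_mean_identity\<close>). The lower limit is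
  handled in the same way, so \<open>r\<close> converges; since \<open>r\<close> multiplied by \<open>exp (- \<alpha> t)\<close> is monotone,
  the averages may be removed again.

  Third, with negative weights the sum of the two tail functions solves the scalar equation,
  while their difference \<open>d\<close> solves it with \<open>r (t - Y)\<close> replaced by \<open>sgn(w\<^sub>j) d (t - Y)\<close>. A plateau value of
  \<open>\<bar>d\<bar>\<close> would be reproduced with the opposite sign, so \<open>d \<rightarrow> 0\<close> (\<open>signed_solution_tendsto_0\<close>) and
  both tails receive half of the constant.
\<close>

section \<open>Renewal equations under an exponential contraction\<close>

text \<open>
  The moment condition says that the operator \<open>r \<mapsto> E[r (t - Y)]\<close> contracts the space of functions
  \<open>O(exp (\<theta> t))\<close> by the factor \<open>\<rho>\<close>; the mean of \<open>Y\<close> may be infinite.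
\<close>

locale drift_walk = prob_space P for P :: "'p measure" +
  fixes Y :: "'p \<Rightarrow> real" and \<theta> \<rho> :: real
  assumes Y_meas[measurable]: "Y \<in> borel_measurable P"
    and theta: "\<theta> > 0" and rho: "0 \<le> \<rho>" "\<rho> < 1"
    and Y_exp: "(\<integral>\<^sup>+\<omega>. ennreal (exp (- \<theta> * Y \<omega>)) \<partial>P) \<le> ennreal \<rho>"
begin

text \<open>
  The expected number of visits to \<open>(t - 1, t]\<close> among the first \<open>n\<close> positions of the walk started at \<open>0\<close>.
\<close>

primrec potential :: "nat \<Rightarrow> real \<Rightarrow> ennreal" where
  "potential 0 t = 0"
| "potential (Suc n) t = indicator {0..<1} t + (\<integral>\<^sup>+\<omega>. potential n (t - Y \<omega>) \<partial>P)"

lemma measurable_potential[measurable]: "potential n \<in> borel_measurable borel"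
proof (induction n)
  case (Suc n)
  note Suc[measurable]
  have "(\<lambda>t. indicator {0..<1} t + (\<integral>\<^sup>+\<omega>. potential n (t - Y \<omega>) \<partial>P)) \<in> borel_measurable borel"
    by measurable
  then show ?case by simp
qed (simp add: fun_eq_iff[symmetric])

lemma nn_integral_exp_shift:
  assumes "0 \<le> B"
  shows "(\<integral>\<^sup>+\<omega>. ennreal (B * exp (\<theta> * (t - Y \<omega>))) \<partial>P) \<le> ennreal (B * \<rho> * exp (\<theta> * t))"
proof -
  have "(\<integral>\<^sup>+\<omega>. ennreal (B * exp (\<theta> * (t - Y \<omega>))) \<partial>P)
      = (\<integral>\<^sup>+\<omega>. ennreal (B * exp (\<theta> * t)) * ennreal (exp (- \<theta> * Y \<omega>)) \<partial>P)"
    using assms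
    by (intro nn_integral_cong) (simp add: ennreal_mult'[symmetric] exp_add[symmetric] algebra_simps exp_diff exp_minus divide_inverse)
  also have "\<dots> = ennreal (B * exp (\<theta> * t)) * (\<integral>\<^sup>+\<omega>. ennreal (exp (- \<theta> * Y \<omega>)) \<partial>P)"
    by (rule nn_integral_cmult) simp
  also have "\<dots> \<le> ennreal (B * exp (\<theta> * t)) * ennreal \<rho>"
    by (intro mult_left_mono Y_exp) simp
  also have "\<dots> = ennreal (B * \<rho> * exp (\<theta> * t))"
    using assms rho by (simp add: ennreal_mult'[symmetric] mult_ac)
  finally show ?thesis .
qed

lemma potential_le_exp: "potential n t \<le> ennreal (1 / (1 - \<rho>) * exp (\<theta> * t))"
proof (induction n arbitrary: t)
  case (Suc n)
  have c: "0 \<le> 1 / (1 - \<rho>)" using rho by simp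
  have "(\<integral>\<^sup>+\<omega>. potential n (t - Y \<omega>) \<partial>P)
      \<le> (\<integral>\<^sup>+\<omega>. ennreal (1 / (1 - \<rho>) * exp (\<theta> * (t - Y \<omega>))) \<partial>P)"
    by (intro nn_integral_mono Suc)
  also have "\<dots> \<le> ennreal (1 / (1 - \<rho>) * \<rho> * exp (\<theta> * t))"
    by (rule nn_integral_exp_shift[OF c])
  finally have 1: "(\<integral>\<^sup>+\<omega>. potential n (t - Y \<omega>) \<partial>P) \<le> ennreal (1 / (1 - \<rho>) * \<rho> * exp (\<theta> * t))" .
  have 2: "indicator {0..<1} t \<le> ennreal (exp (\<theta> * t))"
    using theta by (auto simp: indicator_def)
  have "potential (Suc n) t \<le> ennreal (exp (\<theta> * t)) + ennreal (1 / (1 - \<rho>) * \<rho> * exp (\<theta> * t))"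
    using 1 2 by (simp add: add_mono)
  also have "\<dots> = ennreal (1 / (1 - \<rho>) * exp (\<theta> * t))"
    using rho by (subst ennreal_plus[symmetric]) (auto simp: field_simps)
  finally show ?case .
qed simp

text \<open>
  Outside \<open>[0, 1)\<close> the potential is an average of potentials of smaller order, so only its values on
  \<open>[0, 1)\<close> matter; there the exponential bound is at most \<open>exp \<theta> / (1 - \<rho>)\<close>.
\<close>

lemma potential_le: "potential n t \<le> ennreal (exp \<theta> / (1 - \<rho>))"
proof (induction n arbitrary: t)
  case (Suc n)
  show ?case
  proof (cases "t \<in> {0..<1}")
    case True
    have "potential (Suc n) t \<le> ennreal (1 / (1 - \<rho>) * exp (\<theta> * t))"
      by (rule potential_le_exp)
    also have "\<dots> \<le> ennreal (exp \<theta> / (1 - \<rho>))"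
      using True theta rho by (intro ennreal_leI) (auto intro!: divide_right_mono mult_left_le simp: mult_left_le)
    finally show ?thesis .
  next
    case False
    have "potential (Suc n) t = (\<integral>\<^sup>+\<omega>. potential n (t - Y \<omega>) \<partial>P)"
      using False by simp
    also have "\<dots> \<le> (\<integral>\<^sup>+\<omega>. ennreal (exp \<theta> / (1 - \<rho>)) \<partial>P)"
      by (intro nn_integral_mono Suc)
    also have "\<dots> = ennreal (exp \<theta> / (1 - \<rho>))"
      by (simp add: emeasure_space_1)
    finally show ?thesis .
  qed
qed simp

text \<open>
  Iterating the inequality \<open>n\<close> times; the remainder decays like \<open>\<rho>\<^sup>n\<close> by the contraction.
\<close>

lemma smoothed_subsolution_le_potential:
  fixes \<zeta> r :: "real \<Rightarrow> ennreal"
  assumes [measurable]: "\<zeta> \<in> borel_measurable borel" "r \<in> borel_measurable borel"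
    and sub: "\<And>t. r t \<le> \<zeta> t + (\<integral>\<^sup>+\<omega>. r (t - Y \<omega>) \<partial>P)"
    and B: "0 \<le> B" "\<And>t. r t \<le> ennreal (B * exp (\<theta> * t))"
  shows "(\<integral>\<^sup>+s. indicator {0..<1} (t - s) * r s \<partial>lborel)
    \<le> (\<integral>\<^sup>+s. \<zeta> s * potential n (t - s) \<partial>lborel) + ennreal (B * \<rho> ^ n * exp (\<theta> * t))"
proof (induction n arbitrary: t)
  case 0
  have "(\<integral>\<^sup>+s. indicator {0..<1} (t - s) * r s \<partial>lborel)
    \<le> (\<integral>\<^sup>+s. ennreal (B * exp (\<theta> * t)) * indicator {t-1..t} s \<partial>lborel)"
  proof (intro nn_integral_mono)
    fix s
    show "indicator {0..<1} (t - s) * r s \<le> ennreal (B * exp (\<theta> * t)) * indicator {t-1..t} s"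
    proof (cases "t - s \<in> {0..<1}")
      case True
      have "r s \<le> ennreal (B * exp (\<theta> * s))" by (rule B)
      also have "\<dots> \<le> ennreal (B * exp (\<theta> * t))"
        using True B theta by (intro ennreal_leI mult_left_mono) auto
      finally show ?thesis using True by (auto simp: indicator_def)
    qed simp
  qed
  also have "\<dots> = ennreal (B * exp (\<theta> * t))"
    by (subst nn_integral_cmult_indicator) auto
  finally show ?case by simp
next
  case (Suc n)
  let ?K = "\<lambda>t. indicator {0..<1::real} t :: ennreal"
  have "(\<integral>\<^sup>+s. ?K (t - s) * r s \<partial>lborel)
    \<le> (\<integral>\<^sup>+s. ?K (t - s) * \<zeta> s + ?K (t - s) * (\<integral>\<^sup>+\<omega>. r (s - Y \<omega>) \<partial>P) \<partial>lborel)"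
    unfolding distrib_left[symmetric] by (intro nn_integral_mono mult_left_mono sub) simp
  also have "\<dots> = (\<integral>\<^sup>+s. ?K (t - s) * \<zeta> s \<partial>lborel)
      + (\<integral>\<^sup>+s. ?K (t - s) * (\<integral>\<^sup>+\<omega>. r (s - Y \<omega>) \<partial>P) \<partial>lborel)"
    by (rule nn_integral_add) measurable
  also have "(\<integral>\<^sup>+s. ?K (t - s) * (\<integral>\<^sup>+\<omega>. r (s - Y \<omega>) \<partial>P) \<partial>lborel)
      = (\<integral>\<^sup>+s. (\<integral>\<^sup>+\<omega>. ?K (t - s) * r (s - Y \<omega>) \<partial>P) \<partial>lborel)"
    by (intro nn_integral_cong nn_integral_cmult[symmetric]) measurable
  also have "\<dots> = (\<integral>\<^sup>+\<omega>. (\<integral>\<^sup>+s. ?K (t - s) * r (s - Y \<omega>) \<partial>lborel) \<partial>P)"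
    by (rule pair_sigma_finite.Fubini') (unfold_locales, measurable)
  also have "\<dots> = (\<integral>\<^sup>+\<omega>. (\<integral>\<^sup>+s. ?K (t - Y \<omega> - s) * r s \<partial>lborel) \<partial>P)"
  proof (rule nn_integral_cong)
    fix \<omega>
    show "(\<integral>\<^sup>+s. ?K (t - s) * r (s - Y \<omega>) \<partial>lborel) = (\<integral>\<^sup>+s. ?K (t - Y \<omega> - s) * r s \<partial>lborel)"
      using nn_integral_real_affine[where c=1 and t="Y \<omega>" and f="\<lambda>s. ?K (t - s) * r (s - Y \<omega>)"]
      by (simp add: algebra_simps)
  qed
  also have "\<dots> \<le> (\<integral>\<^sup>+\<omega>. (\<integral>\<^sup>+s. \<zeta> s * potential n (t - Y \<omega> - s) \<partial>lborel)
      + ennreal (B * \<rho> ^ n * exp (\<theta> * (t - Y \<omega>))) \<partial>P)"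
    by (intro nn_integral_mono Suc)
  also have "\<dots> = (\<integral>\<^sup>+\<omega>. (\<integral>\<^sup>+s. \<zeta> s * potential n (t - Y \<omega> - s) \<partial>lborel) \<partial>P)
      + (\<integral>\<^sup>+\<omega>. ennreal (B * \<rho> ^ n * exp (\<theta> * (t - Y \<omega>))) \<partial>P)"
    by (rule nn_integral_add) measurable
  also have "(\<integral>\<^sup>+\<omega>. (\<integral>\<^sup>+s. \<zeta> s * potential n (t - Y \<omega> - s) \<partial>lborel) \<partial>P)
     = (\<integral>\<^sup>+s. (\<integral>\<^sup>+\<omega>. \<zeta> s * potential n (t - Y \<omega> - s) \<partial>P) \<partial>lborel)"
    by (rule pair_sigma_finite.Fubini'[symmetric]) (unfold_locales, measurable)
  also have "\<dots> = (\<integral>\<^sup>+s. \<zeta> s * (\<integral>\<^sup>+\<omega>. potential n (t - s - Y \<omega>) \<partial>P) \<partial>lborel)"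
    by (intro nn_integral_cong, subst nn_integral_cmult[symmetric]) (auto simp: algebra_simps)
  also have "(\<integral>\<^sup>+\<omega>. ennreal (B * \<rho> ^ n * exp (\<theta> * (t - Y \<omega>))) \<partial>P)
     \<le> ennreal (B * \<rho> ^ Suc n * exp (\<theta> * t))"
    using nn_integral_exp_shift[of "B * \<rho> ^ n" t] B rho by (simp add: mult_ac)
  also have "(\<integral>\<^sup>+s. ?K (t - s) * \<zeta> s \<partial>lborel) +
     ((\<integral>\<^sup>+s. \<zeta> s * (\<integral>\<^sup>+\<omega>. potential n (t - s - Y \<omega>) \<partial>P) \<partial>lborel)
        + ennreal (B * \<rho> ^ Suc n * exp (\<theta> * t)))
     = (\<integral>\<^sup>+s. \<zeta> s * potential (Suc n) (t - s) \<partial>lborel) + ennreal (B * \<rho> ^ Suc n * exp (\<theta> * t))"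
    by (simp add: distrib_left nn_integral_add add.assoc mult.commute)
  finally show ?case by (simp add: add_left_mono)
qed

lemma smoothed_subsolution_bounded:
  fixes \<zeta> r :: "real \<Rightarrow> ennreal"
  assumes [measurable]: "\<zeta> \<in> borel_measurable borel" "r \<in> borel_measurable borel"
    and sub: "\<And>t. r t \<le> \<zeta> t + (\<integral>\<^sup>+\<omega>. r (t - Y \<omega>) \<partial>P)"
    and B: "0 \<le> B" "\<And>t. r t \<le> ennreal (B * exp (\<theta> * t))"
  shows "(\<integral>\<^sup>+s. indicator {0..<1} (t - s) * r s \<partial>lborel)
    \<le> ennreal (exp \<theta> / (1 - \<rho>)) * (\<integral>\<^sup>+s. \<zeta> s \<partial>lborel)" (is "?l \<le> ?c")
proof (rule LIMSEQ_le_const)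
  have "(\<lambda>n. ?c + ennreal (B * \<rho> ^ n * exp (\<theta> * t))) \<longlonglongrightarrow> ?c + ennreal (B * 0 * exp (\<theta> * t))"
    using rho by (intro tendsto_intros LIMSEQ_power_zero) auto
  then show "(\<lambda>n. ?c + ennreal (B * \<rho> ^ n * exp (\<theta> * t))) \<longlonglongrightarrow> ?c" by simp
  have "?l \<le> ?c + ennreal (B * \<rho> ^ n * exp (\<theta> * t))" for n
  proof -
    have "?l \<le> (\<integral>\<^sup>+s. \<zeta> s * potential n (t - s) \<partial>lborel) + ennreal (B * \<rho> ^ n * exp (\<theta> * t))"
      by (rule smoothed_subsolution_le_potential) fact+
    also have "(\<integral>\<^sup>+s. \<zeta> s * potential n (t - s) \<partial>lborel)
        \<le> (\<integral>\<^sup>+s. ennreal (exp \<theta> / (1 - \<rho>)) * \<zeta> s \<partial>lborel)"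
      by (subst mult.commute, intro nn_integral_mono mult_right_mono potential_le) simp
    also have "\<dots> = ?c" by (rule nn_integral_cmult) simp
    finally show ?thesis by (simp add: add_right_mono)
  qed
  then show "\<exists>N. \<forall>n\<ge>N. ?l \<le> ?c + ennreal (B * \<rho> ^ n * exp (\<theta> * t))" by blast
qed

lemma integrable_solution_shift:
  assumes [measurable]: "r \<in> borel_measurable borel"
    and B: "\<And>t. \<bar>r t\<bar> \<le> B * exp (\<theta> * t)"
  shows "integrable P (\<lambda>\<omega>. r (t - Y \<omega>))"
proof (rule integrableI_bounded)
  have B0: "0 \<le> B" using B[of 0] by simp
  have "(\<integral>\<^sup>+\<omega>. ennreal (norm (r (t - Y \<omega>))) \<partial>P) \<le> (\<integral>\<^sup>+\<omega>. ennreal (B * exp (\<theta> * (t - Y \<omega>))) \<partial>P)"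
    by (intro nn_integral_mono ennreal_leI) (simp add: B)
  also have "\<dots> \<le> ennreal (B * \<rho> * exp (\<theta> * t))" by (rule nn_integral_exp_shift[OF B0])
  finally show "(\<integral>\<^sup>+\<omega>. ennreal (norm (r (t - Y \<omega>))) \<partial>P) < \<infinity>"
    by (simp add: le_less_trans)
qed simp

text \<open>
  The potential bounds the integral of \<open>r\<close> over unit windows, and the growth condition bounds \<open>r t\<close> by
  its values on \<open>(t - 1, t]\<close>.
\<close>

lemma solution_bounded:
  assumes [measurable]: "r \<in> borel_measurable borel"
    and nonneg: "\<And>t. 0 \<le> r t" and B: "\<And>t. r t \<le> B * exp (\<theta> * t)"
    and growth: "\<And>s t. 0 \<le> s \<Longrightarrow> r (t + s) \<le> exp (\<alpha> * s) * r t" and alpha: "0 \<le> \<alpha>"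
    and z: "integrable lborel z"
    and eq: "\<And>t. r t = z t + (\<integral>\<omega>. r (t - Y \<omega>) \<partial>P)"
  shows "\<exists>b. \<forall>t. r t \<le> b"
proof -
  have [measurable]: "z \<in> borel_measurable borel" using z by simp
  have B0: "0 \<le> B" using order_trans[OF nonneg B, of 0] by simp
  have sub: "ennreal (r t) \<le> ennreal \<bar>z t\<bar> + (\<integral>\<^sup>+\<omega>. ennreal (r (t - Y \<omega>)) \<partial>P)" for t
  proof -
    have "integrable P (\<lambda>\<omega>. r (t - Y \<omega>))"
      by (rule integrable_solution_shift[where B=B]) (auto simp: nonneg B)
    then have "(\<integral>\<^sup>+\<omega>. ennreal (r (t - Y \<omega>)) \<partial>P) = ennreal (\<integral>\<omega>. r (t - Y \<omega>) \<partial>P)"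
      by (rule nn_integral_eq_integral) (simp add: nonneg)
    moreover have "ennreal (r t) \<le> ennreal (\<bar>z t\<bar> + (\<integral>\<omega>. r (t - Y \<omega>) \<partial>P))"
      by (subst eq) (rule ennreal_leI, simp)
    ultimately show ?thesis by (simp add: ennreal_plus nonneg)
  qed
  define I where "I = (\<integral>s. \<bar>z s\<bar> \<partial>lborel)"
  have I: "(\<integral>\<^sup>+s. ennreal \<bar>z s\<bar> \<partial>lborel) = ennreal I"
    unfolding I_def using z by (intro nn_integral_eq_integral) auto
  have I0: "0 \<le> I" unfolding I_def by simp
  have "r t \<le> exp \<alpha> * (exp \<theta> / (1 - \<rho>) * I)" for t
  proof -
    \<comment> \<open>On the window \<open>(t - 1, t]\<close> the growth condition gives \<open>r s \<ge> exp (- \<alpha>) r t\<close>.\<close>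
    have "ennreal (exp (- \<alpha>) * r t) = (\<integral>\<^sup>+s. ennreal (exp (- \<alpha>) * r t) * indicator {t-1<..t} s \<partial>lborel)"
      by (subst nn_integral_cmult_indicator) auto
    also have "\<dots> \<le> (\<integral>\<^sup>+s. indicator {0..<1} (t - s) * ennreal (r s) \<partial>lborel)"
    proof (intro nn_integral_mono)
      fix s
      show "ennreal (exp (- \<alpha>) * r t) * indicator {t-1<..t} s \<le> indicator {0..<1} (t - s) * ennreal (r s)"
      proof (cases "s \<in> {t-1<..t}")
        case True
        then have "r t \<le> exp (\<alpha> * (t - s)) * r s" using growth[of "t - s" s] by simp
        also have "\<dots> \<le> exp \<alpha> * r s"
          using True alpha nonneg by (intro mult_right_mono) (auto intro: mult_left_le)
        finally have "exp (- \<alpha>) * r t \<le> r s" by (simp add: exp_minus field_simps)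
        then show ?thesis using True by (auto simp: indicator_def intro: ennreal_leI)
      qed simp
    qed
    also have "\<dots> \<le> ennreal (exp \<theta> / (1 - \<rho>)) * ennreal I"
      unfolding I[symmetric]
      by (rule smoothed_subsolution_bounded[where B=B]) (auto intro: sub B0 ennreal_leI B)
    also have "\<dots> = ennreal (exp \<theta> / (1 - \<rho>) * I)"
      using rho I0 by (subst ennreal_mult) auto
    finally have "exp (- \<alpha>) * r t \<le> exp \<theta> / (1 - \<rho>) * I"
      using rho I0 by (subst (asm) ennreal_le_iff) auto
    then show ?thesis by (simp add: exp_minus field_simps)
  qed
  then show ?thesis by blast
qed

end

section \<open>Asymptotic solutions of the signed equation\<close>

text \<open>
  A subgroup of the reals that is not contained in a lattice is dense: a least positive
  element would generate the group.
\<close>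

lemma small_positive_element:
  fixes D :: "real set"
  assumes zero: "0 \<in> D" and diff: "\<And>x y. x \<in> D \<Longrightarrow> y \<in> D \<Longrightarrow> x - y \<in> D"
    and nonlat: "\<And>l. l > 0 \<Longrightarrow> \<exists>d\<in>D. \<forall>k::int. d \<noteq> of_int k * l" and "\<delta> > 0"
  shows "\<exists>d\<in>D. 0 < d \<and> d < \<delta>"
proof (rule ccontr)
  assume "\<not> ?thesis"
  then have gap: "\<delta> \<le> d" if "d \<in> D" "0 < d" for d using that by force
  define E where "E = {d\<in>D. 0 < d}"
  have neg: "- x \<in> D" if "x \<in> D" for x using diff[OF zero that] by simp
  have add: "x + y \<in> D" if "x \<in> D" "y \<in> D" for x y using diff[OF that(1) neg[OF that(2)]] by simp
  obtain d0 where d0: "d0 \<in> D" "\<forall>k::int. d0 \<noteq> of_int k * 1" using nonlat[of 1] by auto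
  have "d0 \<noteq> 0" using d0(2)[rule_format, of 0] by simp
  then have "\<bar>d0\<bar> \<in> E" using d0(1) neg by (auto simp: E_def abs_if)
  then have ne: "E \<noteq> {}" by blast
  have bdd: "bdd_below E" by (rule bdd_belowI[of _ 0]) (auto simp: E_def)
  define l where "l = Inf E"
  have l: "\<delta> \<le> l" unfolding l_def by (rule cInf_greatest[OF ne]) (auto simp: E_def gap)
  have lE: "l \<in> E"
  proof -
    obtain d where d: "d \<in> E" "d < l + \<delta>"
      using cInf_lessD[OF ne, of "l + \<delta>"] \<open>\<delta> > 0\<close> by (auto simp: l_def)
    have "l \<le> d" unfolding l_def by (rule cInf_lower[OF d(1) bdd])
    moreover have "\<not> l < d"
    proof
      assume "l < d"
      then obtain d' where d': "d' \<in> E" "d' < d" using cInf_lessD[OF ne, of d] by (auto simp: l_def)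
      have "l \<le> d'" unfolding l_def by (rule cInf_lower[OF d'(1) bdd])
      moreover have "\<delta> \<le> d - d'" using d(1) d' by (intro gap diff) (auto simp: E_def)
      ultimately show False using d(2) by simp
    qed
    ultimately show ?thesis using d(1) by simp
  qed
  have multn: "of_nat n * l \<in> D" for n
    by (induction n) (use zero lE in \<open>auto simp: algebra_simps E_def intro: add\<close>)
  have mult: "of_int k * l \<in> D" for k :: int
    by (cases k) (use multn neg[OF multn] in \<open>auto simp del: of_nat_Suc\<close>)
  obtain d where d: "d \<in> D" "\<forall>k::int. d \<noteq> of_int k * l" using nonlat[of l] l \<open>\<delta> > 0\<close> by auto
  define e where "e = d - of_int \<lfloor>d / l\<rfloor> * l"
  have eD: "e \<in> D" unfolding e_def by (intro diff d mult)
  have "0 \<le> d / l - of_int \<lfloor>d / l\<rfloor>" "d / l - of_int \<lfloor>d / l\<rfloor> < 1" by linarith+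
  moreover have "e = (d / l - of_int \<lfloor>d / l\<rfloor>) * l"
    using l \<open>\<delta> > 0\<close> by (simp add: e_def left_diff_distrib)
  ultimately have e: "0 \<le> e" "e < l" using l \<open>\<delta> > 0\<close> by auto
  have "e \<noteq> 0" using d(2) by (auto simp: e_def)
  then have "e \<in> E" using e eD by (auto simp: E_def)
  then have "l \<le> e" unfolding l_def by (rule cInf_lower[OF _ bdd])
  then show False using e by simp
qed

text \<open>
  If the means reach an asymptotic upper bound, there is no room for deviations below it.
\<close>

lemma (in prob_space) L1_convergence_to_upper_bound:
  fixes \<phi> :: "nat \<Rightarrow> 'a \<Rightarrow> real"
  assumes [measurable]: "\<And>n. \<phi> n \<in> borel_measurable M"
    and b: "\<And>n \<omega>. \<bar>\<phi> n \<omega>\<bar> \<le> b"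
    and up: "\<And>\<omega> e. e > 0 \<Longrightarrow> \<forall>\<^sub>F n in sequentially. \<phi> n \<omega> \<le> m + e"
    and lim: "(\<lambda>n. \<integral>\<omega>. \<phi> n \<omega> \<partial>M) \<longlonglongrightarrow> m"
  shows "(\<lambda>n. \<integral>\<omega>. \<bar>\<phi> n \<omega> - m\<bar> \<partial>M) \<longlonglongrightarrow> 0"
proof -
  have int: "integrable M (\<phi> n)" for n
    by (rule integrable_const_bound[where B=b]) (auto simp: b)
  have pos: "(\<lambda>n. \<integral>\<omega>. max (\<phi> n \<omega> - m) 0 \<partial>M) \<longlonglongrightarrow> (\<integral>\<omega>. 0 \<partial>M)"
  proof (rule integral_dominated_convergence[where w="\<lambda>_. \<bar>b\<bar> + \<bar>m\<bar>"])
    show "AE \<omega> in M. (\<lambda>n. max (\<phi> n \<omega> - m) 0) \<longlonglongrightarrow> 0"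
    proof (rule AE_I2, rule LIMSEQ_I)
      fix \<omega> and e :: real assume "e > 0"
      then have "\<forall>\<^sub>F n in sequentially. norm (max (\<phi> n \<omega> - m) 0 - 0) < e"
        using up[of "e/2" \<omega>] by (auto elim!: eventually_mono)
      then show "\<exists>no. \<forall>n\<ge>no. norm (max (\<phi> n \<omega> - m) 0 - 0) < e"
        by (simp add: eventually_sequentially)
    qed
    show "AE \<omega> in M. norm (max (\<phi> n \<omega> - m) 0) \<le> \<bar>b\<bar> + \<bar>m\<bar>" for n
      using b[of n] by (intro AE_I2) (smt (verit) real_norm_def)
  qed auto
  have "(\<lambda>n. 2 * (\<integral>\<omega>. max (\<phi> n \<omega> - m) 0 \<partial>M) - ((\<integral>\<omega>. \<phi> n \<omega> \<partial>M) - m)) \<longlonglongrightarrow> 2 * 0 - (m - m)"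
    by (intro tendsto_intros lim) (use pos in simp)
  moreover have "(\<integral>\<omega>. \<bar>\<phi> n \<omega> - m\<bar> \<partial>M)
      = 2 * (\<integral>\<omega>. max (\<phi> n \<omega> - m) 0 \<partial>M) - ((\<integral>\<omega>. \<phi> n \<omega> \<partial>M) - m)" for n
  proof -
    have i1: "integrable M (\<lambda>\<omega>. max (\<phi> n \<omega> - m) 0)"
      by (intro Bochner_Integration.integrable_max Bochner_Integration.integrable_diff int) auto
    have "(\<integral>\<omega>. \<bar>\<phi> n \<omega> - m\<bar> \<partial>M) = (\<integral>\<omega>. 2 * max (\<phi> n \<omega> - m) 0 - (\<phi> n \<omega> - m) \<partial>M)"
      by (intro Bochner_Integration.integral_cong) (auto simp: max_def)
    also have "\<dots> = 2 * (\<integral>\<omega>. max (\<phi> n \<omega> - m) 0 \<partial>M) - ((\<integral>\<omega>. \<phi> n \<omega> \<partial>M) - m)"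
      using i1 int by (simp add: prob_space)
    finally show ?thesis .
  qed
  ultimately show ?thesis by simp
qed

text \<open>
  The sign \<open>a\<close> records whether \<open>f\<close> or \<open>- f\<close> approaches the upper limit \<open>m\<close> of \<open>\<bar>f\<bar>\<close> along the sequence.
\<close>

lemma limsup_abs_at_top:
  fixes f :: "real \<Rightarrow> real"
  assumes b: "\<And>t. \<bar>f t\<bar> \<le> b"
  obtains m a t0 where "0 \<le> m" "\<And>e. e > 0 \<Longrightarrow> \<forall>\<^sub>F t in at_top. \<bar>f t\<bar> \<le> m + e"
    "\<bar>a\<bar> = 1" "filterlim t0 at_top sequentially" "(\<lambda>n. a * f (t0 n)) \<longlonglongrightarrow> m"
proof -
  define S where "S = {c. \<forall>\<^sub>F t in at_top. \<bar>f t\<bar> \<le> c}"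
  have bS: "b \<in> S" using b by (auto simp: S_def)
  have S0: "0 \<le> c" if "c \<in> S" for c
  proof -
    have "\<forall>\<^sub>F t in at_top. \<bar>f t\<bar> \<le> c" using that by (simp add: S_def)
    then obtain t where "\<bar>f t\<bar> \<le> c" by (auto simp: eventually_at_top_linorder)
    then show ?thesis by linarith
  qed
  have bdd: "bdd_below S" using S0 by (rule bdd_belowI)
  define m where "m = Inf S"
  have m0: "0 \<le> m" unfolding m_def using bS by (intro cInf_greatest S0) auto
  have up: "\<forall>\<^sub>F t in at_top. \<bar>f t\<bar> \<le> m + e" if e: "e > 0" for e
  proof -
    obtain c where "c \<in> S" "c < m + e" using cInf_lessD[of S "m + e"] bS e unfolding m_def by (metis empty_iff less_add_same_cancel1)
    then show ?thesis by (auto simp: S_def elim!: eventually_mono)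
  qed
  have "\<exists>t\<ge>real n. \<bar>f t\<bar> > m - 1 / Suc n" for n
  proof (rule ccontr)
    assume "\<not> ?thesis"
    then have "m - 1 / Suc n \<in> S" unfolding S_def by (auto simp: eventually_at_top_linorder not_less)
    then have "m \<le> m - 1 / Suc n" unfolding m_def using bdd by (rule cInf_lower)
    then show False by simp
  qed
  then obtain t1 where t1: "\<And>n. real n \<le> t1 n" "\<And>n. m - 1 / Suc n < \<bar>f (t1 n)\<bar>" by metis
  have t1_top: "filterlim t1 at_top sequentially"
    by (rule filterlim_at_top_mono[OF filterlim_real_sequentially]) (simp add: t1)
  have lim1: "(\<lambda>n. \<bar>f (t1 n)\<bar>) \<longlonglongrightarrow> m"
  proof (rule LIMSEQ_I)
    fix e :: real assume e: "e > 0"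
    have "\<forall>\<^sub>F n in sequentially. \<bar>f (t1 n)\<bar> \<le> m + e/2"
      using filterlim_iff[THEN iffD1, OF t1_top, rule_format, OF up[of "e/2"]] e by simp
    moreover have "\<forall>\<^sub>F n in sequentially. 1 / real (Suc n) < e"
      using LIMSEQ_inverse_real_of_nat[THEN order_tendstoD(2), OF e] by (simp add: inverse_eq_divide)
    ultimately have "\<forall>\<^sub>F n in sequentially. norm (\<bar>f (t1 n)\<bar> - m) < e"
    proof eventually_elim
      case (elim n) then show ?case using t1(2)[of n] e by (simp add: abs_less_iff)
    qed
    then show "\<exists>no. \<forall>n\<ge>no. norm (\<bar>f (t1 n)\<bar> - m) < e" by (simp add: eventually_sequentially)
  qed
  have "\<exists>a. \<bar>a\<bar> = 1 \<and> infinite {n. \<bar>f (t1 n)\<bar> = a * f (t1 n)}"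
  proof (rule ccontr)
    assume "\<not> ?thesis"
    then have "finite {n. \<bar>f (t1 n)\<bar> = 1 * f (t1 n)}" "finite {n. \<bar>f (t1 n)\<bar> = -1 * f (t1 n)}"
      by (metis (mono_tags) abs_1 abs_minus_cancel)+
    then have "finite ({n. \<bar>f (t1 n)\<bar> = 1 * f (t1 n)} \<union> {n. \<bar>f (t1 n)\<bar> = -1 * f (t1 n)})" by blast
    moreover have "{n. \<bar>f (t1 n)\<bar> = 1 * f (t1 n)} \<union> {n. \<bar>f (t1 n)\<bar> = -1 * f (t1 n)} = UNIV" by auto
    ultimately have "finite (UNIV :: nat set)" by (simp only:)
    then show False by simp
  qed
  then obtain a where a: "\<bar>a\<bar> = 1" "infinite {n. \<bar>f (t1 n)\<bar> = a * f (t1 n)}" by blast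
  define k where "k = enumerate {n. \<bar>f (t1 n)\<bar> = a * f (t1 n)}"
  have k: "strict_mono k" "\<And>n. \<bar>f (t1 (k n))\<bar> = a * f (t1 (k n))"
    using strict_mono_enumerate[OF a(2)] enumerate_in_set[OF a(2)] by (auto simp: k_def)
  show thesis
  proof (rule that[OF m0 up a(1)])
    show "filterlim (\<lambda>n. t1 (k n)) at_top sequentially"
      by (rule filterlim_compose[OF t1_top filterlim_subseq[OF k(1)]])
    show "(\<lambda>n. a * f (t1 (k n))) \<longlonglongrightarrow> m"
      using LIMSEQ_subseq_LIMSEQ[OF lim1 k(1)] k(2) by (simp add: o_def)
  qed
qed

text \<open>
  Only lattices through the origin are excluded: it is the group generated by the steps that has to be dense.
\<close>

locale signed_walk = drift_walk P Y \<theta> \<rho> for P :: "'p measure" and Y \<theta> \<rho> +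
  fixes X :: "'p \<Rightarrow> real"
  assumes X_meas[measurable]: "X \<in> borel_measurable P" and X_sign: "\<And>\<omega>. \<bar>X \<omega>\<bar> = 1"
    and Y_nonlattice: "\<And>l. l > 0 \<Longrightarrow> \<not> (AE \<omega> in P. Y \<omega> \<in> {of_int k * l | k. True})"
begin

lemma AE_in_support: "AE \<omega> in P. \<forall>\<delta>>0. prob {\<omega>'\<in>space P. \<bar>Y \<omega>' - Y \<omega>\<bar> < \<delta> \<and> X \<omega>' = X \<omega>} > 0"
proof -
  let ?A = "\<lambda>p q s. {\<omega>\<in>space P. Y \<omega> \<in> {p<..<q} \<and> X \<omega> = s}"
  have "AE \<omega> in P. prob (?A p q s) = 0 \<longrightarrow> \<omega> \<notin> ?A p q s" for p q s
  proof (cases "prob (?A p q s) = 0")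
    case True
    then have "?A p q s \<in> null_sets P" by (auto simp: null_sets_def emeasure_eq_measure)
    then show ?thesis by (auto dest: AE_not_in)
  qed simp
  then have "AE \<omega> in P. \<forall>p\<in>\<rat>. \<forall>q\<in>\<rat>. \<forall>s\<in>{1,-1}. prob (?A p q s) = 0 \<longrightarrow> \<omega> \<notin> ?A p q s"
    by (intro AE_ball_countable' countable_rat) auto
  then show ?thesis
  proof (rule AE_mp, intro AE_I2 impI allI)
    fix \<omega> and \<delta> :: real
    assume \<omega>: "\<omega> \<in> space P" and d: "\<delta> > 0"
      and *: "\<forall>p\<in>\<rat>. \<forall>q\<in>\<rat>. \<forall>s\<in>{1,-1}. prob (?A p q s) = 0 \<longrightarrow> \<omega> \<notin> ?A p q s"
    obtain p where p: "p \<in> \<rat>" "Y \<omega> - \<delta> < p" "p < Y \<omega>"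
      using Rats_dense_in_real[of "Y \<omega> - \<delta>" "Y \<omega>"] d by auto
    obtain q where q: "q \<in> \<rat>" "Y \<omega> < q" "q < Y \<omega> + \<delta>"
      using Rats_dense_in_real[of "Y \<omega>" "Y \<omega> + \<delta>"] d by auto
    have "X \<omega> \<in> {1,-1}" using X_sign[of \<omega>] by (auto simp: abs_if split: if_splits)
    then have "prob (?A p q (X \<omega>)) \<noteq> 0" using * p q \<omega> by auto
    then have "0 < prob (?A p q (X \<omega>))" by (simp add: measure_le_0_iff order_less_le)
    also have "\<dots> \<le> prob {\<omega>'\<in>space P. \<bar>Y \<omega>' - Y \<omega>\<bar> < \<delta> \<and> X \<omega>' = X \<omega>}"
      using p q by (intro finite_measure_mono) auto
    finally show "0 < prob {\<omega>'\<in>space P. \<bar>Y \<omega>' - Y \<omega>\<bar> < \<delta> \<and> X \<omega>' = X \<omega>}" .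
  qed
qed

end

text \<open>
  The equation only needs to hold up to an error that vanishes at infinity, because all arguments take
  place along sequences \<open>t\<^sub>n \<rightarrow> \<infinity>\<close>. The number \<open>m\<close> is an asymptotic bound for \<open>\<bar>f\<bar>\<close>.
\<close>

locale asymptotic_solution = signed_walk P Y \<theta> \<rho> X for P :: "'p measure" and Y \<theta> \<rho> X +
  fixes f :: "real \<Rightarrow> real" and b L m :: real
  assumes f_bound: "\<And>t. \<bar>f t\<bar> \<le> b"
    and f_lip: "\<And>s t. \<bar>f s - f t\<bar> \<le> L * \<bar>s - t\<bar>"
    and f_eq: "((\<lambda>t. f t - (\<integral>\<omega>. X \<omega> * f (t - Y \<omega>) \<partial>P)) \<longlongrightarrow> 0) at_top"
    and m_up: "\<And>e. e > 0 \<Longrightarrow> \<forall>\<^sub>F t in at_top. \<bar>f t\<bar> \<le> m + e"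
begin

lemma L_nonneg: "0 \<le> L"
  using f_lip[of 1 0] by (simp add: order_trans[OF abs_ge_zero])

lemma f_meas[measurable]: "f \<in> borel_measurable borel"
proof (rule borel_measurable_continuous_onI)
  have "L-lipschitz_on UNIV f"
    by (rule lipschitz_onI) (auto simp: dist_real_def f_lip L_nonneg)
  then show "continuous_on UNIV f" by (rule lipschitz_on_continuous_on)
qed

text \<open>
  Wherever \<open>f\<close> comes close to the extremal value \<open>m\<close> (up to a sign), so it does after a shift by \<open>y\<close>, with its
  sign multiplied by \<open>\<sigma>\<close>.
\<close>

definition transports :: "real \<Rightarrow> real \<Rightarrow> bool" where
  "transports \<sigma> y \<longleftrightarrow> (\<forall>t a. filterlim t at_top sequentially \<longrightarrow> \<bar>a\<bar> = 1 \<longrightarrow>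
     (\<lambda>n. a * f (t n)) \<longlonglongrightarrow> m \<longrightarrow> (\<lambda>n. \<sigma> * a * f (t n - y)) \<longlonglongrightarrow> m)"

lemma transportsD:
  "transports \<sigma> y \<Longrightarrow> filterlim t at_top sequentially \<Longrightarrow> \<bar>a\<bar> = 1 \<Longrightarrow>
     (\<lambda>n. a * f (t n)) \<longlonglongrightarrow> m \<Longrightarrow> (\<lambda>n. \<sigma> * a * f (t n - y)) \<longlonglongrightarrow> m"
  by (auto simp: transports_def)

lemma filterlim_shift: "filterlim t at_top sequentially \<Longrightarrow> filterlim (\<lambda>n. t n - y :: real) at_top sequentially"
  using filterlim_tendsto_add_at_top[of "\<lambda>_. - y" "- y" sequentially t] by (simp add: add.commute)

lemma transports_add:
  assumes "transports \<sigma> y" "transports \<sigma>' y'" "\<bar>\<sigma>\<bar> = 1"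
  shows "transports (\<sigma>' * \<sigma>) (y + y')"
  unfolding transports_def
proof (intro allI impI)
  fix t a assume t: "filterlim t at_top sequentially" and a: "\<bar>a\<bar> = (1::real)"
    and lim: "(\<lambda>n. a * f (t n)) \<longlonglongrightarrow> m"
  have "(\<lambda>n. \<sigma> * a * f (t n - y)) \<longlonglongrightarrow> m" by (rule transportsD[OF assms(1) t a lim])
  then have "(\<lambda>n. \<sigma>' * (\<sigma> * a) * f ((t n - y) - y')) \<longlonglongrightarrow> m"
    using assms(3) a by (intro transportsD[OF assms(2)] filterlim_shift t) (auto simp: abs_mult)
  then show "(\<lambda>n. \<sigma>' * \<sigma> * a * f (t n - (y + y'))) \<longlonglongrightarrow> m" by (simp add: mult.assoc diff_diff_eq)
qed

lemma transports_0: "transports 1 0"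
  by (auto simp: transports_def)

lemma transports_mult: "transports 1 y \<Longrightarrow> transports 1 (real n * y)"
proof (induction n)
  case (Suc n)
  then show ?case using transports_add[of 1 y 1 "real n * y"] by (simp add: algebra_simps)
qed (simp add: transports_0)

text \<open>
  The equation exhibits \<open>a f (t\<^sub>n)\<close> as an average of the values \<open>a X f (t\<^sub>n - Y)\<close>, none of which exceeds \<open>m\<close>
  asymptotically. If the average tends to \<open>m\<close>, the values do so in mean, hence also near every point of the support;
  the Lipschitz condition passes from nearby points to the point itself.
\<close>

lemma transports_support:
  assumes supp: "\<And>\<delta>. \<delta> > 0 \<Longrightarrow> prob {\<omega>\<in>space P. \<bar>Y \<omega> - y\<bar> < \<delta> \<and> X \<omega> = \<sigma>} > 0"
  shows "transports \<sigma> y"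
  unfolding transports_def
proof (intro allI impI)
  fix t and a :: real assume t: "filterlim t at_top sequentially" and a: "\<bar>a\<bar> = (1::real)"
    and lim: "(\<lambda>n. a * f (t n)) \<longlonglongrightarrow> m"
  define \<phi> where "\<phi> n \<omega> = a * X \<omega> * f (t n - Y \<omega>)" for n \<omega>
  have [measurable]: "\<phi> n \<in> borel_measurable P" for n unfolding \<phi>_def by measurable
  have \<phi>_abs: "\<bar>\<phi> n \<omega>\<bar> = \<bar>f (t n - Y \<omega>)\<bar>" for n \<omega> by (simp add: \<phi>_def abs_mult a X_sign)
  have \<phi>b: "\<bar>\<phi> n \<omega>\<bar> \<le> b" for n \<omega> by (simp add: \<phi>_abs f_bound)
  have L1: "(\<lambda>n. \<integral>\<omega>. \<bar>\<phi> n \<omega> - m\<bar> \<partial>P) \<longlonglongrightarrow> 0"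
  proof (rule L1_convergence_to_upper_bound)
    show "\<phi> n \<in> borel_measurable P" for n by measurable
    show "\<bar>\<phi> n \<omega>\<bar> \<le> b" for n \<omega> by (rule \<phi>b)
    show "\<forall>\<^sub>F n in sequentially. \<phi> n \<omega> \<le> m + e" if "e > 0" for \<omega> e
    proof -
      have "\<forall>\<^sub>F n in sequentially. \<bar>f (t n - Y \<omega>)\<bar> \<le> m + e"
        using filterlim_iff[THEN iffD1, OF filterlim_shift[OF t], rule_format, OF m_up[OF that]] .
      then show ?thesis by eventually_elim (metis \<phi>_abs abs_ge_self order_trans)
    qed
    have "(\<lambda>n. f (t n) - (\<integral>\<omega>. X \<omega> * f (t n - Y \<omega>) \<partial>P)) \<longlonglongrightarrow> 0"
      by (rule filterlim_compose[OF f_eq t])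
    then have "(\<lambda>n. a * f (t n) - a * (f (t n) - (\<integral>\<omega>. X \<omega> * f (t n - Y \<omega>) \<partial>P))) \<longlonglongrightarrow> m - a * 0"
      by (intro tendsto_intros lim)
    then show "(\<lambda>n. \<integral>\<omega>. \<phi> n \<omega> \<partial>P) \<longlonglongrightarrow> m"
      by (simp add: \<phi>_def mult.assoc algebra_simps)
  qed
  show "(\<lambda>n. \<sigma> * a * f (t n - y)) \<longlonglongrightarrow> m"
  proof (rule LIMSEQ_I)
    fix e :: real assume e: "e > 0"
    \<comment> \<open>Half of \<open>e\<close> is spent on the Lipschitz interpolation between points at distance \<open>\<delta>\<close>; \<open>L + 1\<close> avoids division by zero.\<close>
  define \<delta> where "\<delta> = e / (2 * (L + 1))"
    have \<delta>: "\<delta> > 0" using e L_nonneg by (simp add: \<delta>_def)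
    have L\<delta>: "L * \<delta> < e / 2"
      using e L_nonneg by (simp add: \<delta>_def field_simps)
    define A where "A = {\<omega>\<in>space P. \<bar>Y \<omega> - y\<bar> < \<delta> \<and> X \<omega> = \<sigma>}"
    define p where "p = prob A"
    have [measurable]: "A \<in> events" unfolding A_def by measurable
    have p: "p > 0" unfolding p_def A_def by (rule supp[OF \<delta>])
    then have "A \<noteq> {}" by (auto simp: p_def)
    then have \<sigma>: "\<bar>\<sigma>\<bar> = 1" using X_sign by (auto simp: A_def)
    have "\<forall>\<^sub>F n in sequentially. (\<integral>\<omega>. \<bar>\<phi> n \<omega> - m\<bar> \<partial>P) < p * (e / 2)"
      using e p by (intro order_tendstoD(2)[OF L1]) simp
    then have "\<forall>\<^sub>F n in sequentially. norm (\<sigma> * a * f (t n - y) - m) < e"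
    proof eventually_elim
      case (elim n)
      let ?v = "\<bar>\<sigma> * a * f (t n - y) - m\<bar>"
      have int: "integrable P (\<lambda>\<omega>. \<bar>\<phi> n \<omega> - m\<bar>)"
      proof -
        have "integrable P (\<phi> n)" by (rule integrable_const_bound[where B=b]) (auto simp: \<phi>b)
        then show ?thesis by (intro integrable_abs Bochner_Integration.integrable_diff) auto
      qed
      have "p * (?v - L * \<delta>) = (\<integral>\<omega>. indicator A \<omega> * (?v - L * \<delta>) \<partial>P)"
        by (simp add: p_def)
      also have "\<dots> \<le> (\<integral>\<omega>. \<bar>\<phi> n \<omega> - m\<bar> \<partial>P)"
      proof (rule integral_mono[OF _ int])
        show "integrable P (\<lambda>\<omega>. indicator A \<omega> * (?v - L * \<delta>))"
          by (intro integrable_mult_left integrable_real_indicator) (auto simp: emeasure_eq_measure)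
        fix \<omega>
        show "indicator A \<omega> * (?v - L * \<delta>) \<le> \<bar>\<phi> n \<omega> - m\<bar>"
        proof (cases "\<omega> \<in> A")
          case True
          then have w: "\<bar>Y \<omega> - y\<bar> < \<delta>" "X \<omega> = \<sigma>" by (auto simp: A_def)
          have "\<bar>\<sigma> * a * f (t n - y) - \<phi> n \<omega>\<bar> = \<bar>\<sigma> * a * (f (t n - y) - f (t n - Y \<omega>))\<bar>"
            using w by (simp add: \<phi>_def algebra_simps)
          also have "\<dots> = \<bar>f (t n - y) - f (t n - Y \<omega>)\<bar>" by (simp add: abs_mult \<sigma> a)
          also have "\<dots> \<le> L * \<bar>Y \<omega> - y\<bar>" using f_lip[of "t n - y" "t n - Y \<omega>"] by simp
          also have "\<dots> \<le> L * \<delta>" using w L_nonneg by (intro mult_left_mono) auto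
          finally have "?v - L * \<delta> \<le> \<bar>\<phi> n \<omega> - m\<bar>" by linarith
          then show ?thesis using True by simp
        qed simp
      qed
      also have "\<dots> < p * (e / 2)" by fact
      finally have "?v - L * \<delta> < e / 2" using p by simp
      then show ?case using L\<delta> by simp
    qed
    then show "\<exists>no. \<forall>n\<ge>no. norm (\<sigma> * a * f (t n - y) - m) < e"
      by (simp add: eventually_sequentially)
  qed
qed

lemma AE_transports: "AE \<omega> in P. transports (X \<omega>) (Y \<omega>)"
  using AE_in_support by (rule AE_mp) (intro AE_I2 impI transports_support, auto)

text \<open>
  Differences of sign-preserving shifts form a group. It contains \<open>2 Y\<close> almost surely, since two
  steps of equal sign preserve the sign; if it were contained in a lattice, \<open>Y\<close> would live on the
  lattice of half the span.
\<close>

lemma small_transport_difference: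
  assumes "\<delta> > 0"
  obtains x y where "transports 1 x" "transports 1 y" "0 < x - y" "x - y < \<delta>"
proof -
  define D where "D = {x - y | x y. transports 1 x \<and> transports 1 y}"
  have "\<exists>d\<in>D. 0 < d \<and> d < \<delta>"
  proof (rule small_positive_element[OF _ _ _ assms])
    show "0 \<in> D" using transports_0 by (force simp: D_def)
    show "x - y \<in> D" if xyD: "x \<in> D" "y \<in> D" for x y
    proof -
      obtain x1 x2 y1 y2 where x: "x = x1 - x2" "transports 1 x1" "transports 1 x2"
        and y: "y = y1 - y2" "transports 1 y1" "transports 1 y2" using xyD unfolding D_def by blast
      have "transports 1 (x1 + y2)" "transports 1 (x2 + y1)"
        using transports_add[of 1 _ 1] x y by fastforce+
      moreover have "x - y = (x1 + y2) - (x2 + y1)" using x y by simp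
      ultimately show ?thesis unfolding D_def by blast
    qed
    fix l :: real assume l: "l > 0"
    show "\<exists>d\<in>D. \<forall>k::int. d \<noteq> of_int k * l"
    proof (rule ccontr)
      assume "\<not> ?thesis"
      then have lat: "\<exists>k::int. d = of_int k * l" if "d \<in> D" for d using that by blast
      have "AE \<omega> in P. Y \<omega> \<in> {of_int k * (l / 2) | k. True}"
        using AE_transports
      proof (rule AE_mp, intro AE_I2 impI)
        fix \<omega> assume tr: "transports (X \<omega>) (Y \<omega>)"
        have "transports (X \<omega> * X \<omega>) (Y \<omega> + Y \<omega>)" using transports_add[OF tr tr X_sign] .
        moreover have "X \<omega> * X \<omega> = 1" using X_sign[of \<omega>] by (metis abs_mult_self_eq mult_1)
        ultimately have "2 * Y \<omega> - 0 \<in> D" using transports_0 unfolding D_def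
          by (intro CollectI exI[of _ "2 * Y \<omega>"] exI[of _ 0]) auto
        then obtain k :: int where "2 * Y \<omega> = of_int k * l" using lat by force
        then have "Y \<omega> = of_int k * (l / 2)" by simp
        then show "Y \<omega> \<in> {of_int k * (l / 2) | k. True}" by blast
      qed
      then show False using Y_nonlattice[of "l / 2"] l by auto
    qed
  qed
  then show thesis using that by (auto simp: D_def)
qed

text \<open>
  Combining \<open>N\<close> shifts, \<open>j\<close> of them equal to \<open>x\<close> and the others to \<open>y\<close>, reaches an arithmetic progression with
  the small span \<open>x - y\<close>; the Lipschitz condition fills the gaps.
\<close>

lemma long_plateau:
  assumes t0: "filterlim t0 at_top sequentially" and a: "\<bar>a\<bar> = 1" and lim: "(\<lambda>n. a * f (t0 n)) \<longlonglongrightarrow> m"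
    and l: "l > 0" and e: "e > 0"
  shows "\<exists>\<tau>>l. \<forall>s. \<bar>s\<bar> \<le> l \<longrightarrow> \<bar>a * f (\<tau> + s) - m\<bar> < e"
proof -
  define \<delta> where "\<delta> = e / (2 * (L + 1))"
  have \<delta>: "\<delta> > 0" using e L_nonneg by (simp add: \<delta>_def)
  have L\<delta>: "L * \<delta> < e / 2"
    using e L_nonneg by (simp add: \<delta>_def field_simps)
  obtain x y where xy: "transports 1 x" "transports 1 y" "0 < x - y" "x - y < \<delta>"
    using small_transport_difference[OF \<delta>] .
  define d where "d = x - y"
  have d: "0 < d" "d < \<delta>" using xy by (auto simp: d_def)
  obtain N :: nat where N: "2 * l / d \<le> real N" using real_arch_simple by blast
  have tr: "transports 1 (real N * y + real j * d)" if "j \<le> N" for j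
  proof -
    have "transports 1 (real (N - j) * y + real j * x)"
      using transports_add[of 1 _ 1, OF transports_mult[OF xy(2), of "N - j"] transports_mult[OF xy(1), of j]]
      by simp
    moreover have "real (N - j) * y + real j * x = real N * y + real j * d"
      using that by (simp add: d_def of_nat_diff algebra_simps)
    ultimately show ?thesis by simp
  qed
  have "\<forall>\<^sub>F n in sequentially. \<bar>a * f (t0 n - (real N * y + real j * d)) - m\<bar> < e / 2" if "j \<le> N" for j
  proof -
    have "(\<lambda>n. 1 * a * f (t0 n - (real N * y + real j * d))) \<longlonglongrightarrow> m"
      by (rule transportsD[OF tr[OF that] t0 a lim])
    then show ?thesis using e
      by (auto dest!: tendstoD[where e="e/2"] simp: dist_real_def)
  qed
  then have "\<forall>\<^sub>F n in sequentially. \<forall>j\<in>{..N}. \<bar>a * f (t0 n - (real N * y + real j * d)) - m\<bar> < e / 2"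
    by (intro eventually_ball_finite) auto
  moreover have "\<forall>\<^sub>F n in sequentially. t0 n > real N * y + 2 * l"
    using t0 by (simp add: filterlim_at_top_dense)
  ultimately have "\<forall>\<^sub>F n in sequentially. t0 n > real N * y + 2 * l \<and>
      (\<forall>j\<in>{..N}. \<bar>a * f (t0 n - (real N * y + real j * d)) - m\<bar> < e / 2)"
    by eventually_elim auto
  then obtain n where n: "t0 n > real N * y + 2 * l"
    "\<And>j. j \<le> N \<Longrightarrow> \<bar>a * f (t0 n - (real N * y + real j * d)) - m\<bar> < e / 2"
    using eventually_happens[of _ sequentially] by fastforce
  \<comment> \<open>The points \<open>t0 n - N y - j d\<close> with \<open>j \<le> N\<close> come within distance \<open>\<delta>\<close> of every point of \<open>[\<tau> - l, \<tau> + l]\<close>.\<close>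
  define \<tau> where "\<tau> = t0 n - real N * y - l"
  show ?thesis
  proof (intro exI[of _ \<tau>] conjI allI impI)
    show "l < \<tau>" using n by (simp add: \<tau>_def)
    fix s assume s: "\<bar>s\<bar> \<le> l"
    define j where "j = nat \<lfloor>(l - s) / d\<rfloor>"
    have q: "0 \<le> (l - s) / d" "(l - s) / d \<le> 2 * l / d" using s d by (auto intro!: divide_right_mono)
    have j: "real j \<le> (l - s) / d" "(l - s) / d < real j + 1" unfolding j_def using q by linarith+
    have jN: "j \<le> N" using j q N by linarith
    have j': "real j * d \<le> l - s" "l - s < (real j + 1) * d" using j d by (auto simp: field_simps)
    let ?u = "t0 n - (real N * y + real j * d)"
    have "\<bar>(\<tau> + s) - ?u\<bar> \<le> \<delta>" using j' d by (simp add: \<tau>_def algebra_simps abs_le_iff)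
    then have "\<bar>f (\<tau> + s) - f ?u\<bar> \<le> L * \<delta>"
      using f_lip[of "\<tau> + s" ?u] L_nonneg mult_left_mono order_trans by blast
    then have "\<bar>a * f (\<tau> + s) - a * f ?u\<bar> \<le> L * \<delta>"
      by (simp add: right_diff_distrib[symmetric] abs_mult a)
    then show "\<bar>a * f (\<tau> + s) - m\<bar> < e" using n(2)[OF jN] L\<delta> by linarith
  qed
qed

lemma growing_plateaus:
  assumes t0: "filterlim t0 at_top sequentially" and a: "\<bar>a\<bar> = 1" and lim: "(\<lambda>n. a * f (t0 n)) \<longlonglongrightarrow> m"
  obtains \<tau> where "filterlim \<tau> at_top sequentially" "\<And>s. (\<lambda>n. a * f (\<tau> n + s)) \<longlonglongrightarrow> m"
proof -
  have "\<exists>\<tau>. \<tau> > real (Suc n) \<and> (\<forall>s. \<bar>s\<bar> \<le> real (Suc n) \<longrightarrow> \<bar>a * f (\<tau> + s) - m\<bar> < inverse (real (Suc n)))" for n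
    using long_plateau[OF assms, of "real (Suc n)" "inverse (real (Suc n))"] by auto
  then obtain \<tau> where \<tau>: "\<And>n. \<tau> n > real (Suc n)"
    "\<And>n s. \<bar>s\<bar> \<le> real (Suc n) \<Longrightarrow> \<bar>a * f (\<tau> n + s) - m\<bar> < inverse (real (Suc n))" by metis
  show thesis
  proof (rule that)
    show "filterlim \<tau> at_top sequentially"
      by (rule filterlim_at_top_mono[OF filterlim_real_sequentially]) (use \<tau>(1) in \<open>auto intro!: always_eventually less_imp_le order.strict_trans1[OF _ \<tau>(1)]\<close>)
    fix s
    show "(\<lambda>n. a * f (\<tau> n + s)) \<longlonglongrightarrow> m"
    proof (rule LIM_zero_cancel, rule Lim_null_comparison[OF _ LIMSEQ_inverse_real_of_nat])
      obtain k :: nat where k: "\<bar>s\<bar> \<le> real k" using real_arch_simple by blast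
      show "\<forall>\<^sub>F n in sequentially. norm (a * f (\<tau> n + s) - m) \<le> inverse (real (Suc n))"
        using eventually_ge_at_top[of k]
      proof eventually_elim
        case (elim n)
        then have "\<bar>s\<bar> \<le> real (Suc n)" using k by linarith
        then show ?case using \<tau>(2)[of s n] by (simp add: less_imp_le)
      qed
    qed
  qed
qed

end

context signed_walk begin

lemma plateaus_exist:
  assumes f_bound: "\<And>t. \<bar>f t\<bar> \<le> b" and f_lip: "\<And>s t. \<bar>f s - f t\<bar> \<le> L * \<bar>s - t\<bar>"
    and f_eq: "((\<lambda>t. f t - (\<integral>\<omega>. X \<omega> * f (t - Y \<omega>) \<partial>P)) \<longlongrightarrow> 0) at_top"
  obtains m a \<tau> where "0 \<le> m" "\<And>e. e > 0 \<Longrightarrow> \<forall>\<^sub>F t in at_top. \<bar>f t\<bar> \<le> m + e" "\<bar>a\<bar> = 1"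
    "filterlim \<tau> at_top sequentially" "\<And>s. (\<lambda>n. a * f (\<tau> n + s)) \<longlonglongrightarrow> m"
proof -
  obtain m a t0 where m: "0 \<le> m" "\<And>e. e > 0 \<Longrightarrow> \<forall>\<^sub>F t in at_top. \<bar>f t\<bar> \<le> m + e"
    and a: "\<bar>a\<bar> = 1" and t0: "filterlim t0 at_top sequentially" "(\<lambda>n. a * f (t0 n)) \<longlonglongrightarrow> m"
    using limsup_abs_at_top[of f b] f_bound by metis
  interpret asymptotic_solution P Y \<theta> \<rho> X f b L m
    by unfold_locales (fact f_bound f_lip f_eq m)+
  show thesis using growing_plateaus[OF t0(1) a t0(2)] that[OF m a] by blast
qed

text \<open>
  On a plateau the function is nearly constant and equal to \<open>\<plusminus>m\<close>; a step with negative sign maps this value to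
  its negative at a point of the same plateau.
\<close>

lemma signed_solution_tendsto_0:
  assumes f_bound: "\<And>t. \<bar>f t\<bar> \<le> b" and f_lip: "\<And>s t. \<bar>f s - f t\<bar> \<le> L * \<bar>s - t\<bar>"
    and f_eq: "((\<lambda>t. f t - (\<integral>\<omega>. X \<omega> * f (t - Y \<omega>) \<partial>P)) \<longlongrightarrow> 0) at_top"
    and neg: "prob {\<omega>\<in>space P. X \<omega> = -1} > 0"
  shows "(f \<longlongrightarrow> 0) at_top"
proof -
  obtain m a \<tau> where m: "0 \<le> m" "\<And>e. e > 0 \<Longrightarrow> \<forall>\<^sub>F t in at_top. \<bar>f t\<bar> \<le> m + e"
    and a: "\<bar>a\<bar> = 1" and \<tau>: "filterlim \<tau> at_top sequentially" "\<And>s. (\<lambda>n. a * f (\<tau> n + s)) \<longlonglongrightarrow> m"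
    using plateaus_exist[OF f_bound f_lip f_eq] by metis
  interpret asymptotic_solution P Y \<theta> \<rho> X f b L m
    by unfold_locales (fact f_bound f_lip f_eq m)+
  have "\<exists>y. transports (-1) y"
  proof (rule ccontr)
    assume no: "\<not> ?thesis"
    from AE_transports have "AE \<omega> in P. \<not> X \<omega> = -1"
      by eventually_elim (use no in auto)
    then have "prob {\<omega>\<in>space P. X \<omega> = -1} = 0" by (subst (asm) AE_iff_measurable[OF _ refl]) (auto simp: measure_def)
    then show False using neg by simp
  qed
  then obtain y where y: "transports (-1) y" by blast
  have "(\<lambda>n. - 1 * a * f (\<tau> n - y)) \<longlonglongrightarrow> m"
    using \<tau>(2)[of 0] by (intro transportsD[OF y \<tau>(1) a]) simp
  moreover have "(\<lambda>n. - (a * f (\<tau> n + (- y)))) \<longlonglongrightarrow> - m" by (intro tendsto_minus \<tau>)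
  ultimately have "m = - m" by (intro LIMSEQ_unique[of "\<lambda>n. - 1 * a * f (\<tau> n - y)"]) simp_all
  then have m0: "m = 0" by simp
  show ?thesis
  proof (rule tendstoI)
    fix e :: real assume "e > 0"
    then have "\<forall>\<^sub>F t in at_top. \<bar>f t\<bar> \<le> 0 + e / 2" using m(2)[of "e/2"] m0 by simp
    then show "\<forall>\<^sub>F t in at_top. dist (f t) 0 < e"
      by eventually_elim (use \<open>e > 0\<close> in simp)
  qed
qed

end

section \<open>The mean identity along plateaus\<close>

definition primitive :: "(real \<Rightarrow> real) \<Rightarrow> real \<Rightarrow> real" where
  "primitive f t = (\<integral>s. indicator {..t} s * f s \<partial>lborel)"

lemma nn_integral_exp_atMost:
  assumes "\<theta> > 0"
  shows "(\<integral>\<^sup>+s. ennreal (exp (\<theta> * s)) * indicator {..t} s \<partial>lborel) = ennreal (exp (\<theta> * t) / \<theta>)"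
proof -
  have "(\<integral>\<^sup>+s. ennreal (exp (\<theta> * s)) * indicator {..t} s \<partial>lborel)
    = (\<integral>\<^sup>+s. ennreal (exp (- \<theta> * s)) * indicator {-t..} s \<partial>lborel)"
    using nn_integral_real_affine[where c="-1" and t=0 and f="\<lambda>s. ennreal (exp (\<theta> * s)) * indicator {..t} s"]
    by (simp add: indicator_def minus_le_iff cong: nn_integral_cong)
  also have "\<dots> = ennreal (0 - (- exp (- \<theta> * (-t)) / \<theta>))"
  proof (rule nn_integral_FTC_atLeast)
    show "((\<lambda>x. - exp (- \<theta> * x) / \<theta>) \<longlongrightarrow> 0) at_top"
      using assms by real_asymp
  qed (use assms in \<open>auto intro!: derivative_eq_intros\<close>)
  finally show ?thesis using assms by simp
qed

lemma integrable_exp_atMost: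
  fixes f :: "real \<Rightarrow> real"
  assumes [measurable]: "f \<in> borel_measurable borel" and "\<And>t. \<bar>f t\<bar> \<le> B * exp (\<theta> * t)" "\<theta> > 0"
  shows "integrable lborel (\<lambda>s. indicator {..t} s * f s)"
proof (rule integrableI_bounded)
  have B: "0 \<le> B" using assms(2)[of 0] abs_ge_zero[of "f 0"] by simp
  have "(\<integral>\<^sup>+s. ennreal (norm (indicator {..t} s * f s)) \<partial>lborel)
     \<le> (\<integral>\<^sup>+s. ennreal B * (ennreal (exp (\<theta> * s)) * indicator {..t} s) \<partial>lborel)"
    using assms(2) B by (intro nn_integral_mono)
      (auto simp: indicator_def ennreal_mult'[symmetric] intro: ennreal_leI)
  also have "\<dots> = ennreal B * ennreal (exp (\<theta> * t) / \<theta>)"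
    by (subst nn_integral_cmult) (auto simp: nn_integral_exp_atMost assms)
  also have "\<dots> < \<infinity>" by (simp add: ennreal_mult_less_top)
  finally show "(\<integral>\<^sup>+s. ennreal (norm (indicator {..t} s * f s)) \<partial>lborel) < \<infinity>" .
qed simp

lemma primitive_nonneg: "(\<And>t. 0 \<le> f t) \<Longrightarrow> 0 \<le> primitive f t"
  unfolding primitive_def by (intro Bochner_Integration.integral_nonneg) simp

lemma primitive_mono:
  assumes "\<And>t. integrable lborel (\<lambda>s. indicator {..t} s * f s)" "\<And>t. 0 \<le> f t" "s \<le> t"
  shows "primitive f s \<le> primitive f t"
  unfolding primitive_def using assms by (intro integral_mono) (auto simp: indicator_def)

lemma primitive_exp_bound:
  assumes [measurable]: "f \<in> borel_measurable borel" and "\<And>t. 0 \<le> f t" "\<And>t. f t \<le> B * exp (\<theta> * t)" "\<theta> > 0"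
  shows "primitive f t \<le> B / \<theta> * exp (\<theta> * t)"
proof -
  have B: "0 \<le> B" using order_trans[OF assms(2) assms(3), of 0] by simp
  have "ennreal (primitive f t) = (\<integral>\<^sup>+s. ennreal (indicator {..t} s * f s) \<partial>lborel)"
    unfolding primitive_def using assms
    by (intro nn_integral_eq_integral[symmetric] integrable_exp_atMost[where B=B]) auto
  also have "\<dots> \<le> (\<integral>\<^sup>+s. ennreal B * (ennreal (exp (\<theta> * s)) * indicator {..t} s) \<partial>lborel)"
    using assms(2,3) B by (intro nn_integral_mono)
      (auto simp: indicator_def ennreal_mult'[symmetric] intro: ennreal_leI)
  also have "\<dots> = ennreal B * ennreal (exp (\<theta> * t) / \<theta>)"
    by (subst nn_integral_cmult) (auto simp: nn_integral_exp_atMost assms)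
  also have "\<dots> = ennreal (B / \<theta> * exp (\<theta> * t))"
    using B assms(4) by (simp add: ennreal_mult'[symmetric])
  finally show ?thesis using B assms(4) by (subst (asm) ennreal_le_iff) auto
qed

lemma measurable_primitive[measurable]:
  assumes [measurable]: "f \<in> borel_measurable borel"
  shows "primitive f \<in> borel_measurable borel"
proof -
  have "(\<lambda>t. \<integral>s. (if s \<le> t then 1 else 0) * f s \<partial>lborel) \<in> borel_measurable borel"
    by measurable
  also have "(\<lambda>t. \<integral>s. (if s \<le> t then 1 else 0) * f s \<partial>lborel) = primitive f"
    unfolding primitive_def by (intro ext Bochner_Integration.integral_cong) (auto simp: indicator_def)
  finally show ?thesis .
qed

lemma primitive_diff:
  assumes "integrable lborel (\<lambda>s. indicator {..t} s * f s)" "integrable lborel (\<lambda>s. indicator {..t - y} s * f s)"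
  shows "primitive f t - primitive f (t - y) = (\<integral>s. f (t + s) * (indicator {..0} s - indicator {..-y} s) \<partial>lborel)"
proof -
  have "primitive f t - primitive f (t - y) = (\<integral>s. f s * (indicator {..t} s - indicator {..t - y} s) \<partial>lborel)"
    unfolding primitive_def using assms by (simp add: algebra_simps)
  also have "\<dots> = (\<integral>s. f (t + s) * (indicator {..t} (t + s) - indicator {..t - y} (t + s)) \<partial>lborel)"
    using lborel_integral_real_affine[of 1 "\<lambda>s. f s * (indicator {..t} s - indicator {..t - y} s)" t] by simp
  finally show ?thesis by (simp add: indicator_def)
qed

lemma indicator_atMost_diff:
  fixes y s :: real
  shows "(indicator {..0} s - indicator {..-y} s :: real)
    = (if 0 \<le> y then indicator {-y<..0} s else - indicator {0<..-y} s)"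
  by (auto simp: indicator_def)

lemma integral_indicator_atMost_diff:
  fixes y :: real
  shows "has_bochner_integral lborel (\<lambda>s. indicator {..0} s - indicator {..-y} s) y"
proof (cases "0 \<le> y")
  case True
  have "has_bochner_integral lborel (indicator {-y<..0} :: real \<Rightarrow> real) (measure lborel {-y<..0})"
    by (rule has_bochner_integral_real_indicator) (use True in auto)
  then show ?thesis using True by (simp add: indicator_atMost_diff)
next
  case False
  have "has_bochner_integral lborel (indicator {0<..-y} :: real \<Rightarrow> real) (measure lborel {0<..-y})"
    by (rule has_bochner_integral_real_indicator) (use False in auto)
  then have "has_bochner_integral lborel (\<lambda>s. - indicator {0<..-y} s :: real) (- (measure lborel {0<..-y}))"
    by (rule has_bochner_integral_minus)
  then show ?thesis using False by (simp add: indicator_atMost_diff)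
qed

lemma abs_primitive_diff_le:
  assumes [measurable]: "f \<in> borel_measurable borel" and b: "\<And>t. \<bar>f t\<bar> \<le> b"
    and int: "\<And>t. integrable lborel (\<lambda>s. indicator {..t} s * f s)"
  shows "\<bar>primitive f t - primitive f (t - y)\<bar> \<le> b * \<bar>y\<bar>"
proof -
  have b0: "0 \<le> b" using b[of 0] by linarith
  have i: "integrable lborel (\<lambda>s. b * \<bar>indicator {..0} s - indicator {..-y} s :: real\<bar>)"
    using integral_indicator_atMost_diff[of y]
    by (intro integrable_mult_right integrable_abs) (simp add: has_bochner_integral_iff)
  have "\<bar>primitive f t - primitive f (t - y)\<bar>
      \<le> (\<integral>s. \<bar>f (t + s) * (indicator {..0} s - indicator {..-y} s)\<bar> \<partial>lborel)"
    unfolding primitive_diff[OF int int] by (rule integral_abs_bound)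
  also have "\<dots> \<le> (\<integral>s. b * \<bar>indicator {..0} s - indicator {..-y} s :: real\<bar> \<partial>lborel)"
    using b b0 by (intro integral_mono' i) (auto simp: abs_mult intro: mult_right_mono)
  also have "\<dots> = b * \<bar>\<integral>s. indicator {..0} s - indicator {..-y} s \<partial>lborel\<bar>"
  proof -
    have "(\<integral>s. \<bar>indicator {..0} s - indicator {..-y} s :: real\<bar> \<partial>lborel)
        = \<bar>\<integral>s. indicator {..0} s - indicator {..-y} s \<partial>lborel\<bar>"
    proof (cases "0 \<le> y")
      case True
      then show ?thesis
        by (simp add: indicator_atMost_diff)
    next
      case False
      then show ?thesis
        by (simp add: indicator_atMost_diff)
    qed
    then show ?thesis by simp
  qed
  also have "(\<integral>s. indicator {..0} s - indicator {..-y} s \<partial>lborel) = y"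
    using integral_indicator_atMost_diff[of y] by (simp add: has_bochner_integral_iff)
  finally show ?thesis .
qed

lemma primitive_diff_on_plateau:
  assumes [measurable]: "f \<in> borel_measurable borel" and b: "\<And>t. \<bar>f t\<bar> \<le> b"
    and int: "\<And>t. integrable lborel (\<lambda>s. indicator {..t} s * f s)"
    and plateau: "\<And>s. (\<lambda>n. f (\<tau> n + s)) \<longlonglongrightarrow> c"
  shows "(\<lambda>n. primitive f (\<tau> n) - primitive f (\<tau> n - y)) \<longlonglongrightarrow> c * y"
proof -
  have i: "integrable lborel (\<lambda>s. indicator {..0} s - indicator {..-y} s :: real)"
    and y: "(\<integral>s. indicator {..0} s - indicator {..-y} s \<partial>lborel) = y"
    using integral_indicator_atMost_diff[of y] by (simp_all add: has_bochner_integral_iff)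
  have "(\<lambda>n. \<integral>s. f (\<tau> n + s) * (indicator {..0} s - indicator {..-y} s) \<partial>lborel)
    \<longlonglongrightarrow> (\<integral>s. c * (indicator {..0} s - indicator {..-y} s) \<partial>lborel)"
  proof (rule integral_dominated_convergence)
    show "integrable lborel (\<lambda>s. b * \<bar>indicator {..0} s - indicator {..-y} s :: real\<bar>)"
      using i by (intro integrable_mult_right integrable_abs)
    show "AE s in lborel. (\<lambda>n. f (\<tau> n + s) * (indicator {..0} s - indicator {..-y} s))
        \<longlonglongrightarrow> c * (indicator {..0} s - indicator {..-y} s)"
      by (intro AE_I2 tendsto_mult plateau tendsto_const)
    show "AE s in lborel. norm (f (\<tau> n + s) * (indicator {..0} s - indicator {..-y} s))
        \<le> b * \<bar>indicator {..0} s - indicator {..-y} s :: real\<bar>" for n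
      using b by (auto simp: abs_mult intro!: mult_right_mono)
  qed auto
  then show ?thesis using y by (simp add: primitive_diff[OF int int])
qed

lemma primitive_tendsto:
  assumes z: "integrable lborel z" and \<tau>: "filterlim \<tau> at_top sequentially"
  shows "(\<lambda>n. primitive z (\<tau> n)) \<longlonglongrightarrow> (\<integral>s. z s \<partial>lborel)"
  unfolding primitive_def
proof (rule integral_dominated_convergence[where w="\<lambda>s. \<bar>z s\<bar>"])
  have [measurable]: "z \<in> borel_measurable borel" using z by simp
  show "AE s in lborel. (\<lambda>n. indicator {..\<tau> n} s * z s) \<longlonglongrightarrow> z s"
  proof (intro AE_I2 tendsto_eventually)
    fix s
    have "\<forall>\<^sub>F n in sequentially. s \<le> \<tau> n" using \<tau> by (simp add: filterlim_at_top)
    then show "\<forall>\<^sub>F n in sequentially. indicator {..\<tau> n} s * z s = z s" by eventually_elim simp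
  qed
qed (use z in \<open>auto simp: indicator_def\<close>)

context drift_walk begin

lemma integrable_shift_exp_bounded:
  assumes "g \<in> borel_measurable borel" "\<And>t. 0 \<le> g t" "\<And>t. g t \<le> B * exp (\<theta> * t)"
  shows "integrable P (\<lambda>\<omega>. g (t - Y \<omega>))"
  by (rule integrable_solution_shift[where B=B]) (use assms in auto)

text \<open>
  Integrating the renewal equation over \<open>(-\<infinity>, t]\<close>.
\<close>

lemma primitive_solution:
  assumes [measurable]: "f \<in> borel_measurable borel" and f0: "\<And>t. 0 \<le> f t"
    and B: "\<And>t. f t \<le> B * exp (\<theta> * t)"
    and z: "integrable lborel z" and eq: "\<And>t. f t = z t + (\<integral>\<omega>. f (t - Y \<omega>) \<partial>P)"
  shows "integrable P (\<lambda>\<omega>. primitive f t - primitive f (t - Y \<omega>))"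
    and "(\<integral>\<omega>. primitive f t - primitive f (t - Y \<omega>) \<partial>P) = primitive z t"
proof -
  have [measurable]: "z \<in> borel_measurable borel" using z by simp
  have iP: "integrable P (\<lambda>\<omega>. primitive f (t - Y \<omega>))" for t
    by (rule integrable_shift_exp_bounded[OF _ primitive_nonneg primitive_exp_bound[where B=B]])
      (auto intro!: f0 B theta)
  then show 1: "integrable P (\<lambda>\<omega>. primitive f t - primitive f (t - Y \<omega>))" by simp
  have intf: "integrable lborel (\<lambda>s. indicator {..t} s * f s)" for t
    by (rule integrable_exp_atMost[where B=B]) (use f0 B theta in auto)
  have intz: "integrable lborel (\<lambda>s. indicator {..t} s * z s)"
    by (rule Bochner_Integration.integrable_bound[OF z]) (auto simp: indicator_def)
  have fz: "f s - z s = (\<integral>\<omega>. f (s - Y \<omega>) \<partial>P)" for s using eq[of s] by simp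
  have fz0: "0 \<le> f s - z s" for s
    unfolding fz by (rule Bochner_Integration.integral_nonneg) (rule f0)
  have ifz: "integrable lborel (\<lambda>s. indicator {..t} s * (f s - z s))"
    using intf[of t] intz by (simp add: right_diff_distrib)
  have nnfz: "ennreal (f s - z s) = (\<integral>\<^sup>+\<omega>. ennreal (f (s - Y \<omega>)) \<partial>P)" for s
    unfolding fz using integrable_shift_exp_bounded[OF _ f0 B]
    by (intro nn_integral_eq_integral[symmetric]) (auto simp: f0)
  have "ennreal (primitive f t - primitive z t) = ennreal (\<integral>s. indicator {..t} s * (f s - z s) \<partial>lborel)"
    unfolding primitive_def using intf intz by (simp add: right_diff_distrib)
  also have "\<dots> = (\<integral>\<^sup>+s. ennreal (indicator {..t} s * (f s - z s)) \<partial>lborel)"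
    using ifz fz0 by (intro nn_integral_eq_integral[symmetric]) auto
  also have "\<dots> = (\<integral>\<^sup>+s. (\<integral>\<^sup>+\<omega>. indicator {..t} s * ennreal (f (s - Y \<omega>)) \<partial>P) \<partial>lborel)"
    by (intro nn_integral_cong) (auto simp: indicator_def nnfz)
  also have "\<dots> = (\<integral>\<^sup>+\<omega>. (\<integral>\<^sup>+s. indicator {..t} s * ennreal (f (s - Y \<omega>)) \<partial>lborel) \<partial>P)"
    by (rule pair_sigma_finite.Fubini') (unfold_locales, measurable)
  also have "\<dots> = (\<integral>\<^sup>+\<omega>. ennreal (primitive f (t - Y \<omega>)) \<partial>P)"
  proof (rule nn_integral_cong)
    fix \<omega>
    have "(\<integral>\<^sup>+s. indicator {..t} s * ennreal (f (s - Y \<omega>)) \<partial>lborel)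
        = (\<integral>\<^sup>+s. ennreal (indicator {..t - Y \<omega>} s * f s) \<partial>lborel)"
      using nn_integral_real_affine[where c=1 and t="Y \<omega>" and f="\<lambda>s. indicator {..t} s * ennreal (f (s - Y \<omega>))"]
      by (auto simp: indicator_def intro!: nn_integral_cong)
    also have "\<dots> = ennreal (primitive f (t - Y \<omega>))"
      unfolding primitive_def by (rule nn_integral_eq_integral[OF intf]) (auto simp: f0)
    finally show "(\<integral>\<^sup>+s. indicator {..t} s * ennreal (f (s - Y \<omega>)) \<partial>lborel) = ennreal (primitive f (t - Y \<omega>))" .
  qed
  also have "\<dots> = ennreal (\<integral>\<omega>. primitive f (t - Y \<omega>) \<partial>P)"
    by (rule nn_integral_eq_integral[OF iP]) (auto simp: primitive_nonneg f0)
  finally have e: "ennreal (primitive f t - primitive z t) = ennreal (\<integral>\<omega>. primitive f (t - Y \<omega>) \<partial>P)" .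
  have "0 \<le> primitive f t - primitive z t"
  proof -
    have "0 \<le> (\<integral>s. indicator {..t} s * (f s - z s) \<partial>lborel)"
      by (rule Bochner_Integration.integral_nonneg) (use fz0 in auto)
    then show ?thesis unfolding primitive_def using intf[of t] intz by (simp add: right_diff_distrib)
  qed
  then have "primitive f t - primitive z t = (\<integral>\<omega>. primitive f (t - Y \<omega>) \<partial>P)"
    using e by (subst (asm) ennreal_inj) (auto intro!: Bochner_Integration.integral_nonneg primitive_nonneg f0)
  then show "(\<integral>\<omega>. primitive f t - primitive f (t - Y \<omega>) \<partial>P) = primitive z t"
    using iP by (simp add: prob_space)
qed

lemma neg_part_Y: "(\<integral>\<^sup>+\<omega>. ennreal (- Y \<omega>) \<partial>P) < \<infinity>"
proof -
  have "ennreal (- y) \<le> ennreal (1 / \<theta>) * ennreal (exp (- \<theta> * y))" for y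
  proof -
    have "1 + - \<theta> * y \<le> exp (- \<theta> * y)" by (rule exp_ge_add_one_self)
    then have "- y \<le> 1 / \<theta> * exp (- \<theta> * y)" using theta by (simp add: field_simps)
    then show ?thesis using theta by (subst ennreal_mult'[symmetric]) (auto intro: ennreal_leI)
  qed
  then have "(\<integral>\<^sup>+\<omega>. ennreal (- Y \<omega>) \<partial>P) \<le> (\<integral>\<^sup>+\<omega>. ennreal (1 / \<theta>) * ennreal (exp (- \<theta> * Y \<omega>)) \<partial>P)"
    by (intro nn_integral_mono)
  also have "\<dots> = ennreal (1 / \<theta>) * (\<integral>\<^sup>+\<omega>. ennreal (exp (- \<theta> * Y \<omega>)) \<partial>P)"
    by (rule nn_integral_cmult) simp
  also have "\<dots> \<le> ennreal (1 / \<theta>) * ennreal \<rho>" by (intro mult_left_mono Y_exp) simp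
  also have "\<dots> < \<infinity>" by (simp add: ennreal_mult_less_top)
  finally show ?thesis .
qed

text \<open>
  The relation between the forcing integral \<open>I\<close> and the limit \<open>c\<close> in the renewal theorem, covering an
  infinite mean as well.
\<close>

definition mean_identity :: "real \<Rightarrow> real \<Rightarrow> bool" where
  "mean_identity c I \<longleftrightarrow> (integrable P Y \<and> c * expectation Y = I) \<or> ((\<integral>\<^sup>+\<omega>. ennreal (Y \<omega>) \<partial>P) = \<infinity> \<and> c = 0)"

text \<open>
  On a plateau of height \<open>c\<close> the primitive \<open>F\<close> of \<open>f\<close> satisfies \<open>F \<tau> - F (\<tau> - y) \<approx> c y\<close>, so the integrated
  equation reads \<open>c E Y = \<integral>z\<close> in the limit. If \<open>E Y = \<infinity>\<close>, truncating the step at \<open>K\<close> shows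
  that \<open>c E[min Y K]\<close> stays bounded, which forces \<open>c = 0\<close>.
\<close>

lemma plateau_mean_identity:
  assumes [measurable]: "f \<in> borel_measurable borel" and f0: "\<And>t. 0 \<le> f t"
    and b: "\<And>t. f t \<le> b" and B: "\<And>t. f t \<le> B * exp (\<theta> * t)"
    and z: "integrable lborel z" and eq: "\<And>t. f t = z t + (\<integral>\<omega>. f (t - Y \<omega>) \<partial>P)"
    and \<tau>: "filterlim \<tau> at_top sequentially" and plateau: "\<And>s. (\<lambda>n. f (\<tau> n + s)) \<longlonglongrightarrow> c"
  shows "mean_identity c (\<integral>s. z s \<partial>lborel)"
proof -
  have ab: "\<bar>f t\<bar> \<le> b" for t using f0 b by (simp add: abs_of_nonneg)
  have b0: "0 \<le> b" using ab[of 0] by linarith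
  have intf: "integrable lborel (\<lambda>s. indicator {..t} s * f s)" for t
    by (rule integrable_exp_atMost[where B=B]) (use f0 B theta in auto)
  note sol = primitive_solution[OF _ f0 B z eq]
  have c0: "0 \<le> c" using LIMSEQ_le_const[OF plateau[of 0]] f0 by blast
  have lim: "(\<lambda>n. \<integral>\<omega>. primitive f (\<tau> n) - primitive f (\<tau> n - V \<omega>) \<partial>P) \<longlonglongrightarrow> (\<integral>\<omega>. c * V \<omega> \<partial>P)"
    if V: "integrable P V" for V
  proof (rule integral_dominated_convergence[where w="\<lambda>\<omega>. b * \<bar>V \<omega>\<bar>"])
    have [measurable]: "V \<in> borel_measurable P" using V by simp
    show "(\<lambda>\<omega>. primitive f (\<tau> n) - primitive f (\<tau> n - V \<omega>)) \<in> borel_measurable P" for n by measurable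
    show "(\<lambda>\<omega>. c * V \<omega>) \<in> borel_measurable P" by measurable
    show "integrable P (\<lambda>\<omega>. b * \<bar>V \<omega>\<bar>)" using V by simp
    show "AE \<omega> in P. (\<lambda>n. primitive f (\<tau> n) - primitive f (\<tau> n - V \<omega>)) \<longlonglongrightarrow> c * V \<omega>"
      by (intro AE_I2 primitive_diff_on_plateau[where b=b] ab intf plateau) simp
    show "AE \<omega> in P. norm (primitive f (\<tau> n) - primitive f (\<tau> n - V \<omega>)) \<le> b * \<bar>V \<omega>\<bar>" for n
      by (intro AE_I2) (simp add: abs_primitive_diff_le ab intf)
  qed
  have limz: "(\<lambda>n. primitive z (\<tau> n)) \<longlonglongrightarrow> (\<integral>s. z s \<partial>lborel)" by (rule primitive_tendsto[OF z \<tau>])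
  show ?thesis
  proof (cases "(\<integral>\<^sup>+\<omega>. ennreal (Y \<omega>) \<partial>P) = \<infinity>")
    case False
    then have iY: "integrable P Y"
      using neg_part_Y by (subst real_integrable_def) (auto simp: less_top)
    have "(\<lambda>n. primitive z (\<tau> n)) \<longlonglongrightarrow> c * expectation Y"
      using lim[OF iY] sol(2) by simp
    then show ?thesis using LIMSEQ_unique[OF limz] iY by (simp add: mean_identity_def)
  next
    case True
    have iV: "integrable P (\<lambda>\<omega>. min (Y \<omega>) (real K))" for K :: nat
    proof (subst real_integrable_def, intro conjI)
      have "(\<integral>\<^sup>+\<omega>. ennreal (min (Y \<omega>) (real K)) \<partial>P) \<le> (\<integral>\<^sup>+\<omega>. ennreal (real K) \<partial>P)"
        by (intro nn_integral_mono ennreal_leI) auto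
      then show "(\<integral>\<^sup>+\<omega>. ennreal (min (Y \<omega>) (real K)) \<partial>P) \<noteq> \<infinity>"
        by (auto simp: emeasure_space_1 top_unique)
      have "(\<integral>\<^sup>+\<omega>. ennreal (- min (Y \<omega>) (real K)) \<partial>P) \<le> (\<integral>\<^sup>+\<omega>. ennreal (- Y \<omega>) \<partial>P)"
        by (intro nn_integral_mono) (auto simp: min_def ennreal_neg)
      then show "(\<integral>\<^sup>+\<omega>. ennreal (- min (Y \<omega>) (real K)) \<partial>P) \<noteq> \<infinity>" using neg_part_Y by (auto simp: top_unique)
    qed simp
    have le: "c * expectation (\<lambda>\<omega>. min (Y \<omega>) (real K)) \<le> (\<integral>s. z s \<partial>lborel)" for K
    proof -
      have l: "(\<lambda>n. \<integral>\<omega>. primitive f (\<tau> n) - primitive f (\<tau> n - min (Y \<omega>) (real K)) \<partial>P)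
          \<longlonglongrightarrow> c * expectation (\<lambda>\<omega>. min (Y \<omega>) (real K))"
        using lim[OF iV] iV by simp
      show ?thesis
      proof (rule LIMSEQ_le[OF l limz], intro exI[of _ 0] allI impI)
        fix n
        have "integrable P (\<lambda>\<omega>. primitive f (\<tau> n) - primitive f (\<tau> n - min (Y \<omega>) (real K)))"
        proof (rule Bochner_Integration.integrable_bound)
          show "integrable P (\<lambda>\<omega>. b * \<bar>min (Y \<omega>) (real K)\<bar>)" using iV by simp
          show "AE \<omega> in P. norm (primitive f (\<tau> n) - primitive f (\<tau> n - min (Y \<omega>) (real K)))
              \<le> norm (b * \<bar>min (Y \<omega>) (real K)\<bar>)"
            by (intro AE_I2) (use abs_primitive_diff_le[OF _ ab intf] b0 in \<open>simp add: abs_mult\<close>)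
        qed simp
        then have "(\<integral>\<omega>. primitive f (\<tau> n) - primitive f (\<tau> n - min (Y \<omega>) (real K)) \<partial>P)
          \<le> (\<integral>\<omega>. primitive f (\<tau> n) - primitive f (\<tau> n - Y \<omega>) \<partial>P)"
          by (intro integral_mono sol(1)) (auto intro!: primitive_mono intf f0)
        then show "(\<integral>\<omega>. primitive f (\<tau> n) - primitive f (\<tau> n - min (Y \<omega>) (real K)) \<partial>P) \<le> primitive z (\<tau> n)"
          by (simp add: sol(2))
      qed
    qed
    have "c = 0"
    proof (rule ccontr)
      assume "c \<noteq> 0"
      then have c: "c > 0" using c0 by simp
      define D where "D = \<bar>\<integral>s. z s \<partial>lborel\<bar> / c"
      have D: "expectation (\<lambda>\<omega>. min (Y \<omega>) (real K)) \<le> D" for K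
      proof -
        have "c * expectation (\<lambda>\<omega>. min (Y \<omega>) (real K)) \<le> \<bar>\<integral>s. z s \<partial>lborel\<bar>" using le[of K] by linarith
        then show ?thesis using c by (simp add: D_def field_simps)
      qed
      define E where "E = (\<integral>\<omega>. max (- Y \<omega>) 0 \<partial>P)"
      have iE: "integrable P (\<lambda>\<omega>. max (- Y \<omega>) 0)"
      proof (rule integrableI_bounded)
        have "(\<integral>\<^sup>+\<omega>. ennreal (norm (max (- Y \<omega>) 0)) \<partial>P) = (\<integral>\<^sup>+\<omega>. ennreal (- Y \<omega>) \<partial>P)"
          by (intro nn_integral_cong) (auto simp: max_def ennreal_neg)
        then show "(\<integral>\<^sup>+\<omega>. ennreal (norm (max (- Y \<omega>) 0)) \<partial>P) < \<infinity>" using neg_part_Y by simp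
      qed simp
      have "(\<integral>\<^sup>+\<omega>. ennreal (min (Y \<omega>) (real K)) \<partial>P) \<le> ennreal (D + E)" for K
      proof -
        have "(\<integral>\<^sup>+\<omega>. ennreal (min (Y \<omega>) (real K)) \<partial>P)
            = (\<integral>\<^sup>+\<omega>. ennreal (min (Y \<omega>) (real K) + max (- Y \<omega>) 0) \<partial>P)"
          by (intro nn_integral_cong) (auto simp: min_def max_def ennreal_neg)
        also have "\<dots> = ennreal (\<integral>\<omega>. min (Y \<omega>) (real K) + max (- Y \<omega>) 0 \<partial>P)"
          by (intro nn_integral_eq_integral) (use iV iE in \<open>auto simp: min_def max_def\<close>)
        also have "\<dots> \<le> ennreal (D + E)"
          using iV[of K] iE D[of K] by (intro ennreal_leI) (simp add: E_def)
        finally show ?thesis .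
      qed
      moreover have "(\<integral>\<^sup>+\<omega>. ennreal (Y \<omega>) \<partial>P) \<le> liminf (\<lambda>K. \<integral>\<^sup>+\<omega>. ennreal (min (Y \<omega>) (real K)) \<partial>P)"
      proof -
        have "(\<integral>\<^sup>+\<omega>. ennreal (Y \<omega>) \<partial>P) = (\<integral>\<^sup>+\<omega>. liminf (\<lambda>K. ennreal (min (Y \<omega>) (real K))) \<partial>P)"
        proof (rule nn_integral_cong)
          fix \<omega>
          obtain k :: nat where k: "Y \<omega> \<le> real k" using real_arch_simple by blast
          have "(\<lambda>K. ennreal (min (Y \<omega>) (real K))) \<longlonglongrightarrow> ennreal (Y \<omega>)"
          proof (rule tendsto_eventually)
            show "\<forall>\<^sub>F K in sequentially. ennreal (min (Y \<omega>) (real K)) = ennreal (Y \<omega>)"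
              using eventually_ge_at_top[of k]
            proof eventually_elim
              case (elim K)
              then have "Y \<omega> \<le> real K" using k by linarith
              then show ?case by (simp add: min_def)
            qed
          qed
          then show "ennreal (Y \<omega>) = liminf (\<lambda>K. ennreal (min (Y \<omega>) (real K)))"
            by (simp add: lim_imp_Liminf)
        qed
        also have "\<dots> \<le> liminf (\<lambda>K. \<integral>\<^sup>+\<omega>. ennreal (min (Y \<omega>) (real K)) \<partial>P)"
          by (rule nn_integral_liminf) simp
        finally show ?thesis .
      qed
      moreover have "liminf (\<lambda>K. \<integral>\<^sup>+\<omega>. ennreal (min (Y \<omega>) (real K)) \<partial>P) \<le> ennreal (D + E)"
        if "\<And>K. (\<integral>\<^sup>+\<omega>. ennreal (min (Y \<omega>) (real K)) \<partial>P) \<le> ennreal (D + E)"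
        using that by (intro Liminf_le) auto
      ultimately have "(\<integral>\<^sup>+\<omega>. ennreal (Y \<omega>) \<partial>P) \<le> ennreal (D + E)"
        using order_trans by blast
      then show False using True by (simp add: top_unique)
    qed
    then show ?thesis using True by (simp add: mean_identity_def)
  qed
qed

end

section \<open>Renewal limits\<close>

definition window_average :: "real \<Rightarrow> (real \<Rightarrow> real) \<Rightarrow> real \<Rightarrow> real" where
  "window_average h r t = (\<integral>s. indicator {t - h..t} s * r s \<partial>lborel) / h"

lemma integrable_indicator_interval[simp]: "integrable lborel (indicator {a..b::real} :: real \<Rightarrow> real)"
  by (cases "a \<le> b") auto

lemma integrable_window:
  fixes r :: "real \<Rightarrow> real"
  assumes [measurable]: "r \<in> borel_measurable borel" and "\<And>t. \<bar>r t\<bar> \<le> b"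
  shows "integrable lborel (\<lambda>s. indicator {t - h..t} s * r s)"
proof (rule Bochner_Integration.integrable_bound)
  show "integrable lborel (\<lambda>s. b * indicator {t - h..t} s :: real)" by simp
  have "0 \<le> b" using assms(2)[of 0] by linarith
  then show "AE s in lborel. norm (indicator {t - h..t} s * r s) \<le> norm (b * indicator {t - h..t} s :: real)"
    using assms(2) by (auto simp: indicator_def intro: order_trans)
qed simp

lemma integrable_window_integrable:
  fixes z :: "real \<Rightarrow> real"
  assumes "integrable lborel z" "A \<in> sets borel"
  shows "integrable lborel (\<lambda>s. indicator A s * z s)"
  using assms by (intro Bochner_Integration.integrable_bound[OF assms(1)]) (auto simp: indicator_def)

lemma measurable_window_average[measurable]:
  assumes [measurable]: "r \<in> borel_measurable borel"
  shows "window_average h r \<in> borel_measurable borel"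
proof -
  have "(\<lambda>t. (\<integral>s. (if t - h \<le> s \<and> s \<le> t then 1 else 0) * r s \<partial>lborel) / h) \<in> borel_measurable borel"
    by measurable
  also have "(\<lambda>t. (\<integral>s. (if t - h \<le> s \<and> s \<le> t then 1 else 0) * r s \<partial>lborel) / h) = window_average h r"
    unfolding window_average_def
    by (intro ext arg_cong[where f="\<lambda>x. x / h"] Bochner_Integration.integral_cong) (auto simp: indicator_def)
  finally show ?thesis .
qed

lemma window_average_const: "h > 0 \<Longrightarrow> window_average h (\<lambda>_. c) t = c"
  by (simp add: window_average_def)

lemma window_average_mono:
  fixes r :: "real \<Rightarrow> real"
  assumes "h > 0" "r \<in> borel_measurable borel" "\<And>t. \<bar>r t\<bar> \<le> b"
    and "q \<in> borel_measurable borel" "\<And>t. \<bar>q t\<bar> \<le> b'" and "\<And>s. t - h \<le> s \<Longrightarrow> s \<le> t \<Longrightarrow> r s \<le> q s"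
  shows "window_average h r t \<le> window_average h q t"
  unfolding window_average_def using assms(1,6)
  by (intro divide_right_mono integral_mono integrable_window[OF assms(2,3)] integrable_window[OF assms(4,5)])
    (auto simp: indicator_def)

lemma window_average_add:
  fixes r q :: "real \<Rightarrow> real"
  assumes "r \<in> borel_measurable borel" "\<And>t. \<bar>r t\<bar> \<le> b" "q \<in> borel_measurable borel" "\<And>t. \<bar>q t\<bar> \<le> b'"
  shows "window_average h (\<lambda>t. c * r t + d * q t) t = c * window_average h r t + d * window_average h q t"
proof -
  have "(\<integral>s. indicator {t - h..t} s * (c * r s + d * q s) \<partial>lborel)
     = (\<integral>s. c * (indicator {t - h..t} s * r s) + d * (indicator {t - h..t} s * q s) \<partial>lborel)"
    by (intro Bochner_Integration.integral_cong) (auto simp: algebra_simps)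
  also have "\<dots> = c * (\<integral>s. indicator {t - h..t} s * r s \<partial>lborel) + d * (\<integral>s. indicator {t - h..t} s * q s \<partial>lborel)"
    using integrable_window[OF assms(1,2)] integrable_window[OF assms(3,4)] by simp
  finally show ?thesis by (simp add: window_average_def add_divide_distrib)
qed

lemma abs_window_average_le:
  assumes "h > 0" "r \<in> borel_measurable borel" "\<And>t. \<bar>r t\<bar> \<le> b"
  shows "\<bar>window_average h r t\<bar> \<le> b"
proof -
  have "window_average h r t \<le> window_average h (\<lambda>_. b) t"
    by (rule window_average_mono[OF assms(1-3), where b'="\<bar>b\<bar>"]) (use assms(3) in \<open>auto simp: abs_le_iff\<close>)
  moreover have "window_average h (\<lambda>_. - b) t \<le> window_average h r t"
    by (rule window_average_mono[OF assms(1) _ _ assms(2,3), where b="\<bar>b\<bar>"]) (use assms(3) in \<open>auto simp: abs_le_iff minus_le_iff\<close>)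
  ultimately show ?thesis using assms(1) by (simp add: window_average_const)
qed

lemma window_average_lipschitz:
  assumes h: "h > 0" and [measurable]: "r \<in> borel_measurable borel" and b: "\<And>t. \<bar>r t\<bar> \<le> b"
  shows "\<bar>window_average h r s - window_average h r t\<bar> \<le> 2 * b / h * \<bar>s - t\<bar>"
proof -
  have b0: "0 \<le> b" using b[of 0] by linarith
  have main: "\<bar>window_average h r t - window_average h r s\<bar> \<le> 2 * b / h * (t - s)" if st: "s \<le> t" for s t
  proof -
    have "\<bar>(\<integral>x. indicator {t - h..t} x * r x \<partial>lborel) - (\<integral>x. indicator {s - h..s} x * r x \<partial>lborel)\<bar>
      = \<bar>\<integral>x. indicator {t - h..t} x * r x - indicator {s - h..s} x * r x \<partial>lborel\<bar>"
      using integrable_window[OF _ b] by simp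
    also have "\<dots> \<le> (\<integral>x. \<bar>indicator {t - h..t} x * r x - indicator {s - h..s} x * r x\<bar> \<partial>lborel)"
      by (rule integral_abs_bound)
    also have "\<dots> \<le> (\<integral>x. b * indicator {s..t} x + b * indicator {s - h..t - h} x \<partial>lborel)"
    proof (rule integral_mono)
      show "integrable lborel (\<lambda>x. \<bar>indicator {t - h..t} x * r x - indicator {s - h..s} x * r x\<bar>)"
        using integrable_window[OF _ b] by simp
      show "integrable lborel (\<lambda>x. b * indicator {s..t} x + b * indicator {s - h..t - h} x :: real)" by simp
      fix x
      show "\<bar>indicator {t - h..t} x * r x - indicator {s - h..s} x * r x\<bar>
          \<le> b * indicator {s..t} x + b * indicator {s - h..t - h} x"
        using b[of x] b0 st h by (auto simp: indicator_def)
    qed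
    also have "\<dots> = 2 * b * (t - s)" using st by (simp add: algebra_simps)
    finally have "\<bar>(\<integral>x. indicator {t - h..t} x * r x \<partial>lborel) - (\<integral>x. indicator {s - h..s} x * r x \<partial>lborel)\<bar> / h
        \<le> 2 * b * (t - s) / h"
      using h by (intro divide_right_mono) auto
    then show ?thesis using h by (simp add: window_average_def diff_divide_distrib[symmetric])
  qed
  show ?thesis
  proof (cases "s \<le> t")
    case True
    then show ?thesis using main[of s t] by (simp add: abs_minus_commute)
  next
    case False
    then show ?thesis using main[of t s] by simp
  qed
qed

lemma window_average_integrable_tendsto_0:
  assumes z: "integrable lborel z"
  shows "(window_average h z \<longlongrightarrow> 0) at_top"
proof -
  have [measurable]: "z \<in> borel_measurable borel" using z by simp
  have "((\<lambda>t. \<integral>s. indicator {t - h..t} s * z s \<partial>lborel) \<longlongrightarrow> (\<integral>s. 0 \<partial>(lborel :: real measure))) at_top"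
  proof (rule integral_dominated_convergence_at_top[where w="\<lambda>s. \<bar>z s\<bar>"])
    show "AE s in lborel. ((\<lambda>t. indicator {t - h..t} s * z s) \<longlongrightarrow> 0) at_top"
    proof (intro AE_I2 tendsto_eventually)
      fix s
      show "\<forall>\<^sub>F t in at_top. indicator {t - h..t} s * z s = 0"
        using eventually_gt_at_top[of "s + h"] by eventually_elim (auto simp: indicator_def)
    qed
    show "\<forall>\<^sub>F t in at_top. AE s in lborel. norm (indicator {t - h..t} s * z s) \<le> \<bar>z s\<bar>"
      by (auto simp: indicator_def)
  qed (use z in auto)
  then have "((\<lambda>t. (\<integral>s. indicator {t - h..t} s * z s \<partial>lborel) / h) \<longlongrightarrow> 0 / h) at_top"
    by (cases "h = 0") (auto dest: tendsto_divide[OF _ tendsto_const])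
  then show ?thesis by (simp add: window_average_def[abs_def])
qed

lemma window_average_integral:
  assumes z: "integrable lborel z" and h: "h > 0"
  shows "integrable lborel (window_average h z)" "(\<integral>t. window_average h z t \<partial>lborel) = (\<integral>t. z t \<partial>lborel)"
proof -
  have [measurable]: "z \<in> borel_measurable borel" using z by simp
  let ?F = "\<lambda>s t. (if t - h \<le> s \<and> s \<le> t then 1 else 0) * z s"
  have F1: "?F s t = indicator {s..s + h} t * z s" for s t by (auto simp: indicator_def)
  have F2: "?F s t = indicator {t - h..t} s * z s" for s t by (auto simp: indicator_def)
  have int: "integrable (lborel \<Otimes>\<^sub>M lborel) (case_prod ?F)"
  proof (rule lborel_pair.Fubini_integrable)
    show "case_prod ?F \<in> borel_measurable (lborel \<Otimes>\<^sub>M lborel)" by measurable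
    have "(\<integral>t. norm (case_prod ?F (s, t)) \<partial>lborel) = h * \<bar>z s\<bar>" for s
      using h by (simp add: F1 abs_mult del: if_distrib) 
    then show "integrable lborel (\<lambda>s. \<integral>t. norm (case_prod ?F (s, t)) \<partial>lborel)" using z by simp
    have "integrable lborel (\<lambda>t. indicator {s..s + h} t * z s)" for s by simp
    then show "AE s in lborel. integrable lborel (\<lambda>t. case_prod ?F (s, t))" unfolding prod.case F1 by simp
  qed
  have "integrable lborel (\<lambda>t. \<integral>s. ?F s t \<partial>lborel)"
    using lborel_pair.integrable_snd[OF int] by simp
  then have "integrable lborel (\<lambda>t. (\<integral>s. ?F s t \<partial>lborel) / h)" by (rule integrable_divide)
  then show "integrable lborel (window_average h z)"
    unfolding F2 by (simp add: window_average_def[abs_def])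
  have "(\<integral>t. window_average h z t \<partial>lborel) = (\<integral>t. (\<integral>s. ?F s t \<partial>lborel) \<partial>lborel) / h"
    unfolding F2 by (simp add: window_average_def)
  also have "(\<integral>t. (\<integral>s. ?F s t \<partial>lborel) \<partial>lborel) = (\<integral>s. (\<integral>t. ?F s t \<partial>lborel) \<partial>lborel)"
    by (rule lborel_pair.Fubini_integral[OF int])
  also have "\<dots> = h * (\<integral>t. z t \<partial>lborel)"
    unfolding F1 using h by simp
  finally show "(\<integral>t. window_average h z t \<partial>lborel) = (\<integral>t. z t \<partial>lborel)" using h by simp
qed

text \<open>
  The growth condition sandwiches \<open>r t\<close> between the averages over \<open>[t - h, t]\<close> and \<open>[t, t + h]\<close>, up to factors
  that tend to \<open>1\<close> as \<open>h \<rightarrow> 0\<close>.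
\<close>

lemma tendsto_of_window_averages:
  assumes [measurable]: "r \<in> borel_measurable borel" and r0: "\<And>t. 0 \<le> r t" and b: "\<And>t. r t \<le> b"
    and growth: "\<And>s t. 0 \<le> s \<Longrightarrow> r (t + s) \<le> exp (\<alpha> * s) * r t" and alpha: "0 \<le> \<alpha>"
    and lim: "\<And>h. h > 0 \<Longrightarrow> (window_average h r \<longlongrightarrow> c) at_top"
  shows "(r \<longlongrightarrow> c) at_top"
proof (rule tendstoI)
  fix e :: real assume e: "e > 0"
  have ab: "\<bar>r t\<bar> \<le> b" for t using r0 b by (simp add: abs_of_nonneg)
  have "((\<lambda>h. exp (\<alpha> * h) * (c + h)) \<longlongrightarrow> exp (\<alpha> * 0) * (c + 0)) (at_right 0)"
    by (intro tendsto_intros)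
  then have 1: "\<forall>\<^sub>F h in at_right 0. exp (\<alpha> * h) * (c + h) < c + e"
    using e by (intro order_tendstoD(2)) auto
  have "((\<lambda>h. exp (- \<alpha> * h) * (c - h)) \<longlongrightarrow> exp (- \<alpha> * 0) * (c - 0)) (at_right 0)"
    by (intro tendsto_intros)
  then have 2: "\<forall>\<^sub>F h in at_right 0. exp (- \<alpha> * h) * (c - h) > c - e"
    using e by (intro order_tendstoD(1)) auto
  obtain h where h: "h > 0" "exp (\<alpha> * h) * (c + h) < c + e" "exp (- \<alpha> * h) * (c - h) > c - e"
    using eventually_happens[OF eventually_conj[OF eventually_at_right_less[of 0] eventually_conj[OF 1 2]]] by auto
  have up: "r t \<le> exp (\<alpha> * h) * window_average h r t" for t
  proof -
    have "window_average h (\<lambda>_. r t) t \<le> window_average h (\<lambda>s. exp (\<alpha> * h) * r s + 0 * r s) t"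
    proof (rule window_average_mono[OF h(1), where b=b and b'="exp (\<alpha> * h) * b"])
      fix s assume s: "t - h \<le> s" "s \<le> t"
      have "r t \<le> exp (\<alpha> * (t - s)) * r s" using growth[of "t - s" s] s by simp
      also have "\<dots> \<le> exp (\<alpha> * h) * r s" using s alpha r0 by (intro mult_right_mono) (auto intro: mult_left_mono)
      finally show "r t \<le> exp (\<alpha> * h) * r s + 0 * r s" by simp
    qed (auto simp: ab abs_mult r0 b)
    then show ?thesis
      unfolding window_average_add[OF assms(1) ab assms(1) ab] using h by (simp add: window_average_const)
  qed
  have lo: "exp (- \<alpha> * h) * window_average h r (t + h) \<le> r t" for t
  proof -
    have "window_average h (\<lambda>s. exp (- \<alpha> * h) * r s + 0 * r s) (t + h) \<le> window_average h (\<lambda>_. r t) (t + h)"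
    proof (rule window_average_mono[OF h(1), where b'=b and b="exp (- \<alpha> * h) * b"])
      fix s assume s: "t + h - h \<le> s" "s \<le> t + h"
      have "r s \<le> exp (\<alpha> * (s - t)) * r t" using growth[of "s - t" t] s by simp
      also have "\<dots> \<le> exp (\<alpha> * h) * r t" using s alpha r0 by (intro mult_right_mono) (auto intro: mult_left_mono)
      finally show "exp (- \<alpha> * h) * r s + 0 * r s \<le> r t" by (simp add: exp_minus field_simps)
    qed (auto simp: ab abs_mult r0 b)
    then show ?thesis
      unfolding window_average_add[OF assms(1) ab assms(1) ab] using h by (simp add: window_average_const)
  qed
  have "\<forall>\<^sub>F t in at_top. window_average h r t < c + h"
    using h by (intro order_tendstoD(2)[OF lim]) auto
  moreover have "\<forall>\<^sub>F t in at_top. window_average h r (t + h) > c - h"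
  proof -
    have "((\<lambda>t. window_average h r (t + h)) \<longlongrightarrow> c) at_top"
      by (rule filterlim_compose[OF lim[OF h(1)]]) (rule filterlim_at_top_mono[OF filterlim_ident], use h in auto)
    then show ?thesis using h by (intro order_tendstoD(1)) auto
  qed
  ultimately show "\<forall>\<^sub>F t in at_top. dist (r t) c < e"
  proof eventually_elim
    case (elim t)
    have "exp (\<alpha> * h) * window_average h r t \<le> exp (\<alpha> * h) * (c + h)"
      "exp (- \<alpha> * h) * (c - h) \<le> exp (- \<alpha> * h) * window_average h r (t + h)"
      using elim by (intro mult_left_mono; simp)+
    then have "r t \<le> exp (\<alpha> * h) * (c + h)" "r t \<ge> exp (- \<alpha> * h) * (c - h)"
      using up[of t] lo[of t] by linarith+
    then show ?case using h by (simp add: dist_real_def abs_less_iff)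
  qed
qed

context drift_walk begin

lemma window_average_equation:
  assumes [measurable]: "X \<in> borel_measurable P" "r \<in> borel_measurable borel"
    and X1: "\<And>\<omega>. \<bar>X \<omega>\<bar> = 1" and b: "\<And>t. \<bar>r t\<bar> \<le> b"
    and z: "integrable lborel z" and eq: "\<And>t. r t = z t + (\<integral>\<omega>. X \<omega> * r (t - Y \<omega>) \<partial>P)"
  shows "window_average h r t = window_average h z t + (\<integral>\<omega>. X \<omega> * window_average h r (t - Y \<omega>) \<partial>P)"
proof -
  interpret LP: pair_sigma_finite lborel P by unfold_locales
  have [measurable]: "z \<in> borel_measurable borel" using z by simp
  have b0: "0 \<le> b" using b[of 0] by linarith
  let ?A = "{t - h..t}"
  let ?F = "\<lambda>s \<omega>. indicator ?A s * (X \<omega> * r (s - Y \<omega>))"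
  have FA: "integrable (lborel \<Otimes>\<^sub>M P) (\<lambda>x. indicator (?A \<times> space P) x * b)"
    by (intro integrable_mult_left integrable_real_indicator)
      (auto simp: emeasure_pair_measure_Times emeasure_space_1 emeasure_lborel_Icc_eq)
  have int: "integrable (lborel \<Otimes>\<^sub>M P) (case_prod ?F)"
  proof (rule Bochner_Integration.integrable_bound[OF FA])
    show "case_prod ?F \<in> borel_measurable (lborel \<Otimes>\<^sub>M P)" by measurable
    show "AE x in lborel \<Otimes>\<^sub>M P. norm (case_prod ?F x) \<le> norm (indicator (?A \<times> space P) x * b)"
      using b b0 by (intro AE_I2) (auto simp: indicator_def space_pair_measure abs_mult X1)
  qed
  have i1: "integrable lborel (\<lambda>s. indicator ?A s * r s)" by (rule integrable_window[OF _ b]) simp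
  have i2: "integrable lborel (\<lambda>s. indicator ?A s * z s)" by (rule integrable_window_integrable[OF z]) simp
  have "(\<integral>s. indicator ?A s * r s \<partial>lborel) - (\<integral>s. indicator ?A s * z s \<partial>lborel)
      = (\<integral>s. indicator ?A s * r s - indicator ?A s * z s \<partial>lborel)"
    using i1 i2 by simp
  also have "\<dots> = (\<integral>s. (\<integral>\<omega>. ?F s \<omega> \<partial>P) \<partial>lborel)"
  proof (intro Bochner_Integration.integral_cong refl)
    fix s
    have "r s - z s = (\<integral>\<omega>. X \<omega> * r (s - Y \<omega>) \<partial>P)" using eq[of s] by simp
    then show "indicator ?A s * r s - indicator ?A s * z s = (\<integral>\<omega>. ?F s \<omega> \<partial>P)"
      by (simp add: right_diff_distrib[symmetric])
  qed
  also have "\<dots> = (\<integral>\<omega>. (\<integral>s. ?F s \<omega> \<partial>lborel) \<partial>P)"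
    by (rule LP.Fubini_integral[OF int, symmetric])
  also have "\<dots> = (\<integral>\<omega>. X \<omega> * (\<integral>s. indicator {t - Y \<omega> - h..t - Y \<omega>} s * r s \<partial>lborel) \<partial>P)"
  proof (intro Bochner_Integration.integral_cong refl)
    fix \<omega>
    have "(\<integral>s. ?F s \<omega> \<partial>lborel) = X \<omega> * (\<integral>s. indicator ?A s * r (s - Y \<omega>) \<partial>lborel)"
      by (simp add: mult.left_commute)
    also have "(\<integral>s. indicator ?A s * r (s - Y \<omega>) \<partial>lborel)
        = (\<integral>s. indicator {t - Y \<omega> - h..t - Y \<omega>} s * r s \<partial>lborel)"
      using lborel_integral_real_affine[of 1 "\<lambda>s. indicator ?A s * r (s - Y \<omega>)" "Y \<omega>"]
      by (auto simp: indicator_def algebra_simps intro!: Bochner_Integration.integral_cong)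
    finally show "(\<integral>s. ?F s \<omega> \<partial>lborel) = X \<omega> * (\<integral>s. indicator {t - Y \<omega> - h..t - Y \<omega>} s * r s \<partial>lborel)" .
  qed
  finally have e: "(\<integral>s. indicator ?A s * r s \<partial>lborel) = (\<integral>s. indicator ?A s * z s \<partial>lborel)
      + (\<integral>\<omega>. X \<omega> * (\<integral>s. indicator {t - Y \<omega> - h..t - Y \<omega>} s * r s \<partial>lborel) \<partial>P)" by simp
  show ?thesis
    unfolding window_average_def e by (simp add: add_divide_distrib)
qed

end

context signed_walk begin

text \<open>
  Both the upper limit of \<open>f\<close> and that of \<open>b - f\<close> are attained along plateaus. The mean identity
  assigns the same value \<open>c\<close> to both plateaus of \<open>f\<close>.
\<close>

lemma unsigned_lipschitz_solution_tendsto: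
  assumes f0: "\<And>t. 0 \<le> f t" and b: "\<And>t. f t \<le> b" and B: "\<And>t. f t \<le> B * exp (\<theta> * t)"
    and lip: "\<And>s t. \<bar>f s - f t\<bar> \<le> L * \<bar>s - t\<bar>"
    and z: "integrable lborel z" "(z \<longlongrightarrow> 0) at_top" and eq: "\<And>t. f t = z t + (\<integral>\<omega>. f (t - Y \<omega>) \<partial>P)"
    and c: "\<And>c'. mean_identity c' (\<integral>s. z s \<partial>lborel) \<Longrightarrow> c' = c"
  shows "(f \<longlongrightarrow> c) at_top"
proof -
  interpret one: signed_walk P Y \<theta> \<rho> "\<lambda>_. 1" by unfold_locales (erule Y_nonlattice | simp)+
  have fb: "\<bar>f t\<bar> \<le> b" for t using f0 b by (simp add: abs_of_nonneg)
  have gb: "\<bar>b - f t\<bar> \<le> b" for t using f0[of t] b[of t] by simp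
  have glip: "\<bar>(b - f s) - (b - f t)\<bar> \<le> L * \<bar>s - t\<bar>" for s t using lip[of t s] by (simp add: abs_minus_commute)
  have f_eq: "((\<lambda>t. f t - (\<integral>\<omega>. 1 * f (t - Y \<omega>) \<partial>P)) \<longlongrightarrow> 0) at_top"
  proof -
    have "f t - (\<integral>\<omega>. 1 * f (t - Y \<omega>) \<partial>P) = z t" for t using eq[of t] by simp
    then show ?thesis using z(2) by simp
  qed
  obtain m a \<tau> where m: "0 \<le> m" "\<And>e. e > 0 \<Longrightarrow> \<forall>\<^sub>F t in at_top. \<bar>f t\<bar> \<le> m + e" and a: "\<bar>a\<bar> = 1"
    and \<tau>: "filterlim \<tau> at_top sequentially" "\<And>s. (\<lambda>n. a * f (\<tau> n + s)) \<longlonglongrightarrow> m"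
    using one.plateaus_exist[OF fb lip f_eq] by metis
  interpret F: asymptotic_solution P Y \<theta> \<rho> "\<lambda>_. 1" f b L m
    by unfold_locales (fact fb lip f_eq m)+
  have [measurable]: "f \<in> borel_measurable borel" by (rule F.f_meas)
  have plateau: "c' = c" if "filterlim \<tau> at_top sequentially" "\<And>s. (\<lambda>n. f (\<tau> n + s)) \<longlonglongrightarrow> c'" for c' \<tau>
    by (rule c[OF plateau_mean_identity[OF _ f0 b B z(1) eq that]]) simp
  have pos: "m = c" if nn: "\<And>t. 0 \<le> f t" and a: "\<bar>a\<bar> = 1" and "0 \<le> m" and lim: "\<And>s. (\<lambda>n. a * f (\<tau> n + s)) \<longlonglongrightarrow> m"
    and pl: "(\<And>s. (\<lambda>n. f (\<tau> n + s)) \<longlonglongrightarrow> m) \<Longrightarrow> m = c" for f :: "real \<Rightarrow> real" and \<tau> a m c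
  proof (cases "a = 1")
    case False
    then have a: "a = -1" using a by linarith
    have "m \<le> 0" by (rule LIMSEQ_le_const2[OF lim[of 0]]) (use a nn in auto)
    then have "m = 0" using \<open>0 \<le> m\<close> by simp
    have "(\<lambda>n. - (a * f (\<tau> n + s))) \<longlonglongrightarrow> - m" for s by (intro tendsto_minus lim)
    then have "(\<lambda>n. f (\<tau> n + s)) \<longlonglongrightarrow> m" for s using \<open>m = 0\<close> a by simp
    then show ?thesis by (rule pl)
  next
    case True
    have "(\<lambda>n. f (\<tau> n + s)) \<longlonglongrightarrow> m" for s using lim[of s] True by simp
    then show ?thesis by (rule pl)
  qed
  have mc: "m = c" using pos[of f a m \<tau> c] f0 a m(1) \<tau>(2) plateau[of \<tau> m, OF \<tau>(1)] by blast
  have g_eq: "((\<lambda>t. (b - f t) - (\<integral>\<omega>. 1 * (b - f (t - Y \<omega>)) \<partial>P)) \<longlongrightarrow> 0) at_top"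
  proof -
    have i: "integrable P (\<lambda>\<omega>. f (t - Y \<omega>))" for t
      by (rule integrable_const_bound[where B=b]) (auto simp: fb)
    then have "(b - f t) - (\<integral>\<omega>. 1 * (b - f (t - Y \<omega>)) \<partial>P) = - z t" for t
      using eq[of t] by (simp add: prob_space)
    then show ?thesis using tendsto_minus[OF z(2)] by simp
  qed
  obtain m' a' \<tau>' where m': "0 \<le> m'" "\<And>e. e > 0 \<Longrightarrow> \<forall>\<^sub>F t in at_top. \<bar>b - f t\<bar> \<le> m' + e" and a': "\<bar>a'\<bar> = 1"
    and \<tau>': "filterlim \<tau>' at_top sequentially" "\<And>s. (\<lambda>n. a' * (b - f (\<tau>' n + s))) \<longlonglongrightarrow> m'"
    using one.plateaus_exist[OF gb glip g_eq] by metis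
  have "m' = b - c"
  proof (rule pos[of "\<lambda>t. b - f t" a' m' \<tau>' "b - c", OF _ a' m'(1) \<tau>'(2)])
    show "0 \<le> b - f t" for t using b by simp
    assume l: "\<And>s. (\<lambda>n. b - f (\<tau>' n + s)) \<longlonglongrightarrow> m'"
    have "(\<lambda>n. b - (b - f (\<tau>' n + s))) \<longlonglongrightarrow> b - m'" for s by (intro tendsto_intros l)
    then have "b - m' = c" by (intro plateau[OF \<tau>'(1)]) simp
    then show "m' = b - c" by simp
  qed
  show ?thesis
  proof (rule tendstoI)
    fix e :: real assume e: "e > 0"
    show "\<forall>\<^sub>F t in at_top. dist (f t) c < e"
      using m(2)[OF half_gt_zero[OF e]] m'(2)[OF half_gt_zero[OF e]]
    proof eventually_elim
      case (elim t)
      then show "dist (f t) c < e"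
        using e mc \<open>m' = b - c\<close> f0[of t] b[of t] by (simp add: dist_real_def abs_less_iff)
    qed
  qed
qed

lemma window_average_solution_tendsto:
  assumes [measurable]: "r \<in> borel_measurable borel" and r0: "\<And>t. 0 \<le> r t" and b: "\<And>t. r t \<le> b"
    and B: "\<And>t. r t \<le> B * exp (\<theta> * t)"
    and z: "integrable lborel z" and eq: "\<And>t. r t = z t + (\<integral>\<omega>. r (t - Y \<omega>) \<partial>P)"
    and c: "\<And>c'. mean_identity c' (\<integral>s. z s \<partial>lborel) \<Longrightarrow> c' = c" and h: "h > 0"
  shows "(window_average h r \<longlongrightarrow> c) at_top"
proof -
  have ab: "\<bar>r t\<bar> \<le> b" for t using r0 b by (simp add: abs_of_nonneg)
  have B0: "0 \<le> B" using order_trans[OF r0 B, of 0] by simp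
  show ?thesis
  proof (rule unsigned_lipschitz_solution_tendsto[where b=b and B=B and L="2 * b / h" and z="window_average h z"])
    show "0 \<le> window_average h r t" for t
      unfolding window_average_def using h r0 by (intro divide_nonneg_pos Bochner_Integration.integral_nonneg) auto
    show "window_average h r t \<le> b" for t using abs_window_average_le[of h r b t] h ab by (simp add: abs_le_iff)
    show "window_average h r t \<le> B * exp (\<theta> * t)" for t
    proof -
      have "window_average h r t \<le> window_average h (\<lambda>_. B * exp (\<theta> * t)) t"
      proof (rule window_average_mono[OF h _ ab])
        fix s assume "s \<le> t"
        then have "B * exp (\<theta> * s) \<le> B * exp (\<theta> * t)" using B0 theta by (intro mult_left_mono) auto
        then show "r s \<le> B * exp (\<theta> * t)" using B[of s] by simp
      qed auto
      then show ?thesis using h by (simp add: window_average_const)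
    qed
    show "\<bar>window_average h r s - window_average h r t\<bar> \<le> 2 * b / h * \<bar>s - t\<bar>" for s t
      by (rule window_average_lipschitz[OF h _ ab]) simp
    show "integrable lborel (window_average h z)" by (rule window_average_integral[OF z h])
    show "(window_average h z \<longlongrightarrow> 0) at_top" by (rule window_average_integrable_tendsto_0[OF z])
    show "window_average h r t = window_average h z t + (\<integral>\<omega>. window_average h r (t - Y \<omega>) \<partial>P)" for t
    proof -
      have eq1: "r t = z t + (\<integral>\<omega>. 1 * r (t - Y \<omega>) \<partial>P)" for t using eq[of t] by simp
      show ?thesis using window_average_equation[of "\<lambda>_. 1" r, OF _ _ _ ab z eq1, of h t] by simp
    qed
    show "c' = c" if "mean_identity c' (\<integral>s. window_average h z s \<partial>lborel)" for c'
      by (rule c) (use that in \<open>simp add: window_average_integral[OF z h]\<close>)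
  qed
qed

text \<open>
  The hypothesis on \<open>c\<close> only asks that the mean identity has no other solution, so it treats finite and
  infinite means alike.
\<close>

theorem renewal_limit:
  assumes [measurable]: "r \<in> borel_measurable borel" and r0: "\<And>t. 0 \<le> r t"
    and B: "\<And>t. r t \<le> B * exp (\<theta> * t)"
    and growth: "\<And>s t. 0 \<le> s \<Longrightarrow> r (t + s) \<le> exp (\<alpha> * s) * r t" and alpha: "0 \<le> \<alpha>"
    and z: "integrable lborel z" and eq: "\<And>t. r t = z t + (\<integral>\<omega>. r (t - Y \<omega>) \<partial>P)"
    and c: "\<And>c'. mean_identity c' (\<integral>s. z s \<partial>lborel) \<Longrightarrow> c' = c"
  shows "(r \<longlongrightarrow> c) at_top"
proof -
  obtain b where b: "\<And>t. r t \<le> b" using solution_bounded[OF _ r0 B growth alpha z eq] by auto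
  show ?thesis
    by (rule tendsto_of_window_averages[OF _ r0 b growth alpha])
      (auto intro!: window_average_solution_tendsto[OF _ r0 b B z eq c])
qed

text \<open>
  The sum of the components solves the scalar equation; their difference tends to \<open>0\<close>.
\<close>

theorem signed_renewal_limit:
  assumes [measurable]: "p \<in> borel_measurable borel" "q \<in> borel_measurable borel"
    and p0: "\<And>t. 0 \<le> p t" and q0: "\<And>t. 0 \<le> q t"
    and B: "\<And>t. p t + q t \<le> B * exp (\<theta> * t)"
    and growth: "\<And>s t. 0 \<le> s \<Longrightarrow> p (t + s) \<le> exp (\<alpha> * s) * p t"
      "\<And>s t. 0 \<le> s \<Longrightarrow> q (t + s) \<le> exp (\<alpha> * s) * q t" and alpha: "0 \<le> \<alpha>"
    and z: "integrable lborel z" and eq: "\<And>t. p t + q t = z t + (\<integral>\<omega>. p (t - Y \<omega>) + q (t - Y \<omega>) \<partial>P)"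
    and c: "\<And>c'. mean_identity c' (\<integral>s. z s \<partial>lborel) \<Longrightarrow> c' = c"
    and z': "integrable lborel z'" and eq': "\<And>t. p t - q t = z' t + (\<integral>\<omega>. X \<omega> * (p (t - Y \<omega>) - q (t - Y \<omega>)) \<partial>P)"
    and neg: "prob {\<omega>\<in>space P. X \<omega> = -1} > 0"
  shows "(p \<longlongrightarrow> c / 2) at_top" "(q \<longlongrightarrow> c / 2) at_top"
proof -
  have gr: "p (t + s) + q (t + s) \<le> exp (\<alpha> * s) * (p t + q t)" if "0 \<le> s" for s t
    using add_mono[OF growth(1)[OF that, of t] growth(2)[OF that, of t]] by (simp add: algebra_simps)
  have pq0: "0 \<le> p t + q t" for t using p0 q0 by (simp add: add_nonneg_nonneg)
  obtain b where b: "\<And>t. p t + q t \<le> b"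
    using solution_bounded[OF _ pq0 B gr alpha z eq] by auto
  have db: "\<bar>p t - q t\<bar> \<le> b" for t using b[of t] p0[of t] q0[of t] by simp
  have pb: "p t \<le> b" "q t \<le> b" for t using b[of t] p0[of t] q0[of t] by auto
  have sb: "\<bar>p t + q t\<bar> \<le> b" for t using b[of t] pq0[of t] by simp
  have S: "(window_average h (\<lambda>t. p t + q t) \<longlongrightarrow> c) at_top" if "h > 0" for h
    by (rule window_average_solution_tendsto[OF _ pq0 b B z eq c that]) auto
  have D: "(window_average h (\<lambda>t. p t - q t) \<longlongrightarrow> 0) at_top" if h: "h > 0" for h
  proof (rule signed_solution_tendsto_0[where b=b and L="2 * b / h"])
    show "\<bar>window_average h (\<lambda>t. p t - q t) t\<bar> \<le> b" for t
      by (rule abs_window_average_le[OF h _ db]) simp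
    show "\<bar>window_average h (\<lambda>t. p t - q t) s - window_average h (\<lambda>t. p t - q t) t\<bar> \<le> 2 * b / h * \<bar>s - t\<bar>" for s t
      by (rule window_average_lipschitz[OF h _ db]) simp
    have "window_average h (\<lambda>t. p t - q t) t - (\<integral>\<omega>. X \<omega> * window_average h (\<lambda>t. p t - q t) (t - Y \<omega>) \<partial>P)
        = window_average h z' t" for t
      using window_average_equation[of X "\<lambda>t. p t - q t", OF _ _ X_sign db z' eq', of h t] by simp
    then show "((\<lambda>t. window_average h (\<lambda>t. p t - q t) t - (\<integral>\<omega>. X \<omega> * window_average h (\<lambda>t. p t - q t) (t - Y \<omega>) \<partial>P)) \<longlongrightarrow> 0) at_top"
      using window_average_integrable_tendsto_0[OF z'] by simp
  qed (rule neg)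
  have lim: "((\<lambda>t. 1/2 * window_average h (\<lambda>t. p t + q t) t + d * window_average h (\<lambda>t. p t - q t) t) \<longlongrightarrow> 1/2 * c + d * 0) at_top"
    if "h > 0" for h d
    by (intro tendsto_intros S D that)
  have add: "1/2 * window_average h (\<lambda>t. p t + q t) t + d * window_average h (\<lambda>t. p t - q t) t
      = window_average h (\<lambda>t. 1/2 * (p t + q t) + d * (p t - q t)) t" for h t d
    by (rule window_average_add[symmetric, OF _ sb _ db]) auto
  have "(\<lambda>t. 1/2 * (p t + q t) + 1/2 * (p t - q t)) = p" "(\<lambda>t. 1/2 * (p t + q t) + (-1/2) * (p t - q t)) = q"
    by (auto simp: field_simps)
  then have limp: "(window_average h p \<longlongrightarrow> c / 2) at_top" and limq: "(window_average h q \<longlongrightarrow> c / 2) at_top" if "h > 0" for h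
    using lim[OF that, of "1/2"] lim[OF that, of "-1/2"] unfolding add by simp_all
  show "(p \<longlongrightarrow> c / 2) at_top"
    by (rule tendsto_of_window_averages[OF _ p0 pb(1) growth(1) alpha limp]) auto
  show "(q \<longlongrightarrow> c / 2) at_top"
    by (rule tendsto_of_window_averages[OF _ q0 pb(2) growth(2) alpha limq]) auto
qed

end

section \<open>Sums and their largest term\<close>

lemma powr_add_le:
  fixes x y p :: real
  assumes "0 \<le> x" "0 \<le> y" "0 \<le> p"
  shows "(x + y) powr p \<le> 2 powr p * (x powr p + y powr p)"
proof -
  have "(x + y) powr p \<le> (2 * max x y) powr p" using assms by (intro powr_mono2) auto
  also have "\<dots> = 2 powr p * max x y powr p" using assms by (simp add: powr_mult)
  also have "\<dots> \<le> 2 powr p * (x powr p + y powr p)" by (intro mult_left_mono) (auto simp: max_def)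
  finally show ?thesis .
qed

lemma powr_subadditive:
  fixes x y p :: real
  assumes "0 \<le> x" "0 \<le> y" "0 < p" "p \<le> 1"
  shows "(x + y) powr p \<le> x powr p + y powr p"
proof (cases "x + y = 0")
  case False
  define u where "u = x + y"
  have u: "u > 0" using False assms by (simp add: u_def)
  have *: "t * u powr (p - 1) \<le> t powr p" if "0 \<le> t" "t \<le> u" for t
  proof (cases "t = 0")
    case False
    then have t: "t > 0" using that by simp
    have "u powr (p - 1) \<le> t powr (p - 1)" using t that assms by (intro powr_mono2') auto
    then have "t * u powr (p - 1) \<le> t * t powr (p - 1)" using t by (simp add: mult_left_mono)
    then show ?thesis using t by (simp add: powr_diff)
  qed simp
  have "u powr p = u powr 1 * u powr (p - 1)" using u by (simp add: powr_diff)
  also have "\<dots> = x * u powr (p - 1) + y * u powr (p - 1)" using u by (simp add: u_def distrib_right)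
  also have "\<dots> \<le> x powr p + y powr p" using assms by (intro add_mono *) (auto simp: u_def)
  finally show ?thesis by (simp add: u_def)
qed (use assms in auto)

lemma abs_powr_diff_le:
  fixes x y p b :: real
  assumes "0 \<le> x" "0 \<le> y" "0 < b" "b \<le> 1" "b < p" "p \<le> 1 \<or> b = 1"
  shows "\<bar>x powr p - y powr p\<bar> \<le> (1 + p * 2 powr p) * (\<bar>x - y\<bar> powr b * y powr (p - b) + \<bar>x - y\<bar> powr p)"
proof (cases "p \<le> 1")
  case True
  have *: "\<bar>x powr p - y powr p\<bar> \<le> \<bar>x - y\<bar> powr p" if "0 \<le> x" "0 \<le> y" "x \<le> y" for x y
    using powr_subadditive[of x "y - x" p] that assms True powr_mono2[of p x y] by simp
  have "\<bar>x powr p - y powr p\<bar> \<le> \<bar>x - y\<bar> powr p"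
    using *[of x y] *[of y x] assms by (cases "x \<le> y") (auto simp: abs_minus_commute)
  also have "\<dots> \<le> (1 + p * 2 powr p) * (\<bar>x - y\<bar> powr b * y powr (p - b) + \<bar>x - y\<bar> powr p)"
    using assms by (simp add: algebra_simps)
  finally show ?thesis .
next
  case False
  then have b: "b = 1" and p: "p > 1" using assms by auto
  have *: "\<bar>x powr p - y powr p\<bar> \<le> p * max x y powr (p - 1) * \<bar>x - y\<bar>" if "0 \<le> x" "0 \<le> y" "x < y" for x y :: real
  proof -
    note xy = that
    have der: "((\<lambda>x. x powr p) has_real_derivative p * z powr (p - 1)) (at z)" if "0 < z" for z
      using that by (auto intro!: derivative_eq_intros)
    have "continuous_on {x..y} (\<lambda>x. x powr p)"
      using xy p by (intro continuous_on_powr') auto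
    then obtain l z where z: "x < z" "z < y" and l: "((\<lambda>x. x powr p) has_real_derivative l) (at z)"
      and eq: "y powr p - x powr p = (y - x) * l"
      using MVT[OF xy(3), of "\<lambda>x. x powr p"] der \<open>0 \<le> x\<close>
      by (smt (verit) real_differentiable_def)
    have "l = p * z powr (p - 1)" using DERIV_unique[OF l der] z \<open>0 \<le> x\<close> by simp
    then have z3: "y powr p - x powr p = (y - x) * (p * z powr (p - 1))" using eq by simp
    have "z powr (p - 1) \<le> y powr (p - 1)" using z that p by (intro powr_mono2) auto
    then have "y powr p - x powr p \<le> (y - x) * (p * y powr (p - 1))"
      unfolding z3 using that p by (intro mult_left_mono) auto
    moreover have "x powr p \<le> y powr p" using that p by (intro powr_mono2) auto
    ultimately show ?thesis using that by (simp add: max_def mult_ac)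
  qed
  have "\<bar>x powr p - y powr p\<bar> \<le> p * max x y powr (p - 1) * \<bar>x - y\<bar>"
    using *[of x y] *[of y x] assms by (cases x y rule: linorder_cases) (auto simp: abs_minus_commute max.commute)
  also have "\<dots> \<le> p * (2 powr (p - 1) * (y powr (p - 1) + \<bar>x - y\<bar> powr (p - 1))) * \<bar>x - y\<bar>"
  proof (intro mult_right_mono mult_left_mono)
    have "max x y powr (p - 1) \<le> (y + \<bar>x - y\<bar>) powr (p - 1)"
      using assms p by (intro powr_mono2) auto
    also have "\<dots> \<le> 2 powr (p - 1) * (y powr (p - 1) + \<bar>x - y\<bar> powr (p - 1))"
      using assms p by (intro powr_add_le) auto
    finally show "max x y powr (p - 1) \<le> 2 powr (p - 1) * (y powr (p - 1) + \<bar>x - y\<bar> powr (p - 1))" .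
  qed (use p in auto)
  also have "\<dots> = p * 2 powr (p - 1) * (\<bar>x - y\<bar> powr b * y powr (p - b) + \<bar>x - y\<bar> powr p)"
    using powr_add[of "\<bar>x - y\<bar>" "p - 1" 1] b by (simp add: algebra_simps)
  also have "\<dots> \<le> (1 + p * 2 powr p) * (\<bar>x - y\<bar> powr b * y powr (p - b) + \<bar>x - y\<bar> powr p)"
  proof (intro mult_right_mono)
    have "2 powr (p - 1) \<le> (2::real) powr p" by (intro powr_mono) auto
    then have "p * 2 powr (p - 1) \<le> p * 2 powr p" using p by (intro mult_left_mono) auto
    then show "p * 2 powr (p - 1) \<le> 1 + p * 2 powr p" by simp
  qed auto
  finally show ?thesis .
qed

text \<open>
  With the total \<open>Z\<close>, every term satisfies \<open>z \<le> Z\<close>, hence \<open>z powr p \<le> z * Z powr (p - 1)\<close>.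
\<close>

lemma summable_powr_ge_1:
  fixes z :: "nat \<Rightarrow> real"
  assumes z: "summable z" "\<And>j. 0 \<le> z j" and p: "1 \<le> p"
  shows "summable (\<lambda>j. z j powr p)" "(\<Sum>j. z j powr p) \<le> (\<Sum>j. z j) powr p"
proof -
  let ?Z = "\<Sum>j. z j"
  have zZ: "z j \<le> ?Z" for j using sum_le_suminf[OF z(1), of "{j}"] z(2) by auto
  have le: "z j powr p \<le> z j * ?Z powr (p - 1)" for j
  proof (cases "z j = 0")
    case False
    then have "z j > 0" using z(2)[of j] by simp
    then have "z j powr p = z j * z j powr (p - 1)" by (simp add: powr_diff)
    also have "\<dots> \<le> z j * ?Z powr (p - 1)" using zZ z(2) p by (intro mult_left_mono powr_mono2) auto
    finally show ?thesis .
  qed simp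
  have s: "summable (\<lambda>j. z j * ?Z powr (p - 1))" by (intro summable_mult2 z)
  show s': "summable (\<lambda>j. z j powr p)"
    by (rule summable_comparison_test'[OF s, of 0]) (use le in auto)
  have "(\<Sum>j. z j powr p) \<le> (\<Sum>j. z j * ?Z powr (p - 1))" by (rule suminf_le[OF le s' s])
  also have "\<dots> = ?Z * ?Z powr (p - 1)" using z by (simp add: suminf_mult2)
  also have "\<dots> = ?Z powr p"
  proof (cases "?Z = 0")
    case False
    then have "?Z > 0" using suminf_nonneg[OF z(1)] z(2) by (simp add: order_less_le)
    then show ?thesis by (simp add: powr_diff)
  qed (use p in auto)
  finally show "(\<Sum>j. z j powr p) \<le> ?Z powr p" .
qed

lemma abs_suminf_powr_le:
  fixes A :: "nat \<Rightarrow> real"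
  assumes s: "summable (\<lambda>j. \<bar>A j\<bar> powr b)" and b: "0 < b" "b \<le> 1"
  shows "summable (\<lambda>j. \<bar>A j\<bar>)" "\<bar>\<Sum>j. A j\<bar> powr b \<le> (\<Sum>j. \<bar>A j\<bar> powr b)"
proof -
  have e: "(\<bar>A j\<bar> powr b) powr (1 / b) = \<bar>A j\<bar>" for j using b by (simp add: powr_powr)
  have p: "1 \<le> 1 / b" using b by simp
  note * = summable_powr_ge_1[OF s _ p, unfolded e]
  show s1: "summable (\<lambda>j. \<bar>A j\<bar>)" using *(1) by simp
  have "\<bar>\<Sum>j. A j\<bar> \<le> (\<Sum>j. \<bar>A j\<bar>)" by (rule summable_rabs[OF s1])
  also have "\<dots> \<le> (\<Sum>j. \<bar>A j\<bar> powr b) powr (1 / b)" using *(2) by simp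
  finally have "\<bar>\<Sum>j. A j\<bar> powr b \<le> ((\<Sum>j. \<bar>A j\<bar> powr b) powr (1 / b)) powr b"
    using b by (intro powr_mono2) auto
  also have "\<dots> = (\<Sum>j. \<bar>A j\<bar> powr b)" using b suminf_nonneg[OF s] by (simp add: powr_powr)
  finally show "\<bar>\<Sum>j. A j\<bar> powr b \<le> (\<Sum>j. \<bar>A j\<bar> powr b)" .
qed

lemma summable_max_index:
  fixes z :: "nat \<Rightarrow> real"
  assumes z: "summable z" "\<And>j. 0 \<le> z j"
  obtains i where "\<And>j. z j \<le> z i"
proof (cases "\<forall>j. z j = 0")
  case True
  then show ?thesis using that[of 0] by simp
next
  case False
  then obtain k where k: "z k > 0" using z(2) by (metis order_less_le)
  have "\<forall>\<^sub>F j in sequentially. z j < z k"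
    by (rule order_tendstoD(2)[OF summable_LIMSEQ_zero[OF z(1)] k])
  then obtain n where n: "\<And>j. n \<le> j \<Longrightarrow> z j < z k" by (auto simp: eventually_sequentially)
  then have kn: "k < n" by (meson less_irrefl not_le)
  have "Max (z ` {..<n}) \<in> z ` {..<n}" using kn by (intro Max_in) auto
  then obtain i where i: "z i = Max (z ` {..<n})" by force
  have max: "z j \<le> z i" if "j < n" for j unfolding i using that by (intro Max_ge) auto
  have "z j \<le> z i" for j using max[of j] max[of k] n[of j] kn by (cases "j < n") auto
  then show ?thesis using that by blast
qed

text \<open>
  Stands for the mixed products in \<open>(\<Sum>\<^sub>j z\<^sub>j)\<^sup>\<sigma>\<close>. For independent terms its expectation involves moments of order
  below \<open>\<sigma>\<close> only.
\<close>

definition cross_terms :: "real \<Rightarrow> (nat \<Rightarrow> real) \<Rightarrow> real" where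
  "cross_terms \<sigma> z = (\<Sum>j. z j * ((\<Sum>k. z k) - z j) powr (\<sigma> - 1))"

lemma summable_cross_terms:
  fixes z :: "nat \<Rightarrow> real"
  assumes z: "summable z" "\<And>j. 0 \<le> z j" and "1 < \<sigma>"
  shows "summable (\<lambda>j. z j * ((\<Sum>k. z k) - z j) powr (\<sigma> - 1))"
proof (rule summable_comparison_test'[of "\<lambda>j. z j * (\<Sum>k. z k) powr (\<sigma> - 1)" 0])
  show "summable (\<lambda>j. z j * (\<Sum>k. z k) powr (\<sigma> - 1))" by (intro summable_mult2 z)
  fix j
  have "z j \<le> (\<Sum>k. z k)" using sum_le_suminf[OF z(1), of "{j}"] z(2) by auto
  then show "norm (z j * ((\<Sum>k. z k) - z j) powr (\<sigma> - 1)) \<le> z j * (\<Sum>k. z k) powr (\<sigma> - 1)"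
    using z assms(3) by (auto simp: abs_mult intro!: mult_left_mono powr_mono2)
qed

text \<open>
  If \<open>i\<close> is the index of the largest term, every other term is at most the sum of the terms different
  from it, so each of these expressions is a sum over \<open>j \<noteq> i\<close> of products of distinct terms.
\<close>

lemma cross_terms_bounds:
  fixes z :: "nat \<Rightarrow> real"
  assumes z: "summable z" "\<And>j. 0 \<le> z j" and \<sigma>: "1 < \<sigma>" and i: "\<And>j. z j \<le> z i"
  defines "B \<equiv> (\<Sum>k. z k) - z i"
  shows "0 \<le> B" "B * z i powr (\<sigma> - 1) \<le> cross_terms \<sigma> z" "B powr \<sigma> \<le> cross_terms \<sigma> z"
    "(\<Sum>j. if j = i then 0 else z j powr \<sigma>) \<le> cross_terms \<sigma> z"
proof -
  let ?Z = "\<Sum>k. z k"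
  let ?z' = "\<lambda>j. if j = i then 0 else z j"
  have zi: "(\<lambda>j. if j = i then z j else 0) sums z i" by (rule sums_single)
  have sums: "?z' sums B"
    unfolding B_def using sums_diff[OF summable_sums[OF z(1)] zi] by (rule sums_cong[THEN iffD1, rotated]) auto
  then have z's: "summable ?z'" "suminf ?z' = B" by (auto simp: sums_iff)
  show B0: "0 \<le> B" unfolding z's(2)[symmetric] using z by (intro suminf_nonneg z's) auto
  have zZ: "z i \<le> ?Z - z j" if "j \<noteq> i" for j
    using sum_le_suminf[OF z(1), of "{i,j}"] z(2) that by auto
  have gen: "(\<Sum>j. ?z' j * y j) \<le> cross_terms \<sigma> z" "summable (\<lambda>j. ?z' j * y j)"
    if y: "\<And>j. j \<noteq> i \<Longrightarrow> 0 \<le> y j \<and> y j \<le> (?Z - z j) powr (\<sigma> - 1)" for y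
  proof -
    have le: "?z' j * y j \<le> z j * (?Z - z j) powr (\<sigma> - 1)" "0 \<le> ?z' j * y j" for j
      using y[of j] z(2)[of j] by (auto intro: mult_left_mono)
    show s: "summable (\<lambda>j. ?z' j * y j)"
      by (rule summable_comparison_test'[OF summable_cross_terms[OF z \<sigma>], of 0])
        (use le in \<open>auto simp del: mult_eq_0_iff\<close>)
    show "(\<Sum>j. ?z' j * y j) \<le> cross_terms \<sigma> z"
      unfolding cross_terms_def by (rule suminf_le[OF le(1) s summable_cross_terms[OF z \<sigma>]])
  qed
  have "(\<Sum>j. ?z' j * z i powr (\<sigma> - 1)) \<le> cross_terms \<sigma> z"
    using zZ z(2) \<sigma> by (intro gen(1)) (auto intro!: powr_mono2)
  then show "B * z i powr (\<sigma> - 1) \<le> cross_terms \<sigma> z" using suminf_mult2[OF z's(1)] z's(2) by simp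
  have "(\<Sum>j. ?z' j * B powr (\<sigma> - 1)) \<le> cross_terms \<sigma> z"
    using i z(2) \<sigma> B0 by (intro gen(1)) (auto intro!: powr_mono2 simp: B_def)
  then have "B * B powr (\<sigma> - 1) \<le> cross_terms \<sigma> z" using suminf_mult2[OF z's(1)] z's(2) by simp
  moreover have "B * B powr (\<sigma> - 1) = B powr \<sigma>" using B0 \<sigma> by (cases "B = 0") (auto simp: powr_diff)
  ultimately show "B powr \<sigma> \<le> cross_terms \<sigma> z" by simp
  have "(\<Sum>j. ?z' j * z j powr (\<sigma> - 1)) \<le> cross_terms \<sigma> z"
  proof (intro gen(1) conjI)
    fix j assume "j \<noteq> i"
    then have "z j \<le> ?Z - z j" using zZ[of j] i[of j] by simp
    then show "z j powr (\<sigma> - 1) \<le> (?Z - z j) powr (\<sigma> - 1)" using z(2) \<sigma> by (intro powr_mono2) auto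
  qed simp
  moreover have "?z' j * z j powr (\<sigma> - 1) = (if j = i then 0 else z j powr \<sigma>)" for j
    using z(2)[of j] \<sigma> by (cases "z j = 0") (auto simp: powr_diff)
  ultimately show "(\<Sum>j. if j = i then 0 else z j powr \<sigma>) \<le> cross_terms \<sigma> z" by simp
qed

text \<open>
  The error in replacing a function of \<open>q + \<Sum>\<^sub>j A\<^sub>j\<close> by the function of its largest term, expressed through
  products that contain no \<open>p\<close>-th power of a single \<open>A\<^sub>j\<close>.
\<close>

definition sum_error :: "real \<Rightarrow> real \<Rightarrow> real \<Rightarrow> (nat \<Rightarrow> real) \<Rightarrow> real" where
  "sum_error b p q A = \<bar>q\<bar> powr p + \<bar>q\<bar> powr b * (\<Sum>j. \<bar>A j\<bar> powr b) powr (p / b - 1)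
     + cross_terms (p / b) (\<lambda>j. \<bar>A j\<bar> powr b)"

text \<open>
  Here \<open>b\<close> is an exponent with \<open>\<bar>\<Sum>\<^sub>j A\<^sub>j\<bar>\<^sup>b \<le> \<Sum>\<^sub>j \<bar>A\<^sub>j\<bar>\<^sup>b\<close>. For \<open>p > 1\<close> the increments of \<open>x \<mapsto> x\<^sup>p\<close> are controlled
  linearly, which requires \<open>b = 1\<close>; for \<open>p \<le> 1\<close> any smaller exponent will do.
\<close>

locale exponents =
  fixes b p :: real
  assumes b: "0 < b" "b \<le> 1" and bp: "b < p" and cases_bp: "p \<le> 1 \<or> b = 1"
begin

text \<open>
  The factor collects \<open>\<bar>x\<^sup>p - y\<^sup>p\<bar>\<close> in terms of \<open>\<bar>x - y\<bar>\<close> and the splitting of a \<open>p\<close>-th power of a sum of two terms.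
\<close>

definition gap_const :: real where
  "gap_const = 1 + (1 + p * 2 powr p) * (1 + 2 powr (p / b))"

lemma summable_powr:
  fixes A :: "nat \<Rightarrow> real"
  assumes s: "summable (\<lambda>j. \<bar>A j\<bar> powr b)"
  shows "summable (\<lambda>j. \<bar>A j\<bar> powr p)"
  using summable_powr_ge_1(1)[OF s, of "p / b"] b bp by (simp add: powr_powr)

text \<open>
  Removing the largest term \<open>A\<^sub>i\<close> leaves a remainder that is dominated by the other terms and \<open>q\<close>. The increment
  of the \<open>p\<close>-th power and the \<open>p\<close>-th powers of the remaining terms consist of products of different
  terms, as estimated by \<open>cross_terms_bounds\<close>.
\<close>

lemma max_summand_dominates:
  fixes A :: "nat \<Rightarrow> real" and g :: "real \<Rightarrow> real"
  assumes s: "summable (\<lambda>j. \<bar>A j\<bar> powr b)"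
    and g: "\<And>x. 0 \<le> g x" "\<And>x. g x \<le> \<bar>x\<bar>" "\<And>x y. \<bar>g x - g y\<bar> \<le> \<bar>x - y\<bar>"
  obtains i where
    "\<bar>g ((\<Sum>j. A j) + q) powr p - g (A i) powr p\<bar> + (\<Sum>j. if j = i then 0 else g (A j) powr p)
      \<le> gap_const * sum_error b p q A"
proof -
  define z where "z j = \<bar>A j\<bar> powr b" for j
  define \<sigma> where "\<sigma> = p / b"
  have \<sigma>: "1 < \<sigma>" using b bp by (simp add: \<sigma>_def)
  have z: "summable z" "\<And>j. 0 \<le> z j" using s by (auto simp: z_def[abs_def])
  obtain i where i: "\<And>j. z j \<le> z i" using summable_max_index[OF z] by blast
  define Z where "Z = (\<Sum>j. z j)"
  define B where "B = Z - z i"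
  define D where "D = cross_terms \<sigma> z"
  note ct = cross_terms_bounds[OF z \<sigma> i, folded Z_def, folded B_def D_def]
  define r where "r = (\<Sum>j. A j) + q - A i"
  have A': "(\<Sum>j. if j = i then 0 else A j) = (\<Sum>j. A j) - A i"
    "(\<Sum>j. \<bar>if j = i then 0 else A j\<bar> powr b) = B" "summable (\<lambda>j. \<bar>if j = i then 0 else A j\<bar> powr b)"
  proof -
    have sA: "summable A" using abs_suminf_powr_le(1)[OF s b] by (rule summable_rabs_cancel)
    have "(\<lambda>j. A j - (if j = i then A j else 0)) sums ((\<Sum>j. A j) - A i)"
      by (rule sums_diff[OF summable_sums[OF sA] sums_single])
    moreover have "(\<lambda>j. A j - (if j = i then A j else 0)) = (\<lambda>j. if j = i then 0 else A j)" by auto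
    ultimately show "(\<Sum>j. if j = i then 0 else A j) = (\<Sum>j. A j) - A i" by (simp add: sums_iff)
    have "(\<lambda>j. z j - (if j = i then z j else 0)) sums (Z - z i)"
      unfolding Z_def by (rule sums_diff[OF summable_sums[OF z(1)] sums_single])
    moreover have "(\<lambda>j. z j - (if j = i then z j else 0)) = (\<lambda>j. \<bar>if j = i then 0 else A j\<bar> powr b)"
      by (auto simp: z_def)
    ultimately show "(\<Sum>j. \<bar>if j = i then 0 else A j\<bar> powr b) = B" "summable (\<lambda>j. \<bar>if j = i then 0 else A j\<bar> powr b)"
      by (simp_all add: sums_iff B_def)
  qed
  have r: "\<bar>r\<bar> powr b \<le> \<bar>q\<bar> powr b + B"
  proof -
    have "\<bar>r\<bar> powr b \<le> (\<bar>q\<bar> + \<bar>(\<Sum>j. A j) - A i\<bar>) powr b"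
      using b by (intro powr_mono2) (auto simp: r_def)
    also have "\<dots> \<le> \<bar>q\<bar> powr b + \<bar>(\<Sum>j. A j) - A i\<bar> powr b"
      using b by (intro powr_subadditive) auto
    also have "\<bar>(\<Sum>j. A j) - A i\<bar> powr b \<le> B"
      using abs_suminf_powr_le(2)[OF A'(3) b] by (simp add: A')
    finally show ?thesis by simp
  qed
  have Ai: "\<bar>A i\<bar> powr (p - b) = z i powr (\<sigma> - 1)"
    using b by (simp add: z_def powr_powr \<sigma>_def right_diff_distrib)
  have ziZ: "z i \<le> Z" unfolding Z_def using sum_le_suminf[OF z(1), of "{i}"] z(2) by auto
  have 1: "\<bar>r\<bar> powr b * \<bar>A i\<bar> powr (p - b) \<le> \<bar>q\<bar> powr b * Z powr (\<sigma> - 1) + D"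
  proof -
    have "\<bar>r\<bar> powr b * \<bar>A i\<bar> powr (p - b) \<le> (\<bar>q\<bar> powr b + B) * z i powr (\<sigma> - 1)"
      unfolding Ai using r by (intro mult_right_mono) auto
    also have "\<dots> = \<bar>q\<bar> powr b * z i powr (\<sigma> - 1) + B * z i powr (\<sigma> - 1)" by (simp add: distrib_right)
    also have "\<dots> \<le> \<bar>q\<bar> powr b * Z powr (\<sigma> - 1) + D"
      using ziZ z(2) \<sigma> by (intro add_mono ct mult_left_mono powr_mono2) auto
    finally show ?thesis .
  qed
  have 2: "\<bar>r\<bar> powr p \<le> 2 powr \<sigma> * (\<bar>q\<bar> powr p + D)"
  proof -
    have "\<bar>r\<bar> powr p = (\<bar>r\<bar> powr b) powr \<sigma>" using b by (simp add: powr_powr \<sigma>_def)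
    also have "\<dots> \<le> (\<bar>q\<bar> powr b + B) powr \<sigma>" using r \<sigma> by (intro powr_mono2) auto
    also have "\<dots> \<le> 2 powr \<sigma> * ((\<bar>q\<bar> powr b) powr \<sigma> + B powr \<sigma>)" using ct(1) \<sigma> by (intro powr_add_le) auto
    also have "\<dots> \<le> 2 powr \<sigma> * (\<bar>q\<bar> powr p + D)"
      using b ct(3) by (intro mult_left_mono add_mono) (auto simp: powr_powr \<sigma>_def)
    finally show ?thesis .
  qed
  define E where "E = sum_error b p q A"
  have E: "E = \<bar>q\<bar> powr p + \<bar>q\<bar> powr b * Z powr (\<sigma> - 1) + D"
    by (simp add: E_def sum_error_def Z_def z_def[abs_def] \<sigma>_def D_def)
  have D0: "0 \<le> D" using ct(3) powr_ge_zero order_trans by blast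
  have qZ: "0 \<le> \<bar>q\<bar> powr b * Z powr (\<sigma> - 1)" by simp
  let ?x = "g ((\<Sum>j. A j) + q)" and ?y = "g (A i)"
  have d: "\<bar>?x - ?y\<bar> \<le> \<bar>r\<bar>" using g(3)[of "(\<Sum>j. A j) + q" "A i"] by (simp add: r_def)
  have "\<bar>?x powr p - ?y powr p\<bar>
      \<le> (1 + p * 2 powr p) * (\<bar>?x - ?y\<bar> powr b * ?y powr (p - b) + \<bar>?x - ?y\<bar> powr p)"
    using b bp cases_bp g(1) by (intro abs_powr_diff_le) auto
  also have "\<dots> \<le> (1 + p * 2 powr p) * (\<bar>r\<bar> powr b * \<bar>A i\<bar> powr (p - b) + \<bar>r\<bar> powr p)"
    using d g b bp by (intro mult_left_mono add_mono mult_mono powr_mono2) auto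
  also have "\<dots> \<le> (1 + p * 2 powr p) * (E + 2 powr \<sigma> * E)"
  proof (intro mult_left_mono add_mono)
    show "\<bar>r\<bar> powr b * \<bar>A i\<bar> powr (p - b) \<le> E" using 1 E powr_ge_zero[of "\<bar>q\<bar>" p] by linarith
    have "2 powr \<sigma> * (\<bar>q\<bar> powr p + D) \<le> 2 powr \<sigma> * E" using qZ by (intro mult_left_mono) (auto simp: E)
    then show "\<bar>r\<bar> powr p \<le> 2 powr \<sigma> * E" using 2 by linarith
  qed (use b bp in auto)
  finally have "\<bar>?x powr p - ?y powr p\<bar> \<le> (1 + p * 2 powr p) * (1 + 2 powr \<sigma>) * E"
    by (simp add: algebra_simps)
  moreover have "(\<Sum>j. if j = i then 0 else g (A j) powr p) \<le> E"
  proof -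
    have le: "(if j = i then 0 else g (A j) powr p) \<le> (if j = i then 0 else z j powr \<sigma>)"
      "0 \<le> (if j = i then 0 else g (A j) powr p)" for j
      using g b bp by (auto simp: z_def powr_powr \<sigma>_def intro!: powr_mono2)
    have s2: "summable (\<lambda>j. if j = i then 0 else z j powr \<sigma>)"
      by (rule summable_comparison_test'[OF summable_powr_ge_1(1)[OF z, of \<sigma>], of 0]) (use \<sigma> in auto)
    have s1: "summable (\<lambda>j. if j = i then 0 else g (A j) powr p)"
      by (rule summable_comparison_test'[OF s2, of 0]) (use le in \<open>auto simp: abs_of_nonneg\<close>)
    have "(\<Sum>j. if j = i then 0 else g (A j) powr p) \<le> (\<Sum>j. if j = i then 0 else z j powr \<sigma>)"
      by (rule suminf_le[OF le(1) s1 s2])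
    also have "\<dots> \<le> D" by (rule ct)
    also have "D \<le> E" using qZ by (simp add: E)
    finally show ?thesis .
  qed
  ultimately have "\<bar>?x powr p - ?y powr p\<bar> + (\<Sum>j. if j = i then 0 else g (A j) powr p) \<le> gap_const * E"
    by (simp add: gap_const_def \<sigma>_def algebra_simps)
  then show thesis using that E_def by blast
qed

end

section \<open>Sums over the nodes of a tree\<close>

lemma summable_on_iff_integrable_count_space:
  fixes f :: "'a \<Rightarrow> real"
  shows "f summable_on A \<longleftrightarrow> integrable (count_space A) f"
  using summable_on_iff_abs_summable_on_real[of f A] abs_summable_equivalent[of f A]
  by (simp only: abs_summable_on_def)

text \<open>
  This holds without summability: both sides are \<open>0\<close> otherwise. It makes measurability and Fubini theorems
  applicable to unordered sums.
\<close>

lemma infsum_eq_integral_count_space: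
  fixes f :: "'a \<Rightarrow> real"
  shows "infsum f A = (\<integral>x. f x \<partial>count_space A)"
proof (cases "f summable_on A")
  case True
  then have "Infinite_Sum.abs_summable_on f A" by (rule summable_on_iff_abs_summable_on_real[THEN iffD1])
  then show ?thesis using infsetsum_infsum[of f A] abs_summable_equivalent[of f A] by (simp add: infsetsum_def)
next
  case False
  then show ?thesis
    by (simp add: summable_on_iff_integrable_count_space infsum_not_exists not_integrable_integral_eq)
qed

lemma measurable_case_prod_count_space:
  assumes "countable I" "\<And>i. i \<in> I \<Longrightarrow> (\<lambda>x. f x i) \<in> measurable N K"
  shows "case_prod f \<in> measurable (N \<Otimes>\<^sub>M count_space I) K"
proof -
  have "(\<lambda>p. f (snd p) (fst p)) \<in> measurable (count_space I \<Otimes>\<^sub>M N) K"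
    by (rule measurable_pair_measure_countable1) (use assms in auto)
  then have "(\<lambda>p. f (snd p) (fst p)) \<circ> (\<lambda>(x, y). (y, x)) \<in> measurable (N \<Otimes>\<^sub>M count_space I) K"
    using measurable_pair_swap' by (intro measurable_comp) 
  then show ?thesis by (simp add: comp_def case_prod_unfold)
qed

lemma measurable_nn_integral_count_space:
  assumes "countable I" "\<And>i. i \<in> I \<Longrightarrow> (\<lambda>x. f x i) \<in> borel_measurable N"
  shows "(\<lambda>x. \<integral>\<^sup>+i. f x i \<partial>count_space I) \<in> borel_measurable N"
  by (intro sigma_finite_measure.borel_measurable_nn_integral sigma_finite_measure_count_space_countable
    measurable_case_prod_count_space assms)

lemma measurable_integral_count_space:
  fixes f :: "'a \<Rightarrow> 'b \<Rightarrow> real"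
  assumes "countable I" "\<And>i. i \<in> I \<Longrightarrow> (\<lambda>x. f x i) \<in> borel_measurable N"
  shows "(\<lambda>x. \<integral>i. f x i \<partial>count_space I) \<in> borel_measurable N"
  by (intro sigma_finite_measure.borel_measurable_lebesgue_integral sigma_finite_measure_count_space_countable
    measurable_case_prod_count_space assms)

definition nodes_at :: "nat \<Rightarrow> nat list set" where
  "nodes_at n = {i \<in> nodes. length i = n}"

primrec tree_weight :: "(nat list \<Rightarrow> wvec) \<Rightarrow> nat list \<Rightarrow> real" where
  "tree_weight v [] = 1"
| "tree_weight v (j # i) = snd (snd (v i)) j * tree_weight v i"

definition tree_term :: "(nat list \<Rightarrow> wvec) \<Rightarrow> nat list \<Rightarrow> real" where
  "tree_term v i = fst (v i) * tree_weight v i"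

text \<open>
  As the youngest generation is at the head of the list, the descendants of \<open>s\<close> are the lists \<open>i @ s\<close>.
\<close>

definition subtree :: "nat list \<Rightarrow> (nat list \<Rightarrow> wvec) \<Rightarrow> nat list \<Rightarrow> wvec" where
  "subtree s v = (\<lambda>i\<in>nodes. v (i @ s))"

definition tree_sum :: "(nat list \<Rightarrow> wvec) \<Rightarrow> real" where
  "tree_sum v = (\<Sum>n. \<integral>i. tree_term v i \<partial>count_space (nodes_at n))"

definition level_moment :: "real \<Rightarrow> nat \<Rightarrow> (nat list \<Rightarrow> wvec) \<Rightarrow> ennreal" where
  "level_moment b n v = (\<integral>\<^sup>+i. ennreal (\<bar>tree_term v i\<bar> powr b) \<partial>count_space (nodes_at n))"

lemma countable_nodes: "countable nodes"
  by (rule countable_subset[OF subset_UNIV]) simp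

lemma countable_nodes_at: "countable (nodes_at n)"
  by (rule countable_subset[OF subset_UNIV]) simp

lemma nodes_simps[simp]: "[] \<in> nodes" "j # i \<in> nodes \<longleftrightarrow> 1 \<le> j \<and> i \<in> nodes" "i @ s \<in> nodes \<longleftrightarrow> i \<in> nodes \<and> s \<in> nodes"
  by (auto simp: nodes_def)

lemma last_butlast_nodes:
  assumes "i \<in> nodes" "i \<noteq> []"
  shows "1 \<le> last i" "butlast i \<in> nodes"
proof -
  have "butlast i @ [last i] \<in> nodes" using assms by simp
  then show "1 \<le> last i" "butlast i \<in> nodes" by (simp_all only: nodes_simps)
qed

lemma bij_betw_nodes_at_Suc: "bij_betw (\<lambda>(j, i). i @ [j]) ({1..} \<times> nodes_at n) (nodes_at (Suc n))"
proof (rule bij_betw_byWitness[where f'="\<lambda>i. (last i, butlast i)"])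
  have "last i \<in> {1..} \<and> butlast i \<in> nodes_at n" if "i \<in> nodes_at (Suc n)" for i
    using that last_butlast_nodes[of i] by (cases "i = []") (auto simp: nodes_at_def)
  then show "(\<lambda>i. (last i, butlast i)) ` nodes_at (Suc n) \<subseteq> {1..} \<times> nodes_at n" by blast
  have "butlast i @ [last i] = i" if "i \<in> nodes_at (Suc n)" for i
    using that by (cases "i = []") (auto simp: nodes_at_def)
  then show "\<forall>i\<in>nodes_at (Suc n). (case (last i, butlast i) of (j, i) \<Rightarrow> i @ [j]) = i" by simp
qed (auto simp: nodes_at_def)

lemma bij_betw_nodes: "bij_betw (\<lambda>(j, i). i @ [j]) ({1..} \<times> nodes) (nodes - {[]})"
proof (rule bij_betw_byWitness[where f'="\<lambda>i. (last i, butlast i)"])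
  show "(\<lambda>i. (last i, butlast i)) ` (nodes - {[]}) \<subseteq> {1..} \<times> nodes"
    using last_butlast_nodes by fastforce
qed auto

lemma tree_weight_append: "tree_weight v (i @ [j]) = snd (snd (v [])) j * tree_weight (\<lambda>i. v (i @ [j])) i"
  by (induction i) auto

lemma tree_weight_cong: "i \<in> nodes \<Longrightarrow> (\<And>k. k \<in> nodes \<Longrightarrow> v k = w k) \<Longrightarrow> tree_weight v i = tree_weight w i"
  by (induction i) auto

lemma tree_term_subtree:
  assumes "i \<in> nodes"
  shows "tree_term v (i @ [j]) = snd (snd (v [])) j * tree_term (subtree [j] v) i"
proof -
  have "tree_weight (\<lambda>i. v (i @ [j])) i = tree_weight (subtree [j] v) i"
    by (rule tree_weight_cong[OF assms]) (simp add: subtree_def)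
  then show ?thesis using assms by (simp add: tree_term_def tree_weight_append subtree_def)
qed

lemma tree_term_restrict: "i \<in> nodes \<Longrightarrow> tree_term (subtree [] v) i = tree_term v i"
  using tree_weight_cong[of i "subtree [] v" v] by (simp add: tree_term_def subtree_def)

lemma tree_sum_restrict: "tree_sum (subtree [] v) = tree_sum v"
  unfolding tree_sum_def
  by (intro suminf_cong Bochner_Integration.integral_cong) (auto simp: nodes_at_def tree_term_restrict)

lemma level_moment_restrict: "level_moment b n (subtree [] v) = level_moment b n v"
  unfolding level_moment_def by (intro nn_integral_cong) (auto simp: nodes_at_def tree_term_restrict)

lemma level_moment_Suc:
  "level_moment b (Suc n) v
    = (\<integral>\<^sup>+j. ennreal (\<bar>snd (snd (v [])) j\<bar> powr b) * level_moment b n (subtree [j] v) \<partial>count_space {1..})"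
proof -
  have "level_moment b (Suc n) v
      = (\<integral>\<^sup>+(j, i). ennreal (\<bar>tree_term v (i @ [j])\<bar> powr b) \<partial>count_space ({1..} \<times> nodes_at n))"
    unfolding level_moment_def
    by (subst nn_integral_bij_count_space[OF bij_betw_nodes_at_Suc, symmetric]) (simp add: case_prod_unfold)
  also have "\<dots> = (\<integral>\<^sup>+(j, i). ennreal (\<bar>snd (snd (v [])) j\<bar> powr b) * ennreal (\<bar>tree_term (subtree [j] v) i\<bar> powr b)
      \<partial>(count_space {1..} \<Otimes>\<^sub>M count_space (nodes_at n)))"
    unfolding pair_measure_countable[OF countableI_type countable_nodes_at]
    by (intro nn_integral_cong)
      (auto simp: nodes_at_def tree_term_subtree abs_mult powr_mult ennreal_mult)
  also have "\<dots> = (\<integral>\<^sup>+j. (\<integral>\<^sup>+i. ennreal (\<bar>snd (snd (v [])) j\<bar> powr b) * ennreal (\<bar>tree_term (subtree [j] v) i\<bar> powr b)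
      \<partial>count_space (nodes_at n)) \<partial>count_space {1..})"
    by (subst sigma_finite_measure.nn_integral_fst[symmetric])
      (auto intro!: sigma_finite_measure_count_space_countable countable_nodes_at
        simp: pair_measure_countable[OF countableI_type countable_nodes_at])
  also have "\<dots> = (\<integral>\<^sup>+j. ennreal (\<bar>snd (snd (v [])) j\<bar> powr b) * level_moment b n (subtree [j] v) \<partial>count_space {1..})"
    unfolding level_moment_def by (intro nn_integral_cong nn_integral_cmult) simp
  finally show ?thesis .
qed

lemma sum_level_moments:
  "(\<Sum>n. level_moment b n v) = (\<integral>\<^sup>+i. ennreal (\<bar>tree_term v i\<bar> powr b) \<partial>count_space nodes)"
proof -
  let ?f = "\<lambda>i. ennreal (\<bar>tree_term v i\<bar> powr b)"
  have "level_moment b n v = (\<integral>\<^sup>+i. ?f i * indicator (nodes_at n) i \<partial>count_space nodes)" for n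
    unfolding level_moment_def
    by (subst (1 2) nn_integral_count_space_indicator)
      (auto intro!: nn_integral_cong simp: indicator_def nodes_at_def)
  then have "(\<Sum>n. level_moment b n v) = (\<Sum>n. \<integral>\<^sup>+i. ?f i * indicator (nodes_at n) i \<partial>count_space nodes)" by simp
  also have "\<dots> = (\<integral>\<^sup>+i. (\<Sum>n. ?f i * indicator (nodes_at n) i) \<partial>count_space nodes)"
    by (rule nn_integral_suminf[symmetric]) simp
  also have "\<dots> = (\<integral>\<^sup>+i. ?f i \<partial>count_space nodes)"
  proof (intro nn_integral_cong)
    fix i assume "i \<in> space (count_space nodes)"
    then have "(\<lambda>n. ?f i * indicator (nodes_at n) i) = (\<lambda>n. if n = length i then ?f i else 0)"
      by (auto simp: indicator_def nodes_at_def)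
    then show "(\<Sum>n. ?f i * indicator (nodes_at n) i) = ?f i"
      using sums_unique[OF sums_single[of "length i" "\<lambda>_. ?f i"]] by simp
  qed
  finally show ?thesis .
qed

text \<open>
  For \<open>b \<le> 1\<close> the \<open>b\<close>-th power is subadditive, so summability of the \<open>b\<close>-th powers implies absolute
  summability and bounds the \<open>b\<close>-th power of the total.
\<close>

lemma summable_tree_term:
  assumes fin: "(\<integral>\<^sup>+i. ennreal (\<bar>tree_term v i\<bar> powr b) \<partial>count_space nodes) < \<infinity>" and b: "0 < b" "b \<le> 1"
  shows "integrable (count_space nodes) (tree_term v)"
    and "ennreal (\<bar>\<integral>i. tree_term v i \<partial>count_space nodes\<bar> powr b)
      \<le> (\<integral>\<^sup>+i. ennreal (\<bar>tree_term v i\<bar> powr b) \<partial>count_space nodes)"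
proof -
  have "infinite nodes"
  proof -
    have "infinite ((\<lambda>n. replicate n 1) ` (UNIV :: nat set) :: nat list set)"
      by (rule range_inj_infinite) (auto intro!: injI dest: arg_cong[where f=length])
    moreover have "(\<lambda>n. replicate n 1) ` (UNIV :: nat set) \<subseteq> nodes" by (auto simp: nodes_def)
    ultimately show ?thesis using finite_subset by blast
  qed
  then have e: "bij_betw (from_nat_into nodes) UNIV nodes"
    using countable_nodes by (rule bij_betw_from_nat_into[rotated])
  define t where "t k = tree_term v (from_nat_into nodes k)" for k
  have S: "(\<Sum>k. ennreal (\<bar>t k\<bar> powr b)) = (\<integral>\<^sup>+i. ennreal (\<bar>tree_term v i\<bar> powr b) \<partial>count_space nodes)"
    unfolding t_def nn_integral_count_space_nat[symmetric]
    by (rule nn_integral_bij_count_space[OF e])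
  have s: "summable (\<lambda>k. \<bar>t k\<bar> powr b)"
    using fin unfolding S[symmetric] by (intro summable_suminf_not_top) auto
  note t = abs_suminf_powr_le[OF s b]
  have i: "integrable (count_space UNIV) t" using t(1) by (simp add: integrable_count_space_nat_iff)
  show "integrable (count_space nodes) (tree_term v)"
    using i unfolding t_def by (simp add: integrable_bij_count_space[OF e])
  have "(\<integral>i. tree_term v i \<partial>count_space nodes) = (\<integral>k. t k \<partial>count_space UNIV)"
    unfolding t_def by (rule integral_bij_count_space[OF e, symmetric])
  also have "\<dots> = (\<Sum>k. t k)" by (rule integral_count_space_nat[OF i])
  finally have "ennreal (\<bar>\<integral>i. tree_term v i \<partial>count_space nodes\<bar> powr b) \<le> ennreal (\<Sum>k. \<bar>t k\<bar> powr b)"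
    using t(2) by (simp add: ennreal_leI)
  also have "\<dots> = (\<Sum>k. ennreal (\<bar>t k\<bar> powr b))" by (rule suminf_ennreal2[symmetric]) (use s in auto)
  finally show "ennreal (\<bar>\<integral>i. tree_term v i \<partial>count_space nodes\<bar> powr b)
      \<le> (\<integral>\<^sup>+i. ennreal (\<bar>tree_term v i\<bar> powr b) \<partial>count_space nodes)" by (simp add: S)
qed

lemma tree_sum_eq_integral:
  assumes int: "integrable (count_space nodes) (tree_term v)"
  shows "tree_sum v = (\<integral>i. tree_term v i \<partial>count_space nodes)"
proof -
  have e: "bij_betw (\<lambda>i. (length i, i)) nodes (SIGMA n:UNIV. nodes_at n)"
    by (rule bij_betw_byWitness[where f'=snd]) (auto simp: nodes_at_def)
  have s: "tree_term v summable_on nodes"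
    using int by (simp add: summable_on_iff_integrable_count_space)
  then have s2: "(\<lambda>(n, i). tree_term v i) summable_on (SIGMA n:UNIV. nodes_at n)"
    using summable_on_reindex_bij_betw[OF e, of "\<lambda>(n, i). tree_term v i"] by simp
  have "infsum (tree_term v) nodes = infsum (\<lambda>(n, i). tree_term v i) (SIGMA n:UNIV. nodes_at n)"
    using infsum_reindex_bij_betw[OF e, of "\<lambda>(n, i). tree_term v i"] by simp
  also have "\<dots> = infsum (\<lambda>n. infsum (tree_term v) (nodes_at n)) UNIV"
    using infsum_Sigma_banach[OF s2] by simp
  also have "\<dots> = (\<Sum>n. infsum (tree_term v) (nodes_at n))"
  proof -
    have "(\<lambda>n. infsum (tree_term v) (nodes_at n)) summable_on UNIV"
      by (rule summable_on_Sigma_banach[OF s2])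
    then show ?thesis by (intro sums_unique has_sum_imp_sums has_sum_infsum)
  qed
  finally show ?thesis by (simp add: infsum_eq_integral_count_space tree_sum_def)
qed

text \<open>
  Splitting the nodes different from the root by the child from which they descend.
\<close>

lemma tree_sum_recursion:
  assumes int: "integrable (count_space nodes) (tree_term v)"
  shows "integrable (count_space {1..}) (\<lambda>j. snd (snd (v [])) j * tree_sum (subtree [j] v))"
    "tree_sum v = fst (v []) + (\<integral>j. snd (snd (v [])) j * tree_sum (subtree [j] v) \<partial>count_space {1..})"
proof -
  let ?c = "\<lambda>j. snd (snd (v [])) j"
  let ?g = "\<lambda>(j, i). ?c j * tree_term (subtree [j] v) i"
  have g: "?g (j, i) = tree_term v (i @ [j])" if "i \<in> nodes" for j i using tree_term_subtree[OF that] by simp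
  have s: "tree_term v summable_on nodes"
    using int by (simp add: summable_on_iff_integrable_count_space)
  then have s1: "tree_term v summable_on nodes - {[]}" by (rule summable_on_subset_banach) auto
  have "(\<lambda>(j, i). tree_term v (i @ [j])) summable_on {1..} \<times> nodes"
    using s1 summable_on_reindex_bij_betw[OF bij_betw_nodes, of "tree_term v"] by (simp add: case_prod_unfold)
  then have s2: "?g summable_on {1..} \<times> nodes"
    by (rule summable_on_cong[THEN iffD1, rotated]) (auto simp: tree_term_subtree)
  have inner: "infsum (\<lambda>i. ?g (j, i)) nodes = ?c j * tree_sum (subtree [j] v)" if "j \<in> {1..}" for j
  proof (cases "?c j = 0")
    case False
    have "(\<lambda>i. ?c j * tree_term (subtree [j] v) i) summable_on nodes"
      by (rule summable_on_SigmaD1[OF s2 that])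
    then have "tree_term (subtree [j] v) summable_on nodes"
      using False by (simp add: summable_on_cmult_right')
    then have "integrable (count_space nodes) (tree_term (subtree [j] v))"
      by (simp add: summable_on_iff_integrable_count_space)
    then have "tree_sum (subtree [j] v) = infsum (tree_term (subtree [j] v)) nodes"
      by (simp add: tree_sum_eq_integral infsum_eq_integral_count_space)
    then show ?thesis by (simp add: infsum_cmult_right')
  qed simp
  have "(\<lambda>j. infsum (\<lambda>i. ?g (j, i)) nodes) summable_on {1..}"
    unfolding prod.case by (rule summable_on_Sigma_banach[OF s2])
  then have "(\<lambda>j. ?c j * tree_sum (subtree [j] v)) summable_on {1..}"
    by (rule summable_on_cong[THEN iffD1, rotated]) (use inner in auto)
  then show "integrable (count_space {1..}) (\<lambda>j. ?c j * tree_sum (subtree [j] v))"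
    by (simp add: summable_on_iff_integrable_count_space)
  have "tree_sum v = infsum (tree_term v) nodes" by (simp add: tree_sum_eq_integral[OF int] infsum_eq_integral_count_space)
  also have "nodes = {[]} \<union> (nodes - {[]})" by auto
  also have "infsum (tree_term v) ({[]} \<union> (nodes - {[]})) = infsum (tree_term v) {[]} + infsum (tree_term v) (nodes - {[]})"
    by (rule infsum_Un_disjoint) (use s1 in auto)
  also have "infsum (tree_term v) {[]} = fst (v [])" by (simp add: tree_term_def)
  also have "infsum (tree_term v) (nodes - {[]}) = infsum (\<lambda>(j, i). tree_term v (i @ [j])) ({1..} \<times> nodes)"
    by (subst infsum_reindex_bij_betw[OF bij_betw_nodes, symmetric]) (simp add: case_prod_unfold)
  also have "\<dots> = infsum ?g ({1..} \<times> nodes)" by (rule infsum_cong) (auto simp: tree_term_subtree)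
  also have "\<dots> = infsum (\<lambda>j. infsum (\<lambda>i. ?g (j, i)) nodes) {1..}" by (rule infsum_Sigma_banach[OF s2, symmetric])
  also have "\<dots> = infsum (\<lambda>j. ?c j * tree_sum (subtree [j] v)) {1..}" by (rule infsum_cong[OF inner])
  finally show "tree_sum v = fst (v []) + (\<integral>j. ?c j * tree_sum (subtree [j] v) \<partial>count_space {1..})"
    by (simp add: infsum_eq_integral_count_space)
qed

lemma measurable_tree_weight:
  "i \<in> nodes \<Longrightarrow> (\<lambda>v. tree_weight v i) \<in> borel_measurable (PiM nodes (\<lambda>_. vec_space))"
proof (induction i)
  case (Cons j i)
  have [measurable]: "(\<lambda>v. snd (snd (v i)) j) \<in> borel_measurable (PiM nodes (\<lambda>_. vec_space))"
  proof -
    have "(\<lambda>x. snd (snd x) j) \<in> borel_measurable vec_space"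
      using Cons by (auto simp: vec_space_def intro!: measurable_compose[OF measurable_snd[THEN measurable_compose, OF measurable_snd]] measurable_component_singleton)
    then show ?thesis using Cons by (intro measurable_compose[OF measurable_component_singleton]) auto
  qed
  have [measurable]: "(\<lambda>v. tree_weight v i) \<in> borel_measurable (PiM nodes (\<lambda>_. vec_space))"
    using Cons by auto
  show ?case by simp
qed simp

lemma measurable_tree_term:
  assumes "i \<in> nodes"
  shows "(\<lambda>v. tree_term v i) \<in> borel_measurable (PiM nodes (\<lambda>_. vec_space))"
proof -
  have "fst \<in> borel_measurable vec_space" by (simp add: vec_space_def)
  then have "(\<lambda>v. fst (v i)) \<in> borel_measurable (PiM nodes (\<lambda>_. vec_space))"
    using assms by (intro measurable_compose[OF measurable_component_singleton]) auto
  then show ?thesis unfolding tree_term_def using measurable_tree_weight[OF assms] by (rule borel_measurable_times)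
qed

lemma measurable_tree_sum[measurable]: "tree_sum \<in> borel_measurable (PiM nodes (\<lambda>_. vec_space))"
  unfolding tree_sum_def[abs_def]
  by (intro borel_measurable_suminf measurable_integral_count_space countable_nodes_at measurable_tree_term)
    (auto simp: nodes_at_def)

lemma measurable_level_moment[measurable]: "level_moment b n \<in> borel_measurable (PiM nodes (\<lambda>_. vec_space))"
  unfolding level_moment_def[abs_def]
proof (intro measurable_nn_integral_count_space countable_nodes_at)
  fix i assume "i \<in> nodes_at n"
  then have [measurable]: "(\<lambda>v. tree_term v i) \<in> borel_measurable (PiM nodes (\<lambda>_. vec_space))"
    by (intro measurable_tree_term) (simp add: nodes_at_def)
  show "(\<lambda>v. ennreal (\<bar>tree_term v i\<bar> powr b)) \<in> borel_measurable (PiM nodes (\<lambda>_. vec_space))"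
    by measurable
qed

section \<open>The weighted branching tree\<close>

text \<open>
  Children are numbered from \<open>1\<close> in a vector but from \<open>0\<close> here, so that sums over children are ordinary series.
\<close>

definition weight :: "wvec \<Rightarrow> nat \<Rightarrow> real" where
  "weight x j = snd (snd x) (Suc j)"

lemma measurable_weight_ge_1:
  assumes "1 \<le> j" shows "(\<lambda>x. snd (snd x) j) \<in> borel_measurable vec_space"
  unfolding vec_space_def
  by (rule measurable_compose[OF measurable_compose[OF measurable_snd measurable_snd]
        measurable_component_singleton]) (use assms in simp)

lemma measurable_weight[measurable]: "(\<lambda>x. weight x j) \<in> borel_measurable vec_space"
  unfolding weight_def by (rule measurable_weight_ge_1) simp

lemma measurable_fst_vec_space[measurable]: "fst \<in> borel_measurable vec_space"
  by (simp add: vec_space_def)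

lemma bij_betw_Suc_ge_1: "bij_betw Suc UNIV {1..}"
  by (rule bij_betw_byWitness[where f'="\<lambda>j. j - 1"]) auto

locale branching_tree =
  fixes M :: "'a measure" and Qt :: "nat list \<Rightarrow> 'a \<Rightarrow> real" and Nt :: "nat list \<Rightarrow> 'a \<Rightarrow> enat"
    and Ct :: "nat list \<Rightarrow> 'a \<Rightarrow> real"
  assumes tree: "weighted_branching_tree M Qt Nt Ct"
begin

sublocale prob_space M
  using tree unfolding weighted_branching_tree_def by (elim conjE)

definition V :: "'a \<Rightarrow> nat list \<Rightarrow> wvec" where
  "V \<omega> i = node_vec Qt Nt Ct i \<omega>"

lemma indep_V: "indep_vars (\<lambda>_. vec_space) (\<lambda>i \<omega>. V \<omega> i) nodes"
proof -
  have "(\<lambda>i \<omega>. V \<omega> i) = node_vec Qt Nt Ct" by (simp add: fun_eq_iff V_def)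
  then show ?thesis using tree unfolding weighted_branching_tree_def by metis
qed

lemma measurable_V: "i \<in> nodes \<Longrightarrow> (\<lambda>\<omega>. V \<omega> i) \<in> measurable M vec_space"
  using indep_V by (simp add: indep_vars_def)

lemma measurable_V_root[measurable]: "(\<lambda>\<omega>. V \<omega> []) \<in> measurable M vec_space"
  by (rule measurable_V) simp

lemma distr_V: "i \<in> nodes \<Longrightarrow> distr M vec_space (\<lambda>\<omega>. V \<omega> i) = distr M vec_space (\<lambda>\<omega>. V \<omega> [])"
proof -
  assume "i \<in> nodes"
  moreover have "(\<lambda>\<omega>. V \<omega> k) = node_vec Qt Nt Ct k" for k by (simp add: fun_eq_iff V_def)
  ultimately show ?thesis using tree unfolding weighted_branching_tree_def by metis
qed

lemma tree_weight_V:
  assumes "i \<in> nodes"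
  shows "tree_weight (V \<omega>) i = (if i \<in> generation Nt \<omega> (length i) then path_weight Ct \<omega> i else 0)"
  using assms
proof (induction i)
  case (Cons j i)
  have c: "snd (snd (V \<omega> i)) j = (if j \<in> idx (Nt i \<omega>) then Ct (j # i) \<omega> else 0)"
    using Cons by (simp add: V_def node_vec_def padded_vec_def)
  show ?case using Cons by (auto simp: c)
qed simp

lemma generation_subset: "generation Nt \<omega> n \<subseteq> nodes_at n"
  by (induction n) (auto simp: nodes_at_def idx_def)

text \<open>
  The padding by zeros annihilates the terms of all nodes that do not belong to the tree, so the generation can be
  replaced by the set of all nodes of its depth.
\<close>

lemma W_eq: "W Qt Nt Ct n \<omega> = (\<integral>i. tree_term (V \<omega>) i \<partial>count_space (nodes_at n))"
  unfolding W_def infsum_eq_integral_count_space[symmetric]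
proof (rule infsum_cong_neutral)
  have *: "tree_term (V \<omega>) i = (if i \<in> generation Nt \<omega> n then Qt i \<omega> * path_weight Ct \<omega> i else 0)"
    if "i \<in> nodes_at n" for i
    using that by (auto simp: nodes_at_def tree_term_def tree_weight_V V_def node_vec_def padded_vec_def)
  show "Qt i \<omega> * path_weight Ct \<omega> i = tree_term (V \<omega>) i" if "i \<in> generation Nt \<omega> n \<inter> nodes_at n" for i
    using that * by auto
  show "tree_term (V \<omega>) i = 0" if "i \<in> nodes_at n - generation Nt \<omega> n" for i
    using that * by auto
qed (use generation_subset in blast)

lemma R_series_eq: "R_series Qt Nt Ct \<omega> = tree_sum (V \<omega>)"
  by (simp add: R_series_def tree_sum_def W_eq)

lemma measurable_subtree_V[measurable]:
  assumes "s \<in> nodes"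
  shows "(\<lambda>\<omega>. subtree s (V \<omega>)) \<in> measurable M (PiM nodes (\<lambda>_. vec_space))"
  unfolding subtree_def by (rule measurable_restrict) (use assms in \<open>auto intro: measurable_V\<close>)

lemma measurable_tree_sum_subtree: "s \<in> nodes \<Longrightarrow> (\<lambda>\<omega>. tree_sum (subtree s (V \<omega>))) \<in> borel_measurable M"
  by (rule measurable_compose[OF measurable_subtree_V measurable_tree_sum])

lemma measurable_tree_sum_V[measurable]: "(\<lambda>\<omega>. tree_sum (V \<omega>)) \<in> borel_measurable M"
  using measurable_tree_sum_subtree[of "[]"] by (simp add: tree_sum_restrict)

lemma distr_subtree:
  assumes s: "s \<in> nodes"
  shows "distr M (PiM nodes (\<lambda>_. vec_space)) (\<lambda>\<omega>. subtree s (V \<omega>))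
    = PiM nodes (\<lambda>_. distr M vec_space (\<lambda>\<omega>. V \<omega> []))"
proof -
  have "indep_vars (\<lambda>i. PiM {i @ s} (\<lambda>_. vec_space)) (\<lambda>i \<omega>. restrict (V \<omega>) {i @ s}) nodes"
    by (rule indep_vars_restrict[OF indep_V]) (use s in \<open>auto simp: disjoint_family_on_def\<close>)
  then have "indep_vars (\<lambda>_. vec_space) (\<lambda>i \<omega>. (restrict (V \<omega>) {i @ s}) (i @ s)) nodes"
    by (rule indep_vars_compose2) (auto intro: measurable_component_singleton)
  then have "indep_vars (\<lambda>_. vec_space) (\<lambda>i \<omega>. V \<omega> (i @ s)) nodes" by simp
  then have "distr M (PiM nodes (\<lambda>_. vec_space)) (\<lambda>\<omega>. \<lambda>i\<in>nodes. V \<omega> (i @ s))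
      = PiM nodes (\<lambda>i. distr M vec_space (\<lambda>\<omega>. V \<omega> (i @ s)))"
    by (subst (asm) indep_vars_iff_distr_eq_PiM') (use s in \<open>auto intro: measurable_V simp: ex_in_conv[symmetric] intro!: exI[of _ "[]"]\<close>)
  also have "\<dots> = PiM nodes (\<lambda>_. distr M vec_space (\<lambda>\<omega>. V \<omega> []))"
    by (rule PiM_cong) (use s in \<open>auto intro!: distr_V\<close>)
  finally show ?thesis by (simp add: subtree_def)
qed

lemma nn_integral_subtree:
  assumes s: "s \<in> nodes" and [measurable]: "F \<in> borel_measurable (PiM nodes (\<lambda>_. vec_space))"
    and F: "\<And>v. F (subtree [] v) = F v"
  shows "(\<integral>\<^sup>+\<omega>. F (subtree s (V \<omega>)) \<partial>M) = (\<integral>\<^sup>+\<omega>. F (V \<omega>) \<partial>M)"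
proof -
  have *: "(\<integral>\<^sup>+\<omega>. F (subtree s (V \<omega>)) \<partial>M) = (\<integral>\<^sup>+v. F v \<partial>PiM nodes (\<lambda>_. distr M vec_space (\<lambda>\<omega>. V \<omega> [])))"
    if s: "s \<in> nodes" for s
    unfolding distr_subtree[OF s, symmetric]
    using nn_integral_distr[OF measurable_subtree_V[OF s], of F] by simp
  have "(\<integral>\<^sup>+\<omega>. F (subtree [] (V \<omega>)) \<partial>M) = (\<integral>\<^sup>+\<omega>. F (V \<omega>) \<partial>M)"
    by (rule nn_integral_cong) (rule F)
  then show ?thesis using *[OF s] *[of "[]"] by (simp only: nodes_simps)
qed

text \<open>
  Independence of the root from all other nodes, in the form of Fubini's theorem.
\<close>

lemma root_decoupling:
  assumes H: "H \<in> borel_measurable (vec_space \<Otimes>\<^sub>M PiM (nodes - {[]}) (\<lambda>_. vec_space))"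
  shows "(\<integral>\<^sup>+\<omega>. H (V \<omega> [], restrict (V \<omega>) (nodes - {[]})) \<partial>M)
    = (\<integral>\<^sup>+\<omega>. (\<integral>\<^sup>+\<omega>'. H (V \<omega> [], restrict (V \<omega>') (nodes - {[]})) \<partial>M) \<partial>M)"
proof -
  let ?S = "PiM {[]} (\<lambda>_. vec_space)" and ?T = "PiM (nodes - {[]}) (\<lambda>_. vec_space)"
  let ?X = "\<lambda>\<omega>. restrict (V \<omega>) {[]}" and ?Y = "\<lambda>\<omega>. restrict (V \<omega>) (nodes - {[]})"
  have ind: "indep_var ?S ?X ?T ?Y"
    using indep_var_restrict[OF indep_V, of "{[]}" "nodes - {[]}"] by simp
  have X[measurable]: "?X \<in> measurable M ?S" by (rule indep_var_rv1[OF ind])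
  have Y[measurable]: "?Y \<in> measurable M ?T" by (rule indep_var_rv2[OF ind])
  have eq: "distr M ?S ?X \<Otimes>\<^sub>M distr M ?T ?Y = distr M (?S \<Otimes>\<^sub>M ?T) (\<lambda>\<omega>. (?X \<omega>, ?Y \<omega>))"
    using ind unfolding indep_var_distribution_eq by (elim conjE)
  interpret T: prob_space "distr M ?T ?Y" by (rule prob_space_distr[OF Y])
  have c: "(\<lambda>x. x []) \<in> measurable ?S vec_space" by (rule measurable_component_singleton) simp
  have H'[measurable]: "(\<lambda>(x, y). H (x [], y)) \<in> borel_measurable (?S \<Otimes>\<^sub>M ?T)"
    using measurable_compose[OF _ H, of "\<lambda>p. (fst p [], snd p)" "?S \<Otimes>\<^sub>M ?T"] c
    by (simp add: case_prod_unfold measurable_compose[OF measurable_fst c])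
  have "(\<integral>\<^sup>+\<omega>. H (V \<omega> [], ?Y \<omega>) \<partial>M) = (\<integral>\<^sup>+p. (case p of (x, y) \<Rightarrow> H (x [], y)) \<partial>distr M (?S \<Otimes>\<^sub>M ?T) (\<lambda>\<omega>. (?X \<omega>, ?Y \<omega>)))"
    by (subst nn_integral_distr) (auto simp: H')
  also have "\<dots> = (\<integral>\<^sup>+x. (\<integral>\<^sup>+y. H (x [], y) \<partial>distr M ?T ?Y) \<partial>distr M ?S ?X)"
    unfolding eq[symmetric] by (subst T.nn_integral_fst[symmetric]) (auto simp: H')
  also have "\<dots> = (\<integral>\<^sup>+\<omega>. (\<integral>\<^sup>+y. H (V \<omega> [], y) \<partial>distr M ?T ?Y) \<partial>M)"
    by (subst nn_integral_distr) (auto intro!: T.borel_measurable_nn_integral simp: H')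
  also have "\<dots> = (\<integral>\<^sup>+\<omega>. (\<integral>\<^sup>+\<omega>'. H (V \<omega> [], ?Y \<omega>') \<partial>M) \<partial>M)"
  proof (intro nn_integral_cong)
    fix \<omega> assume "\<omega> \<in> space M"
    then have "V \<omega> [] \<in> space vec_space" using measurable_space[OF measurable_V_root] by blast
    then have [measurable]: "(\<lambda>y. H (V \<omega> [], y)) \<in> borel_measurable ?T"
      by (intro measurable_compose[OF measurable_Pair1' H])
    show "(\<integral>\<^sup>+y. H (V \<omega> [], y) \<partial>distr M ?T ?Y) = (\<integral>\<^sup>+\<omega>'. H (V \<omega> [], ?Y \<omega>') \<partial>M)"
      by (subst nn_integral_distr) auto
  qed
  finally show ?thesis .
qed

lemma subtree_of_rest: "1 \<le> j \<Longrightarrow> subtree [j] v = subtree [j] (restrict v (nodes - {[]}))"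
  by (auto simp: subtree_def restrict_def fun_eq_iff)

lemma measurable_subtree_rest:
  assumes "1 \<le> j"
  shows "subtree [j] \<in> measurable (PiM (nodes - {[]}) (\<lambda>_. vec_space)) (PiM nodes (\<lambda>_. vec_space))"
  unfolding subtree_def[abs_def]
  by (rule measurable_restrict) (use assms in \<open>auto intro!: measurable_component_singleton\<close>)

definition child_sum :: "nat \<Rightarrow> 'a \<Rightarrow> real" where
  "child_sum j \<omega> = tree_sum (subtree [Suc j] (V \<omega>))"

lemma measurable_child_sum[measurable]: "child_sum j \<in> borel_measurable M"
  unfolding child_sum_def[abs_def] by (rule measurable_tree_sum_subtree) simp

text \<open>
  The series of different children depend on disjoint families of nodes.
\<close>

lemma indep_child_sums: "indep_vars (\<lambda>_. borel) child_sum UNIV"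
proof -
  let ?K = "\<lambda>j. {i @ [Suc j] | i. i \<in> nodes}"
  have "indep_vars (\<lambda>j. PiM (?K j) (\<lambda>_. vec_space)) (\<lambda>j \<omega>. restrict (V \<omega>) (?K j)) UNIV"
    by (rule indep_vars_restrict[OF indep_V]) (auto simp: disjoint_family_on_def)
  then have "indep_vars (\<lambda>_. borel) (\<lambda>j \<omega>. tree_sum (subtree [Suc j] (restrict (V \<omega>) (?K j)))) UNIV"
  proof (rule indep_vars_compose2)
    fix j
    have "subtree [Suc j] \<in> measurable (PiM (?K j) (\<lambda>_. vec_space)) (PiM nodes (\<lambda>_. vec_space))"
      unfolding subtree_def[abs_def] by (rule measurable_restrict) (auto intro!: measurable_component_singleton)
    then show "(\<lambda>v. tree_sum (subtree [Suc j] v)) \<in> borel_measurable (PiM (?K j) (\<lambda>_. vec_space))"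
      by (rule measurable_compose) measurable
  qed
  moreover have "subtree [Suc j] (restrict (V \<omega>) (?K j)) = subtree [Suc j] (V \<omega>)" for j \<omega>
    by (auto simp: subtree_def restrict_def fun_eq_iff)
  ultimately show ?thesis by (simp add: child_sum_def[abs_def])
qed

lemma distr_child_sum: "distr M borel (child_sum j) = distr M borel (\<lambda>\<omega>. tree_sum (V \<omega>))"
proof (rule measure_eqI)
  fix A assume "A \<in> sets (distr M borel (child_sum j))"
  then have [measurable]: "A \<in> sets borel" by simp
  have "emeasure (distr M borel (child_sum j)) A = (\<integral>\<^sup>+\<omega>. indicator A (tree_sum (subtree [Suc j] (V \<omega>))) \<partial>M)"
    by (subst nn_integral_indicator[symmetric], simp, subst nn_integral_distr) (auto simp: child_sum_def)
  also have "\<dots> = (\<integral>\<^sup>+\<omega>. indicator A (tree_sum (V \<omega>)) \<partial>M)"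
    by (rule nn_integral_subtree[where F="\<lambda>v. indicator A (tree_sum v)"]) (auto simp: tree_sum_restrict)
  also have "\<dots> = emeasure (distr M borel (\<lambda>\<omega>. tree_sum (V \<omega>))) A"
    by (subst nn_integral_indicator[symmetric], simp, subst nn_integral_distr) auto
  finally show "emeasure (distr M borel (child_sum j)) A = emeasure (distr M borel (\<lambda>\<omega>. tree_sum (V \<omega>))) A" .
qed simp

lemma child_sums_decoupled:
  assumes F: "F \<in> borel_measurable (vec_space \<Otimes>\<^sub>M PiM UNIV (\<lambda>_. borel))"
  shows "(\<integral>\<^sup>+\<omega>. F (V \<omega> [], \<lambda>j. child_sum j \<omega>) \<partial>M)
    = (\<integral>\<^sup>+\<omega>. (\<integral>\<^sup>+\<omega>'. F (V \<omega> [], \<lambda>j. child_sum j \<omega>') \<partial>M) \<partial>M)"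
proof -
  let ?Y = "\<lambda>\<omega>. restrict (V \<omega>) (nodes - {[]})"
  define c where "c y = (\<lambda>j. tree_sum (subtree [Suc j] y))" for y
  have c: "(\<lambda>j. child_sum j \<omega>) = c (?Y \<omega>)" for \<omega>
    unfolding c_def child_sum_def using subtree_of_rest[of "Suc _" "V \<omega>"] by auto
  have [measurable]: "c \<in> measurable (PiM (nodes - {[]}) (\<lambda>_. vec_space)) (PiM UNIV (\<lambda>_. borel))"
    unfolding c_def[abs_def]
    by (rule measurable_PiM_single') (auto intro!: measurable_compose[OF measurable_subtree_rest measurable_tree_sum])
  have "(\<lambda>p. F (fst p, c (snd p))) \<in> borel_measurable (vec_space \<Otimes>\<^sub>M PiM (nodes - {[]}) (\<lambda>_. vec_space))"
    by (rule measurable_compose[OF _ F]) measurable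
  from root_decoupling[OF this] show ?thesis unfolding c by simp
qed

definition weight_moment :: "real \<Rightarrow> ennreal" where
  "weight_moment b = (\<integral>\<^sup>+\<omega>. (\<Sum>j. ennreal (\<bar>weight (V \<omega> []) j\<bar> powr b)) \<partial>M)"

text \<open>
  By independence of the root from the subtrees, each generation multiplies the moment by the same factor.
\<close>

lemma nn_integral_level_moment:
  "(\<integral>\<^sup>+\<omega>. level_moment b n (V \<omega>) \<partial>M) = weight_moment b ^ n * (\<integral>\<^sup>+\<omega>. ennreal (\<bar>fst (V \<omega> [])\<bar> powr b) \<partial>M)"
proof (induction n)
  case 0
  have "nodes_at 0 = {[]}" by (auto simp: nodes_at_def)
  then show ?case by (simp add: level_moment_def nn_integral_count_space_finite tree_term_def)
next
  case (Suc n)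
  let ?L = "\<lambda>j \<omega>. level_moment b n (subtree [Suc j] (V \<omega>))"
  have [measurable]: "?L j \<in> borel_measurable M" for j
    by (rule measurable_compose[OF measurable_subtree_V]) auto
  have "level_moment b (Suc n) (V \<omega>) = (\<Sum>j. ennreal (\<bar>weight (V \<omega> []) j\<bar> powr b) * ?L j \<omega>)" for \<omega>
    unfolding level_moment_Suc weight_def nn_integral_bij_count_space[OF bij_betw_Suc_ge_1, symmetric]
    by (rule nn_integral_count_space_nat)
  then have "(\<integral>\<^sup>+\<omega>. level_moment b (Suc n) (V \<omega>) \<partial>M)
      = (\<Sum>j. \<integral>\<^sup>+\<omega>. ennreal (\<bar>weight (V \<omega> []) j\<bar> powr b) * ?L j \<omega> \<partial>M)"
    by (simp add: nn_integral_suminf)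
  also have "\<dots> = (\<Sum>j. (\<integral>\<^sup>+\<omega>. ennreal (\<bar>weight (V \<omega> []) j\<bar> powr b) \<partial>M) * (\<integral>\<^sup>+\<omega>. level_moment b n (V \<omega>) \<partial>M))"
  proof (rule suminf_cong)
    fix j
    let ?H = "\<lambda>(x, y). ennreal (\<bar>weight x j\<bar> powr b) * level_moment b n (subtree [Suc j] y)"
    have [measurable]: "(\<lambda>y. level_moment b n (subtree [Suc j] y)) \<in> borel_measurable (PiM (nodes - {[]}) (\<lambda>_. vec_space))"
      by (rule measurable_compose[OF measurable_subtree_rest]) auto
    have "?H \<in> borel_measurable (vec_space \<Otimes>\<^sub>M PiM (nodes - {[]}) (\<lambda>_. vec_space))" by measurable
    from root_decoupling[OF this]
    have "(\<integral>\<^sup>+\<omega>. ennreal (\<bar>weight (V \<omega> []) j\<bar> powr b) * ?L j \<omega> \<partial>M)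
        = (\<integral>\<^sup>+\<omega>. (\<integral>\<^sup>+\<omega>'. ennreal (\<bar>weight (V \<omega> []) j\<bar> powr b) * ?L j \<omega>' \<partial>M) \<partial>M)"
      by (simp add: subtree_of_rest[symmetric])
    also have "\<dots> = (\<integral>\<^sup>+\<omega>. ennreal (\<bar>weight (V \<omega> []) j\<bar> powr b) \<partial>M) * (\<integral>\<^sup>+\<omega>. ?L j \<omega> \<partial>M)"
      by (simp add: nn_integral_cmult nn_integral_multc)
    also have "(\<integral>\<^sup>+\<omega>. ?L j \<omega> \<partial>M) = (\<integral>\<^sup>+\<omega>. level_moment b n (V \<omega>) \<partial>M)"
      by (rule nn_integral_subtree) (auto simp: level_moment_restrict)
    finally show "(\<integral>\<^sup>+\<omega>. ennreal (\<bar>weight (V \<omega> []) j\<bar> powr b) * ?L j \<omega> \<partial>M)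
       = (\<integral>\<^sup>+\<omega>. ennreal (\<bar>weight (V \<omega> []) j\<bar> powr b) \<partial>M) * (\<integral>\<^sup>+\<omega>. level_moment b n (V \<omega>) \<partial>M)" .
  qed
  also have "\<dots> = weight_moment b * (\<integral>\<^sup>+\<omega>. level_moment b n (V \<omega>) \<partial>M)"
    by (simp add: weight_moment_def nn_integral_suminf)
  finally show ?case by (simp add: Suc mult.assoc)
qed

text \<open>
  The level moments form a convergent geometric series.
\<close>

lemma tree_moment:
  assumes b: "0 < b" "b \<le> 1" and rho: "weight_moment b < 1"
    and Q: "(\<integral>\<^sup>+\<omega>. ennreal (\<bar>fst (V \<omega> [])\<bar> powr b) \<partial>M) < \<infinity>"
  shows "AE \<omega> in M. integrable (count_space nodes) (tree_term (V \<omega>))"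
    and "(\<integral>\<^sup>+\<omega>. ennreal (\<bar>tree_sum (V \<omega>)\<bar> powr b) \<partial>M) < \<infinity>"
proof -
  let ?S = "\<lambda>\<omega>. \<integral>\<^sup>+i. ennreal (\<bar>tree_term (V \<omega>) i\<bar> powr b) \<partial>count_space nodes"
  obtain r where r: "weight_moment b = ennreal r" "0 \<le> r" "r < 1"
    using rho by (cases "weight_moment b") (auto simp: ennreal_less_one_iff)
  have [measurable]: "(\<lambda>\<omega>. level_moment b n (V \<omega>)) \<in> borel_measurable M" for n
    using measurable_compose[OF measurable_subtree_V[of "[]"] measurable_level_moment[of b n]]
    by (simp add: level_moment_restrict)
  have S: "?S \<omega> = (\<Sum>n. level_moment b n (V \<omega>))" for \<omega> by (rule sum_level_moments[symmetric])
  have [measurable]: "?S \<in> borel_measurable M" unfolding S by measurable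
  have "(\<integral>\<^sup>+\<omega>. ?S \<omega> \<partial>M) = (\<Sum>n. weight_moment b ^ n * (\<integral>\<^sup>+\<omega>. ennreal (\<bar>fst (V \<omega> [])\<bar> powr b) \<partial>M))"
    unfolding S by (simp add: nn_integral_suminf nn_integral_level_moment)
  also have "\<dots> = (\<Sum>n. ennreal (r ^ n)) * (\<integral>\<^sup>+\<omega>. ennreal (\<bar>fst (V \<omega> [])\<bar> powr b) \<partial>M)"
    using r by (simp add: ennreal_power)
  also have "(\<Sum>n. ennreal (r ^ n)) = ennreal (\<Sum>n. r ^ n)"
    by (rule suminf_ennreal2) (use r in \<open>auto intro: summable_geometric\<close>)
  finally have fin: "(\<integral>\<^sup>+\<omega>. ?S \<omega> \<partial>M) < \<infinity>"
    using Q by (simp add: ennreal_mult_less_top)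
  have "AE \<omega> in M. ?S \<omega> \<noteq> \<infinity>"
    by (rule nn_integral_noteq_infinite) (use fin in auto)
  then have AE: "AE \<omega> in M. ?S \<omega> < \<infinity>" by (simp add: less_top)
  then show ae: "AE \<omega> in M. integrable (count_space nodes) (tree_term (V \<omega>))"
    by eventually_elim (rule summable_tree_term(1)[OF _ b])
  have "AE \<omega> in M. ennreal (\<bar>tree_sum (V \<omega>)\<bar> powr b) \<le> ?S \<omega>"
    using AE ae by eventually_elim (simp add: tree_sum_eq_integral summable_tree_term(2)[OF _ b])
  then have "(\<integral>\<^sup>+\<omega>. ennreal (\<bar>tree_sum (V \<omega>)\<bar> powr b) \<partial>M) \<le> (\<integral>\<^sup>+\<omega>. ?S \<omega> \<partial>M)"
    by (rule nn_integral_mono_AE)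
  then show "(\<integral>\<^sup>+\<omega>. ennreal (\<bar>tree_sum (V \<omega>)\<bar> powr b) \<partial>M) < \<infinity>" using fin by (rule le_less_trans)
qed

lemma tree_fixed_point:
  assumes "AE \<omega> in M. integrable (count_space nodes) (tree_term (V \<omega>))"
  shows "AE \<omega> in M. tree_sum (V \<omega>) = fst (V \<omega> []) + (\<Sum>j. weight (V \<omega> []) j * child_sum j \<omega>)"
  using assms
proof eventually_elim
  case (elim \<omega>)
  note rec = tree_sum_recursion[OF elim]
  have i: "integrable (count_space UNIV) (\<lambda>j. weight (V \<omega> []) j * child_sum j \<omega>)"
    using rec(1) unfolding weight_def child_sum_def
    by (subst (asm) integrable_bij_count_space[OF bij_betw_Suc_ge_1, symmetric])
  have "(\<integral>j. snd (snd (V \<omega> [])) j * tree_sum (subtree [j] (V \<omega>)) \<partial>count_space {1..})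
      = (\<integral>j. weight (V \<omega> []) j * child_sum j \<omega> \<partial>count_space UNIV)"
    unfolding weight_def child_sum_def
    by (rule integral_bij_count_space[OF bij_betw_Suc_ge_1, symmetric])
  also have "\<dots> = (\<Sum>j. weight (V \<omega> []) j * child_sum j \<omega>)" by (rule integral_count_space_nat[OF i])
  finally show ?case using rec(2) by simp
qed

end

section \<open>Random sums of iid copies\<close>

lemma powr_tangent_le:
  fixes y w p :: real
  assumes "0 \<le> y" "0 \<le> w" "1 \<le> p"
  shows "p * w powr (p - 1) * y \<le> y powr p + (p - 1) * w powr p"
proof (cases "p = 1")
  case False
  then have p: "p > 1" using assms by simp
  define r where "r = p / (p - 1)"
  have r: "r > 1" "1 / p + 1 / r = 1" using p by (auto simp: r_def field_simps)
  have "y * w powr (p - 1) \<le> y powr p / p + (w powr (p - 1)) powr r / r"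
    using p r assms by (intro Youngs_inequality) auto
  also have "(w powr (p - 1)) powr r = w powr p" using p by (simp add: powr_powr r_def)
  finally have "p * (y * w powr (p - 1)) \<le> p * (y powr p / p + w powr p / r)"
    using p by (intro mult_left_mono) auto
  also have "\<dots> = y powr p + (p - 1) * w powr p" using p by (simp add: r_def field_simps)
  finally show ?thesis by (simp add: mult_ac)
qed (use assms in auto)

text \<open>
  Jensen's inequality for \<open>x \<mapsto> x\<^sup>p\<close>, by comparison with the tangent at the mean.
\<close>

lemma powr_suminf_jensen:
  fixes a y :: "nat \<Rightarrow> real"
  assumes a: "\<And>j. 0 \<le> a j" "a sums 1" and y: "\<And>j. 0 \<le> y j" and s: "summable (\<lambda>j. a j * y j)" and p: "1 \<le> p"
  shows "ennreal ((\<Sum>j. a j * y j) powr p) \<le> (\<Sum>j. ennreal (a j * y j powr p))"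
proof (cases "summable (\<lambda>j. a j * y j powr p)")
  case True
  define w where "w = (\<Sum>j. a j * y j)"
  have w0: "0 \<le> w" unfolding w_def using a y by (intro suminf_nonneg s) auto
  have "p * w powr (p - 1) * w = (\<Sum>j. p * w powr (p - 1) * (a j * y j))"
    unfolding w_def using s by (rule suminf_mult[symmetric])
  also have "\<dots> \<le> (\<Sum>j. a j * y j powr p + (p - 1) * w powr p * a j)"
  proof (rule suminf_le)
    show "p * w powr (p - 1) * (a j * y j) \<le> a j * y j powr p + (p - 1) * w powr p * a j" for j
      using mult_left_mono[OF powr_tangent_le[OF y[of j] w0 p] a(1)[of j]] by (simp add: algebra_simps)
    show "summable (\<lambda>j. p * w powr (p - 1) * (a j * y j))" by (intro summable_mult s)
    show "summable (\<lambda>j. a j * y j powr p + (p - 1) * w powr p * a j)"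
      using a(2) by (intro summable_add True summable_mult) (auto simp: sums_iff)
  qed
  also have "\<dots> = (\<Sum>j. a j * y j powr p) + (\<Sum>j. (p - 1) * w powr p * a j)"
    using a(2) by (intro suminf_add[symmetric] True summable_mult) (auto simp: sums_iff)
  also have "(\<Sum>j. (p - 1) * w powr p * a j) = (p - 1) * w powr p"
    using a(2) suminf_mult[of a "(p - 1) * w powr p"] by (simp add: sums_iff)
  also have "p * w powr (p - 1) * w = p * w powr p"
    using w0 by (cases "w = 0") (auto simp: powr_diff)
  finally have "w powr p \<le> (\<Sum>j. a j * y j powr p)" by (simp add: algebra_simps)
  then have "ennreal (w powr p) \<le> ennreal (\<Sum>j. a j * y j powr p)" by (rule ennreal_leI)
  also have "\<dots> = (\<Sum>j. ennreal (a j * y j powr p))"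
    by (rule suminf_ennreal2[symmetric]) (use a True in auto)
  finally show ?thesis by (simp add: w_def)
next
  case False
  have "(\<Sum>j. ennreal (a j * y j powr p)) = \<infinity>"
  proof (rule ccontr)
    assume "\<not> ?thesis"
    then have "summable (\<lambda>j. a j * y j powr p)"
      by (intro summable_suminf_not_top) (use a in auto)
    then show False using False by contradiction
  qed
  then show ?thesis by simp
qed

lemma mult_powr_le_add_powr:
  fixes u v s :: real
  assumes "0 \<le> u" "0 \<le> v" "1 \<le> s"
  shows "u * v powr (s - 1) \<le> u powr s + v powr s"
proof (cases "max u v = 0")
  case False
  define m where "m = max u v"
  have m: "m > 0" using False assms by (auto simp: m_def max_def split: if_splits)
  have "u * v powr (s - 1) \<le> m * m powr (s - 1)"
    using assms m by (intro mult_mono powr_mono2) (auto simp: m_def)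
  also have "\<dots> = m powr s" using m by (simp add: powr_diff)
  also have "\<dots> \<le> u powr s + v powr s" by (auto simp: m_def max_def)
  finally show ?thesis .
qed (use assms in \<open>auto simp: max_def split: if_splits\<close>)

text \<open>
  Independence of \<open>X\<close> and the sequence of copies is expressed by Fubini's theorem, a form that covers both the
  subtrees of the children and an external sequence.
\<close>

locale iid_sum = prob_space M for M :: "'a measure" +
  fixes X :: "'a \<Rightarrow> wvec" and R :: "'a \<Rightarrow> real" and Rs :: "nat \<Rightarrow> 'a \<Rightarrow> real"
  assumes X_meas[measurable]: "X \<in> measurable M vec_space"
    and R_meas[measurable]: "R \<in> borel_measurable M"
    and Rs_indep: "indep_vars (\<lambda>_. borel) Rs UNIV"
    and Rs_distr: "\<And>j. distr M borel (Rs j) = distr M borel R"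
    and decoupled: "\<And>F. F \<in> borel_measurable (vec_space \<Otimes>\<^sub>M PiM UNIV (\<lambda>_. borel)) \<Longrightarrow>
      (\<integral>\<^sup>+\<omega>. F (X \<omega>, \<lambda>j. Rs j \<omega>) \<partial>M) = (\<integral>\<^sup>+\<omega>. (\<integral>\<^sup>+\<omega>'. F (X \<omega>, \<lambda>j. Rs j \<omega>') \<partial>M) \<partial>M)"
begin

lemma Rs_meas[measurable]: "Rs j \<in> borel_measurable M"
  using Rs_indep by (auto simp: indep_vars_def)

lemma Rs_seq_meas[measurable]: "(\<lambda>\<omega> j. Rs j \<omega>) \<in> measurable M (PiM UNIV (\<lambda>_. borel))"
  by (rule measurable_PiM_single') auto

lemma nn_integral_Rs:
  assumes [measurable]: "f \<in> borel_measurable borel"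
  shows "(\<integral>\<^sup>+\<omega>. f (Rs j \<omega>) \<partial>M) = (\<integral>\<^sup>+\<omega>. f (R \<omega>) \<partial>M)"
  using nn_integral_distr[of "Rs j" M borel f] nn_integral_distr[of R M borel f] by (simp add: Rs_distr)

lemma distr_Rs_seq: "distr M (PiM UNIV (\<lambda>_. borel)) (\<lambda>\<omega> j. Rs j \<omega>) = PiM UNIV (\<lambda>_. distr M borel R)"
  using Rs_indep indep_vars_iff_distr_eq_PiM[where I=UNIV and M'="\<lambda>_. borel" and X=Rs]
  by (simp add: Rs_distr restrict_def)

lemma nn_integral_Rs_seq:
  assumes [measurable]: "f \<in> borel_measurable (PiM UNIV (\<lambda>_. borel))"
  shows "(\<integral>\<^sup>+\<omega>. f (\<lambda>j. Rs j \<omega>) \<partial>M) = (\<integral>\<^sup>+r. f r \<partial>PiM UNIV (\<lambda>_. distr M borel R))"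
  unfolding distr_Rs_seq[symmetric] using nn_integral_distr[OF Rs_seq_meas, of f] by simp

text \<open>
  Setting the \<open>j\<close>-th coordinate to \<open>0\<close> removes the dependence on the \<open>j\<close>-th copy.
\<close>

lemma indep_coordinate:
  fixes f :: "real \<Rightarrow> ennreal" and h :: "(nat \<Rightarrow> real) \<Rightarrow> ennreal"
  assumes f[measurable]: "f \<in> borel_measurable borel" and h[measurable]: "h \<in> borel_measurable (PiM UNIV (\<lambda>_. borel))"
  shows "(\<integral>\<^sup>+\<omega>. f (Rs j \<omega>) * h ((\<lambda>k. Rs k \<omega>)(j := 0)) \<partial>M)
    = (\<integral>\<^sup>+\<omega>. f (Rs j \<omega>) \<partial>M) * (\<integral>\<^sup>+\<omega>. h ((\<lambda>k. Rs k \<omega>)(j := 0)) \<partial>M)"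
proof -
  let ?S = "PiM {j} (\<lambda>_. borel) :: (nat \<Rightarrow> real) measure" and ?T = "PiM (UNIV - {j}) (\<lambda>_. borel) :: (nat \<Rightarrow> real) measure"
  let ?A = "\<lambda>\<omega>. restrict (\<lambda>k. Rs k \<omega>) {j}" and ?B = "\<lambda>\<omega>. restrict (\<lambda>k. Rs k \<omega>) (UNIV - {j})"
  have ind: "indep_var ?S ?A ?T ?B"
    using indep_var_restrict[OF Rs_indep, of "{j}" "UNIV - {j}"] by simp
  have A[measurable]: "?A \<in> measurable M ?S" by (rule indep_var_rv1[OF ind])
  have B[measurable]: "?B \<in> measurable M ?T" by (rule indep_var_rv2[OF ind])
  have eq: "distr M ?S ?A \<Otimes>\<^sub>M distr M ?T ?B = distr M (?S \<Otimes>\<^sub>M ?T) (\<lambda>\<omega>. (?A \<omega>, ?B \<omega>))"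
    using ind unfolding indep_var_distribution_eq by (elim conjE)
  interpret T: prob_space "distr M ?T ?B" by (rule prob_space_distr[OF B])
  define h' where "h' r = h (\<lambda>k. if k = j then 0 else r k)" for r
  have upd: "h ((\<lambda>k. Rs k \<omega>)(j := 0)) = h' (?B \<omega>)" for \<omega>
    unfolding h'_def by (rule arg_cong[where f=h]) (auto simp: fun_eq_iff)
  have [measurable]: "h' \<in> borel_measurable ?T"
    unfolding h'_def[abs_def]
  proof (rule measurable_compose[OF _ h], rule measurable_PiM_single')
    show "(\<lambda>r. if k = j then 0 else r k) \<in> borel_measurable ?T" for k
      by (cases "k = j") (auto intro!: measurable_component_singleton)
  qed auto
  have [measurable]: "(\<lambda>r. f (r j)) \<in> borel_measurable ?S"
    by (rule measurable_compose[OF measurable_component_singleton[where I="{j}" and i=j and M="\<lambda>_. borel"] f]) simp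
  have "(\<integral>\<^sup>+\<omega>. f (Rs j \<omega>) * h ((\<lambda>k. Rs k \<omega>)(j := 0)) \<partial>M)
     = (\<integral>\<^sup>+p. f (fst p j) * h' (snd p) \<partial>distr M (?S \<Otimes>\<^sub>M ?T) (\<lambda>\<omega>. (?A \<omega>, ?B \<omega>)))"
    unfolding upd by (subst nn_integral_distr) auto
  also have "\<dots> = (\<integral>\<^sup>+x. (\<integral>\<^sup>+y. f (x j) * h' y \<partial>distr M ?T ?B) \<partial>distr M ?S ?A)"
    unfolding eq[symmetric] by (subst T.nn_integral_fst[symmetric]) auto
  also have "\<dots> = (\<integral>\<^sup>+x. f (x j) \<partial>distr M ?S ?A) * (\<integral>\<^sup>+y. h' y \<partial>distr M ?T ?B)"
    by (simp add: nn_integral_cmult nn_integral_multc)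
  also have "(\<integral>\<^sup>+x. f (x j) \<partial>distr M ?S ?A) = (\<integral>\<^sup>+\<omega>. f (Rs j \<omega>) \<partial>M)"
    by (subst nn_integral_distr) auto
  also have "(\<integral>\<^sup>+y. h' y \<partial>distr M ?T ?B) = (\<integral>\<^sup>+\<omega>. h ((\<lambda>k. Rs k \<omega>)(j := 0)) \<partial>M)"
    by (subst nn_integral_distr) (auto simp: upd)
  finally show ?thesis .
qed

definition abs_moment :: "real \<Rightarrow> ennreal" where
  "abs_moment p = (\<integral>\<^sup>+\<omega>. ennreal (\<bar>R \<omega>\<bar> powr p) \<partial>M)"

lemma nn_integral_Rs_powr: "(\<integral>\<^sup>+\<omega>. ennreal (\<bar>Rs j \<omega>\<bar> powr p) \<partial>M) = abs_moment p"
  unfolding abs_moment_def using nn_integral_Rs[of "\<lambda>x. ennreal (\<bar>x\<bar> powr p)" j] by simp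

lemma nn_integral_Rs_powr_cmult:
  assumes "0 \<le> a"
  shows "(\<integral>\<^sup>+\<omega>. ennreal (a * \<bar>Rs j \<omega>\<bar> powr p) \<partial>M) = ennreal a * abs_moment p"
proof -
  have "(\<integral>\<^sup>+\<omega>. ennreal (a * \<bar>Rs j \<omega>\<bar> powr p) \<partial>M) = (\<integral>\<^sup>+\<omega>. ennreal a * ennreal (\<bar>Rs j \<omega>\<bar> powr p) \<partial>M)"
    using assms by (simp add: ennreal_mult)
  then show ?thesis by (simp add: nn_integral_cmult nn_integral_Rs_powr)
qed

lemma abs_moment_mono_finite:
  assumes "abs_moment p < \<infinity>" "0 < q" "q \<le> p"
  shows "abs_moment q < \<infinity>"
proof -
  have "abs_moment q \<le> (\<integral>\<^sup>+\<omega>. 1 + ennreal (\<bar>R \<omega>\<bar> powr p) \<partial>M)"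
    unfolding abs_moment_def
  proof (rule nn_integral_mono)
    fix \<omega>
    have "\<bar>R \<omega>\<bar> powr q \<le> 1 + \<bar>R \<omega>\<bar> powr p"
    proof (cases "\<bar>R \<omega>\<bar> \<le> 1")
      case True
      then have "\<bar>R \<omega>\<bar> powr q \<le> 1" using powr_mono2[of q "\<bar>R \<omega>\<bar>" 1] assms by simp
      then show ?thesis by (simp add: add_increasing2)
    next
      case False
      then have "\<bar>R \<omega>\<bar> powr q \<le> \<bar>R \<omega>\<bar> powr p" using assms by (intro powr_mono) auto
      then show ?thesis by simp
    qed
    then show "ennreal (\<bar>R \<omega>\<bar> powr q) \<le> 1 + ennreal (\<bar>R \<omega>\<bar> powr p)"
      by (metis ennreal_1 ennreal_leI ennreal_plus powr_ge_zero zero_le_one)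
  qed
  also have "\<dots> = 1 + abs_moment p" by (simp add: nn_integral_add abs_moment_def emeasure_space_1)
  also have "\<dots> < \<infinity>" using assms by (simp add: less_top)
  finally show ?thesis .
qed

context
  fixes b :: real
  assumes b: "0 < b" and bm: "abs_moment b < \<infinity>"
begin

lemma weighted_sum_expectation:
  fixes a :: "nat \<Rightarrow> real"
  assumes a: "\<And>j. 0 \<le> a j" "summable a"
  shows "(\<integral>\<^sup>+\<omega>. (\<Sum>j. ennreal (a j * \<bar>Rs j \<omega>\<bar> powr b)) \<partial>M) = ennreal (\<Sum>j. a j) * abs_moment b"
    and "AE \<omega> in M. summable (\<lambda>j. a j * \<bar>Rs j \<omega>\<bar> powr b)"
proof -
  have "(\<integral>\<^sup>+\<omega>. (\<Sum>j. ennreal (a j * \<bar>Rs j \<omega>\<bar> powr b)) \<partial>M) = (\<Sum>j. \<integral>\<^sup>+\<omega>. ennreal (a j * \<bar>Rs j \<omega>\<bar> powr b) \<partial>M)"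
    by (rule nn_integral_suminf) measurable
  also have "\<dots> = (\<Sum>j. ennreal (a j) * abs_moment b)"
    by (intro suminf_cong nn_integral_Rs_powr_cmult a)
  also have "\<dots> = (\<Sum>j. ennreal (a j)) * abs_moment b" by simp
  also have "(\<Sum>j. ennreal (a j)) = ennreal (\<Sum>j. a j)" by (rule suminf_ennreal2) (use a in auto)
  finally show e: "(\<integral>\<^sup>+\<omega>. (\<Sum>j. ennreal (a j * \<bar>Rs j \<omega>\<bar> powr b)) \<partial>M) = ennreal (\<Sum>j. a j) * abs_moment b" .
  have "AE \<omega> in M. (\<Sum>j. ennreal (a j * \<bar>Rs j \<omega>\<bar> powr b)) \<noteq> \<infinity>"
    by (rule nn_integral_noteq_infinite) (use bm in \<open>auto simp: e ennreal_mult_eq_top_iff\<close>)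
  then show "AE \<omega> in M. summable (\<lambda>j. a j * \<bar>Rs j \<omega>\<bar> powr b)"
    by eventually_elim (intro summable_suminf_not_top, use a in auto)
qed

text \<open>
  For \<open>\<tau> \<ge> 1\<close>, apply Jensen's inequality with the weights \<open>a\<^sub>j / \<Sum>\<^sub>k a\<^sub>k\<close>; a smaller \<open>\<tau>\<close> reduces to
  exponent \<open>1\<close>.
\<close>

lemma weighted_sum_moment:
  fixes a :: "nat \<Rightarrow> real"
  assumes a: "\<And>j. 0 \<le> a j" "summable a" and "0 < \<tau>"
  shows "(\<integral>\<^sup>+\<omega>. ennreal ((\<Sum>j. a j * \<bar>Rs j \<omega>\<bar> powr b) powr \<tau>) \<partial>M)
    \<le> ennreal ((\<Sum>j. a j) powr \<tau>) * (1 + abs_moment (b * max 1 \<tau>))"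
proof (cases "(\<Sum>j. a j) = 0")
  case True
  then have "a j = 0" for j using suminf_eq_zero_iff[OF a(2,1)] by simp
  then show ?thesis by simp
next
  case False
  define A where "A = (\<Sum>j. a j)"
  have A: "A > 0" using False suminf_nonneg[OF a(2,1)] by (simp add: A_def)
  define p where "p = max 1 \<tau>"
  have p: "1 \<le> p" "\<tau> \<le> p" by (auto simp: p_def)
  let ?y = "\<lambda>\<omega> j. \<bar>Rs j \<omega>\<bar> powr b"
  have as: "(\<lambda>j. a j / A) sums 1" using sums_divide[OF summable_sums[OF a(2)], of A] A by (simp add: A_def)
  have pw: "ennreal ((\<Sum>j. a j * ?y \<omega> j) powr \<tau>)
      \<le> ennreal (A powr \<tau>) * (1 + (\<Sum>j. ennreal (a j / A * \<bar>Rs j \<omega>\<bar> powr (b * p))))"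
    if s: "summable (\<lambda>j. a j * ?y \<omega> j)" for \<omega>
  proof -
    define w where "w = (\<Sum>j. a j / A * ?y \<omega> j)"
    have s': "summable (\<lambda>j. a j / A * ?y \<omega> j)" using summable_divide[OF s, of A] by simp
    have w0: "0 \<le> w" unfolding w_def using a A by (intro suminf_nonneg s') auto
    have Aw: "(\<Sum>j. a j * ?y \<omega> j) = A * w"
      unfolding w_def using A suminf_mult[OF s', of A] by simp
    have "w powr \<tau> \<le> 1 + w powr p"
    proof (cases "w \<le> 1")
      case True
      then have "w powr \<tau> \<le> 1" using powr_mono2[of \<tau> w 1] assms w0 by simp
      then show ?thesis by (simp add: add_increasing2)
    next
      case False
      then have "w powr \<tau> \<le> w powr p" using p by (intro powr_mono) auto
      then show ?thesis by simp
    qed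
    then have "ennreal (w powr \<tau>) \<le> 1 + ennreal (w powr p)"
      by (metis ennreal_1 ennreal_leI ennreal_plus powr_ge_zero zero_le_one)
    also have "ennreal (w powr p) \<le> (\<Sum>j. ennreal (a j / A * ?y \<omega> j powr p))"
      unfolding w_def by (rule powr_suminf_jensen) (use a A as s' p in auto)
    finally have "ennreal (w powr \<tau>) \<le> 1 + (\<Sum>j. ennreal (a j / A * \<bar>Rs j \<omega>\<bar> powr (b * p)))"
      by (simp add: powr_powr)
    then show ?thesis
      unfolding Aw using A w0 by (simp add: powr_mult ennreal_mult mult_left_mono)
  qed
  have "(\<integral>\<^sup>+\<omega>. ennreal ((\<Sum>j. a j * ?y \<omega> j) powr \<tau>) \<partial>M)
    \<le> (\<integral>\<^sup>+\<omega>. ennreal (A powr \<tau>) * (1 + (\<Sum>j. ennreal (a j / A * \<bar>Rs j \<omega>\<bar> powr (b * p)))) \<partial>M)"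
    by (rule nn_integral_mono_AE) (use weighted_sum_expectation(2)[OF a] pw in \<open>auto elim!: eventually_mono\<close>)
  also have "\<dots> = ennreal (A powr \<tau>) * (1 + (\<Sum>j. \<integral>\<^sup>+\<omega>. ennreal (a j / A * \<bar>Rs j \<omega>\<bar> powr (b * p)) \<partial>M))"
    by (simp add: nn_integral_cmult nn_integral_add nn_integral_suminf emeasure_space_1)
  also have "(\<Sum>j. \<integral>\<^sup>+\<omega>. ennreal (a j / A * \<bar>Rs j \<omega>\<bar> powr (b * p)) \<partial>M) = (\<Sum>j. ennreal (a j / A)) * abs_moment (b * p)"
  proof -
    have "(\<integral>\<^sup>+\<omega>. ennreal (a j / A * \<bar>Rs j \<omega>\<bar> powr (b * p)) \<partial>M) = ennreal (a j / A) * abs_moment (b * p)" for j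
      using a A by (intro nn_integral_Rs_powr_cmult) auto
    then show ?thesis by simp
  qed
  also have "(\<Sum>j. ennreal (a j / A)) = ennreal (\<Sum>j. a j / A)"
    by (rule suminf_ennreal2) (use a A as in \<open>auto simp: sums_iff\<close>)
  also have "(\<Sum>j. a j / A) = 1" using as by (simp only: sums_iff)
  finally show ?thesis by (simp add: A_def p_def)
qed

end

end

context iid_sum begin

context
  fixes b :: real
  assumes b: "0 < b" and bm: "abs_moment b < \<infinity>"
begin

text \<open>
  In each cross term the \<open>j\<close>-th copy is independent of the sum of the others. Hence moments of order \<open>b\<close> and
  \<open>max b (b (\<sigma> - 1))\<close> suffice, although the terms are homogeneous of order \<open>b \<sigma>\<close>.
\<close>

lemma cross_terms_expectation:
  fixes a :: "nat \<Rightarrow> real"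
  assumes a: "\<And>j. 0 \<le> a j" "summable a" and \<sigma>: "1 < \<sigma>"
  shows "(\<integral>\<^sup>+\<omega>. ennreal (cross_terms \<sigma> (\<lambda>j. a j * \<bar>Rs j \<omega>\<bar> powr b)) \<partial>M)
    \<le> ennreal ((\<Sum>j. a j) powr \<sigma>) * (abs_moment b * (1 + abs_moment (b * max 1 (\<sigma> - 1))))"
proof -
  define A where "A = (\<Sum>j. a j)"
  have A0: "0 \<le> A" unfolding A_def by (rule suminf_nonneg[OF a(2,1)])
  define K where "K = 1 + abs_moment (b * max 1 (\<sigma> - 1))"
  let ?z = "\<lambda>\<omega> j. a j * \<bar>Rs j \<omega>\<bar> powr b"
  let ?a = "\<lambda>j k. if k = j then 0 else a k"
  have ct: "ennreal (cross_terms \<sigma> (?z \<omega>))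
      = (\<Sum>j. ennreal (?z \<omega> j) * ennreal ((\<Sum>k. ?a j k * \<bar>((\<lambda>k. Rs k \<omega>)(j := 0)) k\<bar> powr b) powr (\<sigma> - 1)))"
    if s: "summable (?z \<omega>)" for \<omega>
  proof -
    have z0: "0 \<le> ?z \<omega> j" for j using a by simp
    have rest: "(\<Sum>k. ?a j k * \<bar>((\<lambda>k. Rs k \<omega>)(j := 0)) k\<bar> powr b) = (\<Sum>k. ?z \<omega> k) - ?z \<omega> j" for j
    proof -
      have "(\<lambda>k. ?z \<omega> k - (if k = j then ?z \<omega> k else 0)) sums ((\<Sum>k. ?z \<omega> k) - ?z \<omega> j)"
        using sums_diff[OF summable_sums[OF s] sums_single[of j "?z \<omega>"]] .
      moreover have "(\<lambda>k. ?z \<omega> k - (if k = j then ?z \<omega> k else 0)) = (\<lambda>k. ?a j k * \<bar>((\<lambda>k. Rs k \<omega>)(j := 0)) k\<bar> powr b)"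
        by (auto simp: fun_eq_iff)
      ultimately show ?thesis by (simp only: sums_iff)
    qed
    have "ennreal (cross_terms \<sigma> (?z \<omega>)) = (\<Sum>j. ennreal (?z \<omega> j * ((\<Sum>k. ?z \<omega> k) - ?z \<omega> j) powr (\<sigma> - 1)))"
      unfolding cross_terms_def
      using suminf_ennreal2[OF mult_nonneg_nonneg[OF z0 powr_ge_zero] summable_cross_terms[OF s z0 \<sigma>]]
      by (rule sym)
    also have "\<dots> = (\<Sum>j. ennreal (?z \<omega> j) * ennreal (((\<Sum>k. ?z \<omega> k) - ?z \<omega> j) powr (\<sigma> - 1)))"
      by (rule suminf_cong, rule ennreal_mult[OF z0 powr_ge_zero])
    finally show ?thesis unfolding rest .
  qed
  have "(\<integral>\<^sup>+\<omega>. ennreal (cross_terms \<sigma> (?z \<omega>)) \<partial>M)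
     = (\<integral>\<^sup>+\<omega>. (\<Sum>j. ennreal (?z \<omega> j) * ennreal ((\<Sum>k. ?a j k * \<bar>((\<lambda>k. Rs k \<omega>)(j := 0)) k\<bar> powr b) powr (\<sigma> - 1))) \<partial>M)"
    by (rule nn_integral_cong_AE) (use weighted_sum_expectation(2)[OF b bm a] ct in \<open>auto elim!: eventually_mono\<close>)
  also have "\<dots> = (\<Sum>j. \<integral>\<^sup>+\<omega>. ennreal (?z \<omega> j) * ennreal ((\<Sum>k. ?a j k * \<bar>((\<lambda>k. Rs k \<omega>)(j := 0)) k\<bar> powr b) powr (\<sigma> - 1)) \<partial>M)"
    by (rule nn_integral_suminf) measurable
  also have "\<dots> \<le> (\<Sum>j. ennreal (a j) * (abs_moment b * (ennreal (A powr (\<sigma> - 1)) * K)))"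
  proof (rule suminf_le)
    fix j
    let ?h = "\<lambda>r. ennreal ((\<Sum>k. ?a j k * \<bar>r k\<bar> powr b) powr (\<sigma> - 1))"
    have "?h \<in> borel_measurable (PiM UNIV (\<lambda>_. borel))" by measurable
    then have "(\<integral>\<^sup>+\<omega>. ennreal (?z \<omega> j) * ?h ((\<lambda>k. Rs k \<omega>)(j := 0)) \<partial>M)
       = (\<integral>\<^sup>+\<omega>. ennreal (?z \<omega> j) \<partial>M) * (\<integral>\<^sup>+\<omega>. ?h ((\<lambda>k. Rs k \<omega>)(j := 0)) \<partial>M)"
      by (intro indep_coordinate[where f="\<lambda>x. ennreal (a j * \<bar>x\<bar> powr b)"]) measurable
    also have "(\<integral>\<^sup>+\<omega>. ennreal (?z \<omega> j) \<partial>M) = ennreal (a j) * abs_moment b"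
      by (intro nn_integral_Rs_powr_cmult a)
    also have "(\<integral>\<^sup>+\<omega>. ?h ((\<lambda>k. Rs k \<omega>)(j := 0)) \<partial>M)
      = (\<integral>\<^sup>+\<omega>. ennreal ((\<Sum>k. ?a j k * \<bar>Rs k \<omega>\<bar> powr b) powr (\<sigma> - 1)) \<partial>M)"
      by (intro nn_integral_cong arg_cong[where f="\<lambda>x. ennreal (x powr (\<sigma> - 1))"] suminf_cong) auto
    also have "\<dots> \<le> ennreal ((\<Sum>k. ?a j k) powr (\<sigma> - 1)) * K"
      unfolding K_def
      by (rule weighted_sum_moment[OF b bm]) (use a \<sigma> in \<open>auto intro: summable_comparison_test'[OF a(2), of 0]\<close>)
    also have "\<dots> \<le> ennreal (A powr (\<sigma> - 1)) * K"
    proof (intro mult_right_mono ennreal_leI powr_mono2)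
      show "(\<Sum>k. ?a j k) \<le> A" unfolding A_def
        by (rule suminf_le) (use a in \<open>auto intro: summable_comparison_test'[OF a(2), of 0]\<close>)
      show "0 \<le> (\<Sum>k. ?a j k)"
        by (rule suminf_nonneg) (use a in \<open>auto intro: summable_comparison_test'[OF a(2), of 0]\<close>)
    qed (use \<sigma> in auto)
    finally show "(\<integral>\<^sup>+\<omega>. ennreal (?z \<omega> j) * ?h ((\<lambda>k. Rs k \<omega>)(j := 0)) \<partial>M)
        \<le> ennreal (a j) * (abs_moment b * (ennreal (A powr (\<sigma> - 1)) * K))"
      by (simp add: mult.assoc mult_left_mono)
  qed (rule summableI)+
  also have "\<dots> = (\<Sum>j. ennreal (a j)) * (abs_moment b * (ennreal (A powr (\<sigma> - 1)) * K))" by simp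
  also have "(\<Sum>j. ennreal (a j)) = ennreal A" unfolding A_def by (rule suminf_ennreal2) (use a in auto)
  also have "ennreal A * (abs_moment b * (ennreal (A powr (\<sigma> - 1)) * K)) = ennreal (A powr \<sigma>) * (abs_moment b * K)"
  proof -
    have "A * A powr (\<sigma> - 1) = A powr \<sigma>" using A0 \<sigma> by (cases "A = 0") (auto simp: powr_diff)
    then have "ennreal A * ennreal (A powr (\<sigma> - 1)) = ennreal (A powr \<sigma>)"
      using A0 by (simp add: ennreal_mult'[symmetric])
    then show ?thesis by (metis mult.assoc mult.left_commute)
  qed
  finally show ?thesis by (simp add: A_def K_def)
qed
end

end

section \<open>Moments of a solution of the fixed-point equation\<close>

lemma powr_le_one_plus:
  fixes x p q :: real
  assumes "0 \<le> x" "0 < q" "q \<le> p"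
  shows "x powr q \<le> 1 + x powr p"
proof (cases "x \<le> 1")
  case True
  then have "x powr q \<le> 1" using powr_mono2[of q x 1] assms by simp
  then show ?thesis by (simp add: add_increasing2)
next
  case False
  then have "x powr q \<le> x powr p" using assms by (intro powr_mono) auto
  then show ?thesis by simp
qed

context iid_sum begin

definition summand :: "nat \<Rightarrow> 'a \<Rightarrow> real" where
  "summand j \<omega> = weight (X \<omega>) j * Rs j \<omega>"

lemma measurable_weight_X[measurable]: "(\<lambda>\<omega>. weight (X \<omega>) j) \<in> borel_measurable M"
  by (rule measurable_compose[OF X_meas measurable_weight])

lemma measurable_fst_X[measurable]: "(\<lambda>\<omega>. fst (X \<omega>)) \<in> borel_measurable M"
  by (rule measurable_compose[OF X_meas measurable_fst_vec_space])

lemma measurable_summand[measurable]: "summand j \<in> borel_measurable M"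
  unfolding summand_def[abs_def] by measurable

lemma nn_integral_summand:
  assumes [measurable]: "f \<in> borel_measurable (borel \<Otimes>\<^sub>M borel)"
  shows "(\<integral>\<^sup>+\<omega>. f (weight (X \<omega>) j, Rs j \<omega>) \<partial>M) = (\<integral>\<^sup>+\<omega>. (\<integral>\<^sup>+\<omega>'. f (weight (X \<omega>) j, R \<omega>') \<partial>M) \<partial>M)"
proof -
  have "(\<lambda>p. f (weight (fst p) j, snd p j)) \<in> borel_measurable (vec_space \<Otimes>\<^sub>M PiM UNIV (\<lambda>_. borel))"
    by measurable
  from decoupled[OF this]
  have "(\<integral>\<^sup>+\<omega>. f (weight (X \<omega>) j, Rs j \<omega>) \<partial>M) = (\<integral>\<^sup>+\<omega>. (\<integral>\<^sup>+\<omega>'. f (weight (X \<omega>) j, Rs j \<omega>') \<partial>M) \<partial>M)" by simp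
  also have "\<dots> = (\<integral>\<^sup>+\<omega>. (\<integral>\<^sup>+\<omega>'. f (weight (X \<omega>) j, R \<omega>') \<partial>M) \<partial>M)"
  proof (rule nn_integral_cong)
    fix \<omega>
    show "(\<integral>\<^sup>+\<omega>'. f (weight (X \<omega>) j, Rs j \<omega>') \<partial>M) = (\<integral>\<^sup>+\<omega>'. f (weight (X \<omega>) j, R \<omega>') \<partial>M)"
      using nn_integral_Rs[of "\<lambda>y. f (weight (X \<omega>) j, y)" j] by simp
  qed
  finally show ?thesis .
qed

end

text \<open>
  The data of the critical fixed-point equation. The exponent \<open>b\<close> makes the equation a contraction for
  moments of order \<open>b\<close>, while \<open>\<alpha>\<close> is the critical exponent at which the weights have total mass \<open>1\<close>.
\<close>

locale smoothing_fixed_point = iid_sum M X R Rs + exponents b \<alpha>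
  for M :: "'a measure" and X R Rs b \<alpha> +
  fixes \<rho> :: real
  assumes rho: "0 \<le> \<rho>" "\<rho> < 1"
    and weight_b: "(\<integral>\<^sup>+\<omega>. (\<Sum>j. ennreal (\<bar>weight (X \<omega>) j\<bar> powr b)) \<partial>M) \<le> ennreal \<rho>"
    and weight_\<alpha>: "(\<integral>\<^sup>+\<omega>. (\<Sum>j. ennreal (\<bar>weight (X \<omega>) j\<bar> powr \<alpha>)) \<partial>M) = 1"
    and sum_moment: "(\<integral>\<^sup>+\<omega>. ennreal ((\<Sum>j. \<bar>weight (X \<omega>) j\<bar> powr b) powr (\<alpha> / b)) \<partial>M) < \<infinity>"
    and q_moment: "(\<integral>\<^sup>+\<omega>. ennreal (\<bar>fst (X \<omega>)\<bar> powr \<alpha>) \<partial>M) < \<infinity>"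
    and R_moment: "abs_moment b < \<infinity>"
    and fixed: "distr M borel R = distr M borel (\<lambda>\<omega>. fst (X \<omega>) + (\<Sum>j. summand j \<omega>))"
begin

lemma nn_integral_fixed:
  assumes [measurable]: "f \<in> borel_measurable borel"
  shows "(\<integral>\<^sup>+\<omega>. f (R \<omega>) \<partial>M) = (\<integral>\<^sup>+\<omega>. f (fst (X \<omega>) + (\<Sum>j. summand j \<omega>)) \<partial>M)"
  using nn_integral_distr[of R M borel f]
    nn_integral_distr[of "\<lambda>\<omega>. fst (X \<omega>) + (\<Sum>j. summand j \<omega>)" M borel f] by (simp add: fixed)

lemma AE_summable_weights: "AE \<omega> in M. summable (\<lambda>j. \<bar>weight (X \<omega>) j\<bar> powr b)"
proof -
  have "AE \<omega> in M. (\<Sum>j. ennreal (\<bar>weight (X \<omega>) j\<bar> powr b)) \<noteq> \<infinity>"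
    by (rule nn_integral_noteq_infinite) (use weight_b in \<open>auto simp: top_unique\<close>)
  then show ?thesis by eventually_elim (intro summable_suminf_not_top, auto)
qed

lemma nn_integral_summand_powr:
  "(\<integral>\<^sup>+\<omega>. ennreal (\<bar>summand j \<omega>\<bar> powr p) \<partial>M) = (\<integral>\<^sup>+\<omega>. ennreal (\<bar>weight (X \<omega>) j\<bar> powr p) \<partial>M) * abs_moment p"
proof -
  have "(\<integral>\<^sup>+\<omega>. ennreal (\<bar>summand j \<omega>\<bar> powr p) \<partial>M)
     = (\<integral>\<^sup>+\<omega>. (\<integral>\<^sup>+\<omega>'. ennreal (\<bar>weight (X \<omega>) j\<bar> powr p) * ennreal (\<bar>R \<omega>'\<bar> powr p) \<partial>M) \<partial>M)"
    using nn_integral_summand[of "\<lambda>(c, r). ennreal (\<bar>c\<bar> powr p) * ennreal (\<bar>r\<bar> powr p)" j]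
    by (simp add: summand_def abs_mult powr_mult ennreal_mult)
  then show ?thesis by (simp add: nn_integral_cmult nn_integral_multc abs_moment_def)
qed

lemma summand_b_moment: "(\<integral>\<^sup>+\<omega>. (\<Sum>j. ennreal (\<bar>summand j \<omega>\<bar> powr b)) \<partial>M) \<le> ennreal \<rho> * abs_moment b"
proof -
  have e: "(\<integral>\<^sup>+\<omega>. (\<Sum>j. ennreal (\<bar>summand j \<omega>\<bar> powr b)) \<partial>M)
      = (\<integral>\<^sup>+\<omega>. (\<Sum>j. ennreal (\<bar>weight (X \<omega>) j\<bar> powr b)) \<partial>M) * abs_moment b"
    by (simp add: nn_integral_suminf nn_integral_summand_powr)
  show ?thesis unfolding e by (rule mult_right_mono[OF weight_b]) simp
qed

lemma AE_summable_summands: "AE \<omega> in M. summable (\<lambda>j. \<bar>summand j \<omega>\<bar> powr b)"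
proof -
  have "ennreal \<rho> * abs_moment b < \<infinity>" using R_moment by (simp add: ennreal_mult_less_top)
  then have "AE \<omega> in M. (\<Sum>j. ennreal (\<bar>summand j \<omega>\<bar> powr b)) \<noteq> \<infinity>"
    using summand_b_moment by (intro nn_integral_noteq_infinite) (auto simp: top_unique)
  then show ?thesis by eventually_elim (intro summable_suminf_not_top, auto)
qed

text \<open>
  The moment of the weights is convex in the exponent, at most \<open>\<rho> < 1\<close> at \<open>b\<close> and equal to \<open>1\<close> at \<open>\<alpha>\<close>.
\<close>

lemma weight_moment_less_1:
  assumes "b \<le> s" "s < \<alpha>"
  obtains r where "0 \<le> r" "r < 1" "(\<integral>\<^sup>+\<omega>. (\<Sum>j. ennreal (\<bar>weight (X \<omega>) j\<bar> powr s)) \<partial>M) \<le> ennreal r"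
proof -
  define l where "l = (\<alpha> - s) / (\<alpha> - b)"
  have l: "0 < l" "l \<le> 1" using assms bp by (auto simp: l_def)
  have s: "s = l * b + (1 - l) * \<alpha>"
  proof -
    have "l * (\<alpha> - b) = \<alpha> - s" using bp by (simp add: l_def)
    then show ?thesis by (simp add: algebra_simps)
  qed
  have pw: "ennreal (x powr s) \<le> ennreal l * ennreal (x powr b) + ennreal (1 - l) * ennreal (x powr \<alpha>)"
    if "0 \<le> x" for x :: real
  proof (cases "x = 0")
    case False
    then have x: "x > 0" using that by simp
    have "(x powr b) powr l * (x powr \<alpha>) powr (1 - l) \<le> l * x powr b + (1 - l) * x powr \<alpha>"
      by (rule Youngs_inequality_0) (use l x in auto)
    also have "(x powr b) powr l * (x powr \<alpha>) powr (1 - l) = x powr (b * l + \<alpha> * (1 - l))"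
      by (simp only: powr_powr powr_add)
    also have "b * l + \<alpha> * (1 - l) = s" by (subst s) (simp only: mult.commute)
    finally have "ennreal (x powr s) \<le> ennreal (l * x powr b + (1 - l) * x powr \<alpha>)" by (rule ennreal_leI)
    also have "\<dots> = ennreal l * ennreal (x powr b) + ennreal (1 - l) * ennreal (x powr \<alpha>)"
      using l by (simp add: ennreal_mult)
    finally show ?thesis .
  qed simp
  have "(\<integral>\<^sup>+\<omega>. (\<Sum>j. ennreal (\<bar>weight (X \<omega>) j\<bar> powr s)) \<partial>M)
    \<le> (\<integral>\<^sup>+\<omega>. (\<Sum>j. ennreal l * ennreal (\<bar>weight (X \<omega>) j\<bar> powr b) + ennreal (1 - l) * ennreal (\<bar>weight (X \<omega>) j\<bar> powr \<alpha>)) \<partial>M)"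
    by (intro nn_integral_mono suminf_le pw) auto
  also have "\<dots> = (\<integral>\<^sup>+\<omega>. ennreal l * (\<Sum>j. ennreal (\<bar>weight (X \<omega>) j\<bar> powr b)) + ennreal (1 - l) * (\<Sum>j. ennreal (\<bar>weight (X \<omega>) j\<bar> powr \<alpha>)) \<partial>M)"
    by (simp add: suminf_add[symmetric])
  also have "\<dots> = ennreal l * (\<integral>\<^sup>+\<omega>. (\<Sum>j. ennreal (\<bar>weight (X \<omega>) j\<bar> powr b)) \<partial>M)
      + ennreal (1 - l) * (\<integral>\<^sup>+\<omega>. (\<Sum>j. ennreal (\<bar>weight (X \<omega>) j\<bar> powr \<alpha>)) \<partial>M)"
    by (simp add: nn_integral_add nn_integral_cmult)
  also have "\<dots> \<le> ennreal l * ennreal \<rho> + ennreal (1 - l) * 1"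
    by (intro add_mono mult_left_mono weight_b) (auto simp: weight_\<alpha>)
  also have "\<dots> = ennreal (l * \<rho> + (1 - l))"
    using l rho by (simp add: ennreal_mult)
  finally have "(\<integral>\<^sup>+\<omega>. (\<Sum>j. ennreal (\<bar>weight (X \<omega>) j\<bar> powr s)) \<partial>M) \<le> ennreal (l * \<rho> + (1 - l))" .
  moreover have "l * \<rho> + (1 - l) < 1" using l rho by simp
  moreover have "0 \<le> l * \<rho> + (1 - l)" using l rho by simp
  ultimately show thesis using that by blast
qed

text \<open>
  Conditionally on the weights, each part of the error is bounded by a moment of \<open>R\<close> of order at most
  \<open>max b (p - b)\<close>, times \<open>\<bar>q\<bar> powr p + (\<Sum>\<^sub>j \<bar>w\<^sub>j\<bar> powr b) powr (p / b)\<close>.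
\<close>

lemma error_moment:
  assumes p: "b < p" "p \<le> \<alpha>" and m: "abs_moment (max b (p - b)) < \<infinity>"
  shows "(\<integral>\<^sup>+\<omega>. ennreal (sum_error b p (fst (X \<omega>)) (\<lambda>j. summand j \<omega>)) \<partial>M) < \<infinity>"
proof -
  define \<sigma> where "\<sigma> = p / b"
  have \<sigma>: "1 < \<sigma>" "b * \<sigma> = p" using b p by (auto simp: \<sigma>_def)
  have bmax: "b * max 1 (\<sigma> - 1) = max b (p - b)"
    using b \<sigma> by (auto simp: max_def right_diff_distrib)
  define K where "K = 1 + abs_moment (max b (p - b))"
  have K: "K < \<infinity>" using m by (simp add: K_def less_top)
  let ?a = "\<lambda>\<omega> j. \<bar>weight (X \<omega>) j\<bar> powr b"
  let ?A = "\<lambda>\<omega>. \<Sum>j. ?a \<omega> j"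
  let ?F = "\<lambda>p'. ennreal (sum_error b p (fst (fst p')) (\<lambda>j. weight (fst p') j * snd p' j))"
  have "?F \<in> borel_measurable (vec_space \<Otimes>\<^sub>M PiM UNIV (\<lambda>_. borel))"
    unfolding sum_error_def cross_terms_def by measurable
  from decoupled[OF this]
  have "(\<integral>\<^sup>+\<omega>. ennreal (sum_error b p (fst (X \<omega>)) (\<lambda>j. summand j \<omega>)) \<partial>M)
    = (\<integral>\<^sup>+\<omega>. (\<integral>\<^sup>+\<omega>'. ennreal (sum_error b p (fst (X \<omega>)) (\<lambda>j. weight (X \<omega>) j * Rs j \<omega>')) \<partial>M) \<partial>M)"
    by (simp add: summand_def)
  also have "\<dots> \<le> (\<integral>\<^sup>+\<omega>. (1 + K + abs_moment b * K) * (ennreal (\<bar>fst (X \<omega>)\<bar> powr p) + ennreal (?A \<omega> powr \<sigma>)) \<partial>M)"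
  proof (rule nn_integral_mono_AE)
    show "AE \<omega> in M. (\<integral>\<^sup>+\<omega>'. ennreal (sum_error b p (fst (X \<omega>)) (\<lambda>j. weight (X \<omega>) j * Rs j \<omega>')) \<partial>M)
      \<le> (1 + K + abs_moment b * K) * (ennreal (\<bar>fst (X \<omega>)\<bar> powr p) + ennreal (?A \<omega> powr \<sigma>))"
      using AE_summable_weights
    proof eventually_elim
      case (elim \<omega>)
      let ?q = "\<bar>fst (X \<omega>)\<bar>"
      let ?z = "\<lambda>\<omega>' j. ?a \<omega> j * \<bar>Rs j \<omega>'\<bar> powr b"
      have a0: "\<And>j. 0 \<le> ?a \<omega> j" by simp
      have A0: "0 \<le> ?A \<omega>" by (rule suminf_nonneg[OF elim a0])
      have split: "(\<integral>\<^sup>+\<omega>'. ennreal (sum_error b p (fst (X \<omega>)) (\<lambda>j. weight (X \<omega>) j * Rs j \<omega>')) \<partial>M)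
        \<le> (\<integral>\<^sup>+\<omega>'. ennreal (?q powr p) + (ennreal (?q powr b) * ennreal ((\<Sum>j. ?z \<omega>' j) powr (\<sigma> - 1))
            + ennreal (cross_terms \<sigma> (?z \<omega>'))) \<partial>M)"
      proof (rule nn_integral_mono)
        fix \<omega>'
        define S D where "S = (\<Sum>j. ?z \<omega>' j) powr (\<sigma> - 1)" and "D = cross_terms \<sigma> (?z \<omega>')"
        have S0: "0 \<le> S" by (simp add: S_def)
        have sub: "ennreal (u + v) \<le> ennreal u + ennreal v" if "0 \<le> u" for u v :: real
        proof (cases "0 \<le> v")
          case False
          then have "ennreal (u + v) \<le> ennreal u" by (intro ennreal_leI) simp
          then show ?thesis by (simp add: add_increasing2)
        qed (use that in simp)
        have e1: "sum_error b p (fst (X \<omega>)) (\<lambda>j. weight (X \<omega>) j * Rs j \<omega>') = (?q powr p + ?q powr b * S) + D"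
          by (simp add: sum_error_def S_def D_def \<sigma>_def abs_mult powr_mult)
        have e2: "ennreal (?q powr p + ?q powr b * S) = ennreal (?q powr p) + ennreal (?q powr b) * ennreal S"
          using S0 by (simp add: ennreal_mult)
        have "ennreal ((?q powr p + ?q powr b * S) + D) \<le> ennreal (?q powr p + ?q powr b * S) + ennreal D"
          using S0 by (intro sub) simp
        then show "ennreal (sum_error b p (fst (X \<omega>)) (\<lambda>j. weight (X \<omega>) j * Rs j \<omega>'))
          \<le> ennreal (?q powr p) + (ennreal (?q powr b) * ennreal ((\<Sum>j. ?z \<omega>' j) powr (\<sigma> - 1)) + ennreal (cross_terms \<sigma> (?z \<omega>')))"
          unfolding e1 e2 S_def[symmetric] D_def[symmetric] by (simp only: add.assoc)
      qed
      also have "\<dots> = ennreal (?q powr p) + (ennreal (?q powr b) * (\<integral>\<^sup>+\<omega>'. ennreal ((\<Sum>j. ?z \<omega>' j) powr (\<sigma> - 1)) \<partial>M)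
            + (\<integral>\<^sup>+\<omega>'. ennreal (cross_terms \<sigma> (?z \<omega>')) \<partial>M))"
      proof -
        have add: "(\<integral>\<^sup>+\<omega>'. c + (d * f \<omega>' + g \<omega>') \<partial>M) = c + (d * (\<integral>\<^sup>+\<omega>'. f \<omega>' \<partial>M) + (\<integral>\<^sup>+\<omega>'. g \<omega>' \<partial>M))"
          if [measurable]: "f \<in> borel_measurable M" "g \<in> borel_measurable M" for c d :: ennreal and f g
          by (simp add: nn_integral_add nn_integral_cmult emeasure_space_1)
        show ?thesis by (rule add) (unfold cross_terms_def, measurable)
      qed
      also have "\<dots> \<le> ennreal (?q powr p) + (ennreal (?q powr b) * (ennreal (?A \<omega> powr (\<sigma> - 1)) * K)
            + ennreal (?A \<omega> powr \<sigma>) * (abs_moment b * K))"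
      proof (intro add_mono mult_left_mono order_refl)
        show "(\<integral>\<^sup>+\<omega>'. ennreal ((\<Sum>j. ?z \<omega>' j) powr (\<sigma> - 1)) \<partial>M) \<le> ennreal (?A \<omega> powr (\<sigma> - 1)) * K"
          using weighted_sum_moment[OF b(1) R_moment a0 elim, of "\<sigma> - 1"] \<sigma> by (simp add: K_def bmax)
        show "(\<integral>\<^sup>+\<omega>'. ennreal (cross_terms \<sigma> (?z \<omega>')) \<partial>M) \<le> ennreal (?A \<omega> powr \<sigma>) * (abs_moment b * K)"
          using cross_terms_expectation[OF b(1) R_moment a0 elim \<sigma>(1)] by (simp add: K_def bmax)
      qed simp
      also have "\<dots> \<le> ennreal (?q powr p) + ((ennreal (?q powr p) + ennreal (?A \<omega> powr \<sigma>)) * K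
            + ennreal (?A \<omega> powr \<sigma>) * (abs_moment b * K))"
      proof (intro add_mono order_refl)
        have "?q powr b * ?A \<omega> powr (\<sigma> - 1) \<le> (?q powr b) powr \<sigma> + ?A \<omega> powr \<sigma>"
          by (rule mult_powr_le_add_powr) (use A0 \<sigma> in auto)
        then have "?q powr b * ?A \<omega> powr (\<sigma> - 1) \<le> ?q powr p + ?A \<omega> powr \<sigma>"
          by (simp add: powr_powr \<sigma>)
        then have "ennreal (?q powr b * ?A \<omega> powr (\<sigma> - 1)) \<le> ennreal (?q powr p + ?A \<omega> powr \<sigma>)" by (rule ennreal_leI)
        then have "ennreal (?q powr b) * ennreal (?A \<omega> powr (\<sigma> - 1)) \<le> ennreal (?q powr p) + ennreal (?A \<omega> powr \<sigma>)"
          by (simp add: ennreal_mult)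
        then show "ennreal (?q powr b) * (ennreal (?A \<omega> powr (\<sigma> - 1)) * K) \<le> (ennreal (?q powr p) + ennreal (?A \<omega> powr \<sigma>)) * K"
          by (metis mult.assoc mult_right_mono zero_le)
      qed
      also have "\<dots> \<le> (1 + K + abs_moment b * K) * (ennreal (?q powr p) + ennreal (?A \<omega> powr \<sigma>))"
      proof -
        have "u + ((u + v) * K + v * (n * K)) \<le> (1 + K + n * K) * (u + v)" for u v n :: ennreal
        proof -
          have "(1 + K + n * K) * (u + v) = (u + ((u + v) * K + v * (n * K))) + (v + u * (n * K))"
            by (simp add: algebra_simps)
          also have "\<dots> \<ge> u + ((u + v) * K + v * (n * K))" by (rule le_iff_add[THEN iffD2]) blast
          finally show ?thesis .
        qed
        then show ?thesis .
      qed
      finally show ?case .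
    qed
  qed
  also have "\<dots> = (1 + K + abs_moment b * K) * ((\<integral>\<^sup>+\<omega>. ennreal (\<bar>fst (X \<omega>)\<bar> powr p) \<partial>M) + (\<integral>\<^sup>+\<omega>. ennreal (?A \<omega> powr \<sigma>) \<partial>M))"
    by (simp add: nn_integral_cmult nn_integral_add)
  also have "\<dots> < \<infinity>"
  proof -
    have le: "(\<integral>\<^sup>+\<omega>. ennreal (Z \<omega> powr u) \<partial>M) < \<infinity>"
      if "(\<integral>\<^sup>+\<omega>. ennreal (Z \<omega> powr v) \<partial>M) < \<infinity>" "0 < u" "u \<le> v" "AE \<omega> in M. 0 \<le> Z \<omega>"
        and [measurable]: "Z \<in> borel_measurable M" for Z :: "'a \<Rightarrow> real" and u v
    proof -
      have "(\<integral>\<^sup>+\<omega>. ennreal (Z \<omega> powr u) \<partial>M) \<le> (\<integral>\<^sup>+\<omega>. 1 + ennreal (Z \<omega> powr v) \<partial>M)"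
      proof (rule nn_integral_mono_AE)
        show "AE \<omega> in M. ennreal (Z \<omega> powr u) \<le> 1 + ennreal (Z \<omega> powr v)"
          using that(4)
        proof eventually_elim
          case (elim \<omega>)
          have "ennreal (Z \<omega> powr u) \<le> ennreal (1 + Z \<omega> powr v)"
            by (intro ennreal_leI powr_le_one_plus that elim)
          then show ?case by simp
        qed
      qed
      also have "\<dots> = 1 + (\<integral>\<^sup>+\<omega>. ennreal (Z \<omega> powr v) \<partial>M)" by (simp add: nn_integral_add emeasure_space_1)
      also have "\<dots> < \<infinity>" using that(1) by simp
      finally show ?thesis .
    qed
    have "(\<integral>\<^sup>+\<omega>. ennreal (\<bar>fst (X \<omega>)\<bar> powr p) \<partial>M) < \<infinity>"
      by (rule le[OF q_moment]) (use p b in auto)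
    moreover have "(\<integral>\<^sup>+\<omega>. ennreal (?A \<omega> powr \<sigma>) \<partial>M) < \<infinity>"
    proof (rule le[OF sum_moment])
      show "\<sigma> \<le> \<alpha> / b" using p b by (simp add: \<sigma>_def divide_right_mono)
      show "AE \<omega> in M. 0 \<le> ?A \<omega>"
        using AE_summable_weights by eventually_elim (rule suminf_nonneg, auto)
    qed (use \<sigma> in auto)
    moreover have "1 + K + abs_moment b * K < \<infinity>" using K R_moment by (simp add: ennreal_mult_less_top)
    ultimately show ?thesis using R_moment K by (auto simp: ennreal_mult_less_top)
  qed
  finally show ?thesis .
qed

end

lemma min_le_powr_interpolation:
  fixes u K \<gamma> :: real
  assumes "0 \<le> u" "0 < K" "0 \<le> \<gamma>" "\<gamma> \<le> 1"
  shows "min u K \<le> u powr \<gamma> * K powr (1 - \<gamma>)"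
proof (cases "u = 0")
  case False
  define m where "m = min u K"
  have m: "0 < m" "m \<le> u" "m \<le> K" using False assms by (auto simp: m_def)
  have "m = m powr \<gamma> * m powr (1 - \<gamma>)" using m by (simp add: powr_add[symmetric])
  also have "\<dots> \<le> u powr \<gamma> * K powr (1 - \<gamma>)"
    using m assms by (intro mult_mono powr_mono2) auto
  finally show ?thesis by (simp add: m_def)
qed (use assms in auto)

context smoothing_fixed_point begin

text \<open>
  Truncation keeps the recursion finite before the moment is known to be finite.
\<close>

definition truncated_moment :: "real \<Rightarrow> real \<Rightarrow> ennreal" where
  "truncated_moment s K = (\<integral>\<^sup>+\<omega>. ennreal (min (\<bar>R \<omega>\<bar> powr s) K) \<partial>M)"

lemma truncated_moment_summand:
  assumes "0 < K"
  shows "(\<integral>\<^sup>+\<omega>. ennreal (min (\<bar>summand j \<omega>\<bar> powr s) K) \<partial>M)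
    = (\<integral>\<^sup>+\<omega>. ennreal (\<bar>weight (X \<omega>) j\<bar> powr s) * truncated_moment s (K / \<bar>weight (X \<omega>) j\<bar> powr s) \<partial>M)"
proof -
  have "(\<integral>\<^sup>+\<omega>. ennreal (min (\<bar>summand j \<omega>\<bar> powr s) K) \<partial>M)
     = (\<integral>\<^sup>+\<omega>. (\<integral>\<^sup>+\<omega>'. ennreal (min (\<bar>weight (X \<omega>) j * R \<omega>'\<bar> powr s) K) \<partial>M) \<partial>M)"
    using nn_integral_summand[of "\<lambda>(c, r). ennreal (min (\<bar>c * r\<bar> powr s) K)" j]
    by (simp add: summand_def)
  also have "\<dots> = (\<integral>\<^sup>+\<omega>. ennreal (\<bar>weight (X \<omega>) j\<bar> powr s) * truncated_moment s (K / \<bar>weight (X \<omega>) j\<bar> powr s) \<partial>M)"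
  proof (rule nn_integral_cong)
    fix \<omega>
    define c where "c = \<bar>weight (X \<omega>) j\<bar> powr s"
    have c: "0 \<le> c" by (simp add: c_def)
    have "ennreal (min (\<bar>weight (X \<omega>) j * R \<omega>'\<bar> powr s) K) = ennreal c * ennreal (min (\<bar>R \<omega>'\<bar> powr s) (K / c))" for \<omega>'
    proof -
      have "min (\<bar>weight (X \<omega>) j * R \<omega>'\<bar> powr s) K = c * min (\<bar>R \<omega>'\<bar> powr s) (K / c)"
        using c assms by (cases "c = 0") (auto simp: abs_mult powr_mult c_def[symmetric] min_mult_distrib_left)
      then show ?thesis using c assms by (simp add: ennreal_mult)
    qed
    then show "(\<integral>\<^sup>+\<omega>'. ennreal (min (\<bar>weight (X \<omega>) j * R \<omega>'\<bar> powr s) K) \<partial>M)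
      = ennreal (\<bar>weight (X \<omega>) j\<bar> powr s) * truncated_moment s (K / \<bar>weight (X \<omega>) j\<bar> powr s)"
      unfolding truncated_moment_def c_def[symmetric] by (simp add: nn_integral_cmult)
  qed
  finally show ?thesis .
qed

text \<open>
  The \<open>s\<close>-th power of the sum exceeds that of its largest term by at most an integrable error, and the truncated
  power of the largest term is one of the summands on the right.
\<close>

lemma truncated_moment_recursion:
  assumes s: "b < s" "s \<le> \<alpha>" and m: "abs_moment (max b (s - b)) < \<infinity>" and K: "0 < K"
  shows "truncated_moment s K
    \<le> (\<integral>\<^sup>+\<omega>. (\<Sum>j. ennreal (\<bar>weight (X \<omega>) j\<bar> powr s) * truncated_moment s (K / \<bar>weight (X \<omega>) j\<bar> powr s)) \<partial>M)
      + ennreal (exponents.gap_const b s) * (\<integral>\<^sup>+\<omega>. ennreal (sum_error b s (fst (X \<omega>)) (\<lambda>j. summand j \<omega>)) \<partial>M)"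
proof -
  interpret S: exponents b s using b s cases_bp by unfold_locales auto
  have gc: "0 \<le> S.gap_const" using s b by (simp add: S.gap_const_def)
  let ?E = "\<lambda>\<omega>. sum_error b s (fst (X \<omega>)) (\<lambda>j. summand j \<omega>)"
  have [measurable]: "(\<lambda>\<omega>. ?E \<omega>) \<in> borel_measurable M" unfolding sum_error_def cross_terms_def by measurable
  have [measurable]: "(\<lambda>\<omega>. truncated_moment s (K / \<bar>weight (X \<omega>) j\<bar> powr s)) \<in> borel_measurable M" for j
    unfolding truncated_moment_def by measurable
  have "truncated_moment s K = (\<integral>\<^sup>+\<omega>. ennreal (min (\<bar>fst (X \<omega>) + (\<Sum>j. summand j \<omega>)\<bar> powr s) K) \<partial>M)"
    unfolding truncated_moment_def using nn_integral_fixed[of "\<lambda>x. ennreal (min (\<bar>x\<bar> powr s) K)"] by simp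
  also have "\<dots> \<le> (\<integral>\<^sup>+\<omega>. (\<Sum>j. ennreal (min (\<bar>summand j \<omega>\<bar> powr s) K)) + ennreal S.gap_const * ennreal (?E \<omega>) \<partial>M)"
  proof (rule nn_integral_mono_AE)
    show "AE \<omega> in M. ennreal (min (\<bar>fst (X \<omega>) + (\<Sum>j. summand j \<omega>)\<bar> powr s) K)
      \<le> (\<Sum>j. ennreal (min (\<bar>summand j \<omega>\<bar> powr s) K)) + ennreal S.gap_const * ennreal (?E \<omega>)"
      using AE_summable_summands
    proof eventually_elim
      case (elim \<omega>)
      let ?A = "\<lambda>j. summand j \<omega>"
      obtain i where i: "\<bar>\<bar>(\<Sum>j. ?A j) + fst (X \<omega>)\<bar> powr s - \<bar>?A i\<bar> powr s\<bar>
          + (\<Sum>j. if j = i then 0 else \<bar>?A j\<bar> powr s) \<le> S.gap_const * ?E \<omega>"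
        by (rule S.max_summand_dominates[OF elim, of abs "fst (X \<omega>)"]) (auto intro: abs_triangle_ineq3)
      have nn: "0 \<le> (\<Sum>j. if j = i then 0 else \<bar>?A j\<bar> powr s)"
        by (rule suminf_nonneg)
          (auto intro!: summable_comparison_test'[OF S.summable_powr[OF elim], of 0])
      have "\<bar>fst (X \<omega>) + (\<Sum>j. ?A j)\<bar> powr s \<le> \<bar>?A i\<bar> powr s + S.gap_const * ?E \<omega>"
        using i nn by (simp add: add.commute)
      moreover have "0 \<le> S.gap_const * ?E \<omega>" using i nn by linarith
      ultimately have "min (\<bar>fst (X \<omega>) + (\<Sum>j. ?A j)\<bar> powr s) K \<le> min (\<bar>?A i\<bar> powr s) K + S.gap_const * ?E \<omega>"
        by linarith
      then have "ennreal (min (\<bar>fst (X \<omega>) + (\<Sum>j. ?A j)\<bar> powr s) K)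
          \<le> ennreal (min (\<bar>?A i\<bar> powr s) K + S.gap_const * ?E \<omega>)" by (rule ennreal_leI)
      also have "\<dots> = ennreal (min (\<bar>?A i\<bar> powr s) K) + ennreal S.gap_const * ennreal (?E \<omega>)"
        using \<open>0 \<le> S.gap_const * ?E \<omega>\<close> K gc by (subst ennreal_plus) (auto simp: ennreal_mult')
      also have "\<dots> \<le> (\<Sum>j. ennreal (min (\<bar>?A j\<bar> powr s) K)) + ennreal S.gap_const * ennreal (?E \<omega>)"
        using sum_le_suminf[of "\<lambda>j. ennreal (min (\<bar>?A j\<bar> powr s) K)" "{i}"] by (intro add_right_mono) auto
      finally show ?case .
    qed
  qed
  also have "\<dots> = (\<Sum>j. \<integral>\<^sup>+\<omega>. ennreal (min (\<bar>summand j \<omega>\<bar> powr s) K) \<partial>M) + ennreal S.gap_const * (\<integral>\<^sup>+\<omega>. ennreal (?E \<omega>) \<partial>M)"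
    by (simp add: nn_integral_add nn_integral_cmult nn_integral_suminf)
  finally have le: "truncated_moment s K \<le> (\<Sum>j. \<integral>\<^sup>+\<omega>. ennreal (min (\<bar>summand j \<omega>\<bar> powr s) K) \<partial>M)
      + ennreal S.gap_const * (\<integral>\<^sup>+\<omega>. ennreal (?E \<omega>) \<partial>M)" .
  have "(\<Sum>j. \<integral>\<^sup>+\<omega>. ennreal (min (\<bar>summand j \<omega>\<bar> powr s) K) \<partial>M)
    = (\<integral>\<^sup>+\<omega>. (\<Sum>j. ennreal (\<bar>weight (X \<omega>) j\<bar> powr s) * truncated_moment s (K / \<bar>weight (X \<omega>) j\<bar> powr s)) \<partial>M)"
    by (simp only: truncated_moment_summand[OF K], rule nn_integral_suminf[symmetric]) measurable
  then show ?thesis using le by (simp only:)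
qed

text \<open>
  Iterating the recursion bounds the truncated moments uniformly in \<open>K\<close>: the additive error is summed by the
  factor \<open>r < 1\<close> belonging to \<open>s\<close>. The remainder starts from the interpolation
  \<open>min u K \<le> u powr \<gamma> * K powr (1 - \<gamma>)\<close> with \<open>\<gamma> = s'/s\<close>, which involves the known moment only and is
  reproduced by the recursion with the factor \<open>r' < 1\<close> belonging to \<open>s'\<close>.
\<close>

lemma moment_step:
  assumes s': "b \<le> s'" "s' < s" "s \<le> s' + b" "s < \<alpha>" and m: "abs_moment s' < \<infinity>"
  shows "abs_moment s < \<infinity>"
proof -
  have bs: "b < s" "s \<le> \<alpha>" using s' by auto
  have mm: "abs_moment (max b (s - b)) < \<infinity>"
    by (rule abs_moment_mono_finite[OF m]) (use b s' in auto)
  define c0' where "c0' = ennreal (exponents.gap_const b s) * (\<integral>\<^sup>+\<omega>. ennreal (sum_error b s (fst (X \<omega>)) (\<lambda>j. summand j \<omega>)) \<partial>M)"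
  have "c0' < \<infinity>" unfolding c0'_def using error_moment[OF bs mm] by (simp add: ennreal_mult_less_top)
  then obtain c0 where c0: "c0' = ennreal c0" "0 \<le> c0" by (cases c0') auto
  obtain B where B: "abs_moment s' = ennreal B" "0 \<le> B" using m by (cases "abs_moment s'") auto
  obtain r where r: "0 \<le> r" "r < 1" "(\<integral>\<^sup>+\<omega>. (\<Sum>j. ennreal (\<bar>weight (X \<omega>) j\<bar> powr s)) \<partial>M) \<le> ennreal r"
    by (rule weight_moment_less_1[OF less_imp_le[OF bs(1)] s'(4)]) (rule that)
  obtain r' where r': "0 \<le> r'" "r' < 1" "(\<integral>\<^sup>+\<omega>. (\<Sum>j. ennreal (\<bar>weight (X \<omega>) j\<bar> powr s')) \<partial>M) \<le> ennreal r'"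
    by (rule weight_moment_less_1[OF s'(1) less_trans[OF s'(2,4)]]) (rule that)
  define \<gamma> where "\<gamma> = s' / s"
  have s0: "0 < s" "0 < s'" using b bs s' by auto
  have \<gamma>: "0 < \<gamma>" "\<gamma> < 1" "s * \<gamma> = s'" using s0 s' by (auto simp: \<gamma>_def)
  \<comment> \<open>The fixed point of \<open>c \<mapsto> c0 + r c\<close>, the bound that the recursion reproduces.\<close>
  define c1 where "c1 = c0 / (1 - r)"
  have c1: "0 \<le> c1" "c0 + r * c1 = c1" using c0 r by (auto simp: c1_def field_simps)
  have claim: "truncated_moment s K \<le> ennreal c1 + ennreal (r' ^ n * B * K powr (1 - \<gamma>))" if "0 < K" for n K
    using that
  proof (induction n arbitrary: K)
    case 0
    have "truncated_moment s K \<le> (\<integral>\<^sup>+\<omega>. ennreal (K powr (1 - \<gamma>)) * ennreal (\<bar>R \<omega>\<bar> powr s') \<partial>M)"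
      unfolding truncated_moment_def
    proof (rule nn_integral_mono)
      fix \<omega>
      have "min (\<bar>R \<omega>\<bar> powr s) K \<le> (\<bar>R \<omega>\<bar> powr s) powr \<gamma> * K powr (1 - \<gamma>)"
        by (rule min_le_powr_interpolation) (use 0 \<gamma> in auto)
      then have "min (\<bar>R \<omega>\<bar> powr s) K \<le> K powr (1 - \<gamma>) * \<bar>R \<omega>\<bar> powr s'"
        unfolding powr_powr \<gamma>(3) by (simp only: mult.commute)
      then have "ennreal (min (\<bar>R \<omega>\<bar> powr s) K) \<le> ennreal (K powr (1 - \<gamma>) * \<bar>R \<omega>\<bar> powr s')" by (rule ennreal_leI)
      then show "ennreal (min (\<bar>R \<omega>\<bar> powr s) K) \<le> ennreal (K powr (1 - \<gamma>)) * ennreal (\<bar>R \<omega>\<bar> powr s')"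
        by (simp add: ennreal_mult)
    qed
    also have "\<dots> = ennreal (K powr (1 - \<gamma>)) * abs_moment s'" unfolding abs_moment_def by (rule nn_integral_cmult) simp
    also have "\<dots> = ennreal (B * K powr (1 - \<gamma>))" using B by (simp add: ennreal_mult mult.commute)
    finally show ?case by (simp add: add_increasing)
  next
    case (Suc n)
    define C where "C = r' ^ n * B * K powr (1 - \<gamma>)"
    have C: "0 \<le> C" using r' B by (simp add: C_def)
    have bound: "ennreal (x powr s) * truncated_moment s (K / x powr s)
      \<le> ennreal c1 * ennreal (x powr s) + ennreal C * ennreal (x powr s')" if "0 \<le> x" for x :: real
    proof (cases "x = 0")
      case False
      then have x: "0 < x" using that by simp
      have "(K / x powr s) powr (1 - \<gamma>) = K powr (1 - \<gamma>) / x powr (s * (1 - \<gamma>))"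
        using x Suc by (simp add: powr_divide powr_powr)
      then have e: "x powr s * (r' ^ n * B * (K / x powr s) powr (1 - \<gamma>)) = C * x powr s'"
        using x by (simp add: C_def \<gamma>(3)[symmetric] right_diff_distrib powr_diff field_simps)
      have "ennreal (x powr s) * truncated_moment s (K / x powr s)
        \<le> ennreal (x powr s) * (ennreal c1 + ennreal (r' ^ n * B * (K / x powr s) powr (1 - \<gamma>)))"
        by (intro mult_left_mono Suc) (use x Suc in auto)
      also have "\<dots> = ennreal (x powr s) * ennreal c1 + ennreal (x powr s * (r' ^ n * B * (K / x powr s) powr (1 - \<gamma>)))"
        using r' B by (simp add: distrib_left ennreal_mult)
      also have "\<dots> = ennreal c1 * ennreal (x powr s) + ennreal C * ennreal (x powr s')"
        unfolding e using C by (simp add: ennreal_mult mult.commute)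
      finally show ?thesis .
    qed simp
    let ?I = "\<integral>\<^sup>+\<omega>. (\<Sum>j. ennreal c1 * ennreal (\<bar>weight (X \<omega>) j\<bar> powr s) + ennreal C * ennreal (\<bar>weight (X \<omega>) j\<bar> powr s')) \<partial>M"
    have "truncated_moment s K
      \<le> (\<integral>\<^sup>+\<omega>. (\<Sum>j. ennreal (\<bar>weight (X \<omega>) j\<bar> powr s) * truncated_moment s (K / \<bar>weight (X \<omega>) j\<bar> powr s)) \<partial>M) + c0'"
      unfolding c0'_def by (rule truncated_moment_recursion[OF bs mm \<open>0 < K\<close>])
    also have "\<dots> \<le> ?I + c0'"
      by (intro add_right_mono nn_integral_mono suminf_le bound) auto
    finally have 1: "truncated_moment s K \<le> ?I + c0'" .
    have "?I = (\<integral>\<^sup>+\<omega>. ennreal c1 * (\<Sum>j. ennreal (\<bar>weight (X \<omega>) j\<bar> powr s)) + ennreal C * (\<Sum>j. ennreal (\<bar>weight (X \<omega>) j\<bar> powr s')) \<partial>M)"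
      by (simp add: suminf_add[symmetric])
    also have "\<dots> = ennreal c1 * (\<integral>\<^sup>+\<omega>. (\<Sum>j. ennreal (\<bar>weight (X \<omega>) j\<bar> powr s)) \<partial>M)
        + ennreal C * (\<integral>\<^sup>+\<omega>. (\<Sum>j. ennreal (\<bar>weight (X \<omega>) j\<bar> powr s')) \<partial>M)"
      by (simp add: nn_integral_add nn_integral_cmult)
    also have "\<dots> \<le> ennreal c1 * ennreal r + ennreal C * ennreal r'"
      by (intro add_mono mult_left_mono r r') auto
    finally have 2: "?I \<le> ennreal c1 * ennreal r + ennreal C * ennreal r'" .
    have "truncated_moment s K \<le> ennreal c1 * ennreal r + ennreal C * ennreal r' + c0'"
      using order_trans[OF 1 add_right_mono[OF 2]] .
    also have "\<dots> = ennreal (c1 * r + C * r' + c0)"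
      using c0 c1 C r(1) r'(1) by (simp add: ennreal_mult)
    also have "c1 * r + C * r' + c0 = c1 + r' ^ Suc n * B * K powr (1 - \<gamma>)"
      using c1(2) by (simp add: C_def algebra_simps)
    finally have 3: "truncated_moment s K \<le> ennreal (c1 + r' ^ Suc n * B * K powr (1 - \<gamma>))" .
    have "0 \<le> r' ^ Suc n * B * K powr (1 - \<gamma>)" using r'(1) B by simp
    then show ?case using 3 c1(1) by (simp only: ennreal_plus)
  qed
  have trunc: "truncated_moment s K \<le> ennreal c1" if K: "0 < K" for K
  proof (rule LIMSEQ_le_const)
    have "(\<lambda>n. ennreal c1 + ennreal (r' ^ n * B * K powr (1 - \<gamma>))) \<longlonglongrightarrow> ennreal c1 + ennreal (0 * B * K powr (1 - \<gamma>))"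
      using r' by (intro tendsto_intros LIMSEQ_power_zero) auto
    then show "(\<lambda>n. ennreal c1 + ennreal (r' ^ n * B * K powr (1 - \<gamma>))) \<longlonglongrightarrow> ennreal c1" by simp
  qed (use claim[OF K] in blast)
  have "abs_moment s = (\<integral>\<^sup>+\<omega>. liminf (\<lambda>k. ennreal (min (\<bar>R \<omega>\<bar> powr s) (real (Suc k)))) \<partial>M)"
    unfolding abs_moment_def
  proof (rule nn_integral_cong)
    fix \<omega>
    obtain n :: nat where n: "\<bar>R \<omega>\<bar> powr s \<le> real n" using real_arch_simple by blast
    have "(\<lambda>k. ennreal (min (\<bar>R \<omega>\<bar> powr s) (real (Suc k)))) \<longlonglongrightarrow> ennreal (\<bar>R \<omega>\<bar> powr s)"
    proof (rule tendsto_eventually)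
      show "\<forall>\<^sub>F k in sequentially. ennreal (min (\<bar>R \<omega>\<bar> powr s) (real (Suc k))) = ennreal (\<bar>R \<omega>\<bar> powr s)"
        using eventually_ge_at_top[of n]
      proof eventually_elim
        case (elim k)
        then have "\<bar>R \<omega>\<bar> powr s \<le> real (Suc k)" using n by linarith
        then show ?case by (simp only: min_absorb1)
      qed
    qed
    then show "ennreal (\<bar>R \<omega>\<bar> powr s) = liminf (\<lambda>k. ennreal (min (\<bar>R \<omega>\<bar> powr s) (real (Suc k))))"
      by (rule lim_imp_Liminf[OF trivial_limit_sequentially, symmetric])
  qed
  also have "\<dots> \<le> liminf (\<lambda>k. \<integral>\<^sup>+\<omega>. ennreal (min (\<bar>R \<omega>\<bar> powr s) (real (Suc k))) \<partial>M)"
    by (rule nn_integral_liminf) measurable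
  also have "\<dots> \<le> ennreal c1"
    by (rule Liminf_le) (use trunc[unfolded truncated_moment_def] in auto)
  finally show ?thesis by (simp add: le_less_trans)
qed

text \<open>
  Climbing from \<open>b\<close> in steps of length at most \<open>b\<close>.
\<close>

lemma moments_below:
  assumes "b \<le> s" "s < \<alpha>"
  shows "abs_moment s < \<infinity>"
proof -
  have "\<forall>s. b \<le> s \<and> s < \<alpha> \<and> s \<le> b * (real n + 1) \<longrightarrow> abs_moment s < \<infinity>" for n
  proof (induction n)
    case 0
    then show ?case using R_moment by (auto dest: order_antisym)
  next
    case (Suc n)
    show ?case
    proof (intro allI impI)
      fix s assume s: "b \<le> s \<and> s < \<alpha> \<and> s \<le> b * (real (Suc n) + 1)"
      show "abs_moment s < \<infinity>"
      proof (cases "s = b")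
        case False
        have "max b (s - b) \<le> b * (real n + 1)" using s b by (auto simp: algebra_simps)
        then have "abs_moment (max b (s - b)) < \<infinity>" using Suc s b by auto
        then show ?thesis by (rule moment_step[rotated -1]) (use s b False in auto)
      qed (use R_moment in simp)
    qed
  qed
  moreover obtain n :: nat where "s / b \<le> real n" using real_arch_simple by blast
  then have "s \<le> b * (real n + 1)" using b by (simp add: field_simps)
  ultimately show ?thesis using assms by blast
qed

lemma error_moment_\<alpha>: "(\<integral>\<^sup>+\<omega>. ennreal (sum_error b \<alpha> (fst (X \<omega>)) (\<lambda>j. summand j \<omega>)) \<partial>M) < \<infinity>"
  using b bp by (intro error_moment moments_below) auto

end

section \<open>Tail excess and power gap\<close>

text \<open>
  A measure on a space of levels under which \<open>\<integral>1(level < x) = x\<^sup>p / p\<close>. It is instantiated by \<open>v powr (p - 1) dv\<close> at level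
  \<open>v\<close> and by \<open>exp (p t) dt\<close> at level \<open>exp t\<close>, so that one calculation serves the formula for the constant and
  the renewal equation.
\<close>

locale level_measure = sigma_finite_measure \<nu> for \<nu> :: "'s measure" +
  fixes lev :: "'s \<Rightarrow> real" and p :: real
  assumes p_pos: "0 < p"
    and level_meas[measurable]: "lev \<in> borel_measurable \<nu>"
    and level_pos: "\<And>s. s \<in> space \<nu> \<Longrightarrow> 0 < lev s"
    and emeasure_level: "\<And>x. 0 \<le> x \<Longrightarrow> emeasure \<nu> {s\<in>space \<nu>. lev s < x} = ennreal (x powr p / p)"
begin

lemma nn_integral_level: "0 \<le> x \<Longrightarrow> (\<integral>\<^sup>+s. of_bool (lev s < x) \<partial>\<nu>) = ennreal (x powr p / p)"
  unfolding emeasure_level[symmetric]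
  by (subst nn_integral_indicator[symmetric], simp, rule nn_integral_cong) (auto simp: indicator_def)

lemma nn_integral_level_diff:
  assumes "0 \<le> x" "0 \<le> y"
  shows "(\<integral>\<^sup>+s. ennreal \<bar>of_bool (lev s < x) - of_bool (lev s < y)\<bar> \<partial>\<nu>) = ennreal (\<bar>x powr p - y powr p\<bar> / p)"
proof -
  have *: "(\<integral>\<^sup>+s. ennreal \<bar>of_bool (lev s < x) - of_bool (lev s < y)\<bar> \<partial>\<nu>) = ennreal ((y powr p - x powr p) / p)"
    if "0 \<le> x" "x \<le> y" for x y
  proof -
    let ?D = "\<integral>\<^sup>+s. ennreal \<bar>of_bool (lev s < x) - of_bool (lev s < y)\<bar> \<partial>\<nu>"
    have "?D + (\<integral>\<^sup>+s. of_bool (lev s < x) \<partial>\<nu>)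
        = (\<integral>\<^sup>+s. ennreal \<bar>of_bool (lev s < x) - of_bool (lev s < y)\<bar> + of_bool (lev s < x) \<partial>\<nu>)"
      by (rule nn_integral_add[symmetric]) measurable
    also have "\<dots> = (\<integral>\<^sup>+s. of_bool (lev s < y) \<partial>\<nu>)"
      by (rule nn_integral_cong) (use that in auto)
    finally have e: "?D + ennreal (x powr p / p) = ennreal (y powr p / p)" using that by (simp add: nn_integral_level)
    then have "?D \<le> ennreal (y powr p / p)" by (metis le_iff_add)
    then have "?D \<noteq> \<infinity>" by (auto simp: top_unique)
    then obtain d where d: "?D = ennreal d" "0 \<le> d" by (cases ?D) auto
    have "ennreal (d + x powr p / p) = ennreal (y powr p / p)" using e d p_pos by simp
    then have "d + x powr p / p = y powr p / p" using d p_pos by (subst (asm) ennreal_inj) auto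
    then show ?thesis using d by (simp add: diff_divide_distrib)
  qed
  show ?thesis
  proof (cases "x \<le> y")
    case True
    then have "x powr p \<le> y powr p" using assms p_pos by (intro powr_mono2) auto
    then show ?thesis using *[of x y] True assms by simp
  next
    case False
    then have "y powr p \<le> x powr p" using assms p_pos by (intro powr_mono2) auto
    then show ?thesis using *[of y x] False assms by (simp add: abs_minus_commute)
  qed
qed

end

locale level_gap = exponents b p + level_measure \<nu> lev p
  for b p and \<nu> :: "'s measure" and lev +
  fixes g :: "real \<Rightarrow> real"
  assumes g: "\<And>x. 0 \<le> g x" "\<And>x. g x \<le> \<bar>x\<bar>" "\<And>x y. \<bar>g x - g y\<bar> \<le> \<bar>x - y\<bar>"
begin

lemma summable_g_powr:
  fixes A :: "nat \<Rightarrow> real"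
  assumes s: "summable (\<lambda>j. \<bar>A j\<bar> powr b)"
  shows "summable (\<lambda>j. g (A j) powr p)"
  by (rule summable_comparison_test'[OF summable_powr[OF s], of 0])
    (use g p_pos in \<open>auto intro!: powr_mono2\<close>)

lemma summable_exceedances:
  fixes A :: "nat \<Rightarrow> real" and v :: real
  assumes s: "summable (\<lambda>j. \<bar>A j\<bar> powr b)" and v: "0 < v"
  shows "summable (\<lambda>j. of_bool (v < g (A j)) :: real)"
proof (rule summable_comparison_test'[of "\<lambda>j. \<bar>A j\<bar> powr b / v powr b" 0])
  show "summable (\<lambda>j. \<bar>A j\<bar> powr b / v powr b)" by (rule summable_divide[OF s])
  fix j
  show "norm (of_bool (v < g (A j)) :: real) \<le> \<bar>A j\<bar> powr b / v powr b"
  proof (cases "v < g (A j)")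
    case True
    then have "v powr b \<le> \<bar>A j\<bar> powr b" using g(2)[of "A j"] v b by (intro powr_mono2) auto
    then show ?thesis using True v by simp
  qed simp
qed

lemma nn_integral_exceedances:
  fixes A :: "nat \<Rightarrow> real"
  assumes s: "summable (\<lambda>j. \<bar>A j\<bar> powr b)"
  shows "(\<integral>\<^sup>+s. ennreal (\<Sum>j. of_bool (lev s < g (A j))) \<partial>\<nu>) = ennreal ((\<Sum>j. g (A j) powr p) / p)"
proof -
  have "(\<integral>\<^sup>+s. ennreal (\<Sum>j. of_bool (lev s < g (A j))) \<partial>\<nu>) = (\<integral>\<^sup>+s. (\<Sum>j. of_bool (lev s < g (A j))) \<partial>\<nu>)"
  proof (rule nn_integral_cong)
    fix t assume "t \<in> space \<nu>"
    then have "summable (\<lambda>j. of_bool (lev t < g (A j)) :: real)" by (intro summable_exceedances s level_pos)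
    then have "ennreal (\<Sum>j. of_bool (lev t < g (A j))) = (\<Sum>j. ennreal (of_bool (lev t < g (A j))))"
      by (intro suminf_ennreal2[symmetric]) auto
    also have "\<dots> = (\<Sum>j. of_bool (lev t < g (A j)))" by (intro suminf_cong) auto
    finally show "ennreal (\<Sum>j. of_bool (lev t < g (A j))) = (\<Sum>j. of_bool (lev t < g (A j)))" .
  qed
  also have "\<dots> = (\<Sum>j. \<integral>\<^sup>+s. of_bool (lev s < g (A j)) \<partial>\<nu>)" by (rule nn_integral_suminf) measurable
  also have "\<dots> = (\<Sum>j. ennreal (g (A j) powr p / p))" by (intro suminf_cong nn_integral_level g)
  also have "\<dots> = ennreal (\<Sum>j. g (A j) powr p / p)"
    by (rule suminf_ennreal2) (use p_pos summable_divide[OF summable_g_powr[OF s]] in auto)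
  also have "(\<Sum>j. g (A j) powr p / p) = (\<Sum>j. g (A j) powr p) / p"
    by (rule suminf_divide[OF summable_g_powr[OF s]])
  finally show ?thesis .
qed

lemma level_gap_integral:
  fixes A :: "nat \<Rightarrow> real" and q :: real
  assumes s: "summable (\<lambda>j. \<bar>A j\<bar> powr b)"
  shows "has_bochner_integral \<nu> (\<lambda>s. of_bool (lev s < g (q + (\<Sum>j. A j))) - (\<Sum>j. of_bool (lev s < g (A j))))
      ((g (q + (\<Sum>j. A j)) powr p - (\<Sum>j. g (A j) powr p)) / p)"
proof -
  have 1: "has_bochner_integral \<nu> (\<lambda>s. of_bool (lev s < g (q + (\<Sum>j. A j))) :: real) (g (q + (\<Sum>j. A j)) powr p / p)"
  proof (rule has_bochner_integral_nn_integral)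
    have "(\<integral>\<^sup>+s. ennreal (of_bool (lev s < g (q + (\<Sum>j. A j)))) \<partial>\<nu>) = (\<integral>\<^sup>+s. of_bool (lev s < g (q + (\<Sum>j. A j))) \<partial>\<nu>)"
      by (rule nn_integral_cong) simp
    then show "(\<integral>\<^sup>+s. ennreal (of_bool (lev s < g (q + (\<Sum>j. A j)))) \<partial>\<nu>) = ennreal (g (q + (\<Sum>j. A j)) powr p / p)"
      by (simp add: nn_integral_level g)
  qed (use p_pos in auto)
  have 2: "has_bochner_integral \<nu> (\<lambda>s. \<Sum>j. of_bool (lev s < g (A j)) :: real) ((\<Sum>j. g (A j) powr p) / p)"
  proof (rule has_bochner_integral_nn_integral)
    show "AE t in \<nu>. 0 \<le> (\<Sum>j. of_bool (lev t < g (A j)) :: real)"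
      by (intro AE_I2 suminf_nonneg summable_exceedances s level_pos) auto
    show "0 \<le> (\<Sum>j. g (A j) powr p) / p"
      using p_pos by (intro divide_nonneg_pos suminf_nonneg summable_g_powr s) auto
  qed (auto simp: nn_integral_exceedances[OF s])
  show ?thesis using has_bochner_integral_diff[OF 1 2] by (simp add: diff_divide_distrib)
qed

text \<open>
  Compare both indicators with that of the largest term; the differences integrate to differences of \<open>p\<close>-th
  powers.
\<close>

lemma level_gap_bound:
  fixes A :: "nat \<Rightarrow> real" and q :: real
  assumes s: "summable (\<lambda>j. \<bar>A j\<bar> powr b)"
  shows "(\<integral>\<^sup>+s. ennreal \<bar>of_bool (lev s < g (q + (\<Sum>j. A j))) - (\<Sum>j. of_bool (lev s < g (A j)))\<bar> \<partial>\<nu>)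
    \<le> ennreal (gap_const * sum_error b p q A / p)"
proof -
  obtain i where i: "\<bar>g ((\<Sum>j. A j) + q) powr p - g (A i) powr p\<bar> + (\<Sum>j. if j = i then 0 else g (A j) powr p)
      \<le> gap_const * sum_error b p q A"
    by (rule max_summand_dominates[OF s g]) (rule that)
  define A' where "A' j = (if j = i then 0 else A j)" for j
  have g0: "g 0 = 0" using g(1,2)[of 0] by simp
  have s': "summable (\<lambda>j. \<bar>A' j\<bar> powr b)"
    by (rule summable_comparison_test'[OF s, of 0]) (auto simp: A'_def)
  let ?T = "g (q + (\<Sum>j. A j))"
  have "(\<integral>\<^sup>+s. ennreal \<bar>of_bool (lev s < ?T) - (\<Sum>j. of_bool (lev s < g (A j)))\<bar> \<partial>\<nu>)
    \<le> (\<integral>\<^sup>+s. ennreal \<bar>of_bool (lev s < ?T) - of_bool (lev s < g (A i))\<bar> + ennreal (\<Sum>j. of_bool (lev s < g (A' j))) \<partial>\<nu>)"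
  proof (rule nn_integral_mono)
    fix t assume t: "t \<in> space \<nu>"
    have se: "summable (\<lambda>j. of_bool (lev t < g (A j)) :: real)" by (intro summable_exceedances s level_pos t)
    have se': "summable (\<lambda>j. of_bool (lev t < g (A' j)) :: real)" by (intro summable_exceedances s' level_pos t)
    have "(\<lambda>j. of_bool (lev t < g (A j)) - (if j = i then of_bool (lev t < g (A j)) else 0) :: real)
        sums ((\<Sum>j. of_bool (lev t < g (A j))) - of_bool (lev t < g (A i)))"
      using sums_diff[OF summable_sums[OF se] sums_single[of i "\<lambda>j. of_bool (lev t < g (A j))"]] .
    moreover have "(\<lambda>j. of_bool (lev t < g (A j)) - (if j = i then of_bool (lev t < g (A j)) else 0) :: real)
        = (\<lambda>j. of_bool (lev t < g (A' j)))"
      using level_pos[OF t] by (auto simp: A'_def g0 fun_eq_iff)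
    ultimately have e: "(\<Sum>j. of_bool (lev t < g (A' j)) :: real) = (\<Sum>j. of_bool (lev t < g (A j))) - of_bool (lev t < g (A i))"
      by (simp add: sums_iff)
    have nn: "0 \<le> (\<Sum>j. of_bool (lev t < g (A' j)) :: real)" by (rule suminf_nonneg[OF se']) simp
    have "\<bar>of_bool (lev t < ?T) - (\<Sum>j. of_bool (lev t < g (A j))) :: real\<bar>
      \<le> \<bar>of_bool (lev t < ?T) - of_bool (lev t < g (A i))\<bar> + (\<Sum>j. of_bool (lev t < g (A' j)))"
      using nn unfolding e by linarith
    then have "ennreal \<bar>of_bool (lev t < ?T) - (\<Sum>j. of_bool (lev t < g (A j)))\<bar>
      \<le> ennreal (\<bar>of_bool (lev t < ?T) - of_bool (lev t < g (A i))\<bar> + (\<Sum>j. of_bool (lev t < g (A' j))))"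
      by (rule ennreal_leI)
    then show "ennreal \<bar>of_bool (lev t < ?T) - (\<Sum>j. of_bool (lev t < g (A j)))\<bar>
      \<le> ennreal \<bar>of_bool (lev t < ?T) - of_bool (lev t < g (A i))\<bar> + ennreal (\<Sum>j. of_bool (lev t < g (A' j)))"
      using nn by (subst (asm) ennreal_plus) auto
  qed
  also have "\<dots> = ennreal (\<bar>?T powr p - g (A i) powr p\<bar> / p) + ennreal ((\<Sum>j. g (A' j) powr p) / p)"
    by (subst nn_integral_add) (auto simp: nn_integral_level_diff g nn_integral_exceedances[OF s'])
  also have "\<dots> = ennreal (\<bar>?T powr p - g (A i) powr p\<bar> / p + (\<Sum>j. g (A' j) powr p) / p)"
    using p_pos suminf_nonneg[OF summable_g_powr[OF s']] by (intro ennreal_plus[symmetric]) auto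
  also have "\<dots> \<le> ennreal (gap_const * sum_error b p q A / p)"
  proof (rule ennreal_leI)
    have "g (A' j) powr p = (if j = i then 0 else g (A j) powr p)" for j by (simp add: A'_def g0)
    then show "\<bar>?T powr p - g (A i) powr p\<bar> / p + (\<Sum>j. g (A' j) powr p) / p \<le> gap_const * sum_error b p q A / p"
      using i p_pos by (simp add: add_divide_distrib[symmetric] divide_right_mono add.commute)
  qed
  finally show ?thesis .
qed

end

lemma (in iid_sum) nn_integral_weight_copy:
  assumes f[measurable]: "f \<in> borel_measurable (borel \<Otimes>\<^sub>M borel)"
  shows "(\<integral>\<^sup>+\<omega>. f (weight (X \<omega>) j, Rs k \<omega>) \<partial>M) = (\<integral>\<^sup>+\<omega>. (\<integral>\<^sup>+\<omega>'. f (weight (X \<omega>) j, R \<omega>') \<partial>M) \<partial>M)"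
proof -
  have "(\<lambda>p. f (weight (fst p) j, snd p k)) \<in> borel_measurable (vec_space \<Otimes>\<^sub>M PiM UNIV (\<lambda>_. borel))"
    by measurable
  from decoupled[OF this]
  have "(\<integral>\<^sup>+\<omega>. f (weight (X \<omega>) j, Rs k \<omega>) \<partial>M) = (\<integral>\<^sup>+\<omega>. (\<integral>\<^sup>+\<omega>'. f (weight (X \<omega>) j, Rs k \<omega>') \<partial>M) \<partial>M)" by simp
  also have "\<dots> = (\<integral>\<^sup>+\<omega>. (\<integral>\<^sup>+\<omega>'. f (weight (X \<omega>) j, R \<omega>') \<partial>M) \<partial>M)"
  proof (rule nn_integral_cong)
    fix \<omega>
    show "(\<integral>\<^sup>+\<omega>'. f (weight (X \<omega>) j, Rs k \<omega>') \<partial>M) = (\<integral>\<^sup>+\<omega>'. f (weight (X \<omega>) j, R \<omega>') \<partial>M)"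
      using nn_integral_Rs[of "\<lambda>y. f (weight (X \<omega>) j, y)" k] by simp
  qed
  finally show ?thesis .
qed

text \<open>
  The instances of \<open>g\<close> are the positive part, the negative part and the absolute value.
\<close>

locale tail_setting = smoothing_fixed_point M X R Rs b \<alpha> \<rho>
  for M :: "'a measure" and X R Rs b \<alpha> \<rho> +
  fixes g :: "real \<Rightarrow> real"
  assumes g: "\<And>x. 0 \<le> g x" "\<And>x. g x \<le> \<bar>x\<bar>" "\<And>x y. \<bar>g x - g y\<bar> \<le> \<bar>x - y\<bar>"
begin

lemma g_meas[measurable]: "g \<in> borel_measurable borel"
proof (rule borel_measurable_continuous_onI)
  have "1-lipschitz_on UNIV g"
    by (rule lipschitz_onI) (auto simp: dist_real_def g)
  then show "continuous_on UNIV g" by (rule lipschitz_on_continuous_on)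
qed

lemma g_0: "g 0 = 0" using g(1,2)[of 0] by simp

text \<open>
  The inner integral runs over a copy of \<open>R\<close> that is independent of the weights.
\<close>

definition mean_exceedances :: "real \<Rightarrow> ennreal" where
  "mean_exceedances v = (\<integral>\<^sup>+\<omega>. (\<Sum>j. (\<integral>\<^sup>+\<omega>'. of_bool (v < g (weight (X \<omega>) j * R \<omega>')) \<partial>M)) \<partial>M)"

definition tail_excess :: "real \<Rightarrow> real" where
  "tail_excess v = prob {\<omega>\<in>space M. v < g (R \<omega>)} - enn2real (mean_exceedances v)"

lemma nn_integral_exceedances_copies:
  "(\<integral>\<^sup>+\<omega>. (\<Sum>j. of_bool (v < g (weight (X \<omega>) j * Rs (k j) \<omega>))) \<partial>M) = mean_exceedances v"
proof -
  have "(\<integral>\<^sup>+\<omega>. (\<Sum>j. of_bool (v < g (weight (X \<omega>) j * Rs (k j) \<omega>))) \<partial>M)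
      = (\<Sum>j. \<integral>\<^sup>+\<omega>. of_bool (v < g (weight (X \<omega>) j * Rs (k j) \<omega>)) \<partial>M)"
    by (rule nn_integral_suminf) measurable
  also have "\<dots> = (\<Sum>j. \<integral>\<^sup>+\<omega>. (\<integral>\<^sup>+\<omega>'. of_bool (v < g (weight (X \<omega>) j * R \<omega>')) \<partial>M) \<partial>M)"
    using nn_integral_weight_copy[of "\<lambda>(c, r). of_bool (v < g (c * r))"] by (intro suminf_cong) simp
  also have "\<dots> = mean_exceedances v"
    unfolding mean_exceedances_def by (rule nn_integral_suminf[symmetric]) measurable
  finally show ?thesis .
qed

lemma mean_exceedances_finite:
  assumes v: "0 < v" shows "mean_exceedances v < \<infinity>"
proof -
  have "mean_exceedances v = (\<integral>\<^sup>+\<omega>. (\<Sum>j. of_bool (v < g (summand j \<omega>))) \<partial>M)"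
    using nn_integral_exceedances_copies[of v "\<lambda>j. j"] by (simp add: summand_def)
  also have "\<dots> \<le> (\<integral>\<^sup>+\<omega>. ennreal (1 / v powr b) * (\<Sum>j. ennreal (\<bar>summand j \<omega>\<bar> powr b)) \<partial>M)"
  proof (intro nn_integral_mono)
    fix \<omega>
    have "of_bool (v < g x) \<le> ennreal (1 / v powr b) * ennreal (\<bar>x\<bar> powr b)" for x
    proof (cases "v < g x")
      case True
      then have "v powr b \<le> \<bar>x\<bar> powr b" using g(2)[of x] v b by (intro powr_mono2) auto
      then have "1 \<le> 1 / v powr b * \<bar>x\<bar> powr b" using v by simp
      then have "ennreal 1 \<le> ennreal (1 / v powr b * \<bar>x\<bar> powr b)" by (rule ennreal_leI)
      then show ?thesis using True by (simp add: ennreal_mult[symmetric])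
    qed simp
    then have "(\<Sum>j. of_bool (v < g (summand j \<omega>))) \<le> (\<Sum>j. ennreal (1 / v powr b) * ennreal (\<bar>summand j \<omega>\<bar> powr b))"
      by (intro suminf_le) auto
    then show "(\<Sum>j. of_bool (v < g (summand j \<omega>))) \<le> ennreal (1 / v powr b) * (\<Sum>j. ennreal (\<bar>summand j \<omega>\<bar> powr b))"
      by simp
  qed
  also have "\<dots> = ennreal (1 / v powr b) * (\<integral>\<^sup>+\<omega>. (\<Sum>j. ennreal (\<bar>summand j \<omega>\<bar> powr b)) \<partial>M)"
    by (rule nn_integral_cmult) measurable
  also have "\<dots> < \<infinity>"
    using le_less_trans[OF summand_b_moment] R_moment by (simp add: ennreal_mult_less_top)
  finally show ?thesis .
qed

lemma AE_summable_exceedances: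
  assumes v: "0 < v"
  shows "AE \<omega> in M. summable (\<lambda>j. of_bool (v < g (weight (X \<omega>) j * Rs (k j) \<omega>)) :: real)"
proof -
  have "(\<integral>\<^sup>+\<omega>. (\<Sum>j. of_bool (v < g (weight (X \<omega>) j * Rs (k j) \<omega>))) \<partial>M) \<noteq> \<infinity>"
    using mean_exceedances_finite[OF v] by (simp add: nn_integral_exceedances_copies)
  then have "AE \<omega> in M. (\<Sum>j. of_bool (v < g (weight (X \<omega>) j * Rs (k j) \<omega>)) :: ennreal) \<noteq> \<infinity>"
    by (intro nn_integral_noteq_infinite) auto
  then show ?thesis
  proof eventually_elim
    case (elim \<omega>)
    have "(\<Sum>j. ennreal (of_bool (v < g (weight (X \<omega>) j * Rs (k j) \<omega>)))) = (\<Sum>j. of_bool (v < g (weight (X \<omega>) j * Rs (k j) \<omega>)))"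
      by (intro suminf_cong) auto
    then show ?case using elim by (intro summable_suminf_not_top) auto
  qed
qed

text \<open>
  The map \<open>k\<close> chooses the copy that accompanies each weight. As an expectation of a sum depends on the joint law of
  each weight and its copy only, one copy may serve all weights.
\<close>

lemma exceedances_integral:
  assumes v: "0 < v"
  shows "has_bochner_integral M (\<lambda>\<omega>. \<Sum>j. of_bool (v < g (weight (X \<omega>) j * Rs (k j) \<omega>)) :: real) (enn2real (mean_exceedances v))"
proof (rule has_bochner_integral_nn_integral)
  note AE = AE_summable_exceedances[OF v, of k]
  from AE show "AE \<omega> in M. 0 \<le> (\<Sum>j. of_bool (v < g (weight (X \<omega>) j * Rs (k j) \<omega>)) :: real)"
    by eventually_elim (rule suminf_nonneg, auto)
  have "(\<integral>\<^sup>+\<omega>. ennreal (\<Sum>j. of_bool (v < g (weight (X \<omega>) j * Rs (k j) \<omega>))) \<partial>M)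
    = (\<integral>\<^sup>+\<omega>. (\<Sum>j. of_bool (v < g (weight (X \<omega>) j * Rs (k j) \<omega>))) \<partial>M)"
  proof (rule nn_integral_cong_AE)
    show "AE \<omega> in M. ennreal (\<Sum>j. of_bool (v < g (weight (X \<omega>) j * Rs (k j) \<omega>))) = (\<Sum>j. of_bool (v < g (weight (X \<omega>) j * Rs (k j) \<omega>)))"
      using AE
    proof eventually_elim
      case (elim \<omega>)
      have "ennreal (\<Sum>j. of_bool (v < g (weight (X \<omega>) j * Rs (k j) \<omega>))) = (\<Sum>j. ennreal (of_bool (v < g (weight (X \<omega>) j * Rs (k j) \<omega>))))"
        by (rule suminf_ennreal2[symmetric]) (use elim in auto)
      also have "\<dots> = (\<Sum>j. of_bool (v < g (weight (X \<omega>) j * Rs (k j) \<omega>)))" by (intro suminf_cong) auto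
      finally show ?case .
    qed
  qed
  then show "(\<integral>\<^sup>+\<omega>. ennreal (\<Sum>j. of_bool (v < g (weight (X \<omega>) j * Rs (k j) \<omega>))) \<partial>M) = ennreal (enn2real (mean_exceedances v))"
    using mean_exceedances_finite[OF v] by (simp add: nn_integral_exceedances_copies)
qed auto

lemma tail_excess_eq:
  assumes v: "0 < v"
  shows "tail_excess v = (\<integral>\<omega>. of_bool (v < g (fst (X \<omega>) + (\<Sum>j. summand j \<omega>))) - (\<Sum>j. of_bool (v < g (summand j \<omega>))) \<partial>M)"
proof -
  have 1: "has_bochner_integral M (\<lambda>\<omega>. of_bool (v < g (fst (X \<omega>) + (\<Sum>j. summand j \<omega>))) :: real) (prob {\<omega>\<in>space M. v < g (R \<omega>)})"
  proof (rule has_bochner_integral_nn_integral)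
    have "(\<integral>\<^sup>+\<omega>. ennreal (of_bool (v < g (fst (X \<omega>) + (\<Sum>j. summand j \<omega>)))) \<partial>M) = (\<integral>\<^sup>+\<omega>. ennreal (of_bool (v < g (R \<omega>))) \<partial>M)"
      using nn_integral_fixed[of "\<lambda>x. ennreal (of_bool (v < g x))"] by simp
    also have "\<dots> = (\<integral>\<^sup>+\<omega>. indicator {\<omega>\<in>space M. v < g (R \<omega>)} \<omega> \<partial>M)"
      by (rule nn_integral_cong) (auto simp: indicator_def)
    also have "\<dots> = ennreal (prob {\<omega>\<in>space M. v < g (R \<omega>)})" by (simp add: emeasure_eq_measure)
    finally show "(\<integral>\<^sup>+\<omega>. ennreal (of_bool (v < g (fst (X \<omega>) + (\<Sum>j. summand j \<omega>)))) \<partial>M) = ennreal (prob {\<omega>\<in>space M. v < g (R \<omega>)})" .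
  qed auto
  have 2: "has_bochner_integral M (\<lambda>\<omega>. \<Sum>j. of_bool (v < g (summand j \<omega>)) :: real) (enn2real (mean_exceedances v))"
    using exceedances_integral[OF v, of "\<lambda>j. j"] by (simp add: summand_def)
  show ?thesis using has_bochner_integral_diff[OF 1 2] unfolding tail_excess_def by (simp add: has_bochner_integral_iff)
qed

definition tail_power_gap :: "'a \<Rightarrow> real" where
  "tail_power_gap \<omega> = g (fst (X \<omega>) + (\<Sum>j. summand j \<omega>)) powr \<alpha> - (\<Sum>j. g (summand j \<omega>) powr \<alpha>)"

text \<open>
  Fubini's theorem for the difference of indicators. It applies because the integral over the levels is bounded by the
  error of replacing the sum by its largest term, which has finite expectation.
\<close>

theorem tail_excess_integral:
  assumes "level_measure \<nu> lev \<alpha>"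
  shows "integrable \<nu> (\<lambda>s. tail_excess (lev s))" "integrable M tail_power_gap"
    "(\<integral>s. tail_excess (lev s) \<partial>\<nu>) = (\<integral>\<omega>. tail_power_gap \<omega> \<partial>M) / \<alpha>"
proof -
  interpret N: level_measure \<nu> lev \<alpha> by fact
  interpret G: level_gap b \<alpha> \<nu> lev g
    by (unfold_locales) (auto simp: g)
  interpret PM: pair_sigma_finite M \<nu> by unfold_locales
  define h where "h \<omega> s = of_bool (lev s < g (fst (X \<omega>) + (\<Sum>j. summand j \<omega>))) - (\<Sum>j. of_bool (lev s < g (summand j \<omega>)) :: real)" for \<omega> s
  have hm[measurable]: "case_prod h \<in> borel_measurable (M \<Otimes>\<^sub>M \<nu>)" unfolding h_def[abs_def] by measurable
  let ?E = "\<lambda>\<omega>. sum_error b \<alpha> (fst (X \<omega>)) (\<lambda>j. summand j \<omega>)"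
  have Em[measurable]: "(\<lambda>\<omega>. ?E \<omega>) \<in> borel_measurable M" unfolding sum_error_def cross_terms_def by measurable
  have gc: "0 \<le> gap_const" using N.p_pos by (simp add: gap_const_def)
  have "(\<integral>\<^sup>+\<omega>. (\<integral>\<^sup>+s. ennreal \<bar>h \<omega> s\<bar> \<partial>\<nu>) \<partial>M) \<le> (\<integral>\<^sup>+\<omega>. ennreal (gap_const / \<alpha>) * ennreal (?E \<omega>) \<partial>M)"
  proof (rule nn_integral_mono_AE)
    show "AE \<omega> in M. (\<integral>\<^sup>+s. ennreal \<bar>h \<omega> s\<bar> \<partial>\<nu>) \<le> ennreal (gap_const / \<alpha>) * ennreal (?E \<omega>)"
      using AE_summable_summands
    proof eventually_elim
      case (elim \<omega>)
      have "(\<integral>\<^sup>+s. ennreal \<bar>h \<omega> s\<bar> \<partial>\<nu>) \<le> ennreal (gap_const * ?E \<omega> / \<alpha>)"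
        unfolding h_def by (rule G.level_gap_bound[OF elim])
      also have "\<dots> = ennreal (gap_const / \<alpha>) * ennreal (?E \<omega>)"
        using gc N.p_pos by (simp add: ennreal_mult'[symmetric])
      finally show ?case .
    qed
  qed
  also have "\<dots> = ennreal (gap_const / \<alpha>) * (\<integral>\<^sup>+\<omega>. ennreal (?E \<omega>) \<partial>M)" by (rule nn_integral_cmult) measurable
  also have "\<dots> < \<infinity>" using error_moment_\<alpha> by (simp add: ennreal_mult_less_top)
  finally have fin: "(\<integral>\<^sup>+\<omega>. (\<integral>\<^sup>+s. ennreal \<bar>h \<omega> s\<bar> \<partial>\<nu>) \<partial>M) < \<infinity>" .
  have int: "integrable (M \<Otimes>\<^sub>M \<nu>) (case_prod h)"
  proof (rule integrableI_bounded[OF hm])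
    have "(\<integral>\<^sup>+x. ennreal (norm (case_prod h x)) \<partial>(M \<Otimes>\<^sub>M \<nu>)) = (\<integral>\<^sup>+\<omega>. (\<integral>\<^sup>+s. ennreal \<bar>h \<omega> s\<bar> \<partial>\<nu>) \<partial>M)"
      by (subst N.nn_integral_fst[symmetric]) auto
    then show "(\<integral>\<^sup>+x. ennreal (norm (case_prod h x)) \<partial>(M \<Otimes>\<^sub>M \<nu>)) < \<infinity>" using fin by simp
  qed
  have ex: "(\<integral>\<omega>. h \<omega> s \<partial>M) = tail_excess (lev s)" if "s \<in> space \<nu>" for s
    unfolding h_def using tail_excess_eq[OF N.level_pos[OF that]] by simp
  have "integrable \<nu> (\<lambda>s. \<integral>\<omega>. h \<omega> s \<partial>M)" using PM.integrable_snd[OF int] by simp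
  then show "integrable \<nu> (\<lambda>s. tail_excess (lev s))"
    by (rule Bochner_Integration.integrable_cong[THEN iffD1, rotated 2]) (auto simp: ex)
  have AEh: "AE \<omega> in M. (\<integral>s. h \<omega> s \<partial>\<nu>) = tail_power_gap \<omega> / \<alpha>"
    using AE_summable_summands
  proof eventually_elim
    case (elim \<omega>)
    then show ?case
      using G.level_gap_integral[OF elim, of "fst (X \<omega>)"] unfolding h_def tail_power_gap_def has_bochner_integral_iff by blast
  qed
  have [measurable]: "tail_power_gap \<in> borel_measurable M" unfolding tail_power_gap_def[abs_def] by measurable
  have i1: "integrable M (\<lambda>\<omega>. \<integral>s. h \<omega> s \<partial>\<nu>)" using PM.integrable_fst[OF int] by simp
  have "integrable M (\<lambda>\<omega>. tail_power_gap \<omega> / \<alpha>)"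
    by (rule integrable_cong_AE[THEN iffD1, OF _ _ AEh i1]) (use i1 in auto)
  then have "integrable M (\<lambda>\<omega>. \<alpha> * (tail_power_gap \<omega> / \<alpha>))" by (rule integrable_mult_right)
  then show "integrable M tail_power_gap" using N.p_pos by simp
  have "(\<integral>s. tail_excess (lev s) \<partial>\<nu>) = (\<integral>s. (\<integral>\<omega>. h \<omega> s \<partial>M) \<partial>\<nu>)"
    by (rule Bochner_Integration.integral_cong) (auto simp: ex)
  also have "\<dots> = (\<integral>\<omega>. (\<integral>s. h \<omega> s \<partial>\<nu>) \<partial>M)" by (rule PM.Fubini_integral[OF int])
  also have "\<dots> = (\<integral>\<omega>. tail_power_gap \<omega> / \<alpha> \<partial>M)"
    by (rule integral_cong_AE) (use AEh i1 in auto)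
  finally show "(\<integral>s. tail_excess (lev s) \<partial>\<nu>) = (\<integral>\<omega>. tail_power_gap \<omega> \<partial>M) / \<alpha>" by simp
qed

end

section \<open>The biased choice of a child\<close>

text \<open>
  The density biases the choice of the child \<open>j\<close>; it turns the product with a counting measure into a
  probability measure if \<open>E[\<Sum>\<^sub>j \<bar>w\<^sub>j\<bar>\<^sup>\<alpha>] = 1\<close>.
\<close>

definition step_space :: "'a measure \<Rightarrow> ('a \<Rightarrow> wvec) \<Rightarrow> real \<Rightarrow> ('a \<times> nat) measure" where
  "step_space M X \<alpha> = density (M \<Otimes>\<^sub>M count_space UNIV) (\<lambda>(\<omega>, j). ennreal (\<bar>weight (X \<omega>) j\<bar> powr \<alpha>))"

definition step :: "('a \<Rightarrow> wvec) \<Rightarrow> 'a \<times> nat \<Rightarrow> real" where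
  "step X = (\<lambda>(\<omega>, j). ln \<bar>weight (X \<omega>) j\<bar>)"

definition step_sign :: "('a \<Rightarrow> wvec) \<Rightarrow> 'a \<times> nat \<Rightarrow> real" where
  "step_sign X = (\<lambda>(\<omega>, j). if weight (X \<omega>) j < 0 then - 1 else 1)"

context
  fixes M :: "'a measure" and X :: "'a \<Rightarrow> wvec" and \<alpha> :: real
  assumes X[measurable]: "X \<in> measurable M vec_space"
begin

lemma measurable_pair_nat:
  assumes "\<And>j. (\<lambda>\<omega>. f (\<omega>, j)) \<in> measurable M K"
  shows "f \<in> measurable (M \<Otimes>\<^sub>M count_space (UNIV :: nat set)) K"
  using measurable_case_prod_count_space[of UNIV "\<lambda>\<omega> j. f (\<omega>, j)" M K] assms by simp

lemma measurable_weight_comp[measurable]: "(\<lambda>\<omega>. weight (X \<omega>) j) \<in> borel_measurable M"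
  by (rule measurable_compose[OF X measurable_weight])

lemma sets_step_space[measurable_cong]: "sets (step_space M X \<alpha>) = sets (M \<Otimes>\<^sub>M count_space UNIV)"
  by (simp add: step_space_def)

lemma measurable_step[measurable]: "step X \<in> borel_measurable (M \<Otimes>\<^sub>M count_space UNIV)"
  by (rule measurable_pair_nat) (simp add: step_def)

lemma measurable_step_sign[measurable]: "step_sign X \<in> borel_measurable (M \<Otimes>\<^sub>M count_space UNIV)"
  by (rule measurable_pair_nat) (simp add: step_sign_def)

lemma nn_integral_step_space:
  assumes F[measurable]: "F \<in> borel_measurable (M \<Otimes>\<^sub>M count_space UNIV)"
  shows "(\<integral>\<^sup>+p. F p \<partial>step_space M X \<alpha>) = (\<integral>\<^sup>+\<omega>. (\<Sum>j. ennreal (\<bar>weight (X \<omega>) j\<bar> powr \<alpha>) * F (\<omega>, j)) \<partial>M)"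
proof -
  have d[measurable]: "(\<lambda>(\<omega>, j). ennreal (\<bar>weight (X \<omega>) j\<bar> powr \<alpha>)) \<in> borel_measurable (M \<Otimes>\<^sub>M count_space UNIV)"
    unfolding case_prod_unfold by measurable
  have "(\<integral>\<^sup>+p. F p \<partial>step_space M X \<alpha>)
      = (\<integral>\<^sup>+p. (case p of (\<omega>, j) \<Rightarrow> ennreal (\<bar>weight (X \<omega>) j\<bar> powr \<alpha>)) * F p \<partial>(M \<Otimes>\<^sub>M count_space UNIV))"
    unfolding step_space_def by (rule nn_integral_density[OF d F])
  also have "\<dots> = (\<integral>\<^sup>+\<omega>. (\<integral>\<^sup>+j. ennreal (\<bar>weight (X \<omega>) j\<bar> powr \<alpha>) * F (\<omega>, j) \<partial>count_space UNIV) \<partial>M)"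
    using sigma_finite_measure.nn_integral_fst[OF sigma_finite_measure_count_space_countable[OF countableI_type],
      of "\<lambda>p. (case p of (\<omega>, j) \<Rightarrow> ennreal (\<bar>weight (X \<omega>) j\<bar> powr \<alpha>)) * F p" M] by simp
  also have "\<dots> = (\<integral>\<^sup>+\<omega>. (\<Sum>j. ennreal (\<bar>weight (X \<omega>) j\<bar> powr \<alpha>) * F (\<omega>, j)) \<partial>M)"
    by (intro nn_integral_cong nn_integral_count_space_nat)
  finally show ?thesis .
qed

text \<open>
  Children of weight \<open>0\<close> carry no mass.
\<close>

lemma AE_step_space:
  assumes "sigma_finite_measure M" "Measurable.pred (M \<Otimes>\<^sub>M count_space UNIV) P"
  shows "(AE p in step_space M X \<alpha>. P p) \<longleftrightarrow> (AE \<omega> in M. \<forall>j. weight (X \<omega>) j \<noteq> 0 \<longrightarrow> P (\<omega>, j))"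
proof -
  interpret N: sigma_finite_measure "count_space (UNIV :: nat set)"
    by (rule sigma_finite_measure_count_space_countable) simp
  interpret M: sigma_finite_measure M by fact
  interpret pair_sigma_finite M "count_space (UNIV :: nat set)" ..
  have [measurable]: "Measurable.pred (M \<Otimes>\<^sub>M count_space UNIV) P" by fact
  have [measurable]: "(\<lambda>(\<omega>, j). ennreal (\<bar>weight (X \<omega>) j\<bar> powr \<alpha>)) \<in> borel_measurable (M \<Otimes>\<^sub>M count_space UNIV)"
    unfolding case_prod_unfold by measurable
  have "(AE p in step_space M X \<alpha>. P p) \<longleftrightarrow>
      (AE p in M \<Otimes>\<^sub>M count_space UNIV. weight (X (fst p)) (snd p) \<noteq> 0 \<longrightarrow> P p)"
    unfolding step_space_def by (subst AE_density) (auto simp: case_prod_unfold powr_def)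
  also have "\<dots> \<longleftrightarrow> (AE \<omega> in M. AE j in count_space UNIV. weight (X \<omega>) j \<noteq> 0 \<longrightarrow> P (\<omega>, j))"
    using AE_pair_iff[of "\<lambda>\<omega> j. weight (X \<omega>) j \<noteq> 0 \<longrightarrow> P (\<omega>, j)"] by simp
  finally show ?thesis by (simp add: AE_count_space)
qed

end

lemma level_measure_exp:
  assumes "0 < \<alpha>"
  shows "level_measure (density lborel (\<lambda>t. ennreal (exp (\<alpha> * t)))) exp \<alpha>"
proof -
  interpret sigma_finite_measure "density lborel (\<lambda>t. ennreal (exp (\<alpha> * t)))"
    using sigma_finite_measure.sigma_finite_iff_density_finite'[OF lborel.sigma_finite_measure_axioms,
      of "\<lambda>t. ennreal (exp (\<alpha> * t))"] by simp
  show ?thesis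
  proof
    fix x :: real assume x: "0 \<le> x"
    show "emeasure (density lborel (\<lambda>t. ennreal (exp (\<alpha> * t)))) {s \<in> space (density lborel (\<lambda>t. ennreal (exp (\<alpha> * t)))). exp s < x}
        = ennreal (x powr \<alpha> / \<alpha>)"
    proof (cases "x = 0")
      case False
      then have "x > 0" using x by simp
      have "exp s < x \<longleftrightarrow> s < ln x" for s using exp_less_cancel_iff[of s "ln x"] \<open>x > 0\<close> by simp
      then have e: "{s. exp s < x} = {..<ln x}" by auto
      have "emeasure (density lborel (\<lambda>t. ennreal (exp (\<alpha> * t)))) {..<ln x}
          = (\<integral>\<^sup>+s. ennreal (exp (\<alpha> * s)) * indicator {..<ln x} s \<partial>lborel)"
        by (subst emeasure_density) auto
      also have "\<dots> = (\<integral>\<^sup>+s. ennreal (exp (\<alpha> * s)) * indicator {..ln x} s \<partial>lborel)"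
        by (rule nn_integral_cong_AE) (use AE_lborel_singleton[of "ln x"] in \<open>auto elim!: eventually_mono simp: indicator_def\<close>)
      also have "\<dots> = ennreal (exp (\<alpha> * ln x) / \<alpha>)" by (rule nn_integral_exp_atMost[OF assms])
      also have "exp (\<alpha> * ln x) = x powr \<alpha>" using \<open>x > 0\<close> by (simp add: powr_def)
      finally show ?thesis by (simp add: e)
    qed (simp add: not_less[THEN iffD2, OF less_imp_le[OF exp_gt_zero]])
  qed (use assms in auto)
qed

lemma level_measure_powr:
  assumes "0 < \<alpha>"
  shows "level_measure (density (restrict_space lborel {0<..}) (\<lambda>v. ennreal (v powr (\<alpha> - 1)))) (\<lambda>v. v) \<alpha>"
proof -
  interpret R: sigma_finite_measure "restrict_space lborel {0::real<..}"
    by (rule sigma_finite_measure_restrict_space) (auto intro: lborel.sigma_finite_measure_axioms)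
  have m[measurable]: "(\<lambda>v. v powr (\<alpha> - 1)) \<in> borel_measurable (restrict_space lborel {0<..})"
    by (rule measurable_restrict_space1) measurable
  interpret sigma_finite_measure "density (restrict_space lborel {0<..}) (\<lambda>v. ennreal (v powr (\<alpha> - 1)))"
    using R.sigma_finite_iff_density_finite'[of "\<lambda>v. ennreal (v powr (\<alpha> - 1))"] by simp
  show ?thesis
  proof
    fix x :: real assume x: "0 \<le> x"
    have "emeasure (density (restrict_space lborel {0<..}) (\<lambda>v. ennreal (v powr (\<alpha> - 1)))) {0<..<x}
        = (\<integral>\<^sup>+v. ennreal (v powr (\<alpha> - 1)) * indicator {0<..<x} v \<partial>restrict_space lborel {0<..})"
      by (subst emeasure_density) (auto simp: sets_restrict_space_iff)
    also have "\<dots> = (\<integral>\<^sup>+v. ennreal (v powr (\<alpha> - 1)) * indicator {0<..<x} v * indicator {0<..} v \<partial>lborel)"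
      by (subst nn_integral_restrict_space) auto
    also have "\<dots> = (\<integral>\<^sup>+v. ennreal (v powr (\<alpha> - 1)) * indicator {0..x} v \<partial>lborel)"
      by (rule nn_integral_cong_AE)
        (use AE_lborel_singleton[of x] AE_lborel_singleton[of "0::real"] in \<open>eventually_elim, auto simp: indicator_def\<close>)
    also have "\<dots> = (\<integral>\<^sup>+v. ennreal (indicator {0..x} v * v powr (\<alpha> - 1)) \<partial>lborel)"
      by (intro nn_integral_cong) (auto simp: indicator_def)
    also have "\<dots> = ennreal (x powr \<alpha> / \<alpha>)"
    proof (rule nn_integral_has_integral_lborel)
      have "((\<lambda>v. v powr (\<alpha> - 1)) has_integral x powr \<alpha> / \<alpha>) {0..x}"
        using has_integral_powr_from_0[of "\<alpha> - 1" x] assms x by simp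
      then have "((\<lambda>v. if v \<in> {0..x} then v powr (\<alpha> - 1) else 0) has_integral x powr \<alpha> / \<alpha>) UNIV"
        by (simp only: has_integral_restrict_UNIV)
      moreover have "(\<lambda>v. if v \<in> {0..x} then v powr (\<alpha> - 1) else 0) = (\<lambda>v. indicator {0..x} v * v powr (\<alpha> - 1))"
        by (auto simp: indicator_def)
      ultimately show "((\<lambda>v. indicator {0..x} v * v powr (\<alpha> - 1)) has_integral x powr \<alpha> / \<alpha>) UNIV"
        by (simp only:)
    qed auto
    finally show "emeasure (density (restrict_space lborel {0<..}) (\<lambda>v. ennreal (v powr (\<alpha> - 1))))
        {s \<in> space (density (restrict_space lborel {0<..}) (\<lambda>v. ennreal (v powr (\<alpha> - 1)))). s < x} = ennreal (x powr \<alpha> / \<alpha>)"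
      by (simp add: space_restrict_space greaterThanLessThan_def greaterThan_def lessThan_def Int_def)
  qed (use assms in \<open>auto simp: space_restrict_space intro: measurable_restrict_space1\<close>)
qed

section \<open>Exponential moments and drift of the step\<close>

text \<open>
  Bernoulli's inequality for \<open>exp (- \<theta> y / (n + 1))\<close>; it says that the difference quotients of a convex
  function are monotone.
\<close>

lemma one_minus_exp_quotient_mono:
  fixes \<theta> y :: real
  assumes "0 < \<theta>"
  shows "(1 - exp (- \<theta> * y)) / \<theta> \<le> (1 - exp (- (\<theta> / real (Suc n)) * y)) / (\<theta> / real (Suc n))"
proof -
  define u where "u = exp (- (\<theta> / real (Suc n)) * y)"
  have u: "exp (- \<theta> * y) = u ^ Suc n"
    unfolding u_def exp_of_nat_mult[symmetric] by simp
  have "- 1 \<le> u - 1" by (simp add: u_def)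
  from Bernoulli_inequality[OF this, of "Suc n"]
  have "1 + real (Suc n) * (u - 1) \<le> u ^ Suc n" by simp
  then have "(1 - u ^ Suc n) / \<theta> \<le> (real (Suc n) * (1 - u)) / \<theta>"
    using assms by (intro divide_right_mono) (auto simp: algebra_simps)
  then show ?thesis unfolding u u_def[symmetric] using assms by (simp add: field_simps)
qed

lemma one_minus_exp_quotient_tendsto:
  fixes \<theta> y :: real
  assumes "0 < \<theta>"
  shows "(\<lambda>n. (1 - exp (- (\<theta> / real (Suc n)) * y)) / (\<theta> / real (Suc n))) \<longlonglongrightarrow> y"
proof (cases "y = 0")
  case False
  define z where "z n = - (\<theta> / real (Suc n)) * y" for n
  have "z \<longlonglongrightarrow> 0" unfolding z_def[abs_def] by real_asymp
  moreover have "z n \<noteq> 0" for n using assms False by (simp add: z_def)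
  ultimately have "filterlim z (at 0) sequentially" by (simp add: filterlim_at)
  then have "(\<lambda>n. (exp (z n) - 1) / z n) \<longlonglongrightarrow> 1" by (rule filterlim_compose[OF lim_exp_minus_1])
  then have "(\<lambda>n. y * ((exp (z n) - 1) / z n)) \<longlonglongrightarrow> y * 1" by (intro tendsto_mult tendsto_const)
  moreover have "y * ((exp (z n) - 1) / z n) = (1 - exp (- (\<theta> / real (Suc n)) * y)) / (\<theta> / real (Suc n))" for n
    using assms False unfolding z_def by (simp add: field_simps)
  ultimately show ?thesis by simp
qed simp

text \<open>
  Otherwise all quotients \<open>(1 - E[exp (- \<theta>' Y)]) / \<theta>'\<close> are nonpositive. They increase to \<open>Y\<close> inside the
  expectation as \<open>\<theta>' \<rightarrow> 0\<close>, so Fatou's lemma yields integrability of \<open>Y\<close> and \<open>E Y \<le> 0\<close>.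
\<close>

lemma (in prob_space) exists_exp_moment_less_1:
  assumes Y[measurable]: "Y \<in> borel_measurable M" and \<theta>: "0 < \<theta>"
    and fin: "(\<integral>\<^sup>+\<omega>. ennreal (exp (- \<theta> * Y \<omega>)) \<partial>M) < \<infinity>"
    and drift: "\<not> (integrable M Y \<and> expectation Y \<le> 0)"
  shows "\<exists>\<theta>'. 0 < \<theta>' \<and> \<theta>' \<le> \<theta> \<and> (\<integral>\<^sup>+\<omega>. ennreal (exp (- \<theta>' * Y \<omega>)) \<partial>M) < 1"
proof (rule ccontr)
  assume no: "\<not> ?thesis"
  \<comment> \<open>Along \<open>\<theta> / (n + 1)\<close> the monotonicity of the difference quotients follows from Bernoulli's inequality.\<close>
  define \<tau> where "\<tau> n = \<theta> / real (Suc n)" for n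
  define f where "f n \<omega> = (1 - exp (- \<tau> n * Y \<omega>)) / \<tau> n" for n \<omega>
  have \<tau>: "0 < \<tau> n" "\<tau> n \<le> \<theta>" for n using \<theta> by (auto simp: \<tau>_def field_simps)
  have \<tau>0: "\<tau> 0 = \<theta>" by (simp add: \<tau>_def)
  have i0: "integrable M (\<lambda>\<omega>. exp (- \<theta> * Y \<omega>))" by (rule integrableI_nonneg) (use fin in auto)
  have ie: "integrable M (\<lambda>\<omega>. exp (- \<tau> n * Y \<omega>))" for n
  proof (rule Bochner_Integration.integrable_bound[of M "\<lambda>\<omega>. 1 + exp (- \<theta> * Y \<omega>)"])
    have "exp (- \<tau> n * y) \<le> 1 + exp (- \<theta> * y)" for y
    proof (cases "0 \<le> y")
      case True
      then have "exp (- \<tau> n * y) \<le> 1" using \<tau>(1)[of n] by simp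
      then show ?thesis by (smt (verit) exp_gt_zero)
    next
      case False
      then have "exp (- \<tau> n * y) \<le> exp (- \<theta> * y)" using \<tau>(2)[of n]
        by (simp only: exp_le_cancel_iff) (auto intro: mult_right_mono_neg)
      then show ?thesis by (rule order_trans) simp
    qed
    then show "AE \<omega> in M. norm (exp (- \<tau> n * Y \<omega>)) \<le> norm (1 + exp (- \<theta> * Y \<omega>))" by (simp add: abs_of_pos add_pos_pos)
  qed (use i0 in auto)
  have if': "integrable M (f n)" for n unfolding f_def using ie by simp
  have fneg: "expectation (f n) \<le> 0" for n
  proof -
    have "1 \<le> (\<integral>\<^sup>+\<omega>. ennreal (exp (- \<tau> n * Y \<omega>)) \<partial>M)" using no \<tau>[of n] by (meson not_le)
    also have "\<dots> = ennreal (expectation (\<lambda>\<omega>. exp (- \<tau> n * Y \<omega>)))" by (rule nn_integral_eq_integral[OF ie]) simp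
    finally have "1 \<le> expectation (\<lambda>\<omega>. exp (- \<tau> n * Y \<omega>))" by simp
    moreover have "expectation (f n) = (1 - expectation (\<lambda>\<omega>. exp (- \<tau> n * Y \<omega>))) / \<tau> n"
      unfolding f_def using ie[of n] by (simp add: Bochner_Integration.integral_diff prob_space)
    ultimately show ?thesis using \<tau>(1)[of n] by (simp add: divide_nonpos_pos)
  qed
  have mono: "f 0 \<omega> \<le> f n \<omega>" for n \<omega>
    unfolding f_def \<tau>0 unfolding \<tau>_def by (rule one_minus_exp_quotient_mono[OF \<theta>])
  have lim: "(\<lambda>n. f n \<omega>) \<longlonglongrightarrow> Y \<omega>" for \<omega>
    unfolding f_def \<tau>_def by (rule one_minus_exp_quotient_tendsto[OF \<theta>])
  have "f 0 \<omega> \<le> Y \<omega>" for \<omega> by (rule LIMSEQ_le_const[OF lim]) (use mono in auto)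
  note f0Y = this
  have [measurable]: "f n \<in> borel_measurable M" for n using if' by auto
  have "(\<integral>\<^sup>+\<omega>. ennreal (Y \<omega> - f 0 \<omega>) \<partial>M) = (\<integral>\<^sup>+\<omega>. liminf (\<lambda>n. ennreal (f n \<omega> - f 0 \<omega>)) \<partial>M)"
    by (intro nn_integral_cong lim_imp_Liminf[symmetric] tendsto_ennrealI tendsto_diff tendsto_const lim) simp
  also have "\<dots> \<le> liminf (\<lambda>n. \<integral>\<^sup>+\<omega>. ennreal (f n \<omega> - f 0 \<omega>) \<partial>M)"
    by (rule nn_integral_liminf) measurable
  also have "\<dots> \<le> liminf (\<lambda>n. ennreal (- expectation (f 0)))"
  proof (intro Liminf_mono always_eventually allI)
    fix n
    have "(\<integral>\<^sup>+\<omega>. ennreal (f n \<omega> - f 0 \<omega>) \<partial>M) = ennreal (expectation (\<lambda>\<omega>. f n \<omega> - f 0 \<omega>))"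
      by (rule nn_integral_eq_integral) (use if' mono in auto)
    also have "\<dots> = ennreal (expectation (f n) - expectation (f 0))" using if' by (simp add: Bochner_Integration.integral_diff)
    also have "\<dots> \<le> ennreal (- expectation (f 0))" using fneg[of n] by (intro ennreal_leI) simp
    finally show "(\<integral>\<^sup>+\<omega>. ennreal (f n \<omega> - f 0 \<omega>) \<partial>M) \<le> ennreal (- expectation (f 0))" .
  qed
  also have "\<dots> = ennreal (- expectation (f 0))" by (rule Liminf_const) simp
  finally have le: "(\<integral>\<^sup>+\<omega>. ennreal (Y \<omega> - f 0 \<omega>) \<partial>M) \<le> ennreal (- expectation (f 0))" .
  have iD: "integrable M (\<lambda>\<omega>. Y \<omega> - f 0 \<omega>)"
    by (rule integrableI_nonneg) (use f0Y le_less_trans[OF le] in auto)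
  then have "integrable M (\<lambda>\<omega>. (Y \<omega> - f 0 \<omega>) + f 0 \<omega>)" using if' by (rule Bochner_Integration.integrable_add)
  then have iY: "integrable M Y" by simp
  have "ennreal (expectation (\<lambda>\<omega>. Y \<omega> - f 0 \<omega>)) \<le> ennreal (- expectation (f 0))"
    using le nn_integral_eq_integral[OF iD] f0Y by simp
  then have "expectation (\<lambda>\<omega>. Y \<omega> - f 0 \<omega>) \<le> - expectation (f 0)" using fneg[of 0] by simp
  then have "expectation Y \<le> 0" using iY if' by (simp add: Bochner_Integration.integral_diff)
  then show False using iY drift by blast
qed

lemma (in prob_space) ext_expectation_pos_cases:
  assumes [measurable]: "Y \<in> borel_measurable M"
    and neg: "(\<integral>\<^sup>+\<omega>. ennreal (- Y \<omega>) \<partial>M) < \<infinity>" and pos: "0 < ext_expectation M Y"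
  shows "ext_expectation M Y = \<infinity> \<Longrightarrow> (\<integral>\<^sup>+\<omega>. ennreal (Y \<omega>) \<partial>M) = \<infinity> \<and> \<not> integrable M Y"
    and "ext_expectation M Y \<noteq> \<infinity> \<Longrightarrow> integrable M Y \<and> ext_expectation M Y = ereal (expectation Y) \<and> 0 < expectation Y"
proof -
  have fin: "integrable M Y \<and> ext_expectation M Y = ereal (expectation Y)" if p: "(\<integral>\<^sup>+\<omega>. ennreal (Y \<omega>) \<partial>M) \<noteq> \<infinity>"
  proof -
    have i: "integrable M Y" using p neg by (auto simp: real_integrable_def)
    obtain p where "(\<integral>\<^sup>+\<omega>. ennreal (Y \<omega>) \<partial>M) = ennreal p" "0 \<le> p"
      using p by (cases "\<integral>\<^sup>+\<omega>. ennreal (Y \<omega>) \<partial>M") auto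
    moreover obtain n where "(\<integral>\<^sup>+\<omega>. ennreal (- Y \<omega>) \<partial>M) = ennreal n" "0 \<le> n"
      using neg by (cases "\<integral>\<^sup>+\<omega>. ennreal (- Y \<omega>) \<partial>M") auto
    ultimately show ?thesis using i real_lebesgue_integral_def[OF i] by (simp add: ext_expectation_def)
  qed
  have inf: "ext_expectation M Y = \<infinity> \<and> \<not> integrable M Y" if "(\<integral>\<^sup>+\<omega>. ennreal (Y \<omega>) \<partial>M) = \<infinity>"
  proof -
    have "\<not> integrable M Y" using that by (auto simp: real_integrable_def)
    then show ?thesis using that by (simp add: ext_expectation_def)
  qed
  show "ext_expectation M Y = \<infinity> \<Longrightarrow> (\<integral>\<^sup>+\<omega>. ennreal (Y \<omega>) \<partial>M) = \<infinity> \<and> \<not> integrable M Y"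
    using fin inf by fastforce
  show "ext_expectation M Y \<noteq> \<infinity> \<Longrightarrow> integrable M Y \<and> ext_expectation M Y = ereal (expectation Y) \<and> 0 < expectation Y"
    using fin inf pos by (cases "(\<integral>\<^sup>+\<omega>. ennreal (Y \<omega>) \<partial>M) = \<infinity>") auto
qed

text \<open>
  All but finitely many weights are below \<open>1\<close>, where \<open>\<bar>ln x\<bar> \<le> x powr (\<beta> - \<alpha>) / (\<alpha> - \<beta>)\<close>.
\<close>

lemma summable_imp_summable_log:
  fixes w :: "nat \<Rightarrow> real"
  assumes s: "summable (\<lambda>j. \<bar>w j\<bar> powr \<beta>)" and b: "0 < \<beta>" "\<beta> < \<alpha>"
  shows "summable (\<lambda>j. \<bar>w j\<bar> powr \<alpha> * \<bar>ln \<bar>w j\<bar>\<bar>)"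
proof -
  have "(\<lambda>j. \<bar>w j\<bar> powr \<beta>) \<longlonglongrightarrow> 0" by (rule summable_LIMSEQ_zero[OF s])
  then have "\<forall>\<^sub>F j in sequentially. \<bar>w j\<bar> powr \<beta> < 1" by (rule order_tendstoD) simp
  then obtain n0 where n0: "\<And>j. n0 \<le> j \<Longrightarrow> \<bar>w j\<bar> powr \<beta> < 1" by (auto simp: eventually_sequentially)
  show ?thesis
  proof (rule summable_comparison_test'[of "\<lambda>j. \<bar>w j\<bar> powr \<beta> / (\<alpha> - \<beta>)" n0])
    show "summable (\<lambda>j. \<bar>w j\<bar> powr \<beta> / (\<alpha> - \<beta>))" by (rule summable_divide[OF s])
    fix j assume "n0 \<le> j"
    then have "\<bar>w j\<bar> powr \<beta> < 1" by (rule n0)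
    then have w1: "\<bar>w j\<bar> < 1" using b by (metis abs_ge_zero ge_one_powr_ge_zero less_imp_le not_less)
    show "norm (\<bar>w j\<bar> powr \<alpha> * \<bar>ln \<bar>w j\<bar>\<bar>) \<le> \<bar>w j\<bar> powr \<beta> / (\<alpha> - \<beta>)"
    proof (cases "w j = 0")
      case False
      define x where "x = - ln \<bar>w j\<bar>"
      have x0: "0 \<le> x" using w1 False by (simp add: x_def)
      have "(\<alpha> - \<beta>) * x \<le> exp ((\<alpha> - \<beta>) * x)" using exp_ge_add_one_self[of "(\<alpha> - \<beta>) * x"] by linarith
      then have "exp (- \<alpha> * x) * x \<le> exp (- \<alpha> * x) * (exp ((\<alpha> - \<beta>) * x) / (\<alpha> - \<beta>))"
        using b by (intro mult_left_mono) (auto simp: field_simps)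
      also have "\<dots> = exp (- \<beta> * x) / (\<alpha> - \<beta>)" by (simp add: exp_add[symmetric] algebra_simps)
      finally have "exp (- \<alpha> * x) * x \<le> exp (- \<beta> * x) / (\<alpha> - \<beta>)" .
      moreover have "\<bar>ln \<bar>w j\<bar>\<bar> = x" using x0 by (simp add: x_def)
      ultimately show ?thesis using False by (simp add: powr_def abs_mult) (simp add: x_def)
    qed (use b in simp)
  qed
qed

locale weight_vector = prob_space M for M :: "'a measure" +
  fixes X :: "'a \<Rightarrow> wvec" and \<alpha> \<beta> :: real
  assumes X_measurable[measurable]: "X \<in> measurable M vec_space"
    and \<beta>_pos: "0 < \<beta>" and \<beta>_less: "\<beta> < \<alpha>"
    and weights_\<alpha>: "(\<integral>\<^sup>+\<omega>. (\<Sum>j. ennreal (\<bar>weight (X \<omega>) j\<bar> powr \<alpha>)) \<partial>M) = 1"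
    and weights_\<beta>: "(\<integral>\<^sup>+\<omega>. (\<Sum>j. ennreal (\<bar>weight (X \<omega>) j\<bar> powr \<beta>)) \<partial>M) < \<infinity>"
begin

lemma measurable_weight_vector[measurable]: "(\<lambda>\<omega>. weight (X \<omega>) j) \<in> borel_measurable M"
  by (rule measurable_weight_comp[OF X_measurable])

lemma measurable_step_vector:
  "step X \<in> borel_measurable (M \<Otimes>\<^sub>M count_space UNIV)" "step X \<in> borel_measurable (step_space M X \<alpha>)"
  using measurable_step[OF X_measurable] by (auto simp: measurable_cong_sets[OF sets_step_space refl])

sublocale S: prob_space "step_space M X \<alpha>"
proof
  have "emeasure (step_space M X \<alpha>) (space (step_space M X \<alpha>)) = (\<integral>\<^sup>+p. 1 \<partial>step_space M X \<alpha>)" by simp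
  also have "\<dots> = 1" by (subst nn_integral_step_space[OF X_measurable]) (auto simp: weights_\<alpha>)
  finally show "emeasure (step_space M X \<alpha>) (space (step_space M X \<alpha>)) = 1" .
qed

lemma step_exp_moment:
  "(\<integral>\<^sup>+p. ennreal (exp (- (\<alpha> - b) * step X p)) \<partial>step_space M X \<alpha>)
    = (\<integral>\<^sup>+\<omega>. (\<Sum>j. ennreal (\<bar>weight (X \<omega>) j\<bar> powr b)) \<partial>M)"
proof -
  note [measurable] = measurable_step_vector(1)
  have "(\<integral>\<^sup>+p. ennreal (exp (- (\<alpha> - b) * step X p)) \<partial>step_space M X \<alpha>)
    = (\<integral>\<^sup>+\<omega>. (\<Sum>j. ennreal (\<bar>weight (X \<omega>) j\<bar> powr \<alpha>) * ennreal (exp (- (\<alpha> - b) * step X (\<omega>, j)))) \<partial>M)"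
    by (rule nn_integral_step_space[OF X_measurable]) measurable
  also have "\<dots> = (\<integral>\<^sup>+\<omega>. (\<Sum>j. ennreal (\<bar>weight (X \<omega>) j\<bar> powr b)) \<partial>M)"
  proof (intro nn_integral_cong suminf_cong)
    fix \<omega> j
    have "\<bar>w\<bar> powr \<alpha> * exp (- (\<alpha> - b) * ln \<bar>w\<bar>) = \<bar>w\<bar> powr b" for w :: real
      by (cases "w = 0") (auto simp: powr_def exp_add[symmetric] algebra_simps)
    then show "ennreal (\<bar>weight (X \<omega>) j\<bar> powr \<alpha>) * ennreal (exp (- (\<alpha> - b) * step X (\<omega>, j))) = ennreal (\<bar>weight (X \<omega>) j\<bar> powr b)"
      by (simp add: step_def ennreal_mult[symmetric])
  qed
  finally show ?thesis .
qed

lemma step_neg_part_finite: "(\<integral>\<^sup>+p. ennreal (- step X p) \<partial>step_space M X \<alpha>) < \<infinity>"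
proof -
  note [measurable] = measurable_step_vector(2)
  define \<theta> where "\<theta> = \<alpha> - \<beta>"
  have \<theta>: "0 < \<theta>" using \<beta>_less by (simp add: \<theta>_def)
  have "(\<integral>\<^sup>+p. ennreal (- step X p) \<partial>step_space M X \<alpha>)
      \<le> (\<integral>\<^sup>+p. ennreal (1 / \<theta>) * ennreal (exp (- \<theta> * step X p)) \<partial>step_space M X \<alpha>)"
  proof (intro nn_integral_mono)
    fix p
    have "- \<theta> * step X p \<le> exp (- \<theta> * step X p)" using exp_ge_add_one_self[of "- \<theta> * step X p"] by linarith
    then have "- step X p \<le> 1 / \<theta> * exp (- \<theta> * step X p)" using \<theta> by (simp add: field_simps)
    then show "ennreal (- step X p) \<le> ennreal (1 / \<theta>) * ennreal (exp (- \<theta> * step X p))"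
      using \<theta> by (simp add: ennreal_mult[symmetric] ennreal_leI)
  qed
  also have "\<dots> = ennreal (1 / \<theta>) * (\<integral>\<^sup>+p. ennreal (exp (- \<theta> * step X p)) \<partial>step_space M X \<alpha>)"
    by (rule nn_integral_cmult) measurable
  also have "\<dots> < \<infinity>" using weights_\<beta> unfolding \<theta>_def step_exp_moment by (simp add: ennreal_mult_less_top)
  finally show ?thesis .
qed

lemma AE_summable_weights_\<beta>: "AE \<omega> in M. summable (\<lambda>j. \<bar>weight (X \<omega>) j\<bar> powr \<beta>)"
proof -
  have "AE \<omega> in M. (\<Sum>j. ennreal (\<bar>weight (X \<omega>) j\<bar> powr \<beta>)) \<noteq> \<infinity>"
    by (rule nn_integral_noteq_infinite) (use weights_\<beta> in auto)
  then show ?thesis by eventually_elim (rule summable_suminf_not_top, auto)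
qed

text \<open>
  The sum over the children may have infinite positive part in mean, so linearity of the integral is not
  available. Positive and negative parts of the individual terms are summed separately; the negative ones are integrable, and
  cancellation within the sum changes both parts by the same finite amount.
\<close>

lemma ext_expectation_log_sum:
  "ext_expectation M (\<lambda>\<omega>. \<Sum>j. \<bar>weight (X \<omega>) j\<bar> powr \<alpha> * ln \<bar>weight (X \<omega>) j\<bar>)
    = ext_expectation (step_space M X \<alpha>) (step X)"
proof -
  note [measurable] = measurable_step_vector
  let ?w = "\<lambda>\<omega> j. weight (X \<omega>) j"
  let ?a = "\<lambda>\<omega> j. \<bar>?w \<omega> j\<bar> powr \<alpha> * ln \<bar>?w \<omega> j\<bar>"
  let ?L = "\<lambda>\<omega>. \<Sum>j. ?a \<omega> j"
  define P where "P \<omega> = (\<Sum>j. ennreal (?a \<omega> j))" for \<omega>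
  define n where "n \<omega> = (\<Sum>j. ennreal (- ?a \<omega> j))" for \<omega>
  have [measurable]: "P \<in> borel_measurable M" "n \<in> borel_measurable M" unfolding P_def[abs_def] n_def[abs_def] by measurable
  have SP: "(\<integral>\<^sup>+p. ennreal (step X p) \<partial>step_space M X \<alpha>) = (\<integral>\<^sup>+\<omega>. P \<omega> \<partial>M)"
    unfolding P_def by (subst nn_integral_step_space[OF X_measurable]) (auto simp: step_def ennreal_mult'[symmetric])
  have Sn: "(\<integral>\<^sup>+p. ennreal (- step X p) \<partial>step_space M X \<alpha>) = (\<integral>\<^sup>+\<omega>. n \<omega> \<partial>M)"
    unfolding n_def by (subst nn_integral_step_space[OF X_measurable]) (auto simp: step_def ennreal_mult'[symmetric])
  have nfin: "(\<integral>\<^sup>+\<omega>. n \<omega> \<partial>M) < \<infinity>" using step_neg_part_finite by (simp add: Sn)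
  have bal: "AE \<omega> in M. ennreal (?L \<omega>) + n \<omega> = P \<omega> + ennreal (- ?L \<omega>) \<and> ennreal (- ?L \<omega>) \<le> n \<omega> \<and> ennreal (?L \<omega>) \<le> P \<omega>"
    using AE_summable_weights_\<beta>
  proof eventually_elim
    case (elim \<omega>)
    have sa: "summable (\<lambda>j. \<bar>?a \<omega> j\<bar>)"
      using summable_imp_summable_log[OF elim \<beta>_pos \<beta>_less] by (simp add: abs_mult)
    have sp: "summable (\<lambda>j. max (?a \<omega> j) 0)" by (rule summable_comparison_test'[OF sa, of 0]) auto
    have sn: "summable (\<lambda>j. max (- ?a \<omega> j) 0)" by (rule summable_comparison_test'[OF sa, of 0]) auto
    have P: "P \<omega> = ennreal (\<Sum>j. max (?a \<omega> j) 0)"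
      unfolding P_def using suminf_ennreal2[OF _ sp] by (simp add: ennreal_max_0' ennreal_max_0)
    have n: "n \<omega> = ennreal (\<Sum>j. max (- ?a \<omega> j) 0)"
      unfolding n_def using suminf_ennreal2[OF _ sn] by (simp add: ennreal_max_0' ennreal_max_0)
    have "?L \<omega> = (\<Sum>j. max (?a \<omega> j) 0 - max (- ?a \<omega> j) 0)" by (intro suminf_cong) auto
    also have "\<dots> = (\<Sum>j. max (?a \<omega> j) 0) - (\<Sum>j. max (- ?a \<omega> j) 0)" by (rule suminf_diff[OF sp sn, symmetric])
    finally have L: "?L \<omega> = (\<Sum>j. max (?a \<omega> j) 0) - (\<Sum>j. max (- ?a \<omega> j) 0)" .
    have p0: "0 \<le> (\<Sum>j. max (?a \<omega> j) 0)" "0 \<le> (\<Sum>j. max (- ?a \<omega> j) 0)" by (auto intro!: suminf_nonneg sp sn)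
    have "ennreal (p - q) + ennreal q = ennreal p + ennreal (- (p - q)) \<and> ennreal (- (p - q)) \<le> ennreal q \<and> ennreal (p - q) \<le> ennreal p"
      if "0 \<le> p" "0 \<le> q" for p q :: real
      using that by (cases "q \<le> p") (auto simp: ennreal_neg ennreal_plus[symmetric] simp del: ennreal_plus intro!: ennreal_leI)
    from this[OF p0] show ?case unfolding P n L .
  qed
  have Lnfin: "(\<integral>\<^sup>+\<omega>. ennreal (- ?L \<omega>) \<partial>M) < \<infinity>"
    by (rule le_less_trans[OF nn_integral_mono_AE nfin]) (use bal in \<open>auto elim: eventually_mono\<close>)
  have "(\<integral>\<^sup>+\<omega>. ennreal (?L \<omega>) \<partial>M) + (\<integral>\<^sup>+\<omega>. n \<omega> \<partial>M) = (\<integral>\<^sup>+\<omega>. ennreal (?L \<omega>) + n \<omega> \<partial>M)"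
    by (rule nn_integral_add[symmetric]) measurable
  also have "\<dots> = (\<integral>\<^sup>+\<omega>. P \<omega> + ennreal (- ?L \<omega>) \<partial>M)"
    by (rule nn_integral_cong_AE) (use bal in \<open>auto elim: eventually_mono\<close>)
  also have "\<dots> = (\<integral>\<^sup>+\<omega>. P \<omega> \<partial>M) + (\<integral>\<^sup>+\<omega>. ennreal (- ?L \<omega>) \<partial>M)" by (rule nn_integral_add) measurable
  finally have sum: "(\<integral>\<^sup>+\<omega>. ennreal (?L \<omega>) \<partial>M) + (\<integral>\<^sup>+\<omega>. n \<omega> \<partial>M) = (\<integral>\<^sup>+\<omega>. P \<omega> \<partial>M) + (\<integral>\<^sup>+\<omega>. ennreal (- ?L \<omega>) \<partial>M)" .
  have "enn2ereal a - enn2ereal d = enn2ereal p - enn2ereal q" if eq: "a + q = p + d" and fin: "d < \<infinity>" "q < \<infinity>" for a d p q :: ennreal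
  proof -
    obtain d' where d: "d = ennreal d'" "0 \<le> d'" using fin(1) by (cases d) auto
    obtain q' where q: "q = ennreal q'" "0 \<le> q'" using fin(2) by (cases q) auto
    note dq = d q
    show ?thesis
    proof (cases a)
      case (real a')
      have "a + q = ennreal (a' + q')" using real dq by simp
      then have "p + d = ennreal (a' + q')" using eq by simp
      then have "p + d \<noteq> top" by simp
      then have "p \<noteq> top" by (simp only: ennreal_add_eq_top) simp
      then obtain p' where p': "p = ennreal p'" "0 \<le> p'" by (cases p) auto
      have "ennreal (a' + q') = ennreal (p' + d')" using eq real dq p' by simp
      then have "a' + q' = p' + d'" using real dq p' by (subst (asm) ennreal_inj) auto
      then show ?thesis using real dq p' by simp
    next
      case top
      then have "p + d = top" using eq by simp
      then have "p = \<infinity>" using d by (simp only: ennreal_add_eq_top) simp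
      then show ?thesis using top dq by simp
    qed
  qed
  from this[OF sum Lnfin nfin] show ?thesis unfolding ext_expectation_def SP Sn .
qed

text \<open>
  The derivative of \<open>E[\<Sum>\<^sub>j \<bar>w\<^sub>j\<bar>\<^sup>s]\<close> at \<open>s = \<alpha>\<close> from the left is the mean of the step, which is positive, and the
  value there is \<open>1\<close>.
\<close>

lemma exists_weight_moment_less_1:
  assumes "0 < ext_expectation (step_space M X \<alpha>) (step X)"
  shows "\<exists>b. \<beta> \<le> b \<and> b < \<alpha> \<and> (\<integral>\<^sup>+\<omega>. (\<Sum>j. ennreal (\<bar>weight (X \<omega>) j\<bar> powr b)) \<partial>M) < 1"
proof -
  note m = measurable_step_vector(2)
  have "\<not> (integrable (step_space M X \<alpha>) (step X) \<and> S.expectation (step X) \<le> 0)"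
    using S.ext_expectation_pos_cases[OF m step_neg_part_finite assms] by fastforce
  moreover have "(\<integral>\<^sup>+p. ennreal (exp (- (\<alpha> - \<beta>) * step X p)) \<partial>step_space M X \<alpha>) < \<infinity>"
    using weights_\<beta> by (simp only: step_exp_moment)
  ultimately have "\<exists>\<theta>. 0 < \<theta> \<and> \<theta> \<le> \<alpha> - \<beta> \<and> (\<integral>\<^sup>+p. ennreal (exp (- \<theta> * step X p)) \<partial>step_space M X \<alpha>) < 1"
    using \<beta>_less by (intro S.exists_exp_moment_less_1[OF m]) simp
  then obtain \<theta> where \<theta>: "0 < \<theta>" "\<theta> \<le> \<alpha> - \<beta>" "(\<integral>\<^sup>+p. ennreal (exp (- \<theta> * step X p)) \<partial>step_space M X \<alpha>) < 1"
    by (elim exE conjE)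
  have "(\<integral>\<^sup>+\<omega>. (\<Sum>j. ennreal (\<bar>weight (X \<omega>) j\<bar> powr (\<alpha> - \<theta>))) \<partial>M) < 1"
    using \<theta>(3) step_exp_moment[of "\<alpha> - \<theta>"] by simp
  then show ?thesis using \<theta> by (intro exI[of _ "\<alpha> - \<theta>"]) auto
qed

end

section \<open>Tails as solutions of a renewal equation\<close>

context smoothing_fixed_point begin

sublocale steps: weight_vector M X \<alpha> b
proof
  show "(\<integral>\<^sup>+\<omega>. (\<Sum>j. ennreal (\<bar>weight (X \<omega>) j\<bar> powr b)) \<partial>M) < \<infinity>"
    by (rule le_less_trans[OF weight_b]) simp
qed (rule X_meas b bp weight_\<alpha>)+

lemma drift_walk_step: "drift_walk (step_space M X \<alpha>) (step X) (\<alpha> - b) \<rho>"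
proof -
  have "(\<integral>\<^sup>+p. ennreal (exp (- (\<alpha> - b) * step X p)) \<partial>step_space M X \<alpha>) \<le> ennreal \<rho>"
    unfolding steps.step_exp_moment by (rule weight_b)
  then show ?thesis
    by unfold_locales (use steps.measurable_step_vector rho bp in auto)
qed

end

text \<open>
  Homogeneity moves the modulus of a weight out of \<open>g\<close>, where it becomes a shift in logarithmic coordinates.
\<close>

locale homogeneous_tail = tail_setting M X R Rs b \<alpha> \<rho> g
  for M :: "'a measure" and X R Rs b \<alpha> \<rho> g +
  assumes hom: "\<And>c x. 0 < c \<Longrightarrow> g (c * x) = c * g x"
begin

lemma \<alpha>_pos: "0 < \<alpha>" using b bp by simp

definition tail_fun :: "real \<Rightarrow> real" where
  "tail_fun t = exp (\<alpha> * t) * prob {\<omega>\<in>space M. exp t < g (R \<omega>)}"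

definition reflected_tail_fun :: "real \<Rightarrow> real" where
  "reflected_tail_fun t = exp (\<alpha> * t) * prob {\<omega>\<in>space M. exp t < g (- R \<omega>)}"

lemma prob_eq_integral:
  assumes [measurable]: "f \<in> borel_measurable M"
  shows "prob {\<omega>\<in>space M. v < f \<omega>} = (\<integral>\<omega>. of_bool (v < f \<omega>) \<partial>M)"
proof -
  have "(\<integral>\<omega>. of_bool (v < f \<omega>) \<partial>M) = (\<integral>\<omega>. indicator {\<omega>\<in>space M. v < f \<omega>} \<omega> \<partial>M)"
    by (rule Bochner_Integration.integral_cong) (auto simp: indicator_def)
  also have "\<dots> = prob {\<omega>\<in>space M. v < f \<omega>}"
    by (simp, intro arg_cong[where f=prob]) auto
  finally show ?thesis by simp
qed

lemma nn_integral_of_bool: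
  fixes v :: real
  assumes [measurable]: "f \<in> borel_measurable M"
  shows "(\<integral>\<^sup>+\<omega>. of_bool (v < f \<omega>) \<partial>M) = ennreal (prob {\<omega>\<in>space M. v < f \<omega>})"
proof -
  have "(\<integral>\<^sup>+\<omega>. of_bool (v < f \<omega>) \<partial>M) = (\<integral>\<^sup>+\<omega>. indicator {\<omega>\<in>space M. v < f \<omega>} \<omega> \<partial>M)"
    by (rule nn_integral_cong) (auto simp: indicator_def)
  also have "\<dots> = ennreal (prob {\<omega>\<in>space M. v < f \<omega>})"
  proof -
    have "{\<omega>\<in>space M. v < f \<omega>} \<in> events" by measurable
    then show ?thesis by (simp only: nn_integral_indicator emeasure_eq_measure)
  qed
  finally show ?thesis .
qed

lemma measurable_tail_fun[measurable]: "tail_fun \<in> borel_measurable borel"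
  unfolding tail_fun_def[abs_def] by (subst prob_eq_integral) measurable

lemma measurable_reflected_tail_fun[measurable]: "reflected_tail_fun \<in> borel_measurable borel"
  unfolding reflected_tail_fun_def[abs_def] by (subst prob_eq_integral) measurable

lemma tail_fun_nonneg: "0 \<le> tail_fun t" "0 \<le> reflected_tail_fun t"
  by (simp_all add: tail_fun_def reflected_tail_fun_def)

lemma exp_scaling:
  assumes "0 \<le> s" and [measurable]: "f \<in> borel_measurable M"
  shows "exp (\<alpha> * (t + s)) * prob {\<omega>\<in>space M. exp (t + s) < f \<omega>}
    \<le> exp (\<alpha> * s) * (exp (\<alpha> * t) * prob {\<omega>\<in>space M. exp t < f \<omega>})"
proof -
  have "prob {\<omega>\<in>space M. exp (t + s) < f \<omega>} \<le> prob {\<omega>\<in>space M. exp t < f \<omega>}"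
  proof (rule finite_measure_mono)
    have le: "exp t \<le> exp (t + s)" using assms by simp
    have "exp t < f \<omega>" if "exp (t + s) < f \<omega>" for \<omega> by (rule le_less_trans[OF le that])
    then show "{\<omega>\<in>space M. exp (t + s) < f \<omega>} \<subseteq> {\<omega>\<in>space M. exp t < f \<omega>}" by (intro Collect_mono) simp
  qed measurable
  moreover have "exp (\<alpha> * (t + s)) = exp (\<alpha> * s) * exp (\<alpha> * t)"
    by (simp add: exp_add[symmetric] algebra_simps)
  ultimately show ?thesis
    by (simp only: mult.assoc) (intro mult_left_mono; simp)
qed

lemma tail_fun_growth:
  assumes "0 \<le> s"
  shows "tail_fun (t + s) \<le> exp (\<alpha> * s) * tail_fun t"
    "reflected_tail_fun (t + s) \<le> exp (\<alpha> * s) * reflected_tail_fun t"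
proof -
  have m: "(\<lambda>\<omega>. g (R \<omega>)) \<in> borel_measurable M" "(\<lambda>\<omega>. g (- R \<omega>)) \<in> borel_measurable M" by measurable
  show "tail_fun (t + s) \<le> exp (\<alpha> * s) * tail_fun t"
    unfolding tail_fun_def by (rule exp_scaling[OF assms m(1)])
  show "reflected_tail_fun (t + s) \<le> exp (\<alpha> * s) * reflected_tail_fun t"
    unfolding reflected_tail_fun_def by (rule exp_scaling[OF assms m(2)])
qed

lemma markov_bound:
  assumes [measurable]: "f \<in> borel_measurable M" and f: "\<And>\<omega>. f \<omega> \<le> \<bar>R \<omega>\<bar>"
  shows "exp (\<alpha> * t) * prob {\<omega>\<in>space M. exp t < f \<omega>} \<le> enn2real (abs_moment b) * exp ((\<alpha> - b) * t)"
proof -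
  have "ennreal (prob {\<omega>\<in>space M. exp t < f \<omega>}) = (\<integral>\<^sup>+\<omega>. of_bool (exp t < f \<omega>) \<partial>M)"
    by (rule nn_integral_of_bool[symmetric]) measurable
  also have "\<dots> \<le> (\<integral>\<^sup>+\<omega>. ennreal (exp (- b * t)) * ennreal (\<bar>R \<omega>\<bar> powr b) \<partial>M)"
  proof (rule nn_integral_mono)
    fix \<omega>
    show "of_bool (exp t < f \<omega>) \<le> ennreal (exp (- b * t)) * ennreal (\<bar>R \<omega>\<bar> powr b)"
    proof (cases "exp t < f \<omega>")
      case True
      then have "exp t powr b \<le> \<bar>R \<omega>\<bar> powr b" using f[of \<omega>] b by (intro powr_mono2) auto
      then have "exp (b * t) \<le> \<bar>R \<omega>\<bar> powr b" by (simp add: powr_def mult.commute)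
      then have "1 \<le> exp (- b * t) * \<bar>R \<omega>\<bar> powr b" by (simp add: exp_minus field_simps)
      then have "ennreal 1 \<le> ennreal (exp (- b * t) * \<bar>R \<omega>\<bar> powr b)" by (rule ennreal_leI)
      then show ?thesis using True by (simp add: ennreal_mult)
    qed simp
  qed
  also have "\<dots> = ennreal (exp (- b * t)) * abs_moment b" unfolding abs_moment_def by (rule nn_integral_cmult) measurable
  also have "\<dots> = ennreal (exp (- b * t) * enn2real (abs_moment b))"
    using R_moment by (simp add: ennreal_mult less_top[symmetric])
  finally have "prob {\<omega>\<in>space M. exp t < f \<omega>} \<le> exp (- b * t) * enn2real (abs_moment b)"
    by (subst (asm) ennreal_le_iff) auto
  then have "exp (\<alpha> * t) * prob {\<omega>\<in>space M. exp t < f \<omega>} \<le> exp (\<alpha> * t) * (exp (- b * t) * enn2real (abs_moment b))"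
    by (rule mult_left_mono) simp
  also have "\<dots> = enn2real (abs_moment b) * (exp (\<alpha> * t) * exp (- b * t))" by (simp only: mult_ac)
  also have "exp (\<alpha> * t) * exp (- b * t) = exp ((\<alpha> - b) * t)" by (simp add: exp_add[symmetric] algebra_simps)
  finally show ?thesis .
qed

lemma tail_fun_bound:
  "tail_fun t \<le> enn2real (abs_moment b) * exp ((\<alpha> - b) * t)"
  "reflected_tail_fun t \<le> enn2real (abs_moment b) * exp ((\<alpha> - b) * t)"
proof -
  have "g (R \<omega>) \<le> \<bar>R \<omega>\<bar>" "g (- R \<omega>) \<le> \<bar>R \<omega>\<bar>" for \<omega> using g(2)[of "R \<omega>"] g(2)[of "- R \<omega>"] by auto
  note le = this
  have m: "(\<lambda>\<omega>. g (R \<omega>)) \<in> borel_measurable M" "(\<lambda>\<omega>. g (- R \<omega>)) \<in> borel_measurable M" by measurable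
  show "tail_fun t \<le> enn2real (abs_moment b) * exp ((\<alpha> - b) * t)"
    unfolding tail_fun_def by (rule markov_bound[OF m(1) le(1)])
  show "reflected_tail_fun t \<le> enn2real (abs_moment b) * exp ((\<alpha> - b) * t)"
    unfolding reflected_tail_fun_def by (rule markov_bound[OF m(2) le(2)])
qed

text \<open>
  The bias \<open>\<bar>w\<bar>\<^sup>\<alpha>\<close> combines with \<open>exp (\<alpha> (t - log \<bar>w\<bar>))\<close> to \<open>exp (\<alpha> t)\<close>, independently of the weight.
\<close>

lemma nn_integral_step_tail:
  "(\<integral>\<^sup>+p. ennreal (if step_sign X p < 0 then reflected_tail_fun (t - step X p) else tail_fun (t - step X p)) \<partial>step_space M X \<alpha>)
    = ennreal (exp (\<alpha> * t)) * mean_exceedances (exp t)"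
proof -
  note [measurable] = measurable_step[OF X_meas] measurable_step_sign[OF X_meas]
  let ?f = "\<lambda>p. ennreal (if step_sign X p < 0 then reflected_tail_fun (t - step X p) else tail_fun (t - step X p))"
  have summand: "ennreal (\<bar>w\<bar> powr \<alpha>) * ennreal (if (if w < 0 then - 1 else 1) < (0::real) then reflected_tail_fun (t - ln \<bar>w\<bar>) else tail_fun (t - ln \<bar>w\<bar>))
    = ennreal (exp (\<alpha> * t)) * (\<integral>\<^sup>+\<omega>'. of_bool (exp t < g (w * R \<omega>')) \<partial>M)" for w :: real
  proof (cases "w = 0")
    case True
    have "\<not> exp t < 0" by (simp add: not_less)
    then show ?thesis using True by (simp add: g_0)
  next
    case False
    have e: "\<bar>w\<bar> powr \<alpha> * exp (\<alpha> * (t - ln \<bar>w\<bar>)) = exp (\<alpha> * t)"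
      using False by (simp add: powr_def exp_add[symmetric] algebra_simps)
    have lt: "exp (t - ln \<bar>w\<bar>) < y \<longleftrightarrow> exp t < \<bar>w\<bar> * y" for y
      using False by (simp add: exp_diff field_simps)
    have scale: "ennreal (\<bar>w\<bar> powr \<alpha>) * ennreal (exp (\<alpha> * (t - ln \<bar>w\<bar>)) * prob {\<omega>\<in>space M. exp (t - ln \<bar>w\<bar>) < f \<omega>})
       = ennreal (exp (\<alpha> * t)) * (\<integral>\<^sup>+\<omega>'. of_bool (exp t < \<bar>w\<bar> * f \<omega>') \<partial>M)"
      if [measurable]: "f \<in> borel_measurable M" for f
    proof -
      have "ennreal (\<bar>w\<bar> powr \<alpha>) * ennreal (exp (\<alpha> * (t - ln \<bar>w\<bar>)) * prob {\<omega>\<in>space M. exp (t - ln \<bar>w\<bar>) < f \<omega>})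
        = ennreal ((\<bar>w\<bar> powr \<alpha> * exp (\<alpha> * (t - ln \<bar>w\<bar>))) * prob {\<omega>\<in>space M. exp (t - ln \<bar>w\<bar>) < f \<omega>})"
        by (simp add: ennreal_mult[symmetric] mult.assoc)
      also have "\<dots> = ennreal (exp (\<alpha> * t)) * ennreal (prob {\<omega>\<in>space M. exp t < \<bar>w\<bar> * f \<omega>})"
        unfolding e lt by (simp add: ennreal_mult)
      also have "ennreal (prob {\<omega>\<in>space M. exp t < \<bar>w\<bar> * f \<omega>}) = (\<integral>\<^sup>+\<omega>'. of_bool (exp t < \<bar>w\<bar> * f \<omega>') \<partial>M)"
        by (rule nn_integral_of_bool[symmetric]) measurable
      finally show ?thesis .
    qed
    show ?thesis
    proof (cases "w < 0")
      case True
      have "g (w * r) = \<bar>w\<bar> * g (- r)" for r using hom[of "\<bar>w\<bar>" "- r"] True by simp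
      then show ?thesis using True scale[of "\<lambda>\<omega>. g (- R \<omega>)"] by (simp add: reflected_tail_fun_def)
    next
      case nonneg: False
      have "g (w * r) = \<bar>w\<bar> * g r" for r using hom[of "\<bar>w\<bar>" r] nonneg False by simp
      then show ?thesis using nonneg scale[of "\<lambda>\<omega>. g (R \<omega>)"] by (simp add: tail_fun_def)
    qed
  qed
  have "(\<integral>\<^sup>+p. ?f p \<partial>step_space M X \<alpha>) = (\<integral>\<^sup>+\<omega>. (\<Sum>j. ennreal (\<bar>weight (X \<omega>) j\<bar> powr \<alpha>) * ?f (\<omega>, j)) \<partial>M)"
    by (rule nn_integral_step_space[OF X_meas]) measurable
  also have "\<dots> = (\<integral>\<^sup>+\<omega>. (\<Sum>j. ennreal (exp (\<alpha> * t)) * (\<integral>\<^sup>+\<omega>'. of_bool (exp t < g (weight (X \<omega>) j * R \<omega>')) \<partial>M)) \<partial>M)"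
    by (intro nn_integral_cong suminf_cong) (simp only: step_sign_def step_def prod.case summand)
  also have "\<dots> = (\<integral>\<^sup>+\<omega>. ennreal (exp (\<alpha> * t)) * (\<Sum>j. \<integral>\<^sup>+\<omega>'. of_bool (exp t < g (weight (X \<omega>) j * R \<omega>')) \<partial>M) \<partial>M)"
    by simp
  also have "\<dots> = ennreal (exp (\<alpha> * t)) * mean_exceedances (exp t)"
    unfolding mean_exceedances_def by (rule nn_integral_cmult) measurable
  finally show ?thesis .
qed

lemma tail_fun_equation:
  "tail_fun t = exp (\<alpha> * t) * tail_excess (exp t)
    + (\<integral>p. (if step_sign X p < 0 then reflected_tail_fun (t - step X p) else tail_fun (t - step X p)) \<partial>step_space M X \<alpha>)"
proof -
  note [measurable] = measurable_step[OF X_meas] measurable_step_sign[OF X_meas]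
  have "(\<integral>p. (if step_sign X p < 0 then reflected_tail_fun (t - step X p) else tail_fun (t - step X p)) \<partial>step_space M X \<alpha>)
     = enn2real (\<integral>\<^sup>+p. ennreal (if step_sign X p < 0 then reflected_tail_fun (t - step X p) else tail_fun (t - step X p)) \<partial>step_space M X \<alpha>)"
    by (rule integral_eq_nn_integral) (auto simp: tail_fun_nonneg measurable_cong_sets[OF sets_step_space refl])
  also have "\<dots> = exp (\<alpha> * t) * enn2real (mean_exceedances (exp t))"
    by (simp add: nn_integral_step_tail enn2real_mult)
  finally show ?thesis by (simp add: tail_fun_def tail_excess_def right_diff_distrib)
qed

lemma forcing_integral:
  shows "integrable lborel (\<lambda>t. exp (\<alpha> * t) * tail_excess (exp t))"
    "(\<integral>t. exp (\<alpha> * t) * tail_excess (exp t) \<partial>lborel) = (\<integral>\<omega>. tail_power_gap \<omega> \<partial>M) / \<alpha>"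
proof -
  note E = tail_excess_integral[OF level_measure_exp[OF \<alpha>_pos]]
  have [measurable]: "(\<lambda>s. tail_excess (exp s)) \<in> borel_measurable borel"
    using borel_measurable_integrable[OF E(1)] by simp
  show "integrable lborel (\<lambda>t. exp (\<alpha> * t) * tail_excess (exp t))"
    using E(1) by (subst (asm) integrable_density) auto
  show "(\<integral>t. exp (\<alpha> * t) * tail_excess (exp t) \<partial>lborel) = (\<integral>\<omega>. tail_power_gap \<omega> \<partial>M) / \<alpha>"
    using E(3) by (subst (asm) integral_density) auto
qed

lemma tail_excess_set_integral:
  shows "set_integrable lborel {0<..} (\<lambda>v. v powr (\<alpha> - 1) * tail_excess v)"
    "(LBINT v:{0<..}. v powr (\<alpha> - 1) * tail_excess v) = (\<integral>\<omega>. tail_power_gap \<omega> \<partial>M) / \<alpha>"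
proof -
  let ?L = "restrict_space lborel {0::real<..}"
  note E = tail_excess_integral[OF level_measure_powr[OF \<alpha>_pos]]
  have m1[measurable]: "(\<lambda>v. v powr (\<alpha> - 1)) \<in> borel_measurable ?L"
    by (rule measurable_restrict_space1) measurable
  have m2[measurable]: "tail_excess \<in> borel_measurable ?L"
    using borel_measurable_integrable[OF E(1)] by simp
  have "integrable ?L (\<lambda>v. v powr (\<alpha> - 1) * tail_excess v)"
    using E(1) by (subst (asm) integrable_density) auto
  then show "set_integrable lborel {0<..} (\<lambda>v. v powr (\<alpha> - 1) * tail_excess v)"
    by (subst (asm) integrable_restrict_space) (auto simp: set_integrable_def)
  have "(\<integral>v. v powr (\<alpha> - 1) * tail_excess v \<partial>?L) = (\<integral>\<omega>. tail_power_gap \<omega> \<partial>M) / \<alpha>"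
    using E(3) by (subst (asm) integral_density) auto
  then show "(LBINT v:{0<..}. v powr (\<alpha> - 1) * tail_excess v) = (\<integral>\<omega>. tail_power_gap \<omega> \<partial>M) / \<alpha>"
    by (subst (asm) integral_restrict_space) (auto simp: set_lebesgue_integral_def)
qed

lemma power_tail_of_tail_fun:
  assumes "(tail_fun \<longlongrightarrow> c) at_top"
  shows "((\<lambda>t. t powr \<alpha> * prob {\<omega>\<in>space M. t < g (R \<omega>)}) \<longlongrightarrow> c) at_top"
proof -
  have "((\<lambda>t. tail_fun (ln t)) \<longlongrightarrow> c) at_top" by (rule filterlim_compose[OF assms ln_at_top])
  then show ?thesis
  proof (rule Lim_transform_eventually)
    show "\<forall>\<^sub>F t in at_top. tail_fun (ln t) = t powr \<alpha> * prob {\<omega>\<in>space M. t < g (R \<omega>)}"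
      using eventually_gt_at_top[of 0] by eventually_elim (simp add: tail_fun_def powr_def)
  qed
qed

end

section \<open>Tail limits\<close>

lemma (in homogeneous_tail) integrable_step_tail:
  "integrable (step_space M X \<alpha>) (\<lambda>p. if step_sign X p < 0 then reflected_tail_fun (t - step X p) else tail_fun (t - step X p))"
proof (rule integrableI_nonneg)
  note [measurable] = measurable_step[OF X_meas] measurable_step_sign[OF X_meas]
  show "(\<lambda>p. if step_sign X p < 0 then reflected_tail_fun (t - step X p) else tail_fun (t - step X p)) \<in> borel_measurable (step_space M X \<alpha>)"
    by (simp add: measurable_cong_sets[OF sets_step_space refl])
  show "(\<integral>\<^sup>+p. ennreal (if step_sign X p < 0 then reflected_tail_fun (t - step X p) else tail_fun (t - step X p)) \<partial>step_space M X \<alpha>) < \<infinity>"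
    unfolding nn_integral_step_tail using mean_exceedances_finite[of "exp t"] by (simp add: ennreal_mult_less_top)
qed (simp add: tail_fun_nonneg)

locale critical_smoothing = smoothing_fixed_point M X R Rs b \<alpha> \<rho>
  for M :: "'a measure" and X R Rs b \<alpha> \<rho> +
  assumes nonlattice_weight: "\<exists>j. \<forall>l>0. \<not> (AE \<omega> in M. weight (X \<omega>) j \<noteq> 0 \<longrightarrow> ln \<bar>weight (X \<omega>) j\<bar> \<in> {of_int k * l | k. True})"
    and drift_pos: "0 < ext_expectation (step_space M X \<alpha>) (step X)"
begin

sublocale walk: signed_walk "step_space M X \<alpha>" "step X" "\<alpha> - b" \<rho> "step_sign X"
proof (intro signed_walk.intro drift_walk_step signed_walk_axioms.intro notI)
  note [measurable] = measurable_step[OF X_meas] measurable_step_sign[OF X_meas]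
  show "step_sign X \<in> borel_measurable (step_space M X \<alpha>)" by (simp add: measurable_cong_sets[OF sets_step_space refl])
  show "\<bar>step_sign X p\<bar> = 1" for p by (simp add: step_sign_def split: prod.split)
  fix l :: real
  let ?L = "{of_int k * l | k. True}"
  assume l: "0 < l" and lat: "AE p in step_space M X \<alpha>. step X p \<in> ?L"
  have L: "?L \<in> sets borel"
  proof -
    have "?L = range (\<lambda>k. of_int k * l)" by auto
    then have "countable ?L" by simp
    then show ?thesis by (rule sets.countable[rotated]) simp
  qed
  have "Measurable.pred (M \<Otimes>\<^sub>M count_space UNIV) (\<lambda>p. step X p \<in> ?L)" using L by measurable
  from lat[unfolded AE_step_space[OF X_meas sigma_finite_measure_axioms this]]
  have "AE \<omega> in M. \<forall>j. weight (X \<omega>) j \<noteq> 0 \<longrightarrow> ln \<bar>weight (X \<omega>) j\<bar> \<in> ?L" by (simp add: step_def)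
  then have "AE \<omega> in M. weight (X \<omega>) j \<noteq> 0 \<longrightarrow> ln \<bar>weight (X \<omega>) j\<bar> \<in> ?L" for j by (rule AE_mp) simp
  then show False using nonlattice_weight l by blast
qed

text \<open>
  The solution \<open>c\<close> of \<open>c E Y = I\<close>, read as \<open>0\<close> if the mean is infinite.
\<close>

definition renewal_const :: "real \<Rightarrow> real" where
  "renewal_const I = (if ext_expectation (step_space M X \<alpha>) (step X) = \<infinity> then 0
     else I / real_of_ereal (ext_expectation (step_space M X \<alpha>) (step X)))"

lemma mean_identity_imp_renewal_const:
  assumes "walk.mean_identity c I"
  shows "c = renewal_const I"
proof -
  note cases = steps.S.ext_expectation_pos_cases[OF steps.measurable_step_vector(2) steps.step_neg_part_finite drift_pos]
  show ?thesis
  proof (cases "ext_expectation (step_space M X \<alpha>) (step X) = \<infinity>")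
    case True
    then show ?thesis using cases(1)[OF True] assms by (simp add: walk.mean_identity_def renewal_const_def)
  next
    case False
    note F = cases(2)[OF False]
    have "(\<integral>\<^sup>+p. ennreal (step X p) \<partial>step_space M X \<alpha>) \<noteq> \<infinity>" using F by (simp add: real_integrable_def)
    then have "c * steps.S.expectation (step X) = I" using assms by (simp add: walk.mean_identity_def)
    then show ?thesis using F by (auto simp: renewal_const_def)
  qed
qed

lemma tail_limit_nonneg_weights:
  assumes "homogeneous_tail M X R Rs b \<alpha> \<rho> g" and nonneg: "AE \<omega> in M. \<forall>j. 0 \<le> weight (X \<omega>) j"
  shows "((\<lambda>t. t powr \<alpha> * prob {\<omega>\<in>space M. t < g (R \<omega>)}) \<longlongrightarrow> renewal_const
      (expectation (\<lambda>\<omega>. g (fst (X \<omega>) + (\<Sum>j. summand j \<omega>)) powr \<alpha> - (\<Sum>j. g (summand j \<omega>) powr \<alpha>)) / \<alpha>)) at_top"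
proof -
  interpret G: homogeneous_tail M X R Rs b \<alpha> \<rho> g by fact
  note [measurable] = measurable_step[OF X_meas] measurable_step_sign[OF X_meas]
  have pm: "Measurable.pred (M \<Otimes>\<^sub>M count_space UNIV) (\<lambda>p. \<not> step_sign X p < 0)" by measurable
  have pos: "AE p in step_space M X \<alpha>. \<not> step_sign X p < 0"
    unfolding AE_step_space[OF X_meas sigma_finite_measure_axioms pm]
    using nonneg by eventually_elim (auto simp: step_sign_def not_less)
  have eq: "G.tail_fun t = exp (\<alpha> * t) * G.tail_excess (exp t) + (\<integral>p. G.tail_fun (t - step X p) \<partial>step_space M X \<alpha>)" for t
  proof -
    have "(\<integral>p. (if step_sign X p < 0 then G.reflected_tail_fun (t - step X p) else G.tail_fun (t - step X p)) \<partial>step_space M X \<alpha>)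
        = (\<integral>p. G.tail_fun (t - step X p) \<partial>step_space M X \<alpha>)"
      by (rule integral_cong_AE) (use pos in \<open>auto simp: measurable_cong_sets[OF sets_step_space refl] elim: eventually_mono\<close>)
    then show ?thesis using G.tail_fun_equation[of t] by simp
  qed
  have "(G.tail_fun \<longlongrightarrow> renewal_const (expectation G.tail_power_gap / \<alpha>)) at_top"
    by (rule walk.renewal_limit[OF G.measurable_tail_fun G.tail_fun_nonneg(1) G.tail_fun_bound(1) G.tail_fun_growth(1)
        less_imp_le[OF G.\<alpha>_pos] G.forcing_integral(1) eq])
      (simp_all only: G.forcing_integral(2) mean_identity_imp_renewal_const)
  then show ?thesis using G.power_tail_of_tail_fun unfolding G.tail_power_gap_def by simp
qed

lemma homogeneous_tails:
  "homogeneous_tail M X R Rs b \<alpha> \<rho> (\<lambda>x. max x 0)"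
  "homogeneous_tail M X R Rs b \<alpha> \<rho> (\<lambda>x. max (- x) 0)"
  "homogeneous_tail M X R Rs b \<alpha> \<rho> (\<lambda>x. \<bar>x\<bar>)"
proof -
  have *: "homogeneous_tail M X R Rs b \<alpha> \<rho> g"
    if "\<And>x. 0 \<le> g x" "\<And>x. g x \<le> \<bar>x\<bar>" "\<And>x y. \<bar>g x - g y\<bar> \<le> \<bar>x - y\<bar>" "\<And>c x. 0 < c \<Longrightarrow> g (c * x) = c * g x" for g
    by (intro homogeneous_tail.intro homogeneous_tail_axioms.intro tail_setting.intro tail_setting_axioms.intro
      smoothing_fixed_point_axioms that)
  have "max (c * x) 0 = c * max x 0" if "0 < c" for c x :: real
    using that by (simp add: max_def zero_less_mult_iff mult_le_0_iff)
  note mx = this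
  show "homogeneous_tail M X R Rs b \<alpha> \<rho> (\<lambda>x. max x 0)" by (rule *) (auto simp: mx)
  show "homogeneous_tail M X R Rs b \<alpha> \<rho> (\<lambda>x. max (- x) 0)"
    by (rule *) (use mx[of _ "- _"] in auto)
  show "homogeneous_tail M X R Rs b \<alpha> \<rho> (\<lambda>x. \<bar>x\<bar>)" by (rule *) (auto simp: abs_mult)
qed

text \<open>
  The tail functions for the positive and the negative part are exchanged by a negative weight, and their sum is the
  tail function of the absolute value.
\<close>

lemma tail_limit_signed_weights:
  fixes j0 :: nat
  assumes neg: "prob {\<omega>\<in>space M. weight (X \<omega>) j0 < 0} > 0"
  defines "c \<equiv> renewal_const
      (expectation (\<lambda>\<omega>. \<bar>fst (X \<omega>) + (\<Sum>j. summand j \<omega>)\<bar> powr \<alpha> - (\<Sum>j. \<bar>summand j \<omega>\<bar> powr \<alpha>)) / \<alpha>)"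
  shows "((\<lambda>t. t powr \<alpha> * prob {\<omega>\<in>space M. t < max (R \<omega>) 0}) \<longlongrightarrow> c / 2) at_top"
    and "((\<lambda>t. t powr \<alpha> * prob {\<omega>\<in>space M. t < max (- R \<omega>) 0}) \<longlongrightarrow> c / 2) at_top"
proof -
  interpret P: homogeneous_tail M X R Rs b \<alpha> \<rho> "\<lambda>x. max x 0" by (rule homogeneous_tails)
  interpret N: homogeneous_tail M X R Rs b \<alpha> \<rho> "\<lambda>x. max (- x) 0" by (rule homogeneous_tails)
  interpret A: homogeneous_tail M X R Rs b \<alpha> \<rho> "\<lambda>x. \<bar>x\<bar>" by (rule homogeneous_tails)
  note [measurable] = measurable_step[OF X_meas] measurable_step_sign[OF X_meas]
  have rP: "P.reflected_tail_fun = N.tail_fun" and rN: "N.reflected_tail_fun = P.tail_fun" and rA: "A.reflected_tail_fun = A.tail_fun"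
    by (simp_all add: fun_eq_iff P.tail_fun_def P.reflected_tail_fun_def N.tail_fun_def N.reflected_tail_fun_def
        A.tail_fun_def A.reflected_tail_fun_def)
  have A: "A.tail_fun t = P.tail_fun t + N.tail_fun t" for t
  proof -
    have "prob {\<omega>\<in>space M. exp t < \<bar>R \<omega>\<bar>} = prob ({\<omega>\<in>space M. exp t < max (R \<omega>) 0} \<union> {\<omega>\<in>space M. exp t < max (- R \<omega>) 0})"
    proof (rule arg_cong[where f=prob])
      have "exp t < \<bar>x\<bar> \<longleftrightarrow> exp t < max x 0 \<or> exp t < max (- x) 0" for x
        using exp_gt_zero[of t] by (auto simp: max_def abs_if)
      then show "{\<omega>\<in>space M. exp t < \<bar>R \<omega>\<bar>} = {\<omega>\<in>space M. exp t < max (R \<omega>) 0} \<union> {\<omega>\<in>space M. exp t < max (- R \<omega>) 0}"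
        by blast
    qed
    also have "\<dots> = prob {\<omega>\<in>space M. exp t < max (R \<omega>) 0} + prob {\<omega>\<in>space M. exp t < max (- R \<omega>) 0}"
    proof (rule finite_measure_Union)
      have "\<not> (exp t < max x 0 \<and> exp t < max (- x) 0)" for x
        using exp_gt_zero[of t] by (auto simp: max_def)
      then show "{\<omega>\<in>space M. exp t < max (R \<omega>) 0} \<inter> {\<omega>\<in>space M. exp t < max (- R \<omega>) 0} = {}" by blast
    qed measurable
    finally show ?thesis by (simp add: A.tail_fun_def P.tail_fun_def N.tail_fun_def distrib_left)
  qed
  have eq: "P.tail_fun t + N.tail_fun t = exp (\<alpha> * t) * A.tail_excess (exp t)
      + (\<integral>p. P.tail_fun (t - step X p) + N.tail_fun (t - step X p) \<partial>step_space M X \<alpha>)" for t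
    using A.tail_fun_equation[of t] by (simp only: rA A if_cancel)
  have eq': "P.tail_fun t - N.tail_fun t = (exp (\<alpha> * t) * P.tail_excess (exp t) - exp (\<alpha> * t) * N.tail_excess (exp t))
      + (\<integral>p. step_sign X p * (P.tail_fun (t - step X p) - N.tail_fun (t - step X p)) \<partial>step_space M X \<alpha>)" for t
  proof -
    have "(\<integral>p. step_sign X p * (P.tail_fun (t - step X p) - N.tail_fun (t - step X p)) \<partial>step_space M X \<alpha>)
      = (\<integral>p. (if step_sign X p < 0 then P.reflected_tail_fun (t - step X p) else P.tail_fun (t - step X p))
          - (if step_sign X p < 0 then N.reflected_tail_fun (t - step X p) else N.tail_fun (t - step X p)) \<partial>step_space M X \<alpha>)"
      by (rule Bochner_Integration.integral_cong) (auto simp: rP rN step_sign_def split: prod.splits)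
    also have "\<dots> = (\<integral>p. (if step_sign X p < 0 then P.reflected_tail_fun (t - step X p) else P.tail_fun (t - step X p)) \<partial>step_space M X \<alpha>)
          - (\<integral>p. (if step_sign X p < 0 then N.reflected_tail_fun (t - step X p) else N.tail_fun (t - step X p)) \<partial>step_space M X \<alpha>)"
      by (rule Bochner_Integration.integral_diff[OF P.integrable_step_tail N.integrable_step_tail])
    finally show ?thesis using P.tail_fun_equation[of t] N.tail_fun_equation[of t] by linarith
  qed
  have bound: "P.tail_fun t + N.tail_fun t \<le> enn2real (abs_moment b) * exp ((\<alpha> - b) * t)" for t
    using A.tail_fun_bound(1)[of t] by (simp only: A)
  have sneg: "steps.S.prob {p\<in>space (step_space M X \<alpha>). step_sign X p = - 1} > 0"
  proof (rule ccontr)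
    assume "\<not> ?thesis"
    then have "steps.S.prob {p\<in>space (step_space M X \<alpha>). step_sign X p = - 1} = 0" by (simp add: zero_less_measure_iff)
    moreover have "{p\<in>space (step_space M X \<alpha>). step_sign X p = - 1} \<in> sets (step_space M X \<alpha>)"
      using walk.X_meas by measurable
    ultimately have "AE p in step_space M X \<alpha>. p \<notin> {p\<in>space (step_space M X \<alpha>). step_sign X p = - 1}"
      by (simp only: steps.S.prob_eq_0)
    with AE_space have AE: "AE p in step_space M X \<alpha>. step_sign X p \<noteq> - 1"
      by eventually_elim blast
    have pm: "Measurable.pred (M \<Otimes>\<^sub>M count_space UNIV) (\<lambda>p. step_sign X p \<noteq> - 1)" by measurable
    have "AE \<omega> in M. \<not> weight (X \<omega>) j0 < 0"
      using AE[unfolded AE_step_space[OF X_meas sigma_finite_measure_axioms pm]]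
    proof eventually_elim
      case (elim \<omega>)
      then show ?case by (cases "weight (X \<omega>) j0 = 0") (auto simp: step_sign_def dest!: spec[of _ j0] split: if_splits)
    qed
    then have "AE \<omega> in M. \<omega> \<notin> {\<omega>\<in>space M. weight (X \<omega>) j0 < 0}" by eventually_elim blast
    moreover have "{\<omega>\<in>space M. weight (X \<omega>) j0 < 0} \<in> events" by measurable
    ultimately have "prob {\<omega>\<in>space M. weight (X \<omega>) j0 < 0} = 0" by (simp only: prob_eq_0)
    then show False using neg by simp
  qed
  note lim = walk.signed_renewal_limit[OF P.measurable_tail_fun N.measurable_tail_fun P.tail_fun_nonneg(1) N.tail_fun_nonneg(1)
      bound P.tail_fun_growth(1) N.tail_fun_growth(1) less_imp_le[OF A.\<alpha>_pos] A.forcing_integral(1) eq _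
      Bochner_Integration.integrable_diff[OF P.forcing_integral(1) N.forcing_integral(1)] eq' sneg, of c]
  have c: "c' = c" if "walk.mean_identity c' (\<integral>s. exp (\<alpha> * s) * A.tail_excess (exp s) \<partial>lborel)" for c'
    using mean_identity_imp_renewal_const[OF that] unfolding A.forcing_integral(2) c_def A.tail_power_gap_def .
  show "((\<lambda>t. t powr \<alpha> * prob {\<omega>\<in>space M. t < max (R \<omega>) 0}) \<longlongrightarrow> c / 2) at_top"
    by (rule P.power_tail_of_tail_fun[OF lim(1)]) (assumption | erule c)+
  show "((\<lambda>t. t powr \<alpha> * prob {\<omega>\<in>space M. t < max (- R \<omega>) 0}) \<longlongrightarrow> c / 2) at_top"
    by (rule N.power_tail_of_tail_fun[OF lim(2)]) (assumption | erule c)+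
qed

end

section \<open>The tree series as a solution of the fixed-point equation\<close>

lemma infsum_nat_eq_suminf:
  fixes f :: "nat \<Rightarrow> 'b::{comm_monoid_add, t2_space}"
  assumes "f summable_on UNIV"
  shows "infsum f UNIV = suminf f"
  using has_sum_imp_sums[OF has_sum_infsum[OF assms]] by (rule sums_unique)

lemma infsum_nat_eq_suminf_real:
  fixes f :: "nat \<Rightarrow> real"
  assumes "summable (\<lambda>j. \<bar>f j\<bar>)"
  shows "infsum f UNIV = suminf f"
  using assms by (intro infsum_nat_eq_suminf norm_summable_imp_summable_on) simp

lemma measurable_infsum_nat:
  fixes f :: "'a \<Rightarrow> nat \<Rightarrow> real"
  assumes "\<And>j. (\<lambda>\<omega>. f \<omega> j) \<in> borel_measurable M"
  shows "(\<lambda>\<omega>. infsum (f \<omega>) UNIV) \<in> borel_measurable M"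
  unfolding infsum_eq_integral_count_space by (rule measurable_integral_count_space) (use assms in auto)

text \<open>
  Independence of generated sigma-algebras gives the product law, for random elements of different types.
\<close>

lemma (in prob_space) nn_integral_indep_set:
  assumes X[measurable]: "X \<in> measurable M S" and Y[measurable]: "Y \<in> measurable M T"
    and ind: "indep_set {X -` A \<inter> space M | A. A \<in> sets S} {Y -` B \<inter> space M | B. B \<in> sets T}"
    and F[measurable]: "F \<in> borel_measurable (S \<Otimes>\<^sub>M T)"
  shows "(\<integral>\<^sup>+\<omega>. F (X \<omega>, Y \<omega>) \<partial>M) = (\<integral>\<^sup>+\<omega>. (\<integral>\<^sup>+\<omega>'. F (X \<omega>, Y \<omega>') \<partial>M) \<partial>M)"
proof -
  interpret S: prob_space "distr M S X" by (rule prob_space_distr) simp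
  interpret T: prob_space "distr M T Y" by (rule prob_space_distr) simp
  have eq: "distr M S X \<Otimes>\<^sub>M distr M T Y = distr M (S \<Otimes>\<^sub>M T) (\<lambda>\<omega>. (X \<omega>, Y \<omega>))"
  proof (rule pair_measure_eqI)
    fix A B assume "A \<in> sets (distr M S X)" "B \<in> sets (distr M T Y)"
    then have [measurable]: "A \<in> sets S" "B \<in> sets T" by auto
    have "prob ((X -` A \<inter> space M) \<inter> (Y -` B \<inter> space M)) = prob (X -` A \<inter> space M) * prob (Y -` B \<inter> space M)"
      by (rule indep_setD[OF ind]) auto
    moreover have "(X -` A \<inter> space M) \<inter> (Y -` B \<inter> space M) = (\<lambda>\<omega>. (X \<omega>, Y \<omega>)) -` (A \<times> B) \<inter> space M" by auto
    ultimately show "emeasure (distr M S X) A * emeasure (distr M T Y) B = emeasure (distr M (S \<Otimes>\<^sub>M T) (\<lambda>\<omega>. (X \<omega>, Y \<omega>))) (A \<times> B)"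
      by (simp add: emeasure_distr emeasure_eq_measure ennreal_mult[symmetric])
  qed (auto intro: S.sigma_finite_measure_axioms T.sigma_finite_measure_axioms cong: sets_pair_measure_cong)
  have "(\<integral>\<^sup>+\<omega>. F (X \<omega>, Y \<omega>) \<partial>M) = (\<integral>\<^sup>+p. F p \<partial>(distr M S X \<Otimes>\<^sub>M distr M T Y))"
    unfolding eq by (subst nn_integral_distr) auto
  also have "\<dots> = (\<integral>\<^sup>+x. (\<integral>\<^sup>+y. F (x, y) \<partial>distr M T Y) \<partial>distr M S X)"
    by (subst T.nn_integral_fst[symmetric]) auto
  also have "\<dots> = (\<integral>\<^sup>+\<omega>. (\<integral>\<^sup>+y. F (X \<omega>, y) \<partial>distr M T Y) \<partial>M)"
    by (subst nn_integral_distr) (auto intro!: T.borel_measurable_nn_integral)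
  also have "\<dots> = (\<integral>\<^sup>+\<omega>. (\<integral>\<^sup>+\<omega>'. F (X \<omega>, Y \<omega>') \<partial>M) \<partial>M)"
  proof (intro nn_integral_cong)
    fix \<omega> assume "\<omega> \<in> space M"
    then have "X \<omega> \<in> space S" using measurable_space[OF X] by blast
    then have [measurable]: "(\<lambda>y. F (X \<omega>, y)) \<in> borel_measurable T" by (intro measurable_compose[OF measurable_Pair1' F])
    show "(\<integral>\<^sup>+y. F (X \<omega>, y) \<partial>distr M T Y) = (\<integral>\<^sup>+\<omega>'. F (X \<omega>, Y \<omega>') \<partial>M)"
      by (subst nn_integral_distr) auto
  qed
  finally show ?thesis .
qed

text \<open>
  The law of an iid sequence is determined by its marginal, so the copies produced by the subtrees and
  the external copies are interchangeable.
\<close>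

lemma iid_sum_functional_cong:
  assumes "iid_sum M X R Rs" "iid_sum M X R Rs'"
    and F[measurable]: "F \<in> borel_measurable (vec_space \<Otimes>\<^sub>M PiM UNIV (\<lambda>_. borel))"
  shows "(\<integral>\<^sup>+\<omega>. F (X \<omega>, \<lambda>j. Rs j \<omega>) \<partial>M) = (\<integral>\<^sup>+\<omega>. F (X \<omega>, \<lambda>j. Rs' j \<omega>) \<partial>M)"
proof -
  interpret A: iid_sum M X R Rs by fact
  interpret B: iid_sum M X R Rs' by fact
  have "(\<integral>\<^sup>+\<omega>'. F (X \<omega>, \<lambda>j. Rs j \<omega>') \<partial>M) = (\<integral>\<^sup>+\<omega>'. F (X \<omega>, \<lambda>j. Rs' j \<omega>') \<partial>M)" if "\<omega> \<in> space M" for \<omega>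
  proof -
    have "X \<omega> \<in> space vec_space" using that measurable_space[OF A.X_meas] by blast
    then have m: "(\<lambda>r. F (X \<omega>, r)) \<in> borel_measurable (PiM UNIV (\<lambda>_. borel))"
      by (intro measurable_compose[OF measurable_Pair1' F])
    show ?thesis using A.nn_integral_Rs_seq[OF m] B.nn_integral_Rs_seq[OF m] by simp
  qed
  then have "(\<integral>\<^sup>+\<omega>. (\<integral>\<^sup>+\<omega>'. F (X \<omega>, \<lambda>j. Rs j \<omega>') \<partial>M) \<partial>M) = (\<integral>\<^sup>+\<omega>. (\<integral>\<^sup>+\<omega>'. F (X \<omega>, \<lambda>j. Rs' j \<omega>') \<partial>M) \<partial>M)"
    by (rule nn_integral_cong)
  then show ?thesis by (simp only: A.decoupled[OF F] B.decoupled[OF F])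
qed

locale tree_copies = branching_tree M Qt Nt Ct
  for M :: "'a measure" and Qt Nt Ct +
  fixes Rc :: "nat \<Rightarrow> 'a \<Rightarrow> real"
  assumes copies: "indep_iid_copies M (R_series Qt Nt Ct) vec_space (padded_vec (Qt []) (Nt []) (\<lambda>j. Ct [j])) Rc"
begin

abbreviation root :: "'a \<Rightarrow> wvec" where "root \<equiv> \<lambda>\<omega>. V \<omega> []"

abbreviation R :: "'a \<Rightarrow> real" where "R \<equiv> R_series Qt Nt Ct"

lemma R_eq: "R = (\<lambda>\<omega>. tree_sum (V \<omega>))" by (simp add: fun_eq_iff R_series_eq)

lemma root_at: "V \<omega> [] = padded_vec (Qt []) (Nt []) (\<lambda>j. Ct [j]) \<omega>"
  by (simp add: V_def node_vec_def)

lemma fst_root: "fst (root \<omega>) = Qt [] \<omega>" by (simp add: root_at padded_vec_def)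

lemma weight_root: "weight (root \<omega>) j = (if Suc j \<in> idx (Nt [] \<omega>) then Ct [Suc j] \<omega> else 0)"
  by (simp add: root_at padded_vec_def weight_def)

text \<open>
  A function that vanishes at weight \<open>0\<close> does not see the padding, so sums over the actual children become series over
  all indices.
\<close>

lemma infsum_children:
  fixes f :: "nat \<Rightarrow> real \<Rightarrow> 'b::{comm_monoid_add, t2_space}"
  assumes "\<And>i. f i 0 = 0"
  shows "(\<Sum>\<^sub>\<infinity>i\<in>idx (Nt [] \<omega>). f i (Ct [i] \<omega>)) = (\<Sum>\<^sub>\<infinity>j. f (Suc j) (weight (root \<omega>) j))"
proof -
  have "(\<Sum>\<^sub>\<infinity>i\<in>idx (Nt [] \<omega>). f i (Ct [i] \<omega>)) = (\<Sum>\<^sub>\<infinity>i\<in>{1..}. f i (weight (root \<omega>) (i - 1)))"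
    by (rule infsum_cong_neutral) (auto simp: weight_root assms idx_def)
  also have "\<dots> = (\<Sum>\<^sub>\<infinity>j. f (Suc j) (weight (root \<omega>) (Suc j - 1)))"
    by (rule infsum_reindex_bij_betw[OF bij_betw_Suc_ge_1, symmetric])
  finally show ?thesis by simp
qed

lemma iid_sum_child_sums: "iid_sum M root R child_sum"
  by unfold_locales (auto simp: R_eq indep_child_sums distr_child_sum child_sums_decoupled)

lemma iid_sum_copies: "iid_sum M root R (\<lambda>j. Rc (Suc j))"
proof
  note c = copies[unfolded indep_iid_copies_def]
  have ind: "indep_vars (\<lambda>_. borel) Rc {1..}" using c by blast
  have [measurable]: "Rc i \<in> borel_measurable M" if "1 \<le> i" for i using ind that by (auto simp: indep_vars_def)
  have "indep_vars (\<lambda>j. PiM {Suc j} (\<lambda>_. borel)) (\<lambda>j \<omega>. restrict (\<lambda>i. Rc i \<omega>) {Suc j}) UNIV"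
    by (rule indep_vars_restrict[OF ind]) (auto simp: disjoint_family_on_def)
  then have "indep_vars (\<lambda>_. borel) (\<lambda>j \<omega>. (restrict (\<lambda>i. Rc i \<omega>) {Suc j}) (Suc j)) UNIV"
    by (rule indep_vars_compose2) (auto intro: measurable_component_singleton)
  then show "indep_vars (\<lambda>_. borel) (\<lambda>j. Rc (Suc j)) UNIV" by simp
  show "distr M borel (Rc (Suc j)) = distr M borel R" for j using c by simp
  fix F :: "wvec \<times> (nat \<Rightarrow> real) \<Rightarrow> ennreal" assume F: "F \<in> borel_measurable (vec_space \<Otimes>\<^sub>M PiM UNIV (\<lambda>_. borel))"
  let ?T = "PiM {1..} (\<lambda>_. borel :: real measure)" and ?Y = "\<lambda>\<omega>. \<lambda>i\<in>{1..}. Rc i \<omega>"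
  have Y: "?Y \<in> measurable M ?T" by (rule measurable_restrict) simp
  have sh: "(\<lambda>y j. y (Suc j)) \<in> measurable ?T (PiM UNIV (\<lambda>_. borel))"
    by (rule measurable_PiM_single') (auto intro!: measurable_component_singleton)
  have F': "(\<lambda>p. F (fst p, \<lambda>j. snd p (Suc j))) \<in> borel_measurable (vec_space \<Otimes>\<^sub>M ?T)"
    by (rule measurable_compose[OF measurable_Pair[OF measurable_fst measurable_compose[OF measurable_snd sh]] F])
  have "indep_set {root -` A \<inter> space M | A. A \<in> sets vec_space} {?Y -` B \<inter> space M | B. B \<in> sets ?T}"
    unfolding root_at using c by blast
  from nn_integral_indep_set[OF measurable_V_root Y this F']
  show "(\<integral>\<^sup>+\<omega>. F (root \<omega>, \<lambda>j. Rc (Suc j) \<omega>) \<partial>M) = (\<integral>\<^sup>+\<omega>. (\<integral>\<^sup>+\<omega>'. F (root \<omega>, \<lambda>j. Rc (Suc j) \<omega>') \<partial>M) \<partial>M)"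
    by simp
qed (simp_all add: R_eq)

lemma distr_R_fixed:
  assumes "AE \<omega> in M. integrable (count_space nodes) (tree_term (V \<omega>))"
  shows "distr M borel R = distr M borel (\<lambda>\<omega>. fst (root \<omega>) + (\<Sum>j. weight (root \<omega>) j * Rc (Suc j) \<omega>))"
proof (rule measure_eqI)
  interpret I: iid_sum M root R "\<lambda>j. Rc (Suc j)" by (rule iid_sum_copies)
  let ?G = "\<lambda>p :: wvec \<times> (nat \<Rightarrow> real). fst (fst p) + (\<Sum>j. weight (fst p) j * snd p j)"
  have G[measurable]: "?G \<in> borel_measurable (vec_space \<Otimes>\<^sub>M PiM UNIV (\<lambda>_. borel))" by measurable
  have [measurable]: "(\<lambda>\<omega>. fst (root \<omega>) + (\<Sum>j. weight (root \<omega>) j * Rc (Suc j) \<omega>)) \<in> borel_measurable M"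
    using I.measurable_summand I.measurable_fst_X unfolding I.summand_def[abs_def] by measurable
  have Rm[measurable]: "R \<in> borel_measurable M" by (rule I.R_meas)
  fix A assume "A \<in> sets (distr M borel R)"
  then have A[measurable]: "A \<in> sets borel" by simp
  have em: "emeasure (distr M borel f) A = (\<integral>\<^sup>+\<omega>. indicator A (f \<omega>) \<partial>M)" if "f \<in> borel_measurable M" for f :: "'a \<Rightarrow> real"
    using nn_integral_distr[OF that, of "indicator A"] by simp
  have "emeasure (distr M borel R) A = (\<integral>\<^sup>+\<omega>. indicator A (R \<omega>) \<partial>M)"
    by (rule em) simp
  also have "\<dots> = (\<integral>\<^sup>+\<omega>. indicator A (?G (root \<omega>, \<lambda>j. child_sum j \<omega>)) \<partial>M)"
    by (rule nn_integral_cong_AE) (use tree_fixed_point[OF assms] in \<open>eventually_elim, simp add: R_eq\<close>)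
  also have "\<dots> = (\<integral>\<^sup>+\<omega>. indicator A (?G (root \<omega>, \<lambda>j. Rc (Suc j) \<omega>)) \<partial>M)"
    by (rule iid_sum_functional_cong[OF iid_sum_child_sums iid_sum_copies, of "\<lambda>p. indicator A (?G p)"]) measurable
  also have "\<dots> = emeasure (distr M borel (\<lambda>\<omega>. fst (root \<omega>) + (\<Sum>j. weight (root \<omega>) j * Rc (Suc j) \<omega>))) A"
    by (subst em) simp_all
  finally show "emeasure (distr M borel R) A = emeasure (distr M borel (\<lambda>\<omega>. fst (root \<omega>) + (\<Sum>j. weight (root \<omega>) j * Rc (Suc j) \<omega>))) A" .
qed simp

lemma abs_powr_sum_eq:
  "abs_powr_sum (Nt []) (\<lambda>j. Ct [j]) p \<omega> = (\<Sum>j. ennreal (\<bar>weight (root \<omega>) j\<bar> powr p))"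
  unfolding abs_powr_sum_def
  by (subst infsum_children) (auto intro!: infsum_nat_eq_suminf nonneg_summable_on_complete)

end

lemma ennreal_powr_suminf:
  fixes z :: "nat \<Rightarrow> real"
  assumes "summable z" "\<And>j. 0 \<le> z j"
  shows "ennreal_powr (\<Sum>j. ennreal (z j)) p = ennreal ((\<Sum>j. z j) powr p)"
  using suminf_nonneg[OF assms] by (simp add: suminf_ennreal2[OF assms(2,1)] ennreal_powr_def)

lemma le_one_plus_ennreal_powr:
  assumes "1 \<le> p"
  shows "x \<le> 1 + ennreal_powr x p"
proof (cases x)
  case (real r)
  have "r \<le> 1 + r powr p" using powr_le_one_plus[of r 1 p] assms real by simp
  then have "ennreal r \<le> ennreal (1 + r powr p)" by (rule ennreal_leI)
  then show ?thesis using real by (simp add: ennreal_powr_def ennreal_plus[symmetric] del: ennreal_plus flip: ennreal_1)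
qed (simp add: ennreal_powr_def)

section \<open>Tail asymptotics of the tree series\<close>

context tree_copies begin

abbreviation N0 :: "'a \<Rightarrow> enat" where "N0 \<equiv> Nt []"
abbreviation C0 :: "nat \<Rightarrow> 'a \<Rightarrow> real" where "C0 \<equiv> (\<lambda>j. Ct [j])"

lemma log_moment_eq_ext_expectation_step:
  assumes "weight_vector M root \<alpha> \<beta>"
  shows "log_moment M N0 C0 \<alpha> = ext_expectation (step_space M root \<alpha>) (step root)"
proof -
  interpret weight_vector M root \<alpha> \<beta> by fact
  let ?a = "\<lambda>\<omega> j. \<bar>weight (root \<omega>) j\<bar> powr \<alpha> * ln \<bar>weight (root \<omega>) j\<bar>"
  have eq: "AE \<omega> in M. (\<Sum>\<^sub>\<infinity>j\<in>idx (N0 \<omega>). \<bar>C0 j \<omega>\<bar> powr \<alpha> * ln \<bar>C0 j \<omega>\<bar>) = (\<Sum>j. ?a \<omega> j)"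
    using AE_summable_weights_\<beta>
  proof eventually_elim
    case (elim \<omega>)
    have "(\<Sum>\<^sub>\<infinity>j\<in>idx (N0 \<omega>). \<bar>C0 j \<omega>\<bar> powr \<alpha> * ln \<bar>C0 j \<omega>\<bar>) = (\<Sum>\<^sub>\<infinity>j. ?a \<omega> j)"
      using infsum_children[of "\<lambda>_ c. \<bar>c\<bar> powr \<alpha> * ln \<bar>c\<bar>" \<omega>] by simp
    also have "\<dots> = (\<Sum>j. ?a \<omega> j)"
      using summable_imp_summable_log[OF elim \<beta>_pos \<beta>_less] by (intro infsum_nat_eq_suminf_real) (simp add: abs_mult)
    finally show ?case .
  qed
  have "(\<integral>\<^sup>+\<omega>. ennreal (\<Sum>\<^sub>\<infinity>j\<in>idx (N0 \<omega>). \<bar>C0 j \<omega>\<bar> powr \<alpha> * ln \<bar>C0 j \<omega>\<bar>) \<partial>M) = (\<integral>\<^sup>+\<omega>. ennreal (\<Sum>j. ?a \<omega> j) \<partial>M)"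
    by (rule nn_integral_cong_AE) (use eq in \<open>eventually_elim, simp\<close>)
  moreover have "(\<integral>\<^sup>+\<omega>. ennreal (- (\<Sum>\<^sub>\<infinity>j\<in>idx (N0 \<omega>). \<bar>C0 j \<omega>\<bar> powr \<alpha> * ln \<bar>C0 j \<omega>\<bar>)) \<partial>M) = (\<integral>\<^sup>+\<omega>. ennreal (- (\<Sum>j. ?a \<omega> j)) \<partial>M)"
    by (rule nn_integral_cong_AE) (use eq in \<open>eventually_elim, simp\<close>)
  ultimately have "log_moment M N0 C0 \<alpha> = ext_expectation M (\<lambda>\<omega>. \<Sum>j. ?a \<omega> j)"
    unfolding log_moment_def ext_expectation_def by simp
  then show ?thesis by (simp only: ext_expectation_log_sum)
qed

text \<open>
  The moment conditions on the weights have a common form, with \<open>\<beta> = 1\<close> for \<open>\<alpha> > 1\<close> and \<open>\<beta> = \<alpha> / (1 + \<epsilon>)\<close> for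
  \<open>\<alpha> \<le> 1\<close>. The condition at \<open>\<beta>\<close> implies that at larger exponents (\<open>summable_powr_ge_1\<close>). For \<open>\<alpha> \<le> 1\<close> this leaves
  room to choose \<open>b\<close> between \<open>\<beta>\<close> and \<open>\<alpha>\<close> such that moments of order \<open>b\<close> contract; for \<open>\<alpha> > 1\<close> they do at
  \<open>b = 1\<close>.
\<close>

lemma exists_critical_smoothing:
  assumes \<beta>: "0 < \<beta>" "\<beta> < \<alpha>" "\<beta> \<le> 1"
    and cases: "\<alpha> \<le> 1 \<or> \<beta> = 1 \<and> (\<integral>\<^sup>+\<omega>. abs_powr_sum N0 C0 1 \<omega> \<partial>M) < 1"
    and C\<alpha>: "(\<integral>\<^sup>+\<omega>. abs_powr_sum N0 C0 \<alpha> \<omega> \<partial>M) = 1"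
    and C\<beta>: "(\<integral>\<^sup>+\<omega>. ennreal_powr (abs_powr_sum N0 C0 \<beta> \<omega>) (\<alpha> / \<beta>) \<partial>M) < \<infinity>"
    and Q: "(\<integral>\<^sup>+\<omega>. ennreal (\<bar>Qt [] \<omega>\<bar> powr \<alpha>) \<partial>M) < \<infinity>"
    and nonlattice: "\<exists>j. \<forall>l>0. \<not> (AE \<omega> in M. weight (root \<omega>) j \<noteq> 0 \<longrightarrow> ln \<bar>weight (root \<omega>) j\<bar> \<in> {of_int k * l | k. True})"
    and drift: "0 < log_moment M N0 C0 \<alpha>"
  obtains b \<rho> where "critical_smoothing M root R (\<lambda>j. Rc (Suc j)) b \<alpha> \<rho>"
proof -
  let ?w = "\<lambda>\<omega> j. weight (root \<omega>) j"
  interpret I: iid_sum M root R "\<lambda>j. Rc (Suc j)" by (rule iid_sum_copies)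
  have p: "1 \<le> \<alpha> / \<beta>" using \<beta> by simp
  have "(\<integral>\<^sup>+\<omega>. (\<Sum>j. ennreal (\<bar>?w \<omega> j\<bar> powr \<beta>)) \<partial>M) \<le> (\<integral>\<^sup>+\<omega>. 1 + ennreal_powr (abs_powr_sum N0 C0 \<beta> \<omega>) (\<alpha> / \<beta>) \<partial>M)"
    unfolding abs_powr_sum_eq by (intro nn_integral_mono le_one_plus_ennreal_powr p)
  also have "\<dots> = 1 + (\<integral>\<^sup>+\<omega>. ennreal_powr (abs_powr_sum N0 C0 \<beta> \<omega>) (\<alpha> / \<beta>) \<partial>M)"
    unfolding abs_powr_sum_eq ennreal_powr_def by (subst nn_integral_add) (auto simp: emeasure_space_1)
  also have "\<dots> < \<infinity>" using C\<beta> by (simp add: less_top[symmetric])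
  finally have w\<beta>: "(\<integral>\<^sup>+\<omega>. (\<Sum>j. ennreal (\<bar>?w \<omega> j\<bar> powr \<beta>)) \<partial>M) < \<infinity>" .
  have wv: "weight_vector M root \<alpha> \<beta>"
    by unfold_locales (use \<beta> C\<alpha> w\<beta> in \<open>auto simp: abs_powr_sum_eq\<close>)
  interpret wv: weight_vector M root \<alpha> \<beta> by (rule wv)
  have drift': "0 < ext_expectation (step_space M root \<alpha>) (step root)"
    using drift by (simp only: log_moment_eq_ext_expectation_step[OF wv])
  have "\<exists>b. \<beta> \<le> b \<and> b < \<alpha> \<and> b \<le> 1 \<and> (\<alpha> \<le> 1 \<or> b = 1) \<and> weight_moment b < 1"
  proof (cases "\<alpha> \<le> 1")
    case True
    obtain b where "\<beta> \<le> b" "b < \<alpha>" "(\<integral>\<^sup>+\<omega>. (\<Sum>j. ennreal (\<bar>?w \<omega> j\<bar> powr b)) \<partial>M) < 1"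
      using wv.exists_weight_moment_less_1[OF drift'] by (elim exE conjE)
    then show ?thesis using True by (intro exI[of _ b]) (simp add: weight_moment_def)
  next
    case False
    then have \<beta>1: "\<beta> = 1" and less: "(\<integral>\<^sup>+\<omega>. abs_powr_sum N0 C0 1 \<omega> \<partial>M) < 1" using cases by auto
    have "weight_moment 1 < 1" using less by (simp only: weight_moment_def abs_powr_sum_eq)
    then have "\<beta> \<le> 1 \<and> 1 < \<alpha> \<and> (1::real) \<le> 1 \<and> (\<alpha> \<le> 1 \<or> (1::real) = 1) \<and> weight_moment 1 < 1"
      using False \<beta>1 by linarith
    then show ?thesis by (rule exI)
  qed
  then obtain b where b: "\<beta> \<le> b" "b < \<alpha>" "b \<le> 1" "\<alpha> \<le> 1 \<or> b = 1" "weight_moment b < 1"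
    by (elim exE conjE)
  have b0: "0 < b" using b \<beta> by simp
  obtain \<rho> where \<rho>: "weight_moment b = ennreal \<rho>" "0 \<le> \<rho>" "\<rho> < 1"
    using b(5) by (cases "weight_moment b") (auto simp: ennreal_less_one_iff)
  have Q\<alpha>: "(\<integral>\<^sup>+\<omega>. ennreal (\<bar>fst (root \<omega>)\<bar> powr \<alpha>) \<partial>M) < \<infinity>" using Q by (simp add: fst_root)
  have "(\<integral>\<^sup>+\<omega>. ennreal (\<bar>fst (root \<omega>)\<bar> powr b) \<partial>M) \<le> (\<integral>\<^sup>+\<omega>. 1 + ennreal (\<bar>fst (root \<omega>)\<bar> powr \<alpha>) \<partial>M)"
  proof (intro nn_integral_mono)
    fix \<omega>
    have "ennreal (\<bar>fst (root \<omega>)\<bar> powr b) \<le> ennreal (1 + \<bar>fst (root \<omega>)\<bar> powr \<alpha>)"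
      using b b0 by (intro ennreal_leI powr_le_one_plus) auto
    then show "ennreal (\<bar>fst (root \<omega>)\<bar> powr b) \<le> 1 + ennreal (\<bar>fst (root \<omega>)\<bar> powr \<alpha>)" by simp
  qed
  also have "\<dots> = 1 + (\<integral>\<^sup>+\<omega>. ennreal (\<bar>fst (root \<omega>)\<bar> powr \<alpha>) \<partial>M)"
    using I.measurable_fst_X by (subst nn_integral_add) (auto simp: emeasure_space_1)
  also have "\<dots> < \<infinity>" using Q\<alpha> by (simp add: less_top[symmetric])
  finally have Qb: "(\<integral>\<^sup>+\<omega>. ennreal (\<bar>fst (root \<omega>)\<bar> powr b) \<partial>M) < \<infinity>" .
  note tree = tree_moment[OF b0 b(3,5) Qb]
  have sum_moment: "(\<integral>\<^sup>+\<omega>. ennreal ((\<Sum>j. \<bar>?w \<omega> j\<bar> powr b) powr (\<alpha> / b)) \<partial>M) < \<infinity>"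
  proof (rule le_less_trans[OF nn_integral_mono_AE C\<beta>])
    show "AE \<omega> in M. ennreal ((\<Sum>j. \<bar>?w \<omega> j\<bar> powr b) powr (\<alpha> / b)) \<le> ennreal_powr (abs_powr_sum N0 C0 \<beta> \<omega>) (\<alpha> / \<beta>)"
      using wv.AE_summable_weights_\<beta>
    proof eventually_elim
      case (elim \<omega>)
      have e: "(\<bar>?w \<omega> j\<bar> powr \<beta>) powr (b / \<beta>) = \<bar>?w \<omega> j\<bar> powr b" for j using \<beta> by (simp add: powr_powr)
      have r: "1 \<le> b / \<beta>" using b \<beta> by simp
      note s = summable_powr_ge_1[OF elim _ r, unfolded e]
      have "(\<Sum>j. \<bar>?w \<omega> j\<bar> powr b) powr (\<alpha> / b) \<le> ((\<Sum>j. \<bar>?w \<omega> j\<bar> powr \<beta>) powr (b / \<beta>)) powr (\<alpha> / b)"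
        using s b b0 by (intro powr_mono2) (auto intro!: suminf_nonneg)
      also have "\<dots> = (\<Sum>j. \<bar>?w \<omega> j\<bar> powr \<beta>) powr (\<alpha> / \<beta>)" using b0 \<beta> by (simp add: powr_powr)
      finally show ?case
        unfolding abs_powr_sum_eq by (subst ennreal_powr_suminf[OF elim]) (auto intro: ennreal_leI)
    qed
  qed
  have "critical_smoothing M root R (\<lambda>j. Rc (Suc j)) b \<alpha> \<rho>"
  proof
    show "(\<integral>\<^sup>+\<omega>. (\<Sum>j. ennreal (\<bar>?w \<omega> j\<bar> powr b)) \<partial>M) \<le> ennreal \<rho>"
      using \<rho>(1) by (simp add: weight_moment_def)
    show "(\<integral>\<^sup>+\<omega>. (\<Sum>j. ennreal (\<bar>?w \<omega> j\<bar> powr \<alpha>)) \<partial>M) = 1" using C\<alpha> by (simp only: abs_powr_sum_eq)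
    show "I.abs_moment b < \<infinity>" using tree(2) by (simp only: I.abs_moment_def R_series_eq)
    show "distr M borel R = distr M borel (\<lambda>\<omega>. fst (root \<omega>) + (\<Sum>j. I.summand j \<omega>))"
      unfolding I.summand_def by (rule distr_R_fixed[OF tree(1)])
  qed (rule b0 b \<rho> sum_moment Q\<alpha> nonlattice drift')+
  then show ?thesis by (rule that)
qed

context
  fixes b \<alpha> \<rho>
  assumes crit: "critical_smoothing M root R (\<lambda>j. Rc (Suc j)) b \<alpha> \<rho>"
begin

interpretation K: critical_smoothing M root R "\<lambda>j. Rc (Suc j)" b \<alpha> \<rho> by (rule crit)

text \<open>
  Two functions are involved because \<open>x\<close> and its positive part exceed a level \<open>v > 0\<close> simultaneously, while only the
  positive part is nonnegative; likewise for \<open>- x\<close>.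
\<close>

lemma tail_gap_eq:
  assumes "homogeneous_tail M root R (\<lambda>j. Rc (Suc j)) b \<alpha> \<rho> g"
    and v: "0 < v" and h: "\<And>x. v < h x \<longleftrightarrow> v < g x"
  shows "tail_gap M N0 C0 R (Rc 1) h v = tail_setting.tail_excess M root R g v"
proof -
  interpret G: homogeneous_tail M root R "\<lambda>j. Rc (Suc j)" b \<alpha> \<rho> g by fact
  have ci: "(\<Sum>\<^sub>\<infinity>i\<in>idx (N0 \<omega>). of_bool (h (C0 i \<omega> * Rc 1 \<omega>) > v)) = (\<Sum>\<^sub>\<infinity>j. of_bool (v < g (weight (root \<omega>) j * Rc (Suc 0) \<omega>)) :: real)" for \<omega>
    using infsum_children[of "\<lambda>_ c. of_bool (v < g (c * Rc 1 \<omega>))" \<omega>] v by (simp add: h G.g_0)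
  have "AE \<omega> in M. (\<Sum>\<^sub>\<infinity>i\<in>idx (N0 \<omega>). of_bool (h (C0 i \<omega> * Rc 1 \<omega>) > v)) = (\<Sum>j. of_bool (v < g (weight (root \<omega>) j * Rc (Suc 0) \<omega>)) :: real)"
    using G.AE_summable_exceedances[OF v, of "\<lambda>_. 0"]
  proof eventually_elim
    case (elim \<omega>)
    have "(\<Sum>\<^sub>\<infinity>j. of_bool (v < g (weight (root \<omega>) j * Rc (Suc 0) \<omega>)) :: real) = (\<Sum>j. of_bool (v < g (weight (root \<omega>) j * Rc (Suc 0) \<omega>)))"
      using elim by (intro infsum_nat_eq_suminf_real) simp
    then show ?case by (simp only: ci)
  qed
  moreover have "(\<lambda>\<omega>. \<Sum>\<^sub>\<infinity>i\<in>idx (N0 \<omega>). of_bool (h (C0 i \<omega> * Rc 1 \<omega>) > v) :: real) \<in> borel_measurable M"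
    unfolding ci using K.Rs_meas K.measurable_weight_X by (intro measurable_infsum_nat) measurable
  ultimately have "(\<integral>\<omega>. (\<Sum>\<^sub>\<infinity>i\<in>idx (N0 \<omega>). of_bool (h (C0 i \<omega> * Rc 1 \<omega>) > v)) \<partial>M)
      = (\<integral>\<omega>. (\<Sum>j. of_bool (v < g (weight (root \<omega>) j * Rc (Suc 0) \<omega>)) :: real) \<partial>M)"
    using G.exceedances_integral[OF v, of "\<lambda>_. 0"] by (intro integral_cong_AE) (auto simp: has_bochner_integral_iff)
  also have "\<dots> = enn2real (G.mean_exceedances v)"
    using G.exceedances_integral[OF v, of "\<lambda>_. 0"] by (simp add: has_bochner_integral_iff)
  finally show ?thesis by (simp add: tail_gap_def G.tail_excess_def h)
qed

text \<open>
  Unordered sums and series agree where they converge absolutely, which is almost everywhere.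
\<close>

lemma power_gap_AE_eq:
  assumes "homogeneous_tail M root R (\<lambda>j. Rc (Suc j)) b \<alpha> \<rho> g"
  shows "AE \<omega> in M. power_gap (Qt []) N0 C0 Rc \<alpha> g \<omega> = tail_setting.tail_power_gap root (\<lambda>j. Rc (Suc j)) \<alpha> g \<omega>"
    and "power_gap (Qt []) N0 C0 Rc \<alpha> g \<in> borel_measurable M"
proof -
  interpret G: homogeneous_tail M root R "\<lambda>j. Rc (Suc j)" b \<alpha> \<rho> g by fact
  have e: "power_gap (Qt []) N0 C0 Rc \<alpha> g \<omega> = g ((\<Sum>\<^sub>\<infinity>j. K.summand j \<omega>) + fst (root \<omega>)) powr \<alpha> - (\<Sum>\<^sub>\<infinity>j. g (K.summand j \<omega>) powr \<alpha>)" for \<omega>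
    using infsum_children[of "\<lambda>i c. c * Rc i \<omega>" \<omega>] infsum_children[of "\<lambda>i c. g (c * Rc i \<omega>) powr \<alpha>" \<omega>]
    by (simp add: power_gap_def K.summand_def fst_root G.g_0)
  show "AE \<omega> in M. power_gap (Qt []) N0 C0 Rc \<alpha> g \<omega> = G.tail_power_gap \<omega>"
    using K.AE_summable_summands
  proof eventually_elim
    case (elim \<omega>)
    have "summable (\<lambda>j. \<bar>K.summand j \<omega>\<bar>)" by (rule abs_suminf_powr_le[OF elim K.b])
    moreover have "summable (\<lambda>j. \<bar>g (K.summand j \<omega>) powr \<alpha>\<bar>)"
      by (rule summable_comparison_test'[OF K.summable_powr[OF elim], of 0])
        (use G.g G.\<alpha>_pos in \<open>auto intro!: powr_mono2\<close>)
    ultimately show ?case unfolding e G.tail_power_gap_def by (simp add: infsum_nat_eq_suminf_real add.commute)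
  qed
  have [measurable]: "(\<lambda>\<omega>. \<Sum>\<^sub>\<infinity>j. K.summand j \<omega>) \<in> borel_measurable M" "(\<lambda>\<omega>. \<Sum>\<^sub>\<infinity>j. g (K.summand j \<omega>) powr \<alpha>) \<in> borel_measurable M"
    by (rule measurable_infsum_nat, measurable)+
  show "power_gap (Qt []) N0 C0 Rc \<alpha> g \<in> borel_measurable M"
    unfolding e[abs_def] using K.measurable_fst_X by measurable
qed

lemma tail_constant:
  assumes G: "homogeneous_tail M root R (\<lambda>j. Rc (Suc j)) b \<alpha> \<rho> g"
    and h: "\<And>v x. 0 < v \<Longrightarrow> v < h x \<longleftrightarrow> v < g x"
  shows "is_tail_constant M \<alpha> (log_moment M N0 C0 \<alpha>) \<kappa> (tail_gap M N0 C0 R (Rc 1) h) (power_gap (Qt []) N0 C0 Rc \<alpha> g)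
    (K.renewal_const (expectation (\<lambda>\<omega>. g (fst (root \<omega>) + (\<Sum>j. K.summand j \<omega>)) powr \<alpha> - (\<Sum>j. g (K.summand j \<omega>) powr \<alpha>)) / \<alpha>) / \<kappa>)"
proof -
  interpret G: homogeneous_tail M root R "\<lambda>j. Rc (Suc j)" b \<alpha> \<rho> g by fact
  note pg = power_gap_AE_eq[OF G]
  have m: "log_moment M N0 C0 \<alpha> = ext_expectation (step_space M root \<alpha>) (step root)"
    by (rule log_moment_eq_ext_expectation_step[OF K.steps.weight_vector_axioms])
  have tg: "tail_gap M N0 C0 R (Rc 1) h v = G.tail_excess v" if "0 < v" for v
    by (rule tail_gap_eq[OF G that h[OF that]])
  have cong: "(\<lambda>v. indicator {0<..} v *\<^sub>R (v powr (\<alpha> - 1) * tail_gap M N0 C0 R (Rc 1) h v)) = (\<lambda>v. indicator {0<..} v *\<^sub>R (v powr (\<alpha> - 1) * G.tail_excess v))"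
    by (auto simp: fun_eq_iff indicator_def tg simp del: One_nat_def)
  have int: "integrable M (power_gap (Qt []) N0 C0 Rc \<alpha> g)" "expectation (power_gap (Qt []) N0 C0 Rc \<alpha> g) = expectation G.tail_power_gap"
    using G.tail_excess_integral(2)[OF level_measure_powr[OF G.\<alpha>_pos]] pg integrable_cong_AE[OF pg(2) _ pg(1)] integral_cong_AE[OF pg(2) _ pg(1)]
    by auto
  have s: "set_integrable lborel {0<..} (\<lambda>v. v powr (\<alpha> - 1) * tail_gap M N0 C0 R (Rc 1) h v)"
    "(LBINT v:{0<..}. v powr (\<alpha> - 1) * tail_gap M N0 C0 R (Rc 1) h v) = expectation G.tail_power_gap / \<alpha>"
    using G.tail_excess_set_integral unfolding set_integrable_def set_lebesgue_integral_def cong by auto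
  show ?thesis
    unfolding is_tail_constant_def m K.renewal_const_def G.tail_power_gap_def[symmetric] s(2) int(2)
    using s(1) int(1) by (simp add: mult.commute mult.left_commute)
qed

end
end
lemma power_tail_cong:
  assumes "((\<lambda>t. t powr \<alpha> * f t) \<longlongrightarrow> H) at_top" and "\<And>t. 0 < t \<Longrightarrow> f t = f' t"
  shows "power_tail f' \<alpha> H"
  unfolding power_tail_def using assms(1)
proof (rule Lim_transform_eventually)
  show "\<forall>\<^sub>F t in at_top. t powr \<alpha> * f t = t powr \<alpha> * f' t"
    using eventually_gt_at_top[of 0] by eventually_elim (simp add: assms(2))
qed

lemma power_tail_nonneg:
  assumes "power_tail f \<alpha> H" "\<And>t. 0 \<le> f t"
  shows "0 \<le> H"
  by (rule tendsto_lowerbound[OF assms(1)[unfolded power_tail_def]]) (use assms(2) in auto)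

text \<open>
  A lattice through the origin would be a lattice for the law of \<open>log \<bar>C\<^sub>j\<bar>\<close> on the event that the weight exists and
  does not vanish.
\<close>

lemma (in tree_copies) nonlattice_root_weight:
  assumes j: "1 \<le> j" and nl: "\<not> lattice_measure (log_weight_measure M N0 C0 j)"
    and l: "0 < l"
  shows "\<not> (AE \<omega> in M. weight (root \<omega>) (j - 1) \<noteq> 0 \<longrightarrow> ln \<bar>weight (root \<omega>) (j - 1)\<bar> \<in> {of_int k * l | k. True})"
proof
  let ?w = "\<lambda>\<omega>. weight (root \<omega>) (j - 1)"
  let ?S = "{\<omega>\<in>space M. \<bar>C0 j \<omega>\<bar> > 0 \<and> enat j \<le> N0 \<omega>}" and ?L = "{0 + of_int k * l | k. True}"
  assume ae: "AE \<omega> in M. ?w \<omega> \<noteq> 0 \<longrightarrow> ln \<bar>?w \<omega>\<bar> \<in> {of_int k * l | k. True}"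
  have w: "?w \<omega> = (if enat j \<le> N0 \<omega> then C0 j \<omega> else 0)" for \<omega>
    using j by (simp add: weight_root idx_def)
  have wm[measurable]: "?w \<in> borel_measurable M" by (rule measurable_weight_comp[OF measurable_V_root])
  have S: "?S = {\<omega>\<in>space M. ?w \<omega> \<noteq> 0}" by (auto simp: w simp del: One_nat_def)
  have SM: "?S \<in> sets M" unfolding S by measurable
  have f: "(\<lambda>\<omega>. ln \<bar>C0 j \<omega>\<bar>) \<in> borel_measurable (restrict_space M ?S)"
  proof (subst measurable_cong)
    show "ln \<bar>C0 j \<omega>\<bar> = ln \<bar>?w \<omega>\<bar>" if "\<omega> \<in> space (restrict_space M ?S)" for \<omega>
      using that by (auto simp: w space_restrict_space simp del: One_nat_def)
    show "(\<lambda>\<omega>. ln \<bar>?w \<omega>\<bar>) \<in> borel_measurable (restrict_space M ?S)"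
      by (rule measurable_restrict_space1) measurable
  qed
  have "?L = range (\<lambda>k. 0 + of_int k * l)" by auto
  then have "countable ?L" by simp
  then have L: "?L \<in> sets borel" by (rule sets.countable[rotated]) simp
  have "AE x in log_weight_measure M N0 C0 j. x \<in> ?L"
    unfolding log_weight_measure_def
  proof (subst AE_distr_iff[OF f])
    show "{x \<in> space borel. x \<in> ?L} \<in> sets borel" using L by simp
    have "AE \<omega> in M. \<omega> \<in> ?S \<longrightarrow> ln \<bar>C0 j \<omega>\<bar> \<in> ?L"
      using ae by eventually_elim (auto simp: w simp del: One_nat_def)
    then show "AE \<omega> in restrict_space M ?S. ln \<bar>C0 j \<omega>\<bar> \<in> ?L"
      using SM by (subst AE_restrict_space_iff) auto
  qed
  then show False using nl l unfolding lattice_measure_def by blast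
qed

theorem theorem4p6:
  fixes M :: "'a measure"
    and Qt :: "nat list \<Rightarrow> 'a \<Rightarrow> real" and Nt :: "nat list \<Rightarrow> 'a \<Rightarrow> enat"
    and Ct :: "nat list \<Rightarrow> 'a \<Rightarrow> real"
    and Q :: "'a \<Rightarrow> real" and N :: "'a \<Rightarrow> enat" and C :: "nat \<Rightarrow> 'a \<Rightarrow> real"
    and R :: "'a \<Rightarrow> real" and Rc :: "nat \<Rightarrow> 'a \<Rightarrow> real"
    and \<alpha> :: real and m :: ereal
  assumes tree: "weighted_branching_tree M Qt Nt Ct"
    and root: "Q = Qt []" "N = Nt []" "C = (\<lambda>j. Ct [j])"
    and R: "R = R_series Qt Nt Ct"
    and copies: "indep_iid_copies M R vec_space (padded_vec Q N C) Rc"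
    and Q_nonzero: "measure M {\<omega>\<in>space M. \<bar>Q \<omega>\<bar> > 0} > 0"
    and nonlattice: "\<exists>j\<ge>1. measure M {\<omega>\<in>space M. enat j \<le> N \<omega> \<and> \<bar>C j \<omega>\<bar> > 0} > 0 \<and>
            \<not> lattice_measure (log_weight_measure M N C j)"
    and alpha: "\<alpha> > 0"
    and Q_moment: "(\<integral>\<^sup>+\<omega>. ennreal (\<bar>Q \<omega>\<bar> powr \<alpha>) \<partial>M) < \<infinity>"
    and m: "m = log_moment M N C \<alpha>" "m > 0"
    and C_moment: "(\<integral>\<^sup>+\<omega>. abs_powr_sum N C \<alpha> \<omega> \<partial>M) = 1"
    and case1: "\<alpha> > 1 \<Longrightarrow>
            (\<integral>\<^sup>+\<omega>. abs_powr_sum N C 1 \<omega> \<partial>M) < 1 \<and>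
            (\<integral>\<^sup>+\<omega>. ennreal_powr (abs_powr_sum N C 1 \<omega>) \<alpha> \<partial>M) < \<infinity>"
    and case2: "\<alpha> \<le> 1 \<Longrightarrow>
            \<exists>\<epsilon>. 0 < \<epsilon> \<and> \<epsilon> < 1 \<and>
              (\<integral>\<^sup>+\<omega>. ennreal_powr (abs_powr_sum N C (\<alpha> / (1 + \<epsilon>)) \<omega>) (1 + \<epsilon>) \<partial>M) < \<infinity>"
  shows
    "((AE \<omega> in M. \<forall>i\<in>idx (N \<omega>). C i \<omega> \<ge> 0) \<longrightarrow>
       (\<exists>Hp\<ge>0. \<exists>Hm\<ge>0.
          power_tail (\<lambda>t. measure M {\<omega>\<in>space M. R \<omega> > t}) \<alpha> Hp \<and>
          power_tail (\<lambda>t. measure M {\<omega>\<in>space M. R \<omega> < - t}) \<alpha> Hm \<and>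
          is_tail_constant M \<alpha> m 1
            (tail_gap M N C R (Rc 1) (\<lambda>x. x)) (power_gap Q N C Rc \<alpha> (\<lambda>x. max x 0)) Hp \<and>
          is_tail_constant M \<alpha> m 1
            (tail_gap M N C R (Rc 1) (\<lambda>x. - x)) (power_gap Q N C Rc \<alpha> (\<lambda>x. max (- x) 0)) Hm)) \<and>
     ((\<exists>j\<ge>1. measure M {\<omega>\<in>space M. enat j \<le> N \<omega> \<and> C j \<omega> < 0} > 0) \<longrightarrow>
       (\<exists>H.
          power_tail (\<lambda>t. measure M {\<omega>\<in>space M. R \<omega> > t}) \<alpha> H \<and>
          power_tail (\<lambda>t. measure M {\<omega>\<in>space M. R \<omega> < - t}) \<alpha> H \<and>
          is_tail_constant M \<alpha> m 2
            (tail_gap M N C R (Rc 1) (\<lambda>x. \<bar>x\<bar>)) (power_gap Q N C Rc \<alpha> (\<lambda>x. \<bar>x\<bar>)) H))"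
proof -
  interpret T: tree_copies M Qt Nt Ct Rc
    by unfold_locales (use tree copies in \<open>simp_all add: root R\<close>)
  obtain \<beta> where \<beta>: "0 < \<beta>" "\<beta> < \<alpha>" "\<beta> \<le> 1" "\<alpha> \<le> 1 \<or> \<beta> = 1 \<and> (\<integral>\<^sup>+\<omega>. abs_powr_sum N C 1 \<omega> \<partial>M) < 1"
    "(\<integral>\<^sup>+\<omega>. ennreal_powr (abs_powr_sum N C \<beta> \<omega>) (\<alpha> / \<beta>) \<partial>M) < \<infinity>"
  proof (cases "\<alpha> \<le> 1")
    case True
    obtain \<epsilon> where \<epsilon>: "0 < \<epsilon>" "(\<integral>\<^sup>+\<omega>. ennreal_powr (abs_powr_sum N C (\<alpha> / (1 + \<epsilon>)) \<omega>) (1 + \<epsilon>) \<partial>M) < \<infinity>"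
      using case2[OF True] by (elim exE conjE)
    \<comment> \<open>The exponent \<open>\<beta> = \<alpha> / (1 + \<epsilon>)\<close> turns the second moment condition into the common form.\<close>
    have e: "\<alpha> / (\<alpha> / (1 + \<epsilon>)) = 1 + \<epsilon>" using alpha \<epsilon> by simp
    show ?thesis
    proof (rule that[of "\<alpha> / (1 + \<epsilon>)"])
      show "(\<integral>\<^sup>+\<omega>. ennreal_powr (abs_powr_sum N C (\<alpha> / (1 + \<epsilon>)) \<omega>) (\<alpha> / (\<alpha> / (1 + \<epsilon>))) \<partial>M) < \<infinity>"
        unfolding e by (rule \<epsilon>)
    qed (use alpha \<epsilon> True in \<open>auto simp: field_simps\<close>)
  next
    case False
    then have a1: "\<alpha> > 1" by simp
    show ?thesis
    \<comment> \<open>For \<open>\<alpha> > 1\<close> increments of \<open>\<alpha>\<close>-th powers are controlled linearly, hence \<open>\<beta> = 1\<close>.\<close>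
    proof (rule that[of 1])
      show "(\<integral>\<^sup>+\<omega>. ennreal_powr (abs_powr_sum N C 1 \<omega>) (\<alpha> / 1) \<partial>M) < \<infinity>" using case1[OF a1] by simp
      show "\<alpha> \<le> 1 \<or> (1::real) = 1 \<and> (\<integral>\<^sup>+\<omega>. abs_powr_sum N C 1 \<omega> \<partial>M) < 1" using case1[OF a1] by blast
    qed (use a1 in auto)
  qed
  have nl: "\<exists>j. \<forall>l>0. \<not> (AE \<omega> in M. weight (T.root \<omega>) j \<noteq> 0 \<longrightarrow> ln \<bar>weight (T.root \<omega>) j\<bar> \<in> {of_int k * l | k. True})"
  proof -
    obtain j where "1 \<le> j" "\<not> lattice_measure (log_weight_measure M N C j)" using nonlattice by (elim exE conjE)
    then show ?thesis using T.nonlattice_root_weight[of j] unfolding root by (intro exI[of _ "j - 1"]) blast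
  qed
  obtain b \<rho> where crit: "critical_smoothing M T.root R (\<lambda>j. Rc (Suc j)) b \<alpha> \<rho>"
    using T.exists_critical_smoothing[OF \<beta>(1-3) \<beta>(4)[unfolded root] C_moment[unfolded root] \<beta>(5)[unfolded root]
      Q_moment[unfolded root] nl m(2)[unfolded m(1) root]] unfolding R .
  interpret K: critical_smoothing M T.root R "\<lambda>j. Rc (Suc j)" b \<alpha> \<rho> by (rule crit)
  note const = T.tail_constant[OF crit[unfolded R], folded R root, folded m(1)]
  have pos: "v < x \<longleftrightarrow> v < max x 0" and neg: "v < - x \<longleftrightarrow> v < max (- x) 0" if "0 < v" for v x :: real
    using that by auto
  have tails: "measure M {\<omega>\<in>space M. t < max (R \<omega>) 0} = measure M {\<omega>\<in>space M. R \<omega> > t}"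
    "measure M {\<omega>\<in>space M. t < max (- R \<omega>) 0} = measure M {\<omega>\<in>space M. R \<omega> < - t}" if "0 < t" for t
    using that by (auto intro!: arg_cong[where f="measure M"])
  show ?thesis
  proof (intro conjI impI)
    assume nonneg: "AE \<omega> in M. \<forall>i\<in>idx (N \<omega>). C i \<omega> \<ge> 0"
    have nw: "AE \<omega> in M. \<forall>j. 0 \<le> weight (T.root \<omega>) j"
      using nonneg by eventually_elim (auto simp: T.weight_root root)
    have "\<exists>H. power_tail (\<lambda>t. measure M {\<omega>\<in>space M. R \<omega> > t}) \<alpha> H \<and>
        is_tail_constant M \<alpha> m 1 (tail_gap M N C R (Rc 1) (\<lambda>x. x)) (power_gap Q N C Rc \<alpha> (\<lambda>x. max x 0)) H"
      by (intro exI conjI, rule power_tail_cong[OF K.tail_limit_nonneg_weights[OF K.homogeneous_tails(1) nw]],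
        erule tails(1), rule const[OF K.homogeneous_tails(1), where \<kappa>=1, unfolded div_by_1], erule pos)
    then obtain Hp where Hp: "power_tail (\<lambda>t. measure M {\<omega>\<in>space M. R \<omega> > t}) \<alpha> Hp"
        "is_tail_constant M \<alpha> m 1 (tail_gap M N C R (Rc 1) (\<lambda>x. x)) (power_gap Q N C Rc \<alpha> (\<lambda>x. max x 0)) Hp"
      by (elim exE conjE)
    have "\<exists>H. power_tail (\<lambda>t. measure M {\<omega>\<in>space M. R \<omega> < - t}) \<alpha> H \<and>
        is_tail_constant M \<alpha> m 1 (tail_gap M N C R (Rc 1) (\<lambda>x. - x)) (power_gap Q N C Rc \<alpha> (\<lambda>x. max (- x) 0)) H"
      by (intro exI conjI, rule power_tail_cong[OF K.tail_limit_nonneg_weights[OF K.homogeneous_tails(2) nw]],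
        erule tails(2), rule const[OF K.homogeneous_tails(2), where \<kappa>=1, unfolded div_by_1], erule neg)
    then obtain Hm where Hm: "power_tail (\<lambda>t. measure M {\<omega>\<in>space M. R \<omega> < - t}) \<alpha> Hm"
        "is_tail_constant M \<alpha> m 1 (tail_gap M N C R (Rc 1) (\<lambda>x. - x)) (power_gap Q N C Rc \<alpha> (\<lambda>x. max (- x) 0)) Hm"
      by (elim exE conjE)
    show "\<exists>Hp\<ge>0. \<exists>Hm\<ge>0.
          power_tail (\<lambda>t. measure M {\<omega>\<in>space M. R \<omega> > t}) \<alpha> Hp \<and>
          power_tail (\<lambda>t. measure M {\<omega>\<in>space M. R \<omega> < - t}) \<alpha> Hm \<and>
          is_tail_constant M \<alpha> m 1
            (tail_gap M N C R (Rc 1) (\<lambda>x. x)) (power_gap Q N C Rc \<alpha> (\<lambda>x. max x 0)) Hp \<and>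
          is_tail_constant M \<alpha> m 1
            (tail_gap M N C R (Rc 1) (\<lambda>x. - x)) (power_gap Q N C Rc \<alpha> (\<lambda>x. max (- x) 0)) Hm"
      using power_tail_nonneg[OF Hp(1) measure_nonneg] power_tail_nonneg[OF Hm(1) measure_nonneg] Hp Hm
      by (intro exI conjI)
  next
    assume "\<exists>j\<ge>1. measure M {\<omega>\<in>space M. enat j \<le> N \<omega> \<and> C j \<omega> < 0} > 0"
    then obtain j where j: "1 \<le> j" "measure M {\<omega>\<in>space M. enat j \<le> N \<omega> \<and> C j \<omega> < 0} > 0" by blast
    have "{\<omega>\<in>space M. weight (T.root \<omega>) (j - 1) < 0} = {\<omega>\<in>space M. enat j \<le> N \<omega> \<and> C j \<omega> < 0}"
      using j(1) by (auto simp: T.weight_root idx_def root)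
    then have nw: "measure M {\<omega>\<in>space M. weight (T.root \<omega>) (j - 1) < 0} > 0" using j(2) by simp
    note lim = K.tail_limit_signed_weights[OF nw]
    show "\<exists>H.
          power_tail (\<lambda>t. measure M {\<omega>\<in>space M. R \<omega> > t}) \<alpha> H \<and>
          power_tail (\<lambda>t. measure M {\<omega>\<in>space M. R \<omega> < - t}) \<alpha> H \<and>
          is_tail_constant M \<alpha> m 2
            (tail_gap M N C R (Rc 1) (\<lambda>x. \<bar>x\<bar>)) (power_gap Q N C Rc \<alpha> (\<lambda>x. \<bar>x\<bar>)) H"
      by (intro exI conjI, rule power_tail_cong[OF lim(1)], erule tails(1), rule power_tail_cong[OF lim(2)], erule tails(2),
        rule const[OF K.homogeneous_tails(3), where \<kappa>=2], rule refl)
  qed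
qed

end
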